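(* Let $m>1$ be an integer, let $\ell$ be an odd integer, and let $H$ be the finite $2$-group defined in the context. We have the following series of normal subgroups of $\mathrm{Aut}(H)$: $$1\subset \mathrm{Aut}_2(H)\subset \mathrm{Inn}(H)\mathrm{Aut}_2(H)\subset\mathrm{Aut}_3(H)\subset \mathrm{Aut}(H),$$ where $\mathrm{Aut}_2(H)\cong (\mathbb{Z}/2^{m-1}\mathbb{Z})^4\times (\mathbb{Z}/2^{m}\mathbb{Z})^2$, $\mathrm{Inn}(H)\mathrm{Aut}_2(H)/\mathrm{Aut}_2(H)\cong (\mathbb{Z}/2^{m-1}\mathbb{Z})^2$, $\mathrm{Aut}_3(H)/\mathrm{Inn}(H)\mathrm{Aut}_2(H)\cong (\mathbb{Z}/2\mathbb{Z})^2$, and $\mathrm{Aut}(H)/\mathrm{Aut}_3(H)$ is isomorphic to $(\mathbb{Z}/2\mathbb{Z})^2$ if $m>2$ and to $\mathbb{Z}/2\mathbb{Z}$ if $m=2$.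
   Context: Notation: $[a,b]=a^{-1}b^{-1}ab$, $b^a=a^{-1}ba$, $\alpha=1+2^m\ell$. Let $$J=\langle A,B\mid A^{[A,B]}=A^{\alpha},\ B^{[B,A]}=B^{\alpha},\ A^{2^{3m-1}}=B^{2^{3m-1}}=1\rangle$$ and $H=J/Z(J)$, which has the presentation $$H=\langle A,B\mid A^{[A,B]}=A^{\alpha},\ B^{[B,A]}=B^{\alpha},\ A^{2^{2m-1}}=B^{2^{2m-1}}=1\rangle.$$ For a group $T$, $Z_0(T)=1, Z_1(T),Z_2(T),\dots$ denotes the upper central series, and $\mathrm{Aut}_i(T)$ is the kernel of the canonical map $\mathrm{Aut}(T)\to\mathrm{Aut}(T/Z_i(T))$. *)

theory Defs
  imports "HOL-Algebra.Algebra"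
begin

section \<open>Group words and group presentations\<close>

text \<open>The letter \<open>(x, True)\<close> stands for the generator \<open>x\<close> and \<open>(x, False)\<close> for its inverse.\<close>

type_synonym 'g group_word = "('g \<times> bool) list"

definition word_inv :: "'g group_word \<Rightarrow> 'g group_word" where
  "word_inv w = rev (map (\<lambda>(x, b). (x, \<not> b)) w)"

definition word_pow :: "'g group_word \<Rightarrow> int \<Rightarrow> 'g group_word" where
  "word_pow w k = concat (replicate (nat \<bar>k\<bar>) (if k \<ge> 0 then w else word_inv w))"

text \<open>Conventions: \<open>[a,b] = a\<inverse>b\<inverse>ab\<close> and \<open>b\<^sup>a = a\<inverse>ba\<close> (first argument of
  \<open>word_conj\<close>: the base \<open>b\<close>; second: the exponent \<open>a\<close>).\<close>

definition word_comm :: "'g group_word \<Rightarrow> 'g group_word \<Rightarrow> 'g group_word" where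
  "word_comm a b = word_inv a @ word_inv b @ a @ b"

definition word_conj :: "'g group_word \<Rightarrow> 'g group_word \<Rightarrow> 'g group_word" where
  "word_conj b a = word_inv a @ b @ a"

text \<open>The congruence on words generated by free cancellation and a set of relations \<open>u = v\<close>,
  each relation being given as the pair \<open>(u, v)\<close>.\<close>

inductive pres_cong ::
  "('g group_word \<times> 'g group_word) set \<Rightarrow> 'g group_word \<Rightarrow> 'g group_word \<Rightarrow> bool"
  for R where
  pres_refl: "pres_cong R u u"
| pres_sym: "pres_cong R u v \<Longrightarrow> pres_cong R v u"
| pres_trans: "pres_cong R u v \<Longrightarrow> pres_cong R v w \<Longrightarrow> pres_cong R u w"
| pres_append: "pres_cong R u u' \<Longrightarrow> pres_cong R v v' \<Longrightarrow> pres_cong R (u @ v) (u' @ v')"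
| pres_cancel: "pres_cong R [(x, b), (x, \<not> b)] []"
| pres_rel: "(u, v) \<in> R \<Longrightarrow> pres_cong R u v"

definition pres_class ::
  "('g group_word \<times> 'g group_word) set \<Rightarrow> 'g group_word \<Rightarrow> 'g group_word set" where
  "pres_class R u = {v. pres_cong R u v}"

text \<open>The group with generators all elements of the type \<open>'g\<close> and defining relations \<open>R\<close>.
  The union in the multiplication is over equal classes, cf. \<open>mult_presented_group\<close>.\<close>

definition presented_group ::
  "('g group_word \<times> 'g group_word) set \<Rightarrow> 'g group_word set monoid" where
  "presented_group R =
    \<lparr>carrier = range (pres_class R),
     monoid.mult = (\<lambda>P Q. \<Union>u\<in>P. \<Union>v\<in>Q. pres_class R (u @ v)),
     one = pres_class R []\<rparr>"

lemma pres_class_eq_iff: "pres_class R u = pres_class R v \<longleftrightarrow> pres_cong R u v"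
  unfolding pres_class_def set_eq_iff mem_Collect_eq
  by (meson pres_refl pres_sym pres_trans)

lemma mult_presented_group:
  "pres_class R u \<otimes>\<^bsub>presented_group R\<^esub> pres_class R v = pres_class R (u @ v)"
proof -
  have "pres_class R (u' @ v') = pres_class R (u @ v)"
    if "u' \<in> pres_class R u" "v' \<in> pres_class R v" for u' v'
    using that unfolding pres_class_eq_iff
    by (auto simp: pres_class_def intro: pres_append pres_sym)
  moreover have "u \<in> pres_class R u" "v \<in> pres_class R v"
    by (auto simp: pres_class_def intro: pres_refl)
  ultimately show ?thesis
    unfolding presented_group_def monoid.simps by blast
qed

lemma pres_cong_word_inv: "pres_cong R (word_inv w @ w) []"
proof (induction w)
  case Nil
  show ?case by (simp add: word_inv_def pres_refl)
next
  case (Cons p w)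
  obtain x b where p: "p = (x, b)" by (cases p)
  have "pres_cong R ([(x, \<not> b), (x, b)] @ w) ([] @ w)"
    using pres_cancel[of R x "\<not> b"] by (intro pres_append pres_refl) simp
  then have "pres_cong R (word_inv w @ [(x, \<not> b), (x, b)] @ w) (word_inv w @ w)"
    using pres_append[OF pres_refl] by fastforce
  with Cons show ?case
    by (auto simp: p word_inv_def intro: pres_trans)
qed

lemma group_presented_group: "group (presented_group R)"
proof (rule groupI)
  have c: "carrier (presented_group R) = range (pres_class R)"
    and o: "\<one>\<^bsub>presented_group R\<^esub> = pres_class R []"
    by (simp_all add: presented_group_def)
  show "\<one>\<^bsub>presented_group R\<^esub> \<in> carrier (presented_group R)"
    by (simp add: c o)
  show "x \<otimes>\<^bsub>presented_group R\<^esub> y \<in> carrier (presented_group R)"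
    if "x \<in> carrier (presented_group R)" "y \<in> carrier (presented_group R)" for x y
    using that by (auto simp: c mult_presented_group)
  show "x \<otimes>\<^bsub>presented_group R\<^esub> y \<otimes>\<^bsub>presented_group R\<^esub> z
      = x \<otimes>\<^bsub>presented_group R\<^esub> (y \<otimes>\<^bsub>presented_group R\<^esub> z)"
    if "x \<in> carrier (presented_group R)" "y \<in> carrier (presented_group R)"
      "z \<in> carrier (presented_group R)" for x y z
    using that by (auto simp: c mult_presented_group)
  show "\<one>\<^bsub>presented_group R\<^esub> \<otimes>\<^bsub>presented_group R\<^esub> x = x"
    if "x \<in> carrier (presented_group R)" for x
    using that by (auto simp: c o mult_presented_group)
  show "\<exists>y\<in>carrier (presented_group R). y \<otimes>\<^bsub>presented_group R\<^esub> x = \<one>\<^bsub>presented_group R\<^esub>"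
    if "x \<in> carrier (presented_group R)" for x
  proof -
    from that obtain w where w: "x = pres_class R w" by (auto simp: c)
    have "pres_class R (word_inv w) \<otimes>\<^bsub>presented_group R\<^esub> x = \<one>\<^bsub>presented_group R\<^esub>"
      by (simp add: w o mult_presented_group pres_class_eq_iff pres_cong_word_inv)
    then show ?thesis by (auto simp: c)
  qed
qed


section \<open>Upper central series and groups of automorphisms\<close>

definition center :: "('a, 'b) monoid_scheme \<Rightarrow> 'a set" where
  "center G = {z \<in> carrier G. \<forall>g \<in> carrier G. z \<otimes>\<^bsub>G\<^esub> g = g \<otimes>\<^bsub>G\<^esub> z}"

primrec upper_central :: "('a, 'b) monoid_scheme \<Rightarrow> nat \<Rightarrow> 'a set" where
  "upper_central G 0 = {\<one>\<^bsub>G\<^esub>}"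
| "upper_central G (Suc i) =
    {x \<in> carrier G. upper_central G i #>\<^bsub>G\<^esub> x \<in> center (G Mod upper_central G i)}"

text \<open>For a characteristic subgroup \<open>N\<close> and an automorphism \<open>f\<close> of \<open>G\<close>, the image of the
  coset \<open>N x\<close> under \<open>f\<close> is the coset \<open>N (f x)\<close>; so the following is the canonical map
  from \<open>Aut(G)\<close> to \<open>Aut(G/N)\<close>.\<close>

definition canonical_aut_map ::
  "('a, 'b) monoid_scheme \<Rightarrow> 'a set \<Rightarrow> ('a \<Rightarrow> 'a) \<Rightarrow> 'a set \<Rightarrow> 'a set" where
  "canonical_aut_map G N f = (\<lambda>P \<in> carrier (G Mod N). f ` P)"

definition Aut_sub :: "nat \<Rightarrow> ('a, 'b) monoid_scheme \<Rightarrow> ('a \<Rightarrow> 'a) set" where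
  "Aut_sub i G = kernel (AutoGroup G) (AutoGroup (G Mod upper_central G i))
                   (canonical_aut_map G (upper_central G i))"

definition Inn :: "('a, 'b) monoid_scheme \<Rightarrow> ('a \<Rightarrow> 'a) set" where
  "Inn G = (\<lambda>g. \<lambda>x \<in> carrier G. inv\<^bsub>G\<^esub> g \<otimes>\<^bsub>G\<^esub> x \<otimes>\<^bsub>G\<^esub> g) ` carrier G"

definition cyclic_power :: "nat \<Rightarrow> nat \<Rightarrow> (nat \<Rightarrow> int) monoid" where
  "cyclic_power n k = product_group {..<k} (\<lambda>_. integer_mod_group n)"


section \<open>The groups J and H\<close>

datatype gen = GenA | GenB

definition J_relations :: "nat \<Rightarrow> int \<Rightarrow> (gen group_word \<times> gen group_word) set" where
  "J_relations m l =
    (let A = [(GenA, True)]; B = [(GenB, True)]; \<alpha> = 1 + 2 ^ m * l in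
     {(word_conj A (word_comm A B), word_pow A \<alpha>),
      (word_conj B (word_comm B A), word_pow B \<alpha>),
      (word_pow A (2 ^ (3 * m - 1)), []),
      (word_pow B (2 ^ (3 * m - 1)), [])})"

definition J_group :: "nat \<Rightarrow> int \<Rightarrow> gen group_word set monoid" where
  "J_group m l = presented_group (J_relations m l)"

definition H_group :: "nat \<Rightarrow> int \<Rightarrow> gen group_word set set monoid" where
  "H_group m l = J_group m l Mod center (J_group m l)"

end

theory Submission
  imports Defs "HOL-Number_Theory.Cong"
begin

text \<open>
  Write \<open>c = [a, b]\<close>, \<open>u = 2\<^sup>m\<^sup>-\<^sup>2 l\<close> and \<open>M = 2\<^sup>2\<^sup>m\<^sup>-\<^sup>1\<close>, so that \<open>\<alpha> = 1 + 4u\<close> and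
  \<open>M\<close> divides \<open>8u\<^sup>2\<close>. The relations \<open>ab = bac\<close>, \<open>ac = ca\<^sup>\<alpha>\<close> and \<open>cb = b\<^sup>\<alpha>c\<close> allow every element to be collected
  into the form \<open>E k j i = c\<^sup>k b\<^sup>j a\<^sup>i\<close>, and as soon as \<open>M\<close>-th powers of \<open>a\<close>, \<open>b\<close>, \<open>c\<close>
  vanish, the product of two such forms is given by explicit polynomials in the exponents
  (\<open>E_mult\<close>). The whole proof consists in showing that \<open>H\<close> is exactly this group of triples modulo
  \<open>M\<close>, and in computing with the polynomials.

  \<^bold>\<open>The group.\<close> In \<open>J\<close>, collecting the same product in two ways gives an equality between a power
  of \<open>a\<close> and a power of \<open>b\<close> whose exponents are odd multiples of \<open>M\<close> (\<open>power_relation\<close>). Hence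
  \<open>a\<^sup>M\<close> commutes with \<open>b\<close>, its powers are central, and \<open>b\<^sup>M\<close>, \<open>c\<^sup>M\<close> are among them; so every
  element of \<open>H\<close> is some \<open>E k j i\<close> with exponents modulo \<open>M\<close>. That there is no further collapse is
  seen by letting words act on triples of integers modulo an explicit equivalence \<open>sim\<close>, as right
  multiplication would act on normal forms. The action respects the relations of \<open>J\<close>
  (\<open>act_pres_cong\<close>), which separates the elements of \<open>J\<close> well enough to determine its centre, and
  the outcome is \<open>macdonald_quotient_H\<close>.

  \<^bold>\<open>The upper central series.\<close> With \<open>\<gamma> = 2\<^sup>m\<^sup>-\<^sup>2\<close> we have \<open>M = 8\<gamma>\<^sup>2\<close>, and each term
  of the series is cut out by congruences: \<open>2\<gamma>\<close> divides \<open>k\<close> and \<open>M\<close> divides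
  \<open>j, i\<close> for \<open>Z\<^sub>1\<close>; \<open>2\<gamma>\<close> divides \<open>k\<close> and \<open>4\<gamma>\<close> divides \<open>j, i\<close> for \<open>Z\<^sub>2\<close>; \<open>2\<gamma>\<close> divides
  \<open>j, i\<close> for \<open>Z\<^sub>3\<close>.

  \<^bold>\<open>The automorphisms.\<close> A choice of \<open>f a = E k j i\<close> and \<open>f b = E k' j' i'\<close> extends to an
  endomorphism iff the images satisfy the relations. For odd \<open>i\<close>, writing these out in coordinates
  leaves congruences on \<open>(i, j, i', j')\<close> alone, collected in the predicate \<open>good\<close>; the exponents
  \<open>k, k'\<close> are free. This describes the automorphisms with \<open>i\<close> odd (\<open>automorphism_if_good\<close>, \<open>good_if_automorphism_odd\<close>),
  and the others arise from them through the automorphism that exchanges \<open>a\<close> and \<open>b\<close>.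

  \<^bold>\<open>The series.\<close> All members of the series are congruence subgroups \<open>Aut_lev \<kappa> \<delta>\<close>:
  automorphisms that change the exponent of \<open>c\<close> by multiples of \<open>\<kappa>\<close> and those of \<open>b, a\<close> by
  multiples of \<open>\<delta>\<close>. The least obvious case is \<open>Inn(H) Aut\<^sub>2(H)\<close>, which consists of the automorphisms
  that are trivial on \<open>j, i\<close> modulo \<open>4\<gamma>\<close> (\<open>Inn_mult_Aut2\<close>): conjugation produces any prescribed
  pair of \<open>c\<close>-exponents modulo \<open>4\<gamma>\<close> in the images of \<open>a\<close> and \<open>b\<close>. Each factor is then identified
  by reading off coordinates of \<open>f a\<close> and \<open>f b\<close>: they are additive under composition to
  the required precision, \<open>good\<close> shows that they take all values, and their common kernel is the
  next subgroup.
\<close>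

section \<open>Normal forms under the relations of H\<close>

lemma even_triangular: "even (n * (n + 1))" for n :: int
  by simp

text \<open>Identities \<open>x\<^sup>n = F n\<close> with an integer exponent are proved by showing that the cases \<open>n\<close> and \<open>n + 1\<close> are equivalent, which treats positive and negative exponents alike.\<close>

lemma int_shift_induct:
  fixes n :: int
  assumes "P 0" and "\<And>n. P (n + 1) \<longleftrightarrow> P n"
  shows "P n"
proof (induction n rule: int_induct[of _ 0])
  case base
  show ?case by (fact assms(1))
next
  case (step1 i)
  then show ?case using assms(2) by blast
next
  case (step2 i)
  then show ?case using assms(2)[of "i - 1"] by simp
qed

lemma (in group) int_pow_Suc: "x \<in> carrier G \<Longrightarrow> x [^] (n + 1 :: int) = x [^] n \<otimes> x"
  by (simp add: int_pow_mult)

lemma (in group) int_pow_eqI: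
  fixes F :: "int \<Rightarrow> 'a"
  assumes "x \<in> carrier G" "\<And>n. F n \<in> carrier G" "F 0 = \<one>" "\<And>n. F (n + 1) = F n \<otimes> x"
  shows "x [^] (n::int) = F n"
proof (induction n rule: int_shift_induct)
  case 1
  then show ?case using assms(3) by simp
next
  case (2 n)
  then show ?case using assms by (simp add: int_pow_Suc)
qed

lemma (in group) eq_iff_eq_mult_right:
  "\<lbrakk>y = q \<otimes> z; x = p \<otimes> z; p \<in> carrier G; q \<in> carrier G; z \<in> carrier G\<rbrakk> \<Longrightarrow> x = y \<longleftrightarrow> p = q"
  by (simp add: r_cancel)

lemma (in group) int_pow_cong:
  assumes "x \<in> carrier G" "x [^] (n::int) = \<one>" "n dvd i - j"
  shows "x [^] i = x [^] j"
proof -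
  obtain q where "i - j = n * q" using assms(3) by (elim dvdE)
  then have "i = j + n * q" by simp
  then have "x [^] i = x [^] j \<otimes> (x [^] n) [^] q"
    using assms(1) by (simp add: int_pow_mult int_pow_pow)
  then show ?thesis using assms(1,2) by simp
qed

text \<open>The exponents of \<open>c\<close>, \<open>b\<close> and \<open>a\<close> in the product of \<open>c\<^sup>k b\<^sup>j a\<^sup>i\<close> and \<open>c\<^sup>k\<^sup>' b\<^sup>j\<^sup>' a\<^sup>i\<^sup>'\<close>; see \<open>E_mult\<close>.\<close>

definition lawK :: "int \<Rightarrow> int \<Rightarrow> int \<Rightarrow> int \<Rightarrow> int \<Rightarrow> int \<Rightarrow> int \<Rightarrow> int" where
  "lawK u k j i k' j' i' = k + k' + j' * i * (1 + 4 * u * k') + u * (j' * (j' - 1)) * (i * (i + 1))"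

definition lawJ :: "int \<Rightarrow> int \<Rightarrow> int \<Rightarrow> int \<Rightarrow> int \<Rightarrow> int \<Rightarrow> int \<Rightarrow> int" where
  "lawJ u k j i k' j' i' = j * (1 - 4 * u * (k' + i * j')) + j' - 2 * u * i * (j' * (j' + 1))"

definition lawI :: "int \<Rightarrow> int \<Rightarrow> int \<Rightarrow> int \<Rightarrow> int \<Rightarrow> int \<Rightarrow> int \<Rightarrow> int" where
  "lawI u k j i k' j' i' = i * (1 + 4 * u * k') + 2 * u * j' * (i * (i + 1)) + i'"

text \<open>The relations of \<open>H\<close>, with \<open>c = [a, b]\<close>. Since \<open>8u\<^sup>2\<close> annihilates all exponents, the powers
  \<open>(1 + 4u)\<^sup>n\<close> that occur in collecting reduce to \<open>1 + 4un\<close>, and the collected exponents become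
  polynomials.\<close>

locale macdonald_relations = group G for G (structure) +
  fixes a b c :: 'a and u M :: int
  assumes a: "a \<in> carrier G" and b: "b \<in> carrier G" and c: "c \<in> carrier G"
    and ab: "a \<otimes> b = b \<otimes> a \<otimes> c"
    and ac: "a \<otimes> c = c \<otimes> a [^] (1 + 4 * u)"
    and cb: "c \<otimes> b = b [^] (1 + 4 * u) \<otimes> c"
    and aM: "a [^] M = \<one>" and bM: "b [^] M = \<one>" and cM: "c [^] M = \<one>"
    and M: "M dvd 8 * u\<^sup>2"
begin

definition E :: "int \<Rightarrow> int \<Rightarrow> int \<Rightarrow> 'a" where
  "E k j i = c [^] k \<otimes> b [^] j \<otimes> a [^] i"

lemma E_closed [simp]: "E k j i \<in> carrier G"
  by (simp add: E_def a b c)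

lemma E_cong: "\<lbrakk>M dvd k - k'; M dvd j - j'; M dvd i - i'\<rbrakk> \<Longrightarrow> E k j i = E k' j' i'"
  unfolding E_def using int_pow_cong[OF c cM] int_pow_cong[OF b bM] int_pow_cong[OF a aM] by presburger

text \<open>The quotient \<open>q\<close> is always given explicitly, so that each comparison of exponents becomes a polynomial identity.\<close>

lemma dvd_u2: "x = 8 * u\<^sup>2 * q \<Longrightarrow> M dvd x"
  using M by auto

lemma a_c: "a [^] (i::int) \<otimes> c = c \<otimes> a [^] (i * (1 + 4 * u))"
proof (induction i rule: int_shift_induct)
  case 1
  then show ?case by (simp add: c)
next
  case (2 i)
  have *: "c \<otimes> a [^] ((i + 1) * (1 + 4 * u)) = c \<otimes> a [^] (1 + 4 * u) \<otimes> a [^] (i * (1 + 4 * u))"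
    using a c by (simp add: m_assoc flip: int_pow_mult) (simp add: algebra_simps)
  have "a [^] (i + 1) \<otimes> c = a \<otimes> (a [^] i \<otimes> c)"
    using a c by (simp add: add.commute[of i] int_pow_mult m_assoc)
  moreover have "a \<otimes> (c \<otimes> a [^] (i * (1 + 4 * u))) = c \<otimes> a [^] ((i + 1) * (1 + 4 * u))"
    unfolding * using a c by (simp flip: m_assoc add: ac)
  ultimately have "a [^] (i + 1) \<otimes> c = c \<otimes> a [^] ((i + 1) * (1 + 4 * u)) \<longleftrightarrow>
      a \<otimes> (a [^] i \<otimes> c) = a \<otimes> (c \<otimes> a [^] (i * (1 + 4 * u)))"
    by (simp only:)
  then show ?case
    using a c by simp
qed

lemma b_c: "b [^] (j::int) \<otimes> c = c \<otimes> b [^] (j * (1 - 4 * u))"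
proof -
  have "c \<otimes> b [^] j = b [^] (j * (1 + 4 * u)) \<otimes> c" for j :: int
  proof (induction j rule: int_shift_induct)
    case 1
    then show ?case by (simp add: c)
  next
    case (2 j)
    have "b [^] ((j + 1) * (1 + 4 * u)) \<otimes> c = b [^] (j * (1 + 4 * u)) \<otimes> (b [^] (1 + 4 * u) \<otimes> c)"
      using b c by (simp flip: int_pow_mult m_assoc) (simp add: algebra_simps)
    also have "\<dots> = b [^] (j * (1 + 4 * u)) \<otimes> c \<otimes> b"
      using b c by (simp add: m_assoc cb)
    finally have "b [^] ((j + 1) * (1 + 4 * u)) \<otimes> c = b [^] (j * (1 + 4 * u)) \<otimes> c \<otimes> b" .
    moreover have "c \<otimes> b [^] (j + 1) = c \<otimes> b [^] j \<otimes> b"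
      using b c by (simp add: int_pow_Suc m_assoc)
    ultimately show ?case
      using b c by (simp add: r_cancel)
  qed
  note this[of "j * (1 - 4 * u)"]
  moreover have "b [^] (j * (1 - 4 * u) * (1 + 4 * u)) = b [^] j"
    by (rule int_pow_cong[OF b bM], rule dvd_u2[of _ "- 2 * j"])
      (simp add: algebra_simps power2_eq_square)
  ultimately show ?thesis by simp
qed

lemma a_cpow: "a [^] (i::int) \<otimes> c [^] k = c [^] (k::int) \<otimes> a [^] (i * (1 + 4 * u * k))"
proof (induction k rule: int_shift_induct)
  case 1
  then show ?case by (simp add: a)
next
  case (2 k)
  have "a [^] (i * (1 + 4 * u * k) * (1 + 4 * u)) = a [^] (i * (1 + 4 * u * (k + 1)))"
    by (rule int_pow_cong[OF a aM], rule dvd_u2[of _ "2 * i * k"])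
      (simp add: algebra_simps power2_eq_square)
  then have "c [^] (k + 1) \<otimes> a [^] (i * (1 + 4 * u * (k + 1)))
      = c [^] k \<otimes> a [^] (i * (1 + 4 * u * k)) \<otimes> c"
    using a c by (simp add: int_pow_Suc m_assoc a_c)
  moreover have "a [^] i \<otimes> c [^] (k + 1) = a [^] i \<otimes> c [^] k \<otimes> c"
    using a c by (simp add: int_pow_Suc m_assoc)
  ultimately show ?case
    by (rule eq_iff_eq_mult_right) (use a b c in simp_all)
qed

lemma b_cpow: "b [^] (j::int) \<otimes> c [^] k = c [^] (k::int) \<otimes> b [^] (j * (1 - 4 * u * k))"
proof (induction k rule: int_shift_induct)
  case 1
  then show ?case by (simp add: b)
next
  case (2 k)
  have "b [^] (j * (1 - 4 * u * k) * (1 - 4 * u)) = b [^] (j * (1 - 4 * u * (k + 1)))"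
    by (rule int_pow_cong[OF b bM], rule dvd_u2[of _ "2 * j * k"])
      (simp add: algebra_simps power2_eq_square)
  then have "c [^] (k + 1) \<otimes> b [^] (j * (1 - 4 * u * (k + 1)))
      = c [^] k \<otimes> b [^] (j * (1 - 4 * u * k)) \<otimes> c"
    using b c by (simp add: int_pow_Suc m_assoc b_c)
  moreover have "b [^] j \<otimes> c [^] (k + 1) = b [^] j \<otimes> c [^] k \<otimes> c"
    using b c by (simp add: int_pow_Suc m_assoc)
  ultimately show ?case
    by (rule eq_iff_eq_mult_right) (use a b c in simp_all)
qed

lemma E_a: "E k j i \<otimes> a = E k j (i + 1)"
  using a b c by (simp add: E_def int_pow_Suc m_assoc)

lemma E_c: "E k j i \<otimes> c [^] (n::int) = E (k + n) (j * (1 - 4 * u * n)) (i * (1 + 4 * u * n))"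
proof -
  have "E k j i \<otimes> c [^] n = c [^] k \<otimes> (b [^] j \<otimes> c [^] n) \<otimes> a [^] (i * (1 + 4 * u * n))"
    using a b c by (simp add: E_def m_assoc a_cpow)
  then show ?thesis
    using a b c by (simp add: E_def m_assoc b_cpow int_pow_mult)
qed

lemma a_b: "a [^] (i::int) \<otimes> b = E i (1 - 4 * u * i) (i + 2 * u * (i * (i + 1)))"
proof (induction i rule: int_shift_induct)
  case 1
  then show ?case using b by (simp add: E_def)
next
  case (2 i)
  have "E (i + 1) (1 - 4 * u * (i + 1)) (i + 1 + 2 * u * ((i + 1) * (i + 1 + 1)))
     = E (i + 1) ((1 - 4 * u * i) * (1 - 4 * u * 1)) ((i + 2 * u * (i * (i + 1)) + 1) * (1 + 4 * u * 1))"
    (is "_ = E _ _ ?t")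
    apply (rule E_cong)
      apply simp
     apply (rule dvd_u2[of _ "- 2 * i"], simp add: algebra_simps power2_eq_square)
    apply (rule dvd_u2[of _ "- i * (i + 1)"], simp add: algebra_simps power2_eq_square)
    done
  also have "\<dots> = E i (1 - 4 * u * i) (i + 2 * u * (i * (i + 1))) \<otimes> a \<otimes> c"
    using E_c[of _ _ _ 1] c by (simp add: E_a)
  finally have "E (i + 1) (1 - 4 * u * (i + 1)) (i + 1 + 2 * u * ((i + 1) * (i + 1 + 1)))
      = E i (1 - 4 * u * i) (i + 2 * u * (i * (i + 1))) \<otimes> (a \<otimes> c)"
    using a c by (simp add: m_assoc)
  moreover have "a [^] (i + 1) \<otimes> b = a [^] i \<otimes> b \<otimes> (a \<otimes> c)"
    using a b c by (simp add: int_pow_Suc m_assoc ab)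
  ultimately show ?case
    by (rule eq_iff_eq_mult_right) (use a b c in simp_all)
qed

lemma E_b: "E k j i \<otimes> b = E (k + i) (j * (1 - 4 * u * i) + 1 - 4 * u * i) (i + 2 * u * (i * (i + 1)))"
proof -
  have "E k j i \<otimes> b = (c [^] k \<otimes> b [^] j \<otimes> c [^] i) \<otimes> b [^] (1 - 4 * u * i) \<otimes> a [^] (i + 2 * u * (i * (i + 1)))"
    using a b c a_b[of i] by (simp add: E_def m_assoc)
  also have "c [^] k \<otimes> b [^] j \<otimes> c [^] i = c [^] (k + i) \<otimes> b [^] (j * (1 - 4 * u * i))"
    using a b c by (simp add: m_assoc b_cpow int_pow_mult)
  finally show ?thesis
    using a b c by (simp add: E_def m_assoc int_pow_mult add_diff_eq[symmetric])
qed

lemma a_bpow: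
  "a [^] (i::int) \<otimes> b [^] (n::int) =
    E (n * i + u * (n * (n - 1)) * (i * (i + 1))) (n - 2 * u * i * (n * (n + 1)))
      (i + 2 * u * n * (i * (i + 1)))"
proof (induction n rule: int_shift_induct)
  case 1
  then show ?case using a by (simp add: E_def)
next
  case (2 n)
  obtain t where t: "i * (i + 1) = 2 * t"
    using even_triangular[of i] by (elim dvdE)
  have i2: "i * i = 2 * t - i" "\<And>x. i * (i * x) = (2 * t - i) * x"
    using t by (simp_all add: distrib_left mult.assoc[symmetric])
  let ?j = "n - 2 * u * i * (n * (n + 1))"
  let ?i = "i + 2 * u * n * (i * (i + 1))"
  have "E ((n + 1) * i + u * ((n + 1) * (n + 1 - 1)) * (i * (i + 1)))
          (n + 1 - 2 * u * i * ((n + 1) * (n + 1 + 1))) (i + 2 * u * (n + 1) * (i * (i + 1)))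
      = E (n * i + u * (n * (n - 1)) * (i * (i + 1))) ?j ?i \<otimes> b"
    unfolding E_b t
    apply (rule E_cong[symmetric])
      apply (simp add: algebra_simps)
     apply (rule dvd_u2[of _ "i\<^sup>2 * (n * (n + 1)) - 2 * t * n * ?j - 2 * t * n "], simp add: algebra_simps power2_eq_square)
    apply (rule dvd_u2[of _ "n * t * (2 * i + 1) + 4 * u * n\<^sup>2 * t\<^sup>2"], simp add: algebra_simps power2_eq_square i2)
    done
  moreover have "a [^] i \<otimes> b [^] (n + 1) = a [^] i \<otimes> b [^] n \<otimes> b"
    using a b by (simp add: int_pow_Suc m_assoc)
  ultimately show ?case
    by (rule eq_iff_eq_mult_right) (use a b c in simp_all)
qed

text \<open>To collect \<open>c\<^sup>k b\<^sup>j a\<^sup>i c\<^sup>k\<^sup>' b\<^sup>j\<^sup>' a\<^sup>i\<^sup>'\<close>, first move \<open>c\<^sup>k\<^sup>'\<close> to the left, then use \<open>a_bpow\<close> to exchange \<open>a\<close> and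
  \<open>b\<close>, and finally move the newly created power of \<open>c\<close> to the left as well. The remaining differences
  with the stated polynomials are multiples of \<open>8u\<^sup>2\<close>.\<close>

lemma E_mult:
  "E k j i \<otimes> E k' j' i' = E (lawK u k j i k' j' i') (lawJ u k j i k' j' i') (lawI u k j i k' j' i')"
proof -
  let ?i = "i * (1 + 4 * u * k')"
  define j1 where "j1 = j * (1 - 4 * u * k')"
  define K where "K = j' * ?i + u * (j' * (j' - 1)) * (?i * (?i + 1))"
  define J where "J = j' - 2 * u * ?i * (j' * (j' + 1))"
  define I where "I = ?i + 2 * u * j' * (?i * (?i + 1))"
  obtain t where t: "i * (i + 1) = 2 * t"
    using even_triangular[of i] by (elim dvdE)
  obtain s where "(j' - 1) * (j' - 1 + 1) = 2 * s"
    using even_triangular[of "j' - 1"] by (elim dvdE)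
  then have s: "j' * (j' - 1) = 2 * s"
    by (simp add: mult.commute)
  have i2: "i * i = 2 * t - i" "\<And>x. i * (i * x) = (2 * t - i) * x"
    using t by (simp_all add: distrib_left mult.assoc[symmetric])
  have j2: "j' * j' = 2 * s + j'" "\<And>x. j' * (j' * x) = (2 * s + j') * x"
    using s by (simp_all add: right_diff_distrib mult.assoc[symmetric])
  have "E k j i \<otimes> E k' j' i' = E k j i \<otimes> c [^] k' \<otimes> b [^] j' \<otimes> a [^] i'"
    using a b c by (simp add: E_def[of k' j' i'] m_assoc)
  also have "\<dots> = c [^] (k + k') \<otimes> b [^] j1 \<otimes> (a [^] ?i \<otimes> b [^] j') \<otimes> a [^] i'"
    using a b c unfolding E_c by (simp add: E_def m_assoc j1_def)
  also have "\<dots> = E (k + k') j1 0 \<otimes> c [^] K \<otimes> b [^] J \<otimes> a [^] I \<otimes> a [^] i'"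
    using a b c by (simp add: a_bpow K_def J_def I_def E_def m_assoc)
  also have "\<dots> = E (k + k' + K) (j1 * (1 - 4 * u * K) + J) (I + i')"
    using a b c unfolding E_c by (simp add: E_def m_assoc int_pow_mult)
  also have "\<dots> = E (lawK u k j i k' j' i') (lawJ u k j i k' j' i') (lawI u k j i k' j' i')"
    unfolding lawK_def lawJ_def lawI_def j1_def K_def J_def I_def
    apply (rule E_cong)
      apply (rule dvd_u2[of _ "s * i * k' * (2 * i * (1 + 2 * u * k') + 1)"], simp add: algebra_simps power2_eq_square j2)
     apply (rule dvd_u2[of _ "2 * j * k' * (j' * ?i + u * (j' * (j' - 1)) * (?i * (?i + 1)))
        - 2 * j * (i * k' * j' + s * t + 2 * u * s * (i * k' * (2 * i + 1) + 4 * u * k'\<^sup>2 * i\<^sup>2))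
        - i * k' * j' * (j' + 1)"], simp add: algebra_simps power2_eq_square i2 j2)
    apply (rule dvd_u2[of _ "j' * i * k' * (2 * i + 4 * u * k' * i + 1)"], simp add: algebra_simps power2_eq_square)
    done
  finally show ?thesis .
qed

end

section \<open>Powers of the generators of J\<close>

lemma odd_inverse_mod_2power:
  assumes "odd (x :: int)"
  obtains y where "2 ^ n dvd x * y - 1"
proof -
  have "coprime x (2 ^ n)" using assms by simp
  then obtain p q where "p * x + q * 2 ^ n = 1"
    using bezout_int[of x "2 ^ n"] by (auto simp: coprime_iff_gcd_eq_1)
  then have "x * p - 1 = 2 ^ n * (- q)" by (simp add: algebra_simps)
  then show ?thesis using that by (metis dvd_triv_left)
qed

lemma (in group) cancel_both_sides:
  "\<lbrakk>x \<otimes> y \<otimes> z = x \<otimes> y' \<otimes> z; x \<in> carrier G; y \<in> carrier G; y' \<in> carrier G; z \<in> carrier G\<rbrakk> \<Longrightarrow> y = y'"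
  using r_cancel[of z "x \<otimes> y" "x \<otimes> y'"] by simp

lemma (in group) int_pow_intertwine:
  assumes "x \<in> carrier G" "y \<in> carrier G" "z \<in> carrier G" "x \<otimes> z = z \<otimes> y"
  shows "x [^] (n::int) \<otimes> z = z \<otimes> y [^] n"
proof -
  have "x [^] n = z \<otimes> y [^] n \<otimes> inv z"
  proof (rule int_pow_eqI)
    fix n :: int
    have "z \<otimes> y [^] (n + 1) \<otimes> inv z = z \<otimes> y [^] n \<otimes> (y \<otimes> inv z)"
      using assms by (simp add: int_pow_Suc m_assoc)
    also have "y \<otimes> inv z = inv z \<otimes> x"
    proof -
      have "inv z \<otimes> (x \<otimes> z) \<otimes> inv z = inv z \<otimes> x"
        using assms(1-3) by (simp add: m_assoc)
      then show ?thesis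
        unfolding assms(4) using assms(1-3) by (simp flip: m_assoc)
    qed
    finally show "z \<otimes> y [^] (n + 1) \<otimes> inv z = z \<otimes> y [^] n \<otimes> inv z \<otimes> x"
      using assms by (simp add: m_assoc)
  qed (use assms in simp_all)
  then show ?thesis using assms by (simp add: m_assoc)
qed

lemma (in group) nat_pow_intertwine:
  assumes "x \<in> carrier G" "y \<in> carrier G" "z \<in> carrier G" "x \<otimes> z = z \<otimes> y"
  shows "x [^] (n::nat) \<otimes> z = z \<otimes> y [^] n"
  using int_pow_intertwine[OF assms, of "int n"] by (simp add: int_pow_int)

text \<open>The arithmetic of the exponents in \<open>J\<close>: \<open>\<alpha> = 1 + 2\<nu>\<close>, \<open>\<beta>\<close> is its inverse modulo the order \<open>P\<close> of
  \<open>a\<close> and \<open>b\<close>, and \<open>\<sigma> n\<close> is the geometric sum of the powers of \<open>\<beta>\<close>.\<close>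

locale macdonald_parameters =
  fixes m :: nat and l :: int
  assumes m: "m > 1" and l: "odd l"
begin

definition \<nu> :: int where "\<nu> = 2 ^ (m - 1) * l"
definition \<beta> :: int where "\<beta> = 1 - 2 * \<nu> + 4 * \<nu>\<^sup>2"
definition M :: int where "M = 2 ^ (2 * m - 1)"
definition P :: int where "P = 2 ^ (3 * m - 1)"
definition \<sigma> :: "nat \<Rightarrow> int" where "\<sigma> n = (\<Sum>s<n. \<beta> ^ s)"

lemma two_nu: "2 ^ m * l = 2 * \<nu>"
  using m by (simp add: \<nu>_def power_eq_if)

lemma nu2: "2 * \<nu>\<^sup>2 = M * l\<^sup>2"
proof -
  obtain r where "m = r + 2"
    using m by (metis add.commute le_Suc_ex Suc_leI one_add_one plus_1_eq_Suc)
  moreover have "(2::int) ^ (2 * r) = 2 ^ r * 2 ^ r"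
    by (simp add: mult_2 power_add)
  ultimately show ?thesis
    unfolding \<nu>_def M_def by (simp add: power2_eq_square)
qed

lemma M_P: "M * 2 ^ m = P"
  unfolding M_def P_def using m by (simp flip: power_add)

lemma M_nu: "P dvd M * (2 * \<nu>)"
  by (simp add: M_P[symmetric] two_nu[symmetric])

lemma even_nu: "even \<nu>" 
  using m by (simp add: \<nu>_def)

lemma alpha_beta: "P dvd (1 + 2 * \<nu>) * \<beta> - 1"
proof -
  have "(1 + 2 * \<nu>) * \<beta> - 1 = 2 * \<nu> * (2 * (2 * \<nu>\<^sup>2))"
    unfolding \<beta>_def by (simp add: algebra_simps power2_eq_square)
  also have "\<dots> = M * (2 * \<nu>) * (2 * l\<^sup>2)"
    unfolding nu2 by simp
  finally show ?thesis by (simp only: dvd_mult2[OF M_nu])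
qed

lemma two_M_eq: "2 * M = 2 ^ (2 * m)"
  unfolding M_def using m by (simp flip: power_Suc)

lemma two_M_nu: "2 * M dvd 4 * \<nu>\<^sup>2"
  using nu2 by (simp add: dvd_def)

lemma beta_pow: "2 * M dvd \<beta> ^ s - (1 - 2 * \<nu> * int s)"
proof (induction s)
  case (Suc s)
  have "\<beta> ^ Suc s - (1 - 2 * \<nu> * int (Suc s)) =
      \<beta> * (\<beta> ^ s - (1 - 2 * \<nu> * int s)) + 4 * \<nu>\<^sup>2 * (int s + 1 - 2 * \<nu> * int s)"
    unfolding \<beta>_def by (simp add: algebra_simps power2_eq_square)
  then show ?case
    using Suc two_M_nu by (metis dvd_add dvd_mult dvd_mult2)
qed simp

lemma sigma_cong: "2 * M dvd \<sigma> n - (int n - \<nu> * (int n * (int n - 1)))"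
proof (induction n)
  case (Suc n)
  have "\<sigma> (Suc n) - (int (Suc n) - \<nu> * (int (Suc n) * (int (Suc n) - 1))) =
      (\<sigma> n - (int n - \<nu> * (int n * (int n - 1)))) + (\<beta> ^ n - (1 - 2 * \<nu> * int n))"
    unfolding \<sigma>_def by (simp add: algebra_simps)
  then show ?case
    using Suc beta_pow by (metis dvd_add)
qed (simp add: \<sigma>_def)

lemma M_dvd_sigma_M: "M dvd \<sigma> (nat M)"
proof -
  have "M > 0" by (simp add: M_def)
  moreover have "M dvd M - \<nu> * (M * (M - 1))"
    by simp
  ultimately show ?thesis
    using sigma_cong[of "nat M"] by (metis dvd_diffD dvd_mult_right int_nat_eq less_imp_le zdvd_zdiffD)
qed

text \<open>A natural number congruent to \<open>\<alpha>\<close>; it allows a power with exponent \<open>\<alpha>\<close> to be treated by induction even if \<open>l\<close> is negative.\<close>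

definition n\<alpha> :: nat where "n\<alpha> = nat ((1 + 2 * \<nu>) mod P)"

lemma P_pos: "P > 0"
  by (simp add: P_def)

lemma n_alpha: "P dvd (1 + 2 * \<nu>) - int n\<alpha>"
  unfolding n\<alpha>_def using P_pos by (simp add: minus_mod_eq_mult_div [symmetric] dvd_minus_mod)

end

text \<open>The relations of \<open>J\<close>, with \<open>c = [a, b]\<close>.\<close>

locale macdonald_group = macdonald_parameters m l + group G for m l and G (structure) +
  fixes a b c :: 'a
  assumes a: "a \<in> carrier G" and b: "b \<in> carrier G" and c: "c \<in> carrier G"
    and ab: "a \<otimes> b = b \<otimes> a \<otimes> c"
    and ac: "a \<otimes> c = c \<otimes> a [^] (1 + 2 ^ m * l)"
    and cb: "c \<otimes> b = b [^] (1 + 2 ^ m * l) \<otimes> c"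
    and aP: "a [^] (2 ^ (3 * m - 1) :: int) = \<one>" and bP: "b [^] (2 ^ (3 * m - 1) :: int) = \<one>"
begin

lemma a_cong: "P dvd i - j \<Longrightarrow> a [^] i = a [^] (j::int)"
  using int_pow_cong[OF a] aP P_def by simp

lemma b_cong: "P dvd i - j \<Longrightarrow> b [^] i = b [^] (j::int)"
  using int_pow_cong[OF b] bP P_def by simp

lemma a_c: "a [^] (x::int) \<otimes> c = c \<otimes> a [^] (x * (1 + 2 * \<nu>))"
  using int_pow_intertwine[OF a _ c ac[unfolded two_nu], of x] a
  by (simp add: int_pow_pow mult.commute)

lemma c_b: "c \<otimes> b [^] (x::int) = b [^] (x * (1 + 2 * \<nu>)) \<otimes> c"
  using int_pow_intertwine[OF _ b c cb[unfolded two_nu, symmetric], of x] b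
  by (simp add: int_pow_pow mult.commute)

lemma c_a: "c \<otimes> a [^] (x::int) = a [^] (x * \<beta>) \<otimes> c"
proof -
  have "P dvd x * \<beta> * (1 + 2 * \<nu>) - x"
    using dvd_mult[OF alpha_beta, of x] by (simp add: algebra_simps)
  then show ?thesis unfolding a_c by (simp add: a_cong)
qed

lemma b_c: "b [^] (x::int) \<otimes> c = c \<otimes> b [^] (x * \<beta>)"
proof -
  have "P dvd x * \<beta> * (1 + 2 * \<nu>) - x"
    using dvd_mult[OF alpha_beta, of x] by (simp add: algebra_simps)
  then show ?thesis unfolding c_b by (simp add: b_cong)
qed

lemma a_cn: "a [^] (x::int) \<otimes> c [^] n = c [^] n \<otimes> a [^] (x * (1 + 2 * \<nu>) ^ n)" for n :: nat
proof (induction n arbitrary: x)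
  case (Suc n)
  have "a [^] x \<otimes> c [^] Suc n = c [^] n \<otimes> (a [^] (x * (1 + 2 * \<nu>) ^ n) \<otimes> c)"
    using a c by (simp add: m_assoc Suc flip: m_assoc[of "a [^] x"])
  then show ?case using a c by (simp add: a_c m_assoc mult_ac)
qed (use a in simp)

lemma c_bn: "c [^] n \<otimes> b [^] (x::int) = b [^] (x * (1 + 2 * \<nu>) ^ n) \<otimes> c [^] n" for n :: nat
proof (induction n arbitrary: x)
  case (Suc n)
  have "c [^] Suc n \<otimes> b [^] x = c [^] n \<otimes> b [^] (x * (1 + 2 * \<nu>)) \<otimes> c"
    using b c by (simp add: m_assoc c_b)
  then show ?case using b c by (simp add: Suc m_assoc mult_ac)
qed (use b in simp)

lemma b_cn: "b [^] (x::int) \<otimes> c [^] n = c [^] n \<otimes> b [^] (x * \<beta> ^ n)" for n :: nat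
proof (induction n arbitrary: x)
  case (Suc n)
  have "b [^] x \<otimes> c [^] Suc n = c [^] n \<otimes> (b [^] (x * \<beta> ^ n) \<otimes> c)"
    using b c by (simp add: m_assoc Suc flip: m_assoc[of "b [^] x"])
  then show ?case using b c by (simp add: b_c m_assoc mult_ac)
qed (use b in simp)

lemma c_an: "c [^] n \<otimes> a [^] (x::int) = a [^] (x * \<beta> ^ n) \<otimes> c [^] n" for n :: nat
proof (induction n arbitrary: x)
  case (Suc n)
  have "c [^] Suc n \<otimes> a [^] x = c [^] n \<otimes> a [^] (x * \<beta>) \<otimes> c"
    using a c by (simp add: m_assoc c_a)
  then show ?case using a c by (simp add: Suc m_assoc mult_ac)
qed (use a in simp)

lemma ac_pow: "(a [^] (x::int) \<otimes> c) [^] n = a [^] (x * \<sigma> n) \<otimes> c [^] n" for n :: nat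
proof (induction n)
  case (Suc n)
  have "(a [^] x \<otimes> c) [^] Suc n = a [^] (x * \<sigma> n) \<otimes> (c [^] n \<otimes> a [^] x) \<otimes> c"
    using a c by (simp add: Suc m_assoc)
  also have "\<dots> = a [^] (x * \<sigma> n) \<otimes> a [^] (x * \<beta> ^ n) \<otimes> c [^] Suc n"
    using a c unfolding c_an by (simp add: m_assoc)
  finally show ?case using a c by (simp add: \<sigma>_def algebra_simps flip: int_pow_mult)
qed (simp add: \<sigma>_def)

lemma an_b: "a [^] n \<otimes> b = b \<otimes> (a [^] \<sigma> n \<otimes> c [^] n)" for n :: nat
  using nat_pow_intertwine[OF a _ b, of "a \<otimes> c" n] ac_pow[of 1 n] a b c by (simp add: ab m_assoc)

lemma a_bn: "a \<otimes> b [^] n = b [^] n \<otimes> (a \<otimes> c [^] n \<otimes> b [^] (int n - \<sigma> n))" for n :: nat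
proof (induction n)
  case (Suc n)
  have 1: "c [^] n \<otimes> b = b \<otimes> (c [^] n \<otimes> b [^] (1 - \<beta> ^ n))"
  proof -
    have "b [^] (1::int) \<otimes> c [^] n = c [^] n \<otimes> b [^] (\<beta> ^ n)"
      using b_cn[of 1 n] by simp
    then have "b \<otimes> (c [^] n \<otimes> b [^] (1 - \<beta> ^ n)) = c [^] n \<otimes> (b [^] (\<beta> ^ n) \<otimes> b [^] (1 - \<beta> ^ n))"
      using b c by (simp flip: m_assoc)
    then show ?thesis using b c by (simp flip: int_pow_mult)
  qed
  have "a \<otimes> b [^] Suc n = a \<otimes> b [^] n \<otimes> b"
    using a b by (simp add: m_assoc)
  also have "\<dots> = b [^] n \<otimes> (a \<otimes> c [^] n \<otimes> (b [^] (int n - \<sigma> n) \<otimes> b))"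
    unfolding Suc using a b c by (simp add: m_assoc)
  also have "b [^] (int n - \<sigma> n) \<otimes> b = b \<otimes> b [^] (int n - \<sigma> n)"
    by (rule int_pow_intertwine[OF b b b refl])
  also have "a \<otimes> c [^] n \<otimes> (b \<otimes> b [^] (int n - \<sigma> n)) = a \<otimes> (c [^] n \<otimes> b) \<otimes> b [^] (int n - \<sigma> n)"
    using a b c by (simp add: m_assoc)
  also have "\<dots> = (a \<otimes> b) \<otimes> (c [^] n \<otimes> (b [^] (1 - \<beta> ^ n) \<otimes> b [^] (int n - \<sigma> n)))"
    unfolding 1 using a b c by (simp add: m_assoc)
  also have "b [^] (1 - \<beta> ^ n) \<otimes> b [^] (int n - \<sigma> n) = b [^] (int (Suc n) - \<sigma> (Suc n))"
    using b by (simp add: \<sigma>_def algebra_simps flip: int_pow_mult)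
  also have "a \<otimes> b \<otimes> (c [^] n \<otimes> b [^] (int (Suc n) - \<sigma> (Suc n)))
      = b \<otimes> (a \<otimes> (c \<otimes> c [^] n) \<otimes> b [^] (int (Suc n) - \<sigma> (Suc n)))"
    unfolding ab using a b c by (simp add: m_assoc)
  also have "c \<otimes> c [^] n = c [^] Suc n"
    using c by (rule nat_pow_Suc2[symmetric])
  finally show ?case using a b c by (simp add: m_assoc)
qed (use a in \<open>simp add: \<sigma>_def\<close>)

text \<open>This relation is the source of all further collapse in \<open>J\<close>. It comes from evaluating \<open>acb\<close> in two
  ways: as \<open>a b\<^sup>\<alpha> c\<close>, where \<open>a\<close> is moved past \<open>b\<^sup>\<alpha>\<close>, and as \<open>c a\<^sup>\<alpha> b\<close>, where \<open>b\<close> is moved past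
  \<open>a\<^sup>\<alpha>\<close>.\<close>

lemma power_relation: "b [^] ((int n\<alpha> - \<sigma> n\<alpha>) * (1 + 2 * \<nu>) ^ n\<alpha>) = a [^] (\<beta> * \<sigma> n\<alpha> - 1)"
proof -
  let ?n = "n\<alpha>"
  have cb': "c \<otimes> b = b [^] ?n \<otimes> c"
    using cb b_cong[OF n_alpha] b by (simp add: two_nu int_pow_int)
  have ac': "a \<otimes> c = c \<otimes> a [^] ?n"
    using ac a_cong[OF n_alpha] a by (simp add: two_nu int_pow_int)
  have "b [^] ?n \<otimes> (a \<otimes> c [^] ?n \<otimes> b [^] (int ?n - \<sigma> ?n)) \<otimes> c = a \<otimes> b [^] ?n \<otimes> c"
    by (simp add: a_bn)
  also have "\<dots> = a \<otimes> c \<otimes> b"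
    using a b c by (simp add: m_assoc cb')
  also have "\<dots> = c \<otimes> (a [^] ?n \<otimes> b)"
    using a b c by (simp add: m_assoc ac')
  also have "a [^] ?n \<otimes> b = b \<otimes> (a \<otimes> c) [^] ?n"
    using a b c by (intro nat_pow_intertwine) (simp_all add: ab m_assoc)
  also have "c \<otimes> (b \<otimes> (a \<otimes> c) [^] ?n) = b [^] ?n \<otimes> (c \<otimes> (a \<otimes> c) [^] ?n)"
    using a b c cb' by (simp flip: m_assoc)
  also have "c \<otimes> (a \<otimes> c) [^] ?n = (a [^] \<beta> \<otimes> c) [^] ?n \<otimes> c"
    using a c c_a[of 1] by (intro nat_pow_intertwine[symmetric]) (simp_all flip: m_assoc)
  finally have "b [^] ?n \<otimes> (a \<otimes> c [^] ?n \<otimes> b [^] (int ?n - \<sigma> ?n)) \<otimes> c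
      = b [^] ?n \<otimes> ((a [^] \<beta> \<otimes> c) [^] ?n) \<otimes> c"
    using a b c by (simp add: m_assoc)
  then have "a \<otimes> c [^] ?n \<otimes> b [^] (int ?n - \<sigma> ?n) = (a [^] \<beta> \<otimes> c) [^] ?n"
    by (rule cancel_both_sides) (use a b c in simp_all)
  then have "a \<otimes> (c [^] ?n \<otimes> b [^] (int ?n - \<sigma> ?n)) = a [^] (\<beta> * \<sigma> ?n) \<otimes> c [^] ?n"
    unfolding ac_pow using a b c by (simp add: m_assoc)
  also have "a [^] (\<beta> * \<sigma> ?n) = a \<otimes> a [^] (\<beta> * \<sigma> ?n - 1)"
    using a int_pow_mult[of a 1 "\<beta> * \<sigma> ?n - 1"] by simp
  finally have "a \<otimes> b [^] ((int ?n - \<sigma> ?n) * (1 + 2 * \<nu>) ^ ?n) \<otimes> c [^] ?n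
      = a \<otimes> a [^] (\<beta> * \<sigma> ?n - 1) \<otimes> c [^] ?n"
    unfolding c_bn using a b c by (simp add: m_assoc)
  then show ?thesis
    by (rule cancel_both_sides) (use a b c in simp_all)
qed

text \<open>By \<open>sigma_cong\<close>, \<open>n - \<sigma> n\<close> is \<open>\<nu> n (n - 1)\<close> modulo \<open>2M\<close>; for \<open>n\<close> congruent to \<open>\<alpha> = 1 + 2\<nu>\<close> this is an odd multiple of \<open>2\<nu>\<^sup>2 = M l\<^sup>2\<close>, and \<open>l\<close> is odd.\<close>

lemma exponent_b: "\<exists>x. odd x \<and> (int n\<alpha> - \<sigma> n\<alpha>) * (1 + 2 * \<nu>) ^ n\<alpha> = M * x"
  and exponent_a: "\<exists>x. odd x \<and> \<beta> * \<sigma> n\<alpha> - 1 = M * x"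
proof -
  define s where "s = \<sigma> n\<alpha>"
  obtain p where "1 + 2 * \<nu> - int n\<alpha> = P * p"
    using n_alpha by (elim dvdE)
  then have p: "int n\<alpha> = 1 + 2 * \<nu> - P * p" by simp
  obtain q where "s - (int n\<alpha> - \<nu> * (int n\<alpha> * (int n\<alpha> - 1))) = 2 * M * q"
    using sigma_cong[of n\<alpha>] unfolding s_def by (elim dvdE)
  then have q: "s = int n\<alpha> - \<nu> * (int n\<alpha> * (int n\<alpha> - 1)) + 2 * M * q" by simp
  obtain v where v: "\<nu> = 2 * v" using even_nu by (elim evenE)
  have P: "P = 4 * M * 2 ^ (m - 2)"
  proof -
    have "m = 2 + (m - 2)" using m by simp
    then have "(2::int) ^ m = 2 ^ 2 * 2 ^ (m - 2)" by (metis power_add)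
    then show ?thesis using M_P by simp
  qed
  let ?w = "2 ^ (m - 2) :: int"
  define x where "x = l\<^sup>2 * int n\<alpha> - 4 * \<nu> * int n\<alpha> * ?w * p - 2 * q"
  have s1: "int n\<alpha> - s = M * x"
  proof -
    have "int n\<alpha> - s = (2 * \<nu>\<^sup>2) * int n\<alpha> - \<nu> * int n\<alpha> * (P * p) - 2 * M * q"
      unfolding q by (simp add: p algebra_simps power2_eq_square)
    then show ?thesis unfolding nu2 P x_def by (simp add: algebra_simps)
  qed
  have "odd (int n\<alpha>)" unfolding p P by simp
  then have o: "odd x"
    using l by (simp add: x_def)
  then show "\<exists>x. odd x \<and> (int n\<alpha> - \<sigma> n\<alpha>) * (1 + 2 * \<nu>) ^ n\<alpha> = M * x"
    using s1 by (intro exI[of _ "x * (1 + 2 * \<nu>) ^ n\<alpha>"]) (simp add: s_def)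
  have "s = 1 + 2 * \<nu> - P * p - M * x" using s1 p by simp
  then have "\<beta> * s - 1 = \<beta> * (1 + 2 * \<nu> - P * p - M * x) - 1" by (simp only:)
  also have "\<dots> = ((1 + 2 * \<nu>) * \<beta> - 1) - \<beta> * P * p - \<beta> * M * x"
    by (simp add: algebra_simps)
  also have "(1 + 2 * \<nu>) * \<beta> - 1 = 2 * \<nu> * 2 * (2 * \<nu>\<^sup>2)"
    by (simp add: \<beta>_def algebra_simps power2_eq_square)
  finally have "\<beta> * s - 1 = M * (4 * \<nu> * l\<^sup>2 - \<beta> * 4 * ?w * p - \<beta> * x)"
    unfolding nu2 P by (simp add: algebra_simps)
  moreover have "odd (4 * \<nu> * l\<^sup>2 - \<beta> * 4 * ?w * p - \<beta> * x)"
    using o by (simp add: \<beta>_def)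
  ultimately show "\<exists>x. odd x \<and> \<beta> * \<sigma> n\<alpha> - 1 = M * x"
    unfolding s_def by blast
qed

text \<open>An odd factor in the exponent can be inverted because the order of \<open>y\<^sup>M\<close> is a power of two.\<close>

lemma powers_comparable:
  assumes x: "x \<in> carrier G" and y: "y \<in> carrier G" and yP: "y [^] P = \<one>"
    and "odd p" and eq: "y [^] (M * p) = x [^] (M * q)"
  shows "\<exists>w. y [^] M = x [^] (M * w)"
proof -
  obtain p' where p': "2 ^ m dvd p * p' - 1"
    using odd_inverse_mod_2power[OF \<open>odd p\<close>] by blast
  have "P dvd M * p * p' - M"
    using mult_dvd_mono[OF dvd_refl[of M] p'] by (simp add: M_P algebra_simps)
  then have "y [^] M = (y [^] (M * p)) [^] p'"
    using y yP int_pow_cong[OF y yP, of "M * p * p'" M] by (simp add: int_pow_pow)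
  also have "\<dots> = x [^] (M * (q * p'))"
    using x by (simp add: eq int_pow_pow mult.assoc)
  finally show ?thesis by blast
qed

lemma bM: "\<exists>w. b [^] M = a [^] (M * w)"
  using exponent_a exponent_b power_relation powers_comparable[OF a b] bP P_def by metis

lemma aM: "\<exists>w. a [^] M = b [^] (M * w)"
  using exponent_a exponent_b power_relation powers_comparable[OF b a] aP P_def by metis

lemma aM_b: "a [^] M \<otimes> b = b \<otimes> a [^] M"
  using aM int_pow_intertwine[OF b b b refl] by metis

text \<open>Moving \<open>b\<close> past \<open>a\<^sup>M\<close>, with which it commutes, by \<open>an_b\<close> expresses \<open>c\<^sup>M\<close> through \<open>a\<close>.\<close>

lemma cM: "\<exists>w. c [^] M = a [^] (M * w)"
proof -
  have M0: "M > 0" by (simp add: M_def)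
  have "b \<otimes> a [^] M = a [^] (nat M) \<otimes> b"
    using aM_b M0 by (simp add: int_pow_int[symmetric])
  also have "\<dots> = b \<otimes> (a [^] \<sigma> (nat M) \<otimes> c [^] nat M)"
    by (rule an_b)
  finally have "a [^] M = a [^] \<sigma> (nat M) \<otimes> c [^] M"
    using a b c M0 by (simp add: int_pow_int[symmetric])
  then have "c [^] M = inv (a [^] \<sigma> (nat M)) \<otimes> a [^] M"
    using a c by (simp add: inv_solve_left)
  also have "\<dots> = a [^] (M - \<sigma> (nat M))"
    using a by (simp flip: int_pow_neg int_pow_mult)
  finally show ?thesis
    using M_dvd_sigma_M by (metis dvd_diff dvd_refl dvdE)
qed

lemma normal_form_step_a:
  "c [^] (k::int) \<otimes> b [^] (j::int) \<otimes> a [^] (i::int) \<otimes> a [^] (n::int) = c [^] k \<otimes> b [^] j \<otimes> a [^] (i + n)"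
  using a b c by (simp add: m_assoc int_pow_mult)

text \<open>The three steps show that the set of elements \<open>c\<^sup>k b\<^sup>j a\<^sup>i\<close> is closed under right multiplication by the generators.\<close>

lemma normal_form_step_b:
  "\<exists>(k'::int) (j'::int) (i'::int). c [^] (k::int) \<otimes> b [^] (j::int) \<otimes> a [^] (i::int) \<otimes> b
    = c [^] k' \<otimes> b [^] j' \<otimes> a [^] i'"
proof -
  define n where "n = nat (i mod P)"
  have "a [^] i = a [^] n"
    using a_cong[of i "i mod P"] P_pos unfolding n_def by (simp add: int_pow_int[symmetric] dvd_minus_mod)
  then have "c [^] k \<otimes> b [^] j \<otimes> a [^] i \<otimes> b = c [^] k \<otimes> (b [^] j \<otimes> b) \<otimes> (a [^] \<sigma> n \<otimes> c [^] n)"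
    using a b c by (simp add: an_b m_assoc)
  also have "\<dots> = c [^] k \<otimes> (b [^] (j + 1) \<otimes> c [^] n) \<otimes> a [^] (\<sigma> n * (1 + 2 * \<nu>) ^ n)"
    using a b c by (simp add: a_cn m_assoc int_pow_Suc)
  also have "\<dots> = c [^] (k + int n) \<otimes> b [^] ((j + 1) * \<beta> ^ n) \<otimes> a [^] (\<sigma> n * (1 + 2 * \<nu>) ^ n)"
    unfolding b_cn using a b c by (simp add: m_assoc int_pow_mult int_pow_int)
  finally show ?thesis by (intro exI)
qed

lemma normal_form_step_bn:
  "\<exists>(k'::int) (j'::int) (i'::int). c [^] (k::int) \<otimes> b [^] (j::int) \<otimes> a [^] (i::int) \<otimes> b [^] (n::nat)
    = c [^] k' \<otimes> b [^] j' \<otimes> a [^] i'"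
proof (induction n)
  case 0
  have "c [^] k \<otimes> b [^] j \<otimes> a [^] i \<otimes> b [^] (0::nat) = c [^] k \<otimes> b [^] j \<otimes> a [^] i"
    using a b c by simp
  then show ?case by (intro exI)
next
  case (Suc n)
  then obtain k' j' i' :: int where "c [^] k \<otimes> b [^] j \<otimes> a [^] i \<otimes> b [^] n = c [^] k' \<otimes> b [^] j' \<otimes> a [^] i'"
    by blast
  moreover have "c [^] k \<otimes> b [^] j \<otimes> a [^] i \<otimes> b [^] Suc n = c [^] k \<otimes> b [^] j \<otimes> a [^] i \<otimes> b [^] n \<otimes> b"
    using a b c by (simp add: m_assoc)
  ultimately show ?case using normal_form_step_b[of k' j' i'] by simp
qed

lemma inv_b: "inv b = b [^] (nat (P - 1))"
proof -
  have "b [^] (- 1 :: int) = b [^] (P - 1)"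
    by (rule b_cong) simp
  then show ?thesis using b P_pos by (simp add: int_pow_neg int_pow_int[symmetric])
qed

end

section \<open>A model of J on triples of integers\<close>

type_synonym triple = "int \<times> int \<times> int"

context macdonald_parameters
begin

definition u :: int where "u = 2 ^ (m - 2) * l"
definition h :: int where "h = 2 ^ (m - 1)"

lemma nu_u: "\<nu> = 2 * u"
proof -
  have "m - 1 = Suc (m - 2)" using m by simp
  then show ?thesis by (simp add: \<nu>_def u_def)
qed

lemma two_u: "2 * u = h * l"
  using nu_u by (simp add: \<nu>_def h_def)

lemma alpha_eq: "1 + 2 ^ m * l = 1 + 4 * u"
  by (simp add: two_nu nu_u)

lemma u2: "8 * u\<^sup>2 = M * l\<^sup>2"
  using nu2 by (simp add: nu_u power2_eq_square)

lemma h_M: "2 * h * M = P"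
  using M_P m by (simp add: h_def mult.commute flip: power_Suc)

lemma P_M_u: "P dvd M * (4 * u)"
  using M_nu by (simp add: nu_u)

lemma P_dvd_u3: "x = 32 * u ^ 3 * q \<Longrightarrow> P dvd x"
proof -
  assume "x = 32 * u ^ 3 * q"
  also have "\<dots> = 8 * u\<^sup>2 * (4 * u * q)" by (simp add: power2_eq_square power3_eq_cube)
  also have "\<dots> = M * (4 * u) * (l\<^sup>2 * q)" unfolding u2 by simp
  finally show ?thesis using P_M_u by (metis dvd_mult2)
qed

lemma even_h: "even h" using m by (simp add: h_def)
lemma even_M: "even M" using m by (simp add: M_def)
lemma M_dvd_P: "M dvd P" using h_M by (metis dvd_triv_right)

lemma coprime_P: "odd x \<Longrightarrow> coprime P x" "odd x \<Longrightarrow> coprime M x"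
  by (simp_all add: P_def M_def)

text \<open>An inverse of 3 modulo \<open>P\<close>, needed for the denominator in a sum of squares.\<close>

definition \<theta> :: int where "\<theta> = (SOME y. P dvd 3 * y - 1)"

lemma theta: "P dvd 3 * \<theta> - 1"
  unfolding \<theta>_def by (rule someI_ex) (use odd_inverse_mod_2power[of 3 "3 * m - 1"] in \<open>auto simp: P_def\<close>)

text \<open>The polynomial that represents \<open>\<alpha>\<^sup>-\<^sup>i\<close> modulo \<open>P\<close>, where \<open>32u\<^sup>3\<close> vanishes.\<close>

definition bp :: "int \<Rightarrow> int" where
  "bp i = 1 - 4 * u * i + 8 * u\<^sup>2 * (i * (i + 1))"

text \<open>The exponent of \<open>a\<close> in the normal form of \<open>a\<^sup>i b\<close>: for \<open>i \<ge> 0\<close> it is \<open>\<alpha> + \<alpha>\<^sup>2 + \<dots> + \<alpha>\<^sup>i\<close>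
  modulo \<open>P\<close>. Its cubic term has a denominator 3, which \<open>\<theta>\<close> replaces.\<close>

definition tau :: "int \<Rightarrow> int" where
  "tau i = i + 2 * u * (i * (i + 1)) + 8 * u\<^sup>2 * \<theta> * ((i - 1) * (i * (i + 1)))"

lemma bp_0 [simp]: "bp 0 = 1" by (simp add: bp_def)

lemma odd_bp: "odd (bp i)" by (simp add: bp_def)

lemma bp_add: "P dvd bp x * bp y - bp (x + y)"
  by (rule P_dvd_u3[of _ "2 * u * (x * (x + 1)) * (y * (y + 1)) - x * (y * (y + 1)) - y * (x * (x + 1))"])
    (simp add: bp_def algebra_simps power2_eq_square power3_eq_cube)

lemma bp_cong: assumes "M dvd x - y" shows "P dvd bp x - bp y"
proof -
  have "bp x - bp y = (x - y) * (4 * u) * (2 * u * (x + y + 1) - 1)"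
    by (simp add: bp_def algebra_simps power2_eq_square)
  then show ?thesis
    using mult_dvd_mono[OF assms dvd_refl[of "4 * u"]] P_M_u by (metis dvd_mult2 dvd_trans)
qed

lemma bp_mult_M: assumes "M dvd x" shows "P dvd x * bp i - x"
proof -
  have "x * bp i - x = x * (4 * u) * (2 * u * (i * (i + 1)) - i)"
    by (simp add: bp_def algebra_simps power2_eq_square)
  then show ?thesis
    using mult_dvd_mono[OF assms dvd_refl[of "4 * u"]] P_M_u by (metis dvd_mult2 dvd_trans)
qed

lemma tau_diff:
  "tau x - tau y = (x - y) * (1 + 2 * u * (x + y + 1) + 8 * u\<^sup>2 * \<theta> * (x\<^sup>2 + x * y + y\<^sup>2 - 1))"
  by (simp add: tau_def algebra_simps power2_eq_square)

lemma tau_dvd_iff: "P dvd tau x - tau y \<longleftrightarrow> P dvd x - y" "M dvd tau x - tau y \<longleftrightarrow> M dvd x - y"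
  unfolding tau_diff by (simp_all add: coprime_P coprime_dvd_mult_left_iff)

lemma tau_M: assumes "M dvd x - y" shows "P dvd tau x - tau y - (x - y) - h * (x - y)"
proof -
  obtain t where t: "x - y = M * t" using assms by (elim dvdE)
  obtain s where s: "l * (2 * y + 1 + M * t) - 1 = 2 * s"
  proof -
    have "even (l * (2 * y + 1 + M * t) - 1)" using l even_M by simp
    then show ?thesis using that by (elim dvdE)
  qed
  have x: "x = y + M * t" using t by simp
  have "tau x - tau y - (x - y) - h * (x - y)
     = M * t * (2 * u * (x + y + 1) - h) + M * (4 * u) * (2 * u * t * \<theta> * (x\<^sup>2 + x * y + y\<^sup>2 - 1))"
    unfolding tau_diff t by (simp add: algebra_simps power2_eq_square)
  also have "M * t * (2 * u * (x + y + 1) - h) = h * M * t * (l * (2 * y + 1 + M * t) - 1)"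
    unfolding two_u by (simp add: x algebra_simps)
  also have "\<dots> = P * (t * s)"
    unfolding s h_M[symmetric] by simp
  finally show ?thesis
    by (simp only: dvd_add dvd_mult2[OF P_M_u] dvd_triv_left)
qed

lemma tau_surj: "\<exists>x. P dvd tau x - y"
proof -
  let ?f = "\<lambda>x. tau x mod P"
  have "inj_on ?f {0..<P}"
    by (rule inj_onI) (auto simp: mod_eq_dvd_iff tau_dvd_iff dest: mod_eq_dvd_iff[THEN iffD2])
  moreover have "?f ` {0..<P} \<subseteq> {0..<P}"
    using P_pos by auto
  ultimately have "?f ` {0..<P} = {0..<P}"
    by (intro endo_inj_surj) simp_all
  moreover have "y mod P \<in> {0..<P}" using P_pos by simp
  ultimately have "y mod P \<in> ?f ` {0..<P}" by (simp only:)
  then obtain x where "y mod P = tau x mod P" by (elim imageE)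
  then show ?thesis unfolding mod_eq_dvd_iff dvd_diff_commute[of P y] by (rule exI)
qed

text \<open>As \<open>tau\<close> permutes the residues modulo \<open>P\<close>, it has an inverse.\<close>

definition \<iota> :: "int \<Rightarrow> int" where "\<iota> y = (SOME x. P dvd tau x - y)"

lemma tau_iota: "P dvd tau (\<iota> y) - y"
  unfolding \<iota>_def by (rule someI_ex) (rule tau_surj)

text \<open>Equality of the elements \<open>c\<^sup>k b\<^sup>j a\<^sup>i\<close> of the model, in which
  \<open>b\<^sup>M = a\<^sup>-\<^sup>M\<close> and \<open>c\<^sup>M = a\<^sup>-\<^sup>h\<^sup>M\<close>.\<close>

fun sim :: "triple \<Rightarrow> triple \<Rightarrow> bool" where
  "sim (k, j, i) (k', j', i') \<longleftrightarrow> M dvd k - k' \<and> M dvd j - j' \<and> P dvd (i - i') - (j - j') - h * (k - k')"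

lemma sim_refl [simp]: "sim x x"
  by (cases x) simp

lemma sim_sym: "sim x y \<Longrightarrow> sim y x"
  by (cases x; cases y) (auto simp: dvd_diff_commute algebra_simps
      dest: dvd_minus_iff[of P, THEN iffD2])

lemma sim_trans: assumes "sim x y" "sim y z" shows "sim x z"
proof -
  obtain k j i where x: "x = (k, j, i)" by (rule prod_cases3)
  obtain k' j' i' where y: "y = (k', j', i')" by (rule prod_cases3)
  obtain k'' j'' i'' where z: "z = (k'', j'', i'')" by (rule prod_cases3)
  note xyz = x y z
  have "k - k'' = (k - k') + (k' - k'')" "j - j'' = (j - j') + (j' - j'')"
    "(i - i'') - (j - j'') - h * (k - k'')
      = ((i - i') - (j - j') - h * (k - k')) + ((i' - i'') - (j' - j'') - h * (k' - k''))"
    by (simp_all add: algebra_simps)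
  then show ?thesis using assms unfolding xyz sim.simps by (metis dvd_add)
qed

lemma sim_imp_M_dvd: "sim (k, j, i) (k', j', i') \<Longrightarrow> M dvd i - i'"
proof -
  assume "sim (k, j, i) (k', j', i')"
  then have "M dvd k - k'" "M dvd j - j'" "M dvd (i - i') - (j - j') - h * (k - k')"
    using M_dvd_P by (auto intro: dvd_trans)
  then have "M dvd ((i - i') - (j - j') - h * (k - k')) + (j - j') + h * (k - k')"
    by (intro dvd_add dvd_mult)
  then show ?thesis by simp
qed

text \<open>Right multiplication of \<open>c\<^sup>k b\<^sup>j a\<^sup>i\<close> by \<open>a\<^sup>n\<close>, \<open>b\<close>, \<open>c\<close> and \<open>b\<^sup>-\<^sup>1\<close>, read on exponents.\<close>

fun amap :: "int \<Rightarrow> triple \<Rightarrow> triple" where "amap n (k, j, i) = (k, j, i + n)"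
fun bmap :: "triple \<Rightarrow> triple" where "bmap (k, j, i) = (k + i, (j + 1) * bp i, tau i)"
fun cmap :: "triple \<Rightarrow> triple" where "cmap (k, j, i) = (k + 1, j * bp 1, i * (1 + 4 * u))"
fun binv :: "triple \<Rightarrow> triple" where "binv (k, j, i) = (k - \<iota> i, j * bp (- \<iota> i) - 1, \<iota> i)"

lemma amap_sim: "sim x y \<Longrightarrow> sim (amap n x) (amap n y)"
  by (cases x; cases y) (simp add: algebra_simps)

lemma cmap_sim: assumes "sim x y" shows "sim (cmap x) (cmap y)"
proof -
  obtain k j i where x: "x = (k, j, i)" by (rule prod_cases3)
  obtain k' j' i' where y: "y = (k', j', i')" by (rule prod_cases3)
  note xy = x y
  have *: "M dvd k - k'" "M dvd j - j'" "M dvd i - i'" "P dvd (i - i') - (j - j') - h * (k - k')"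
    using assms sim_imp_M_dvd[of k j i k' j' i'] unfolding xy sim.simps by blast+
  have "(i * (1 + 4 * u) - i' * (1 + 4 * u)) - (j * bp 1 - j' * bp 1) - h * (k + 1 - (k' + 1))
     = ((i - i') - (j - j') - h * (k - k')) + (i - i') * (4 * u) - ((j - j') * bp 1 - (j - j'))"
    by (simp add: algebra_simps)
  moreover have "P dvd (i - i') * (4 * u)"
    using mult_dvd_mono[OF *(3) dvd_refl[of "4 * u"]] P_M_u by (metis dvd_trans)
  ultimately have "P dvd (i * (1 + 4 * u) - i' * (1 + 4 * u)) - (j * bp 1 - j' * bp 1) - h * (k + 1 - (k' + 1))"
    using *(4) bp_mult_M[OF *(2), of 1] by (simp only: dvd_add dvd_diff)
  moreover have "M dvd j * bp 1 - j' * bp 1"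
    using *(2) by (simp flip: left_diff_distrib)
  ultimately show ?thesis using *(1) by (simp add: xy)
qed

text \<open>The reverse implication makes \<open>bmap\<close> injective on the classes of \<open>sim\<close>. The coupling of the three
  coordinates in \<open>sim\<close> is forced here: by \<open>tau_M\<close>, \<open>tau\<close> changes a difference \<open>d\<close> divisible by \<open>M\<close>
  into \<open>d + hd\<close>, and the extra term is absorbed by the change of \<open>k\<close>.\<close>

lemma bmap_sim_iff: "sim (bmap x) (bmap y) \<longleftrightarrow> sim x y"
proof -
  obtain k j i where x: "x = (k, j, i)" by (rule prod_cases3)
  obtain k' j' i' where y: "y = (k', j', i')" by (rule prod_cases3)
  note xy = x y
  have "sim (bmap x) (bmap y) \<longleftrightarrow> sim x y" if i: "M dvd i - i'"
  proof -
    have j: "(j + 1) * bp i - (j' + 1) * bp i' = (j - j') * bp i + (j' + 1) * (bp i - bp i')"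
      by (simp add: algebra_simps)
    have jM: "M dvd (j + 1) * bp i - (j' + 1) * bp i' \<longleftrightarrow> M dvd j - j'"
    proof -
      have "M dvd (j' + 1) * (bp i - bp i')"
        by (intro dvd_mult dvd_trans[OF M_dvd_P bp_cong[OF i]])
      then show ?thesis
        unfolding j by (simp only: dvd_add_left_iff coprime_dvd_mult_left_iff[OF coprime_P(2)[OF odd_bp]])
    qed
    have kM: "M dvd k + i - (k' + i') \<longleftrightarrow> M dvd k - k'"
      using dvd_add_left_iff[OF i, of "k - k'"] by (simp add: algebra_simps)
    have "P dvd (tau i - tau i') - ((j + 1) * bp i - (j' + 1) * bp i') - h * (k + i - (k' + i'))
        \<longleftrightarrow> P dvd (i - i') - (j - j') - h * (k - k')" if "M dvd j - j'"
    proof -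
      have "(tau i - tau i') - ((j + 1) * bp i - (j' + 1) * bp i') - h * (k + i - (k' + i'))
        = ((i - i') - (j - j') - h * (k - k')) + ((tau i - tau i' - (i - i') - h * (i - i'))
           - ((j - j') * bp i - (j - j')) - (j' + 1) * (bp i - bp i'))"
        unfolding j by (simp add: algebra_simps)
      moreover have "P dvd (tau i - tau i' - (i - i') - h * (i - i'))
           - ((j - j') * bp i - (j - j')) - (j' + 1) * (bp i - bp i')"
        by (intro dvd_diff tau_M i bp_mult_M that dvd_mult bp_cong)
      ultimately show ?thesis by (simp only: dvd_add_left_iff)
    qed
    then show ?thesis using jM kM unfolding xy by auto
  qed
  moreover have "M dvd i - i'" if "sim (bmap x) (bmap y)"
    using sim_imp_M_dvd[of "k + i" "(j + 1) * bp i" "tau i"] that tau_dvd_iff(2) unfolding xy bmap.simps by blast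
  moreover have "M dvd i - i'" if "sim x y"
    using sim_imp_M_dvd[of k j i k' j' i'] that unfolding xy by blast
  ultimately show ?thesis by blast
qed

lemma bmap_binv: "sim (bmap (binv x)) x"
proof -
  obtain k j i where x: "x = (k, j, i)" by (rule prod_cases3)
  have "P dvd (bp (- \<iota> i) * bp (\<iota> i) - bp 0) * j"
    using bp_add[of "- \<iota> i" "\<iota> i"] by (simp only: dvd_mult2 add.left_inverse)
  then have j: "P dvd (j * bp (- \<iota> i) - 1 + 1) * bp (\<iota> i) - j"
    by (simp add: algebra_simps)
  then have "M dvd (j * bp (- \<iota> i) - 1 + 1) * bp (\<iota> i) - j"
    using M_dvd_P by (rule dvd_trans[rotated])
  moreover have "P dvd (tau (\<iota> i) - i) - ((j * bp (- \<iota> i) - 1 + 1) * bp (\<iota> i) - j) - h * 0"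
    using tau_iota[of i] j by (simp only: dvd_diff mult_zero_right dvd_0_right)
  ultimately show ?thesis unfolding x by simp
qed

lemma binv_bmap: "sim (binv (bmap x)) x"
  using bmap_binv[of "bmap x"] by (simp only: bmap_sim_iff)

lemma binv_sim: "sim x y \<Longrightarrow> sim (binv x) (binv y)"
  using bmap_binv[of x] bmap_binv[of y] bmap_sim_iff sim_sym sim_trans by blast

text \<open>The relation \<open>ab = bac\<close> in the model; words act from the right, so the first letter is applied first.\<close>

lemma ab_model: "sim (bmap (amap 1 x)) (cmap (amap 1 (bmap x)))"
proof -
  obtain k j i where x: "x = (k, j, i)" by (rule prod_cases3)
  have "P dvd - ((j + 1) * (bp i * bp 1 - bp (i + 1)))"
    using bp_add[of i 1] by simp
  then have j: "P dvd (j + 1) * bp (i + 1) - (j + 1) * bp i * bp 1"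
    by (simp add: algebra_simps)
  have "tau (i + 1) - (tau i + 1) * (1 + 4 * u)
      = (3 * \<theta> - 1) * (8 * u\<^sup>2 * (i * (i + 1))) + 32 * u ^ 3 * (- \<theta> * ((i - 1) * (i * (i + 1))))"
    by (simp add: tau_def algebra_simps power2_eq_square power3_eq_cube)
  then have "P dvd tau (i + 1) - (tau i + 1) * (1 + 4 * u)"
    using theta P_dvd_u3[OF refl] by (simp only: dvd_add dvd_mult2)
  then have "P dvd (tau (i + 1) - (tau i + 1) * (1 + 4 * u)) - ((j + 1) * bp (i + 1) - (j + 1) * bp i * bp 1) - h * 0"
    using j by (simp only: dvd_diff mult_zero_right dvd_0_right)
  moreover have "M dvd (j + 1) * bp (i + 1) - (j + 1) * bp i * bp 1"
    using j M_dvd_P by (rule dvd_trans[rotated])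
  ultimately show ?thesis unfolding x by (simp add: add_ac)
qed

lemma P_dvd_16u2: "P dvd h * (16 * u\<^sup>2 * q)"
proof -
  have "h * (16 * u\<^sup>2 * q) = 2 * h * (8 * u\<^sup>2) * q" by simp
  also have "\<dots> = P * (l\<^sup>2 * q)" unfolding u2 h_M[symmetric] by simp
  finally show ?thesis by (simp only: dvd_triv_left)
qed

lemma M_dvd_8u2: "M dvd 8 * u\<^sup>2 * q"
  unfolding u2 by simp

text \<open>A closed form for the iterates of \<open>bmap\<close>, with \<open>bk\<close>, \<open>bs\<close>, \<open>bt\<close> for the effect on the
  three coordinates.\<close>

definition tri :: "int \<Rightarrow> int" where "tri i = i * (i + 1) div 2"
definition bk :: "nat \<Rightarrow> int \<Rightarrow> int" where
  "bk n i = int n * i + 4 * u * tri i * int (n choose 2) + 8 * u\<^sup>2 * tri i * int (n choose 3)"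
definition bs :: "nat \<Rightarrow> int \<Rightarrow> int" where
  "bs n i = int n + 4 * u * i * int (n choose 2) + 16 * u\<^sup>2 * tri i * int (n choose 3)
    + 8 * u\<^sup>2 * (i * i * (2 * int (n choose 3) + int (n choose 2)) - i * int (n choose 2))"
definition bt :: "nat \<Rightarrow> int \<Rightarrow> int" where
  "bt n i = i + int n * (4 * u * tri i + 16 * u\<^sup>2 * (\<theta> * tri i * (i - 1)))
    + 8 * u\<^sup>2 * (tri i * (2 * i + 1)) * int (n choose 2) + 16 * u ^ 3 * tri i * int (n choose 3)"

fun bpow :: "nat \<Rightarrow> triple \<Rightarrow> triple" where
  "bpow n (k, j, i) = (k + bk n i, bp (bk n i) * (j + bs n i), bt n i)"

lemma choose_0: "(0::nat) choose 2 = 0" "(0::nat) choose 3 = 0"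
  by (simp_all add: numeral_2_eq_2 numeral_3_eq_3)

lemma P_dvd_3: "P dvd 3 * x \<Longrightarrow> P dvd x"
  using coprime_P(1)[of 3] by (simp add: coprime_dvd_mult_right_iff)

lemma two_tri: "2 * tri i = i * (i + 1)"
  unfolding tri_def by simp

lemma bpow_step: "sim (bpow n (bmap x)) (bpow (Suc n) x)"
proof -
  obtain k j i where x: "x = (k, j, i)" by (rule prod_cases3)
  define T where "T = tri i"
  define N where "N = int n"
  define c2 where "c2 = int (n choose 2)"
  define c3 where "c3 = int (n choose 3)"
  have choose: "int (Suc n) = N + 1" "int (Suc n choose 2) = c2 + N" "int (Suc n choose 3) = c3 + c2"
    by (simp_all add: N_def c2_def c3_def numeral_2_eq_2 numeral_3_eq_3)
  have i2: "i * i = 2 * T - i" "\<And>x. i * (i * x) = (2 * T - i) * x"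
    using two_tri[of i] unfolding T_def by (simp_all add: distrib_left mult.assoc[symmetric])
  define g where "g = \<theta> * T * (i - 1)"
  define f where "f = T + 4 * u * g"
  define y where "y = f * (2 * i + 1) + 4 * u * (f * f)"
  have tau: "tau i = i + 4 * u * f"
    unfolding tau_def f_def g_def two_tri[symmetric] T_def
    by (simp add: algebra_simps power2_eq_square)
  have "2 * tri (i + 4 * u * f) = 2 * (T + 2 * u * y)"
    unfolding two_tri y_def by (simp add: algebra_simps i2)
  then have T1: "tri (i + 4 * u * f) = T + 2 * u * y" by simp
  have bk: "bk n (tau i) + i - bk (Suc n) i =
      16 * u\<^sup>2 * (N * g + c2 * (i * f + 2 * u * g) + 2 * u * (f * f) * c2) + 16 * u\<^sup>2 * (u * c3 * y)"
    unfolding bk_def choose tau T1 unfolding T_def[symmetric] N_def[symmetric] c2_def[symmetric] c3_def[symmetric]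
    by (simp add: y_def algebra_simps power2_eq_square) (simp add: f_def algebra_simps power2_eq_square)
  have "P dvd bp i * (bs (Suc n) i - 1) - bs n (tau i)"
  proof (rule P_dvd_u3)
    have bp: "bp i = 1 - 4 * u * i + 16 * u\<^sup>2 * T"
      unfolding bp_def two_tri[symmetric] T_def by simp
    define X1 where "X1 = i * (c2 + N)"
    define Y1 where "Y1 = 2 * T * (c3 + c2) + i * i * (2 * c3 + 3 * c2 + N) - X1"
    have "bs (Suc n) i - 1 = N + 4 * u * X1 + 8 * u\<^sup>2 * Y1"
      unfolding bs_def choose X1_def Y1_def T_def by (simp add: algebra_simps)
    then show "bp i * (bs (Suc n) i - 1) - bs n (tau i) = 32 * u ^ 3 *
        (2 * T * X1 - i * Y1 + 4 * u * T * Y1 - 2 * g * c2 - y * c3 - (2 * i * f + 4 * u * (f * f)) * (2 * c3 + c2) + f * c2)"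
      unfolding bp bs_def choose tau T1 unfolding N_def[symmetric] c2_def[symmetric] c3_def[symmetric]
      by (simp add: X1_def Y1_def f_def algebra_simps power2_eq_square power3_eq_cube i2)
  qed
  note bs = this
  have bt: "P dvd bt n (tau i) - bt (Suc n) i"
  proof (rule P_dvd_u3)
    define z where "z = \<theta> * (2 * T * f + y * (i - 1 + 4 * u * f))"
    have W: "\<theta> * (T + 2 * u * y) * (i + 4 * u * f - 1) = g + 2 * u * z"
      unfolding z_def g_def by (simp add: algebra_simps)
    show "bt n (tau i) - bt (Suc n) i = 32 * u ^ 3 *
        (N * z + N * (g * (2 * i + 1) + f * f)
         + c2 * (2 * f * (T + 2 * u * y) + 2 * u * g + 4 * T * f + 2 * u * (f * f) * (2 * i + 1)) + u * y * c3)"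
      unfolding bt_def choose tau T1 W unfolding N_def[symmetric] c2_def[symmetric] c3_def[symmetric]
        T_def[symmetric] g_def[symmetric]
      by (simp add: y_def algebra_simps power2_eq_square power3_eq_cube)
        (simp add: f_def algebra_simps power2_eq_square power3_eq_cube i2)
  qed
  have "\<exists>w. bk n (tau i) + i - bk (Suc n) i = 16 * u\<^sup>2 * w"
    unfolding bk by (rule exI, rule distrib_left[symmetric])
  then obtain w where w: "bk n (tau i) + i - bk (Suc n) i = 16 * u\<^sup>2 * w" by blast
  have M_w: "M dvd 16 * u\<^sup>2 * w" using M_dvd_8u2[of "2 * w"] by (simp add: mult.assoc)
  let ?B = "bp (bk n (tau i))" and ?B' = "bp (bk (Suc n) i)"
  have "P dvd bp (bk n (tau i) + i) - ?B'"
    by (rule bp_cong) (simp only: w M_w)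
  from dvd_add[OF bp_add[of "bk n (tau i)" i] this] have B: "P dvd ?B * bp i - ?B'" by simp
  have "?B * ((j + 1) * bp i + bs n (tau i)) - ?B' * (j + bs (Suc n) i)
      = (?B * bp i - ?B') * (j + bs (Suc n) i) - ?B * (bp i * (bs (Suc n) i - 1) - bs n (tau i))"
    by (simp add: algebra_simps)
  then have Pj: "P dvd ?B * ((j + 1) * bp i + bs n (tau i)) - ?B' * (j + bs (Suc n) i)"
    using B bs by (simp only: dvd_diff dvd_mult dvd_mult2)
  have k: "k + i + bk n (tau i) - (k + bk (Suc n) i) = 16 * u\<^sup>2 * w" using w by simp
  show ?thesis
    unfolding x bmap.simps bpow.simps sim.simps k
    by (intro conjI M_w dvd_trans[OF M_dvd_P Pj] dvd_diff bt Pj P_dvd_16u2)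
qed

lemma bmap_pow: "sim ((bmap ^^ n) x) (bpow n x)"
proof (induction n arbitrary: x)
  case 0
  then show ?case by (cases x) (simp add: bk_def bs_def bt_def choose_0)
next
  case (Suc n)
  have "(bmap ^^ Suc n) x = (bmap ^^ n) (bmap x)" by (simp add: funpow_swap1)
  then show ?case using Suc[of "bmap x"] bpow_step sim_trans by simp
qed

lemma choose_2: "2 * int (n choose 2) = int n * (int n - 1)"
  by (induction n) (simp_all add: numeral_2_eq_2 algebra_simps)

lemma choose_3: "3 * int (n choose 3) = int (n choose 2) * (int n - 2)"
proof (induction n)
  case (Suc n)
  have "int (Suc n choose 2) = int (n choose 2) + int n"
    "int (Suc n choose 3) = int (n choose 3) + int (n choose 2)"
    by (simp_all add: numeral_2_eq_2 numeral_3_eq_3)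
  then show ?case using Suc choose_2[of n] by (simp add: algebra_simps)
qed (simp add: choose_0)

text \<open>The relation \<open>b\<^sup>P = 1\<close> in the model.\<close>

lemma bmap_P: "sim ((bmap ^^ nat P) x) x"
proof -
  obtain k j i where x: "x = (k, j, i)" by (rule prod_cases3)
  let ?c2 = "int (nat P choose 2)" and ?c3 = "int (nat P choose 3)"
  have N: "int (nat P) = P" using P_pos by simp
  have "2 * ?c2 = 2 * (h * M * (P - 1))"
    using choose_2[of "nat P"] unfolding N by (simp add: h_M[symmetric])
  then have c2: "?c2 = h * M * (P - 1)" by simp
  have "P - 2 = 2 * (h * M - 1)" by (simp add: h_M[symmetric])
  then have "3 * ?c3 = 2 * h * M * ((P - 1) * (h * M - 1))"
    using choose_3[of "nat P"] unfolding N c2 by simp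
  then have "P dvd 3 * ?c3" unfolding h_M by simp
  then have c3: "P dvd ?c3" by (rule P_dvd_3)
  have "2 * ?c2 = 2 * h * M * (P - 1)" unfolding c2 by simp
  then have c2': "P dvd 2 * ?c2" unfolding h_M by simp
  have "bk (nat P) i = P * i + 2 * ?c2 * (2 * u * tri i) + ?c3 * (8 * u\<^sup>2 * tri i)"
    unfolding bk_def N by simp
  then have bk: "P dvd bk (nat P) i"
    using c2' c3 by (simp only: dvd_add dvd_mult2 dvd_triv_left)
  have "bs (nat P) i = P + 2 * ?c2 * (2 * u * i) + ?c3 * (16 * u\<^sup>2 * tri i)
      + (2 * ?c2 * (4 * u\<^sup>2 * (i * i - i)) + ?c3 * (16 * u\<^sup>2 * (i * i)))"
    unfolding bs_def N by (simp add: algebra_simps)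
  then have bs: "P dvd bs (nat P) i"
    using c2' c3 by (simp only: dvd_add dvd_mult2 dvd_refl)
  have "bt (nat P) i - i = P * (4 * u * tri i + 16 * u\<^sup>2 * (\<theta> * tri i * (i - 1)))
      + 2 * ?c2 * (4 * u\<^sup>2 * (tri i * (2 * i + 1))) + ?c3 * (16 * u ^ 3 * tri i)"
    unfolding bt_def N by (simp add: algebra_simps)
  then have bt: "P dvd bt (nat P) i - i"
    using c2' c3 by (simp only: dvd_add dvd_mult2 dvd_triv_left)
  have "P dvd bp (bk (nat P) i) - bp 0"
    using bk M_dvd_P by (intro bp_cong) (auto intro: dvd_trans)
  moreover have "bp (bk (nat P) i) * (j + bs (nat P) i) - j
      = (bp (bk (nat P) i) - bp 0) * j + bp (bk (nat P) i) * bs (nat P) i"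
    by (simp add: algebra_simps)
  ultimately have j: "P dvd bp (bk (nat P) i) * (j + bs (nat P) i) - j"
    using bs by (simp only: dvd_add dvd_mult dvd_mult2)
  have "sim (bpow (nat P) x) x"
    unfolding x bpow.simps sim.simps add_diff_cancel_left'
    by (intro conjI dvd_trans[OF M_dvd_P bk] dvd_trans[OF M_dvd_P j] dvd_diff bt j dvd_mult bk)
  then show ?thesis using bmap_pow sim_trans by blast
qed

text \<open>The relation \<open>cb = b\<^sup>\<alpha>c\<close> in the model, with a natural number \<open>n\<close> in place of \<open>\<alpha>\<close>.\<close>

lemma cb_model:
  assumes "P dvd int n - (1 + 4 * u)"
  shows "sim (cmap ((bmap ^^ n) x)) (bmap (cmap x))"
proof -
  obtain k j i where x: "x = (k, j, i)" by (rule prod_cases3)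
  obtain t where "int n - (1 + 4 * u) = P * t" using assms by (elim dvdE)
  then have N: "int n = 1 + 4 * u + P * t" by simp
  define T where "T = tri i"
  define c2 where "c2 = int (n choose 2)"
  define c3 where "c3 = int (n choose 3)"
  define r where "r = t * (8 * u + 1 + P * t)"
  have i2: "i * i = 2 * T - i" "\<And>x. i * (i * x) = (2 * T - i) * x"
    using two_tri[of i] unfolding T_def by (simp_all add: distrib_left mult.assoc[symmetric])
  have "2 * c2 = 2 * (2 * u * (1 + 4 * u) + h * M * r)"
    using choose_2[of n] unfolding N c2_def[symmetric] r_def
    by (simp add: h_M[symmetric] algebra_simps)
  then have c2: "c2 = 2 * u * (1 + 4 * u) + h * M * r" by simp
  have c3: "3 * c3 = c2 * (4 * u - 1 + P * t)"
    using choose_3[of n] unfolding N c2_def[symmetric] c3_def[symmetric] by simp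
  then have "even (3 * c3)" unfolding c2 using even_h by simp
  then obtain c3' where c3': "c3 = 2 * c3'" by (auto elim: evenE)
  have P3: "P dvd 32 * u ^ 3" by (rule P_dvd_u3[of _ 1]) simp
  have "16 * u\<^sup>2 * (3 * c3) = 32 * u ^ 3 * ((1 + 4 * u) * (4 * u - 1 + P * t))
      + M * (4 * u) * (4 * u * h * r * (4 * u - 1 + P * t))"
    unfolding c3 c2 by (simp add: algebra_simps power2_eq_square power3_eq_cube)
  then have "P dvd 16 * u\<^sup>2 * (3 * c3)"
    using P3 P_M_u by (simp only: dvd_add dvd_mult2)
  then have "P dvd 3 * (16 * u\<^sup>2 * c3)"
    by (subst mult.left_commute)
  then have P16: "P dvd 16 * u\<^sup>2 * c3"
    by (rule P_dvd_3)
  define w where "w = 2 * u * T + T * c3'"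
  have "bk n i - i * (1 + 4 * u) - 8 * u\<^sup>2 * T - 16 * u\<^sup>2 * w = P * (t * i) + M * (4 * u) * (h * T * r)"
    unfolding bk_def N T_def[symmetric] c2_def[symmetric] c3_def[symmetric] w_def
    by (simp add: c2 c3' algebra_simps power2_eq_square)
  then have kP: "P dvd bk n i - i * (1 + 4 * u) - 8 * u\<^sup>2 * T - 16 * u\<^sup>2 * w"
    using P_M_u by (simp only: dvd_add dvd_mult2 dvd_triv_left)
  have "bs n i - (1 + 4 * u) - 8 * u\<^sup>2 * i = P * t + 32 * u ^ 3 * (i + (1 + 4 * u) * (T - i))
      + M * (4 * u) * (h * r * i + 4 * u * h * r * (T - i)) + 16 * u\<^sup>2 * c3 * (T + i * i)"
    unfolding bs_def N T_def[symmetric] c2_def[symmetric] c3_def[symmetric]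
    by (simp add: c2 i2 algebra_simps power2_eq_square power3_eq_cube)
  then have sP: "P dvd bs n i - (1 + 4 * u) - 8 * u\<^sup>2 * i"
    using P_M_u P3 P16 by (simp only: dvd_add dvd_mult2 dvd_triv_left)
  define g where "g = \<theta> * T * (i - 1)"
  have "bt n i - (i + 4 * u * T + 16 * u\<^sup>2 * g + 16 * u\<^sup>2 * T + 16 * u ^ 3 * T) =
      P * (t * (4 * u * T + 16 * u\<^sup>2 * g)) + 32 * u ^ 3 * (2 * g + T * i + 2 * u * T * (2 * i + 1) + T * c3')
      + M * (4 * u) * (2 * u * T * (2 * i + 1) * h * r)"
    unfolding bt_def N T_def[symmetric] c2_def[symmetric] c3_def[symmetric] g_def[symmetric]
    by (simp add: c2 c3' algebra_simps power2_eq_square power3_eq_cube)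
  then have tP: "P dvd bt n i - (i + 4 * u * T + 16 * u\<^sup>2 * g + 16 * u\<^sup>2 * T + 16 * u ^ 3 * T)"
    using P_M_u P3 by (simp only: dvd_add dvd_mult2 dvd_triv_left)
  let ?i = "i * (1 + 4 * u)" and ?S = "bs n i"
  let ?D = "bk n i - ?i"
  have P1632: "P dvd x * (32 * u ^ 3)" for x using P3 by simp
  have Mk: "M dvd ?D"
  proof -
    have "M dvd (?D - 8 * u\<^sup>2 * T - 16 * u\<^sup>2 * w) + 8 * u\<^sup>2 * (T + 2 * w)"
      by (rule dvd_add[OF dvd_trans[OF M_dvd_P kP] M_dvd_8u2])
    then show ?thesis by (simp add: algebra_simps)
  qed
  define E1 where "E1 = bp (bk n i)"
  define E0 where "E0 = bp ?i"
  have E: "P dvd E1 - E0" unfolding E1_def E0_def by (rule bp_cong[OF Mk])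
  have E0M: "P dvd 8 * u\<^sup>2 * i * E0 - 8 * u\<^sup>2 * i"
    unfolding E0_def by (rule bp_mult_M) (rule M_dvd_8u2)
  have "E1 * (j + ?S) * bp 1 - (j * bp 1 + 1) * E0 - 8 * u\<^sup>2 * i
      = (E1 - E0) * ((j + ?S) * bp 1) + (?S - (1 + 4 * u) - 8 * u\<^sup>2 * i) * (E0 * bp 1)
       + 32 * u ^ 3 * (E0 * (2 + i * (4 * u - 1))) + (8 * u\<^sup>2 * i * E0 - 8 * u\<^sup>2 * i)"
    by (simp add: bp_def algebra_simps power2_eq_square power3_eq_cube)
  then have jP: "P dvd E1 * (j + ?S) * bp 1 - (j * bp 1 + 1) * E0 - 8 * u\<^sup>2 * i"
    using E sP E0M P3 by (simp only: dvd_add dvd_mult2)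
  have Mj: "M dvd E1 * (j + ?S) * bp 1 - (j * bp 1 + 1) * E0"
    using dvd_add[OF dvd_trans[OF M_dvd_P jP] M_dvd_8u2[of i]] by simp
  define B0 where "B0 = i + 4 * u * T + 16 * u\<^sup>2 * g + 16 * u\<^sup>2 * T + 16 * u ^ 3 * T"
  have "B0 * (1 + 4 * u) - tau ?i - 8 * u\<^sup>2 * i - 16 * u ^ 3 * T
      = 32 * u ^ 3 * (2 * g + 2 * T + 2 * u * T - i * i - \<theta> * (i * i * i * (3 + 12 * u + 16 * u\<^sup>2) - i))"
    unfolding B0_def tau_def g_def by (simp add: i2 algebra_simps power2_eq_square power3_eq_cube)
  then have "bt n i * (1 + 4 * u) - tau ?i - 8 * u\<^sup>2 * i - 16 * u ^ 3 * T = (bt n i - B0) * (1 + 4 * u) +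
      32 * u ^ 3 * (2 * g + 2 * T + 2 * u * T - i * i - \<theta> * (i * i * i * (3 + 12 * u + 16 * u\<^sup>2) - i))"
    by (simp add: algebra_simps)
  then have iP: "P dvd bt n i * (1 + 4 * u) - tau ?i - 8 * u\<^sup>2 * i - 16 * u ^ 3 * T"
    using tP[folded B0_def] P3 by (simp only: dvd_add dvd_mult2)
  have "even (l - 1)" using l by simp
  then obtain s where s: "l - 1 = 2 * s" by (elim dvdE)
  have "16 * u ^ 3 * T - h * (8 * u\<^sup>2 * T) = 8 * u\<^sup>2 * T * (2 * u - h)"
    by (simp add: algebra_simps power2_eq_square power3_eq_cube)
  also have "2 * u - h = h * (2 * s)" unfolding two_u s[symmetric] by (simp add: algebra_simps)
  also have "8 * u\<^sup>2 * T * (h * (2 * s)) = P * (l\<^sup>2 * T * s)" unfolding u2 h_M[symmetric] by simp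
  finally have hP: "P dvd 16 * u ^ 3 * T - h * (8 * u\<^sup>2 * T)" by simp
  have "(bt n i * (1 + 4 * u) - tau ?i) - (E1 * (j + ?S) * bp 1 - (j * bp 1 + 1) * E0) - h * ?D
      = (bt n i * (1 + 4 * u) - tau ?i - 8 * u\<^sup>2 * i - 16 * u ^ 3 * T)
        - (E1 * (j + ?S) * bp 1 - (j * bp 1 + 1) * E0 - 8 * u\<^sup>2 * i)
        - h * (?D - 8 * u\<^sup>2 * T - 16 * u\<^sup>2 * w) - h * (16 * u\<^sup>2 * w)
        + (16 * u ^ 3 * T - h * (8 * u\<^sup>2 * T))"
    by (simp add: algebra_simps)
  then have "P dvd (bt n i * (1 + 4 * u) - tau ?i) - (E1 * (j + ?S) * bp 1 - (j * bp 1 + 1) * E0) - h * ?D"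
    using iP jP dvd_mult[OF kP, of h] P_dvd_16u2[of w] hP by (simp only: dvd_add dvd_diff)
  then have "sim (cmap (bpow n x)) (bmap (cmap x))"
    using Mk Mj unfolding x E1_def E0_def by (simp add: algebra_simps)
  then show ?thesis using cmap_sim[OF bmap_pow] sim_trans by blast
qed


end

section \<open>The action of words on triples\<close>

lemma carrier_presented_group: "carrier (presented_group R) = range (pres_class R)"
  and one_presented_group: "\<one>\<^bsub>presented_group R\<^esub> = pres_class R []"
  by (simp_all add: presented_group_def)

lemma pres_class_closed [simp]: "pres_class R w \<in> carrier (presented_group R)"
  by (simp add: carrier_presented_group)

lemma pres_class_word_inv: "pres_class R (word_inv w) = inv\<^bsub>presented_group R\<^esub> pres_class R w"
proof -
  interpret group "presented_group R" by (rule group_presented_group)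
  have "pres_class R (word_inv w) \<otimes>\<^bsub>presented_group R\<^esub> pres_class R w = \<one>\<^bsub>presented_group R\<^esub>"
    by (simp add: mult_presented_group one_presented_group pres_class_eq_iff pres_cong_word_inv)
  then show ?thesis by (intro inv_equality[symmetric]) simp_all
qed

lemma pres_class_replicate:
  "pres_class R (concat (replicate n w)) = pres_class R w [^]\<^bsub>presented_group R\<^esub> n"
proof -
  interpret group "presented_group R" by (rule group_presented_group)
  show ?thesis
  proof (induction n)
    case 0
    then show ?case by (simp add: one_presented_group)
  next
    case (Suc n)
    have "pres_class R (concat (replicate (Suc n) w))
        = pres_class R w \<otimes>\<^bsub>presented_group R\<^esub> pres_class R w [^]\<^bsub>presented_group R\<^esub> n"
      by (simp add: Suc[symmetric] mult_presented_group)
    then show ?case by (simp only: nat_pow_Suc2[OF pres_class_closed])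
  qed
qed

lemma pres_class_word_pow: "pres_class R (word_pow w k) = pres_class R w [^]\<^bsub>presented_group R\<^esub> k"
proof -
  interpret group "presented_group R" by (rule group_presented_group)
  show ?thesis
  proof (cases "k \<ge> 0")
    case True
    then show ?thesis by (simp add: word_pow_def pres_class_replicate)
  next
    case False
    then show ?thesis
      by (simp add: word_pow_def pres_class_replicate pres_class_word_inv int_pow_neg int_pow_inv)
  qed
qed

lemma word_inv_Nil [simp]: "word_inv [] = []" 
  and word_inv_Cons: "word_inv (p # w) = word_inv w @ [(fst p, \<not> snd p)]"
  by (simp_all add: word_inv_def case_prod_beta)

lemma word_inv_append: "word_inv (v @ w) = word_inv w @ word_inv v"
  by (simp add: word_inv_def)

lemma word_inv_word_inv [simp]: "word_inv (word_inv w) = w"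
  by (induction w) (simp_all add: word_inv_Cons word_inv_append)

abbreviation wA :: "gen group_word" where "wA \<equiv> [(GenA, True)]"
abbreviation wB :: "gen group_word" where "wB \<equiv> [(GenB, True)]"

lemma J_relations_eq: "J_relations m l =
  {(word_conj wA (word_comm wA wB), word_pow wA (1 + 2 ^ m * l)),
   (word_conj wB (word_comm wB wA), word_pow wB (1 + 2 ^ m * l)),
   (word_pow wA (2 ^ (3 * m - 1)), []), (word_pow wB (2 ^ (3 * m - 1)), [])}"
  by (simp add: J_relations_def Let_def)

context macdonald_parameters
begin

lemma sim_lift: "\<lbrakk>sim x x'; sim y y'; sim x' y'\<rbrakk> \<Longrightarrow> sim x y"
  by (rule sim_trans, assumption, rule sim_trans, assumption, rule sim_sym)

lemma sim_drop: "\<lbrakk>sim x x'; sim y y'; sim x y\<rbrakk> \<Longrightarrow> sim x' y'"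
  by (rule sim_lift[OF sim_sym sim_sym])

fun act1 :: "gen \<times> bool \<Rightarrow> triple \<Rightarrow> triple" where
  "act1 (GenA, True) x = amap 1 x"
| "act1 (GenA, False) x = amap (- 1) x"
| "act1 (GenB, True) x = bmap x"
| "act1 (GenB, False) x = binv x"

definition act :: "gen group_word \<Rightarrow> triple \<Rightarrow> triple" where "act w x = fold act1 w x"

lemma act_Nil [simp]: "act [] x = x"
  and act_Cons: "act (p # w) x = act w (act1 p x)"
  and act_append: "act (v @ w) x = act w (act v x)"
  by (simp_all add: act_def)

lemma act1_sim: "sim x y \<Longrightarrow> sim (act1 p x) (act1 p y)"
  by (cases "(p, x)" rule: act1.cases) (simp_all add: amap_sim binv_sim bmap_sim_iff)

lemma act1_cancel: "sim (act1 (g, \<not> b) (act1 (g, b) x)) x"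
proof -
  have "amap n (amap (- n) x) = x" for n by (cases x) simp
  from this[of 1] this[of "- 1"] show ?thesis
    by (cases g; cases b) (simp_all add: binv_bmap bmap_binv)
qed

lemma act_sim: "sim x y \<Longrightarrow> sim (act w x) (act w y)"
  by (induction w arbitrary: x y) (simp_all add: act_Cons act1_sim)

lemma act_word_inv: "sim (act (word_inv w) (act w x)) x"
proof (induction w arbitrary: x)
  case (Cons p w)
  have "sim (act1 (fst p, \<not> snd p) (act (word_inv w) (act w (act1 p x)))) (act1 (fst p, \<not> snd p) (act1 p x))"
    by (rule act1_sim[OF Cons])
  then show ?case
    using sim_trans[OF _ act1_cancel[of "fst p" "snd p" x]] by (simp add: act_Cons act_append word_inv_Cons)
qed simp

lemma act_word_inv': "sim (act w (act (word_inv w) x)) x"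
  using act_word_inv[of "word_inv w" x] by simp

lemma act_replicate: "act (concat (replicate n w)) x = (act w ^^ n) x"
  by (induction n arbitrary: x) (simp_all add: act_append funpow_swap1)

text \<open>The commutator \<open>[a, b]\<close> acts as \<open>c\<close> because of \<open>ab_model\<close>.\<close>

lemma act_comm: "sim (act (word_comm wA wB) x) (cmap x)"
proof -
  let ?y = "act (word_inv wB) (act (word_inv wA) x)"
  have "act (word_comm wA wB) x = bmap (amap 1 ?y)"
    by (simp only: word_comm_def act_append act_Cons act_Nil act1.simps)
  then have 1: "sim (act (word_comm wA wB) x) (cmap (amap 1 (bmap ?y)))"
    by (simp only: ab_model)
  have "sim (cmap (act wA (act wB ?y))) (cmap (act wA (act (word_inv wA) x)))"
    by (intro cmap_sim act_sim act_word_inv')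
  then have 2: "sim (cmap (amap 1 (bmap ?y))) (cmap (act wA (act (word_inv wA) x)))"
    by (simp only: act_Cons act_Nil act1.simps)
  have 3: "sim (cmap (act wA (act (word_inv wA) x))) (cmap x)"
    by (intro cmap_sim act_word_inv')
  show ?thesis by (rule sim_trans[OF 1 sim_trans[OF 2 3]])
qed

lemma act_inv_comm: "sim (cmap (act (word_inv (word_comm wA wB)) x)) x"
  by (rule sim_trans[OF sim_sym[OF act_comm] act_word_inv'])

lemma cmap_sim_cancel: assumes "sim (cmap x) (cmap y)" shows "sim x y"
proof -
  have "sim (act (word_comm wA wB) x) (act (word_comm wA wB) y)"
    by (rule sim_lift[OF act_comm act_comm assms])
  then have "sim (act (word_inv (word_comm wA wB)) (act (word_comm wA wB) x))
      (act (word_inv (word_comm wA wB)) (act (word_comm wA wB) y))"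
    by (rule act_sim)
  then show ?thesis by (rule sim_drop[OF act_word_inv act_word_inv])
qed

lemma act_pow_A: "act (word_pow wA k) x = amap k x"
proof (cases x)
  case (fields p q r)
  have "(act wA ^^ n) (p, q, r) = (p, q, r + int n)" for n
    by (induction n) (simp_all add: act_Cons)
  moreover have "(act (word_inv wA) ^^ n) (p, q, r) = (p, q, r - int n)" for n
    by (induction n) (simp_all add: act_Cons word_inv_Cons)
  ultimately show ?thesis
    by (simp add: word_pow_def act_replicate fields)
qed

lemma act_A_relation:
  "sim (act (word_conj wA (word_comm wA wB)) x) (act (word_pow wA (1 + 2 ^ m * l)) x)"
proof -
  let ?y = "act (word_inv (word_comm wA wB)) x"
  have "sim (act (word_conj wA (word_comm wA wB)) x) (cmap (amap 1 ?y))"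
    by (simp add: word_conj_def act_append act_Cons act_comm)
  also have "cmap (amap 1 ?y) = amap (1 + 4 * u) (cmap ?y)"
    by (cases ?y) (simp add: algebra_simps)
  finally show ?thesis
    unfolding act_pow_A alpha_eq by (rule sim_trans[OF _ amap_sim[OF act_inv_comm]])
qed

lemma bmap_pow_sim: "sim x y \<Longrightarrow> sim ((bmap ^^ n) x) ((bmap ^^ n) y)"
  by (induction n) (simp_all add: bmap_sim_iff)

lemma bmap_pow_P_mult: "sim ((bmap ^^ (nat P * n)) x) x"
proof (induction n)
  case (Suc n)
  have "sim ((bmap ^^ nat P) ((bmap ^^ (nat P * n)) x)) ((bmap ^^ (nat P * n)) x)" by (rule bmap_P)
  from sim_trans[OF this Suc] show ?case by (simp add: funpow_add)
qed simp

lemma bmap_pow_cong: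
  assumes "P dvd int n - int n'"
  shows "sim ((bmap ^^ n) x) ((bmap ^^ n') x)"
proof -
  have *: "sim ((bmap ^^ n) x) ((bmap ^^ n') x)" if "n' \<le> n" "P dvd int n - int n'" for n n'
  proof -
    have "nat P dvd n - n'" using that P_pos by (simp add: nat_dvd_iff of_nat_diff flip: int_dvd_int_iff)
    then obtain q where "n - n' = nat P * q" by (elim dvdE)
    then have "n = n' + nat P * q" using that(1) by simp
    then show ?thesis using bmap_pow_sim[OF bmap_pow_P_mult[of q x], of n'] by (simp add: funpow_add)
  qed
  show ?thesis
    using *[of n' n] *[of n n'] assms sim_sym by (cases "n' \<le> n") (auto simp: dvd_diff_commute)
qed

lemma binv_pow: "sim ((bmap ^^ n) ((binv ^^ n) x)) x"
proof (induction n arbitrary: x)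
  case (Suc n)
  have "sim (bmap ((bmap ^^ n) ((binv ^^ n) (binv x)))) (bmap (binv x))"
    using Suc[of "binv x"] by (simp add: bmap_sim_iff)
  from sim_trans[OF this bmap_binv] show ?case
    by (simp add: funpow_swap1)
qed simp

lemma bmap_pow_sim_cancel: "sim ((bmap ^^ n) x) ((bmap ^^ n) y) \<Longrightarrow> sim x y"
  by (induction n) (simp_all add: bmap_sim_iff)

lemma act_pow_B: 
  assumes "P dvd int n - k"
  shows "sim (act (word_pow wB k) x) ((bmap ^^ n) x)"
proof (cases "k \<ge> 0")
  case True
  have "act wB = bmap" by (rule ext) (simp add: act_Cons)
  moreover have "word_pow wB k = concat (replicate (nat k) wB)"
    using True unfolding word_pow_def by (simp only: abs_of_nonneg if_True)
  ultimately have "act (word_pow wB k) x = (bmap ^^ nat k) x"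
    by (simp only: act_replicate)
  moreover have "P dvd int (nat k) - int n" using True assms by (simp add: dvd_diff_commute)
  ultimately show ?thesis using bmap_pow_cong by simp
next
  case False
  let ?q = "nat (- k)"
  have "act (word_inv wB) = binv" by (rule ext) (simp add: act_Cons word_inv_Cons)
  moreover have "word_pow wB k = concat (replicate ?q (word_inv wB))"
    using False by (simp add: word_pow_def)
  ultimately have "act (word_pow wB k) x = (binv ^^ ?q) x"
    by (simp only: act_replicate)
  moreover have "P dvd int (?q + n) - int 0"
    using assms False by (simp add: algebra_simps)
  then have "sim ((bmap ^^ ?q) ((bmap ^^ n) x)) ((bmap ^^ 0) x)"
    using bmap_pow_cong[of "?q + n" 0 x] by (simp add: funpow_add)
  then have "sim ((bmap ^^ ?q) ((binv ^^ ?q) x)) ((bmap ^^ ?q) ((bmap ^^ n) x))"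
    by (intro sim_lift[OF binv_pow _ sim_refl]) simp
  ultimately show ?thesis using bmap_pow_sim_cancel by simp
qed

lemma word_comm_BA: "word_comm wB wA = word_inv (word_comm wA wB)"
  by (simp only: word_comm_def word_inv_append word_inv_word_inv append_assoc)

lemma act_B_relation:
  "sim (act (word_conj wB (word_comm wB wA)) x) (act (word_pow wB (1 + 2 ^ m * l)) x)"
proof -
  define n where "n = nat ((1 + 4 * u) mod P)"
  have n: "P dvd int n - (1 + 4 * u)"
    unfolding n_def using P_pos by (simp add: mod_eq_dvd_iff[symmetric])
  let ?z = "act (word_conj wB (word_comm wB wA)) x"
  have 1: "sim (cmap ?z) (act wB (act (word_comm wA wB) x))"
    unfolding word_comm_BA word_conj_def word_inv_word_inv act_append by (rule act_inv_comm)
  have 2: "sim (act wB (act (word_comm wA wB) x)) (bmap (cmap x))"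
    by (simp add: act_Cons bmap_sim_iff act_comm)
  have "sim (cmap ?z) (cmap ((bmap ^^ n) x))"
    by (rule sim_trans[OF sim_trans[OF 1 2] sim_sym[OF cb_model[OF n]]])
  then have "sim ?z ((bmap ^^ n) x)" by (rule cmap_sim_cancel)
  moreover have "sim (act (word_pow wB (1 + 2 ^ m * l)) x) ((bmap ^^ n) x)"
    unfolding alpha_eq by (rule act_pow_B[OF n])
  ultimately show ?thesis by (rule sim_lift[OF _ _ sim_refl])
qed

text \<open>Since the four defining relations hold in the model, the action of words descends to \<open>J\<close>: words that
  are equal in \<open>J\<close> move every triple to equivalent places.\<close>

theorem act_pres_cong:
  assumes "pres_cong (J_relations m l) v w"
  shows "sim (act v x) (act w x)"
  using assms
proof (induction arbitrary: x)
  case (pres_rel v w)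
  have "sim (act (word_pow wA (2 ^ (3 * m - 1))) x) x"
    unfolding act_pow_A by (cases x) (simp add: P_def)
  moreover have "sim (act (word_pow wB (2 ^ (3 * m - 1))) x) x"
    using sim_trans[OF act_pow_B[of "nat P" P x] bmap_P] P_pos unfolding P_def by simp
  ultimately show ?case
    using pres_rel act_A_relation[of x] act_B_relation[of x] unfolding J_relations_eq
    by (elim insertE emptyE) (simp_all only: prod.inject act_Nil)
next
  case (pres_append v v' w w')
  show ?case
    unfolding act_append by (rule sim_trans[OF act_sim[OF pres_append.IH(1)] pres_append.IH(2)])
next
  case (pres_cancel g b)
  then show ?case using act1_cancel by (simp add: act_Cons)
next
  case (pres_trans v v' w)
  show ?case by (rule sim_trans[OF pres_trans.IH])
next
  case (pres_sym v w)
  show ?case by (rule sim_sym[OF pres_sym.IH])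
qed simp


section \<open>Normal forms in J\<close>

abbreviation J :: "gen group_word set monoid" where "J \<equiv> presented_group (J_relations m l)"
abbreviation cls :: "gen group_word \<Rightarrow> gen group_word set" where "cls \<equiv> pres_class (J_relations m l)"

definition jA :: "gen group_word set" where "jA = cls wA"
definition jB :: "gen group_word set" where "jB = cls wB"
definition jC :: "gen group_word set" where "jC = cls (word_comm wA wB)"

lemma macdonald_group_J: "macdonald_group m l J jA jB jC"
proof -
  interpret J: group J by (rule group_presented_group)
  have closed: "jA \<in> carrier J" "jB \<in> carrier J" "jC \<in> carrier J"
    by (simp_all add: jA_def jB_def jC_def)
  have rel: "cls v = cls w" if "(v, w) \<in> J_relations m l" for v w
    unfolding pres_class_eq_iff using that by (rule pres_cong.pres_rel)
  have jC: "jC = inv\<^bsub>J\<^esub> jA \<otimes>\<^bsub>J\<^esub> inv\<^bsub>J\<^esub> jB \<otimes>\<^bsub>J\<^esub> jA \<otimes>\<^bsub>J\<^esub> jB"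
    unfolding jA_def jB_def jC_def word_comm_def pres_class_word_inv[symmetric] mult_presented_group append_assoc ..
  have "cls (word_conj wA (word_comm wA wB)) = cls (word_pow wA (1 + 2 ^ m * l))"
    by (rule rel) (simp add: J_relations_eq)
  then have A: "inv\<^bsub>J\<^esub> jC \<otimes>\<^bsub>J\<^esub> jA \<otimes>\<^bsub>J\<^esub> jC = jA [^]\<^bsub>J\<^esub> (1 + 2 ^ m * l)"
    unfolding jA_def jC_def word_conj_def pres_class_word_pow pres_class_word_inv[symmetric]
      mult_presented_group append_assoc .
  have "cls (word_conj wB (word_comm wB wA)) = cls (word_pow wB (1 + 2 ^ m * l))"
    by (rule rel) (simp add: J_relations_eq)
  then have B: "jC \<otimes>\<^bsub>J\<^esub> jB \<otimes>\<^bsub>J\<^esub> inv\<^bsub>J\<^esub> jC = jB [^]\<^bsub>J\<^esub> (1 + 2 ^ m * l)"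
    unfolding word_comm_BA word_conj_def word_inv_word_inv
    unfolding jB_def jC_def pres_class_word_pow pres_class_word_inv[symmetric]
      mult_presented_group append_assoc .
  show ?thesis
  proof (unfold_locales)
    show "jA \<otimes>\<^bsub>J\<^esub> jB = jB \<otimes>\<^bsub>J\<^esub> jA \<otimes>\<^bsub>J\<^esub> jC"
    proof -
      have "jB \<otimes>\<^bsub>J\<^esub> jA \<otimes>\<^bsub>J\<^esub> jC = jB \<otimes>\<^bsub>J\<^esub> (jA \<otimes>\<^bsub>J\<^esub> inv\<^bsub>J\<^esub> jA) \<otimes>\<^bsub>J\<^esub> inv\<^bsub>J\<^esub> jB \<otimes>\<^bsub>J\<^esub> (jA \<otimes>\<^bsub>J\<^esub> jB)"
        unfolding jC using closed by (simp only: J.m_assoc J.m_closed J.inv_closed)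
      also have "\<dots> = jA \<otimes>\<^bsub>J\<^esub> jB" using closed by simp
      finally show ?thesis ..
    qed
    show "jA \<otimes>\<^bsub>J\<^esub> jC = jC \<otimes>\<^bsub>J\<^esub> jA [^]\<^bsub>J\<^esub> (1 + 2 ^ m * l)"
      unfolding A[symmetric] using closed by (simp add: J.m_assoc[symmetric])
    show "jC \<otimes>\<^bsub>J\<^esub> jB = jB [^]\<^bsub>J\<^esub> (1 + 2 ^ m * l) \<otimes>\<^bsub>J\<^esub> jC"
      unfolding B[symmetric] using closed by (simp add: J.m_assoc)
    have "cls (word_pow wA (2 ^ (3 * m - 1))) = cls []" "cls (word_pow wB (2 ^ (3 * m - 1))) = cls []"
      by (rule rel, simp add: J_relations_eq)+
    then show "jA [^]\<^bsub>J\<^esub> (2 ^ (3 * m - 1) :: int) = \<one>\<^bsub>J\<^esub>" "jB [^]\<^bsub>J\<^esub> (2 ^ (3 * m - 1) :: int) = \<one>\<^bsub>J\<^esub>"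
      by (simp_all add: jA_def jB_def pres_class_word_pow one_presented_group)
  qed (use closed m l in simp_all)
qed

interpretation J: macdonald_group m l J jA jB jC
  by (rule macdonald_group_J)

definition EJ :: "int \<Rightarrow> int \<Rightarrow> int \<Rightarrow> gen group_word set" where
  "EJ k j i = jC [^]\<^bsub>J\<^esub> k \<otimes>\<^bsub>J\<^esub> jB [^]\<^bsub>J\<^esub> j \<otimes>\<^bsub>J\<^esub> jA [^]\<^bsub>J\<^esub> i"

lemma EJ_closed [simp]: "EJ k j i \<in> carrier J"
  unfolding EJ_def using J.a J.b J.c by simp

lemma EJ_surj: "x \<in> carrier J \<Longrightarrow> \<exists>k j i. x = EJ k j i"
proof -
  have letters: "cls [(GenA, True)] = jA" "cls [(GenB, True)] = jB"
    "cls [(GenA, False)] = inv\<^bsub>J\<^esub> jA" "cls [(GenB, False)] = inv\<^bsub>J\<^esub> jB"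
    unfolding jA_def jB_def pres_class_word_inv[symmetric] by (simp_all add: word_inv_Cons)
  have "\<exists>k j i. cls w = EJ k j i" for w
  proof (induction w rule: rev_induct)
    case Nil
    have "cls [] = EJ 0 0 0" by (simp add: EJ_def one_presented_group[symmetric])
    then show ?case by blast
  next
    case (snoc p w)
    obtain k j i where w: "cls w = EJ k j i" using snoc by blast
    have wp: "cls (w @ [p]) = EJ k j i \<otimes>\<^bsub>J\<^esub> cls [p]"
      unfolding w[symmetric] by (rule mult_presented_group[symmetric])
    obtain g e where p: "p = (g, e)" by (cases p)
    show ?case
    proof (cases g; cases e)
      assume "g = GenA" "e"
      then have "cls (w @ [p]) = EJ k j (i + 1)"
        unfolding wp unfolding p using letters J.normal_form_step_a[of k j i 1] J.a by (simp add: EJ_def)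
      then show ?case by blast
    next
      assume "g = GenA" "\<not> e"
      then have "cls (w @ [p]) = EJ k j (i - 1)"
        unfolding wp unfolding p using letters J.normal_form_step_a[of k j i "- 1"] J.a by (simp add: EJ_def J.int_pow_neg)
      then show ?case by blast
    next
      assume "g = GenB" "e"
      then have "cls (w @ [p]) = EJ k j i \<otimes>\<^bsub>J\<^esub> jB" unfolding wp unfolding p using letters by simp
      then show ?case unfolding EJ_def using J.normal_form_step_b[of k j i] by simp
    next
      assume "g = GenB" "\<not> e"
      then have "cls (w @ [p]) = EJ k j i \<otimes>\<^bsub>J\<^esub> inv\<^bsub>J\<^esub> jB" unfolding wp unfolding p using letters by simp
      then show ?case unfolding EJ_def J.inv_b using J.normal_form_step_bn[of k j i] by simp
    qed
  qed
  moreover assume "x \<in> carrier J"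
  ultimately show ?thesis by (auto simp: carrier_presented_group)
qed

text \<open>The place to which \<open>g\<close> moves the origin; by \<open>pos_unique\<close> it depends only on \<open>g\<close>, up to \<open>sim\<close>.\<close>

definition pos :: "gen group_word set \<Rightarrow> triple \<Rightarrow> bool" where
  "pos g x \<longleftrightarrow> (\<exists>w. g = cls w \<and> sim (act w (0, 0, 0)) x)"

lemma pos_unique: "\<lbrakk>pos g x; pos g y\<rbrakk> \<Longrightarrow> sim x y"
proof -
  assume "pos g x" "pos g y"
  then obtain v w where v: "g = cls v" "sim (act v (0, 0, 0)) x" and w: "g = cls w" "sim (act w (0, 0, 0)) y"
    unfolding pos_def by blast
  have "cls v = cls w" by (rule trans[OF v(1)[symmetric] w(1)])
  then have "pres_cong (J_relations m l) v w" by (simp only: pres_class_eq_iff)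
  then show "sim x y" by (rule sim_drop[OF v(2) w(2) act_pres_cong])
qed

lemma pos_mult: "\<lbrakk>pos g x; sim (act w x) y\<rbrakk> \<Longrightarrow> pos (g \<otimes>\<^bsub>J\<^esub> cls w) y"
proof -
  assume "pos g x" and xy: "sim (act w x) y"
  then obtain v where v: "g = cls v" "sim (act v (0, 0, 0)) x"
    unfolding pos_def by blast
  show ?thesis
    unfolding pos_def v(1) mult_presented_group
    by (intro exI[of _ "v @ w"] conjI refl) (simp only: act_append sim_trans[OF act_sim[OF v(2)] xy])
qed

lemma pos_int_pow:
  assumes "pos g (f 0)" "\<And>n. sim (act w (f n)) (f (n + 1))" 
  shows "pos (g \<otimes>\<^bsub>J\<^esub> cls w [^]\<^bsub>J\<^esub> (n::int)) (f n)"
proof -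
  have g: "g \<in> carrier J" using assms(1) unfolding pos_def by auto
  have step: "g \<otimes>\<^bsub>J\<^esub> cls w [^]\<^bsub>J\<^esub> (n + 1) = g \<otimes>\<^bsub>J\<^esub> cls w [^]\<^bsub>J\<^esub> n \<otimes>\<^bsub>J\<^esub> cls w" for n :: int
    using g by (simp add: J.int_pow_Suc J.m_assoc)
  show ?thesis
  proof (induction n rule: int_shift_induct)
    case 1
    then show ?case using assms(1) g by simp
  next
    case (2 n)
    have "pos (g \<otimes>\<^bsub>J\<^esub> cls w [^]\<^bsub>J\<^esub> n) (f n)" if "pos (g \<otimes>\<^bsub>J\<^esub> cls w [^]\<^bsub>J\<^esub> (n + 1)) (f (n + 1))"
    proof -
      have "sim (act (word_inv w) (f (n + 1))) (f n)"
        by (rule sim_trans[OF act_sim[OF sim_sym[OF assms(2)]] act_word_inv])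
      from pos_mult[OF that this] show ?thesis
        unfolding step pres_class_word_inv using g by (simp add: J.m_assoc)
    qed
    moreover have "pos (g \<otimes>\<^bsub>J\<^esub> cls w [^]\<^bsub>J\<^esub> (n + 1)) (f (n + 1))" if "pos (g \<otimes>\<^bsub>J\<^esub> cls w [^]\<^bsub>J\<^esub> n) (f n)"
      unfolding step by (rule pos_mult[OF that assms(2)])
    ultimately show ?case by blast
  qed
qed

text \<open>The element \<open>c\<^sup>k b\<^sup>j a\<^sup>i\<close> moves the origin to \<open>(k, j, i)\<close>, so the triple can be recovered from the element.\<close>

lemma pos_EJ: "pos (EJ k j i) (k, j, i)"
proof -
  have "pos (cls []) (0, 0, 0)" unfolding pos_def by (rule exI[of _ "[]"]) simp
  then have 1: "pos (cls [] \<otimes>\<^bsub>J\<^esub> jC [^]\<^bsub>J\<^esub> k) (k, 0, 0)"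
    unfolding jC_def
  proof (rule pos_int_pow[where f = "\<lambda>n. (n, 0, 0)"])
    show "sim (act (word_comm wA wB) (n, 0, 0)) (n + 1, 0, 0)" for n
      using act_comm[of "(n, 0, 0)"] by simp
  qed
  then have 2: "pos (cls [] \<otimes>\<^bsub>J\<^esub> jC [^]\<^bsub>J\<^esub> k \<otimes>\<^bsub>J\<^esub> jB [^]\<^bsub>J\<^esub> j) (k, j, 0)"
    unfolding jB_def
    by (rule pos_int_pow[where f = "\<lambda>n. (k, n, 0)"]) (simp add: act_Cons tau_def)
  then have "pos (cls [] \<otimes>\<^bsub>J\<^esub> jC [^]\<^bsub>J\<^esub> k \<otimes>\<^bsub>J\<^esub> jB [^]\<^bsub>J\<^esub> j \<otimes>\<^bsub>J\<^esub> jA [^]\<^bsub>J\<^esub> i) (k, j, i)"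
    unfolding jA_def
    by (rule pos_int_pow[where f = "\<lambda>n. (k, j, n)"]) (simp add: act_Cons)
  then show ?thesis
    unfolding EJ_def using J.a J.b J.c by (simp flip: one_presented_group)
qed

lemma EJ_eq_imp_sim: "EJ k j i = EJ k' j' i' \<Longrightarrow> sim (k, j, i) (k', j', i')"
  using pos_unique[OF pos_EJ[of k j i]] pos_EJ[of k' j' i'] by (simp only:)

end

section \<open>The centre of J and the structure of H\<close>

lemma (in group) center_iff: "z \<in> center G \<longleftrightarrow> z \<in> carrier G \<and> (\<forall>g \<in> carrier G. z \<otimes> g = g \<otimes> z)"
  by (simp add: center_def)

lemma (in group) center_commute: "z \<in> center G \<Longrightarrow> g \<in> carrier G \<Longrightarrow> z \<otimes> g = g \<otimes> z"
  by (simp add: center_iff)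

lemma (in group) centerI:
  "\<lbrakk>z \<in> carrier G; \<And>g. g \<in> carrier G \<Longrightarrow> z \<otimes> g = g \<otimes> z\<rbrakk> \<Longrightarrow> z \<in> center G"
  unfolding center_iff by blast

lemma (in group) rcos_eq_iff:
  assumes "subgroup N G" "x \<in> carrier G" "y \<in> carrier G"
  shows "N #> x = N #> y \<longleftrightarrow> x \<otimes> inv y \<in> N"
proof
  assume "N #> x = N #> y"
  then have "x \<in> N #> y" using repr_independenceD[OF assms(1,2)] by simp
  then show "x \<otimes> inv y \<in> N" using subgroup.rcos_module_imp[OF assms(1) is_group assms(3)] by simp
next
  assume "x \<otimes> inv y \<in> N"
  then have "x \<in> N #> y" by (rule subgroup.rcos_module_rev[OF assms(1) is_group assms(3,2)])
  then show "N #> x = N #> y" using repr_independence[OF _ assms(3,1)] by simp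
qed

lemma (in group) normal_center: "center G \<lhd> G"
proof (rule normal_invI)
  show "subgroup (center G) G"
  proof (rule subgroupI)
    show "center G \<noteq> {}" using center_iff[of \<one>] by auto
    show "inv z \<in> center G" if "z \<in> center G" for z
    proof -
      have "inv z \<otimes> g = g \<otimes> inv z" if "g \<in> carrier G" for g
        using int_pow_intertwine[of z z g "- 1"] \<open>z \<in> center G\<close> that by (simp add: center_iff int_pow_neg)
      moreover have "inv z \<in> carrier G" using that by (simp add: center_iff)
      ultimately show ?thesis by (intro centerI)
    qed
    show "y \<otimes> z \<in> center G" if "y \<in> center G" "z \<in> center G" for y z
    proof -
      have y: "y \<in> carrier G" and z: "z \<in> carrier G" using that by (simp_all add: center_iff)
      have "y \<otimes> z \<otimes> g = g \<otimes> (y \<otimes> z)" if g: "g \<in> carrier G" for g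
      proof -
        have "y \<otimes> z \<otimes> g = y \<otimes> (z \<otimes> g)" using y z g by (rule m_assoc)
        also have "z \<otimes> g = g \<otimes> z" using \<open>z \<in> center G\<close> g by (rule center_commute)
        also have "y \<otimes> (g \<otimes> z) = y \<otimes> g \<otimes> z" using y g z by (rule m_assoc[symmetric])
        also have "y \<otimes> g = g \<otimes> y" using \<open>y \<in> center G\<close> g by (rule center_commute)
        also have "g \<otimes> y \<otimes> z = g \<otimes> (y \<otimes> z)" using g y z by (rule m_assoc)
        finally show ?thesis .
      qed
      then show ?thesis by (rule centerI[OF m_closed[OF y z]])
    qed
  qed (auto simp: center_iff)
  show "x \<otimes> z \<otimes> inv x \<in> center G" if "x \<in> carrier G" "z \<in> center G" for x z
  proof -
    have "x \<otimes> z = z \<otimes> x" by (rule center_commute[OF that(2,1), symmetric])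
    moreover have "z \<in> carrier G" using that(2) by (simp add: center_iff)
    ultimately have "x \<otimes> z \<otimes> inv x = z" using that(1) by (simp add: m_assoc)
    then show ?thesis using that by simp
  qed
qed

text \<open>The relations of \<open>H\<close> together with the uniqueness of normal forms modulo \<open>M\<close>; up to isomorphism only \<open>H\<close> is of this kind.\<close>

locale macdonald_quotient = macdonald_parameters m l +
    macdonald_relations G a b c "macdonald_parameters.u m l" "macdonald_parameters.M m"
  for m l and G (structure) and a b c +
  assumes E_eq_imp: "E k j i = E k' j' i' \<Longrightarrow> M dvd k - k' \<and> M dvd j - j' \<and> M dvd i - i'"
    and E_surj: "x \<in> carrier G \<Longrightarrow> \<exists>k j i. x = E k j i"

context macdonald_parameters
begin

interpretation J: macdonald_group m l J jA jB jC
  by (rule macdonald_group_J)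

lemma P_dvd_4u_iff: "P dvd 4 * u * k \<longleftrightarrow> M dvd k"
proof -
  have "4 * u = 2 ^ m * l" using two_nu nu_u by simp
  then have "P dvd 4 * u * k \<longleftrightarrow> 2 ^ m * M dvd 2 ^ m * (l * k)"
    by (simp only: M_P[symmetric] mult.commute[of M] mult.assoc)
  moreover have "M dvd l * k \<longleftrightarrow> M dvd k"
    using coprime_P(2)[OF l] by (simp add: coprime_dvd_mult_right_iff)
  ultimately show ?thesis by simp
qed

lemma central_powers: "jA [^]\<^bsub>J\<^esub> (M * t) \<in> center J"
proof -
  let ?z = "jA [^]\<^bsub>J\<^esub> (M * t)"
  have z: "?z \<in> carrier J" using J.a by simp
  have "jA [^]\<^bsub>J\<^esub> M \<otimes>\<^bsub>J\<^esub> jB = jB \<otimes>\<^bsub>J\<^esub> jA [^]\<^bsub>J\<^esub> M" by (rule J.aM_b)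
  then have zb: "?z \<otimes>\<^bsub>J\<^esub> jB = jB \<otimes>\<^bsub>J\<^esub> ?z"
    using J.int_pow_intertwine[of "jA [^]\<^bsub>J\<^esub> M" "jA [^]\<^bsub>J\<^esub> M" jB t] J.a J.b by (simp add: J.int_pow_pow)
  have "P dvd M * t * (1 + 2 * \<nu>) - M * t"
    using dvd_mult2[OF M_nu, of t] by (simp add: algebra_simps)
  then have zc: "?z \<otimes>\<^bsub>J\<^esub> jC = jC \<otimes>\<^bsub>J\<^esub> ?z"
    unfolding J.a_c by (simp add: J.a_cong)
  have a: "jA [^]\<^bsub>J\<^esub> (i::int) \<otimes>\<^bsub>J\<^esub> ?z = ?z \<otimes>\<^bsub>J\<^esub> jA [^]\<^bsub>J\<^esub> i" for i
    using J.a by (simp add: add.commute flip: J.int_pow_mult)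
  have b: "jB [^]\<^bsub>J\<^esub> (i::int) \<otimes>\<^bsub>J\<^esub> ?z = ?z \<otimes>\<^bsub>J\<^esub> jB [^]\<^bsub>J\<^esub> i" for i
    by (rule J.int_pow_intertwine[OF J.b J.b z zb[symmetric]])
  have c: "jC [^]\<^bsub>J\<^esub> (i::int) \<otimes>\<^bsub>J\<^esub> ?z = ?z \<otimes>\<^bsub>J\<^esub> jC [^]\<^bsub>J\<^esub> i" for i
    by (rule J.int_pow_intertwine[OF J.c J.c z zc[symmetric]])
  have "?z \<otimes>\<^bsub>J\<^esub> g = g \<otimes>\<^bsub>J\<^esub> ?z" if "g \<in> carrier J" for g
  proof -
    obtain k j i where g: "g = EJ k j i" using EJ_surj[OF \<open>g \<in> carrier J\<close>] by blast
    let ?x = "jC [^]\<^bsub>J\<^esub> k" and ?y = "jB [^]\<^bsub>J\<^esub> j" and ?w = "jA [^]\<^bsub>J\<^esub> i"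
    have cl: "?x \<in> carrier J" "?y \<in> carrier J" "?w \<in> carrier J" using J.a J.b J.c by simp_all
    have "?z \<otimes>\<^bsub>J\<^esub> (?x \<otimes>\<^bsub>J\<^esub> ?y \<otimes>\<^bsub>J\<^esub> ?w) = ?x \<otimes>\<^bsub>J\<^esub> ?z \<otimes>\<^bsub>J\<^esub> ?y \<otimes>\<^bsub>J\<^esub> ?w"
      unfolding c using cl z by (simp add: J.m_assoc)
    also have "\<dots> = ?x \<otimes>\<^bsub>J\<^esub> (?y \<otimes>\<^bsub>J\<^esub> ?z) \<otimes>\<^bsub>J\<^esub> ?w"
      unfolding b using cl z by (simp add: J.m_assoc)
    also have "\<dots> = ?x \<otimes>\<^bsub>J\<^esub> ?y \<otimes>\<^bsub>J\<^esub> (?w \<otimes>\<^bsub>J\<^esub> ?z)"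
      unfolding a using cl z by (simp add: J.m_assoc)
    finally show ?thesis
      unfolding g EJ_def using cl z by (simp add: J.m_assoc)
  qed
  then show ?thesis by (rule J.centerI[OF z])
qed

lemma bM_central: "M dvd j \<Longrightarrow> \<exists>t. jB [^]\<^bsub>J\<^esub> j = jA [^]\<^bsub>J\<^esub> (M * t)"
  and cM_central: "M dvd j \<Longrightarrow> \<exists>t. jC [^]\<^bsub>J\<^esub> j = jA [^]\<^bsub>J\<^esub> (M * t)"
proof -
  have *: "\<exists>t. y [^]\<^bsub>J\<^esub> j = jA [^]\<^bsub>J\<^esub> (M * t)"
    if y: "y \<in> carrier J" and yM: "y [^]\<^bsub>J\<^esub> M = jA [^]\<^bsub>J\<^esub> (M * w)" and "M dvd j" for y w
  proof -
    obtain q where "j = M * q" using \<open>M dvd j\<close> by (elim dvdE)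
    then have "y [^]\<^bsub>J\<^esub> j = (y [^]\<^bsub>J\<^esub> M) [^]\<^bsub>J\<^esub> q" using y by (simp add: J.int_pow_pow)
    then have "y [^]\<^bsub>J\<^esub> j = jA [^]\<^bsub>J\<^esub> (M * (w * q))"
      using J.a by (simp add: yM J.int_pow_pow mult.assoc)
    then show ?thesis by (rule exI)
  qed
  show "M dvd j \<Longrightarrow> \<exists>t. jB [^]\<^bsub>J\<^esub> j = jA [^]\<^bsub>J\<^esub> (M * t)"
    using J.bM * J.b by blast
  show "M dvd j \<Longrightarrow> \<exists>t. jC [^]\<^bsub>J\<^esub> j = jA [^]\<^bsub>J\<^esub> (M * t)"
    using J.cM * J.c by blast
qed

lemma M_dvd_imp_central:
  assumes "M dvd k" "M dvd j" "M dvd i"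
  shows "EJ k j i \<in> center J"
proof -
  obtain s t where "jC [^]\<^bsub>J\<^esub> k = jA [^]\<^bsub>J\<^esub> (M * s)" "jB [^]\<^bsub>J\<^esub> j = jA [^]\<^bsub>J\<^esub> (M * t)"
    using bM_central[OF assms(2)] cM_central[OF assms(1)] by blast
  moreover obtain q where "i = M * q" using assms(3) by (elim dvdE)
  ultimately have "EJ k j i = jA [^]\<^bsub>J\<^esub> (M * (s + t + q))"
    using J.a by (simp add: EJ_def distrib_left flip: J.int_pow_mult)
  then show ?thesis by (simp add: central_powers)
qed

lemma pos_jC_pow:
  assumes "pos g (0, j, i)"
  shows "pos (g \<otimes>\<^bsub>J\<^esub> jC [^]\<^bsub>J\<^esub> (k::int)) (k, j * bp k, i * bp (- k))"
  unfolding jC_def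
proof (rule pos_int_pow[where f = "\<lambda>k. (k, j * bp k, i * bp (- k))"])
  show "pos g (0, j * bp 0, i * bp (- 0))" using assms by simp
  show "sim (act (word_comm wA wB) (n, j * bp n, i * bp (- n))) (n + 1, j * bp (n + 1), i * bp (- (n + 1)))" for n
  proof -
    have "P dvd j * (bp n * bp 1 - bp (n + 1))" by (intro dvd_mult bp_add)
    then have 1: "P dvd j * bp n * bp 1 - j * bp (n + 1)" by (simp add: algebra_simps)
    have "P dvd i * (bp (- n) * bp (- 1) - bp (- n + - 1))" by (intro dvd_mult bp_add)
    moreover have "bp (- 1) = 1 + 4 * u" by (simp add: bp_def)
    ultimately have 2: "P dvd i * bp (- n) * (1 + 4 * u) - i * bp (- (n + 1))" by (simp add: algebra_simps)
    have "sim (cmap (n, j * bp n, i * bp (- n))) (n + 1, j * bp (n + 1), i * bp (- (n + 1)))"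
      using dvd_trans[OF M_dvd_P 1] dvd_diff[OF 2 1] by simp
    then show ?thesis by (rule sim_trans[OF act_comm])
  qed
qed

text \<open>Compare the places to which \<open>z b\<close> and \<open>b z\<close>, and \<open>z c\<close> and \<open>c z\<close>, move the origin. The result is
  one half of \<open>Z(J) = \<langle>a\<^sup>M\<rangle>\<close>; the other half is \<open>M_dvd_imp_central\<close>.\<close>

lemma center_J_imp_M_dvd:
  assumes z: "EJ k j i \<in> center J"
  shows "M dvd k \<and> M dvd j \<and> M dvd i"
proof -
  have pos1: "pos (cls []) (0, 0, 0)" unfolding pos_def by (rule exI[of _ "[]"]) simp
  have one: "cls [] = \<one>\<^bsub>J\<^esub>" by (rule one_presented_group[symmetric])
  let ?z = "EJ k j i"
  have zb: "?z \<otimes>\<^bsub>J\<^esub> jB = jB \<otimes>\<^bsub>J\<^esub> ?z" and zc: "?z \<otimes>\<^bsub>J\<^esub> jC = jC \<otimes>\<^bsub>J\<^esub> ?z"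
    by (rule J.center_commute[OF z J.b], rule J.center_commute[OF z J.c])
  have "pos (?z \<otimes>\<^bsub>J\<^esub> jB) (bmap (k, j, i))"
    unfolding jB_def by (rule pos_mult[OF pos_EJ]) (simp add: act_Cons)
  moreover have "pos (jB \<otimes>\<^bsub>J\<^esub> ?z) (k, bp k + j, i)"
  proof -
    have "pos (cls [] \<otimes>\<^bsub>J\<^esub> jB) (0, 1, 0)"
      unfolding jB_def by (rule pos_mult[OF pos1]) (simp add: act_Cons tau_def)
    then have "pos (jB \<otimes>\<^bsub>J\<^esub> jC [^]\<^bsub>J\<^esub> k) (k, bp k, 0)"
      using pos_jC_pow[of jB 1 0 k] J.b by (simp add: one)
    then have "pos (jB \<otimes>\<^bsub>J\<^esub> jC [^]\<^bsub>J\<^esub> k \<otimes>\<^bsub>J\<^esub> jB [^]\<^bsub>J\<^esub> j) (k, bp k + j, 0)"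
      unfolding jB_def
      by (intro pos_int_pow[where f = "\<lambda>n. (k, bp k + n, 0)"]) (simp_all add: act_Cons tau_def)
    then have "pos (jB \<otimes>\<^bsub>J\<^esub> jC [^]\<^bsub>J\<^esub> k \<otimes>\<^bsub>J\<^esub> jB [^]\<^bsub>J\<^esub> j \<otimes>\<^bsub>J\<^esub> jA [^]\<^bsub>J\<^esub> i) (k, bp k + j, i)"
      unfolding jA_def
      by (intro pos_int_pow[where f = "\<lambda>n. (k, bp k + j, n)"]) (simp_all add: act_Cons)
    then show ?thesis
      unfolding EJ_def using J.a J.b J.c by (simp add: J.m_assoc)
  qed
  ultimately have "sim (bmap (k, j, i)) (k, bp k + j, i)"
    unfolding zb by (rule pos_unique)
  then have i: "M dvd i" by simp
  have "pos (?z \<otimes>\<^bsub>J\<^esub> jC) (cmap (k, j, i))"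
    unfolding jC_def by (rule pos_mult[OF pos_EJ act_comm])
  then have "pos (jC \<otimes>\<^bsub>J\<^esub> ?z) (cmap (k, j, i))" by (simp only: zc)
  moreover have "jC \<otimes>\<^bsub>J\<^esub> ?z = EJ (k + 1) j i"
    unfolding EJ_def add.commute[of k] using J.a J.b J.c by (simp add: J.int_pow_mult J.m_assoc)
  ultimately have "sim (cmap (k, j, i)) (k + 1, j, i)"
    using pos_unique[OF _ pos_EJ[of "k + 1" j i]] by (simp only:)
  then have "P dvd (i * (1 + 4 * u) - i) - (j * bp 1 - j)" by simp
  moreover have "(i * (1 + 4 * u) - i) - (j * bp 1 - j) = 4 * u * (i + j * (1 - 4 * u))"
    by (simp add: bp_def algebra_simps power2_eq_square)
  ultimately have "M dvd i + j * (1 - 4 * u)" by (simp only: P_dvd_4u_iff)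
  then have "M dvd j * (1 - 4 * u)" using i by (simp add: dvd_add_right_iff)
  then have j: "M dvd j"
    using coprime_P(2)[of "1 - 4 * u"] by (simp add: coprime_dvd_mult_left_iff)
  have n: "jB [^]\<^bsub>J\<^esub> j \<otimes>\<^bsub>J\<^esub> jA [^]\<^bsub>J\<^esub> i \<in> center J" (is "?n \<in> _")
    using M_dvd_imp_central[of 0 j i] i j J.b by (simp add: EJ_def)
  have ncl: "?n \<in> carrier J" using J.a J.b by simp
  have z': "?z = jC [^]\<^bsub>J\<^esub> k \<otimes>\<^bsub>J\<^esub> ?n"
    unfolding EJ_def using J.a J.b J.c by (simp add: J.m_assoc)
  have "jA \<otimes>\<^bsub>J\<^esub> ?z = ?z \<otimes>\<^bsub>J\<^esub> jA" by (rule J.center_commute[OF z J.a, symmetric])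
  moreover have "?n \<otimes>\<^bsub>J\<^esub> jA = jA \<otimes>\<^bsub>J\<^esub> ?n" by (rule J.center_commute[OF n J.a])
  ultimately have "jA \<otimes>\<^bsub>J\<^esub> jC [^]\<^bsub>J\<^esub> k \<otimes>\<^bsub>J\<^esub> ?n = jC [^]\<^bsub>J\<^esub> k \<otimes>\<^bsub>J\<^esub> jA \<otimes>\<^bsub>J\<^esub> ?n"
    unfolding z' using J.a J.c ncl by (simp only: J.m_assoc J.m_closed J.int_pow_closed)
  then have ac: "jA \<otimes>\<^bsub>J\<^esub> jC [^]\<^bsub>J\<^esub> k = jC [^]\<^bsub>J\<^esub> k \<otimes>\<^bsub>J\<^esub> jA"
    using J.r_cancel[of ?n "jA \<otimes>\<^bsub>J\<^esub> jC [^]\<^bsub>J\<^esub> k" "jC [^]\<^bsub>J\<^esub> k \<otimes>\<^bsub>J\<^esub> jA"] ncl J.a J.c by simp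
  have "pos (cls [] \<otimes>\<^bsub>J\<^esub> jA) (0, 0, 1)"
    unfolding jA_def by (rule pos_mult[OF pos1]) (simp add: act_Cons)
  then have "pos (jA \<otimes>\<^bsub>J\<^esub> jC [^]\<^bsub>J\<^esub> k) (k, 0, bp (- k))"
    using pos_jC_pow[of jA 0 1 k] J.a by (simp add: one)
  moreover have "pos (jC [^]\<^bsub>J\<^esub> k \<otimes>\<^bsub>J\<^esub> jA) (k, 0, 1)"
    using pos_EJ[of k 0 1] J.a J.c by (simp add: EJ_def)
  ultimately have "sim (k, 0, bp (- k)) (k, 0, 1)"
    unfolding ac by (rule pos_unique)
  then have "P dvd bp (- k) - 1" by simp
  also have "bp (- k) - 1 = 4 * u * (k * (1 + 2 * u * (k - 1)))"
    by (simp add: bp_def algebra_simps power2_eq_square)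
  finally have "M dvd k * (1 + 2 * u * (k - 1))" by (simp only: P_dvd_4u_iff)
  then have "M dvd k"
    using coprime_P(2)[of "1 + 2 * u * (k - 1)"] by (simp add: coprime_dvd_mult_left_iff)
  then show ?thesis using i j by simp
qed

theorem macdonald_quotient_H:
  "\<exists>a b c. macdonald_quotient m l (H_group m l) a b c"
proof -
  define q where "q = (\<lambda>x. center J #>\<^bsub>J\<^esub> x)"
  interpret N: normal "center J" J by (rule J.normal_center)
  have H: "H_group m l = J Mod center J" by (simp add: H_group_def J_group_def)
  interpret H: group "H_group m l" unfolding H by (rule N.factorgroup_is_group)
  interpret q: group_hom J "H_group m l" q
    by (unfold_locales) (simp add: q_def H N.r_coset_hom_Mod)
  have q_eq: "q x = q y \<longleftrightarrow> x \<otimes>\<^bsub>J\<^esub> inv\<^bsub>J\<^esub> y \<in> center J" if "x \<in> carrier J" "y \<in> carrier J" for x y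
    unfolding q_def by (rule J.rcos_eq_iff[OF N.subgroup_axioms that])
  have rel: "macdonald_relations (H_group m l) (q jA) (q jB) (q jC) u M"
  proof (unfold_locales)
    show "q jA \<otimes>\<^bsub>H_group m l\<^esub> q jB = q jB \<otimes>\<^bsub>H_group m l\<^esub> q jA \<otimes>\<^bsub>H_group m l\<^esub> q jC"
      using J.ab J.a J.b J.c by (simp flip: q.hom_mult)
    show "q jA \<otimes>\<^bsub>H_group m l\<^esub> q jC = q jC \<otimes>\<^bsub>H_group m l\<^esub> q jA [^]\<^bsub>H_group m l\<^esub> (1 + 4 * u)"
      using J.ac J.a J.b J.c unfolding alpha_eq by (simp flip: q.hom_mult q.hom_int_pow)
    show "q jC \<otimes>\<^bsub>H_group m l\<^esub> q jB = q jB [^]\<^bsub>H_group m l\<^esub> (1 + 4 * u) \<otimes>\<^bsub>H_group m l\<^esub> q jC"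
      using J.cb J.a J.b J.c unfolding alpha_eq by (simp flip: q.hom_mult q.hom_int_pow)
    have one: "q x = \<one>\<^bsub>H_group m l\<^esub>" if "x \<in> center J" for x
      using that by (simp add: q_def H N.rcos_const)
    show "q jA [^]\<^bsub>H_group m l\<^esub> M = \<one>\<^bsub>H_group m l\<^esub>"
      using one[OF M_dvd_imp_central[of 0 0 M]] J.a by (simp add: EJ_def flip: q.hom_int_pow)
    show "q jB [^]\<^bsub>H_group m l\<^esub> M = \<one>\<^bsub>H_group m l\<^esub>"
      using one[OF M_dvd_imp_central[of 0 M 0]] J.b by (simp add: EJ_def flip: q.hom_int_pow)
    show "q jC [^]\<^bsub>H_group m l\<^esub> M = \<one>\<^bsub>H_group m l\<^esub>"
      using one[OF M_dvd_imp_central[of M 0 0]] J.c by (simp add: EJ_def flip: q.hom_int_pow)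
    show "M dvd 8 * u\<^sup>2" using M_dvd_8u2[of 1] by simp
  qed (use J.a J.b J.c in simp_all)
  interpret R: macdonald_relations "H_group m l" "q jA" "q jB" "q jC" u M by (rule rel)
  have E: "R.E k j i = q (EJ k j i)" for k j i
    unfolding R.E_def EJ_def using J.a J.b J.c by (simp add: q.hom_int_pow)
  have "macdonald_quotient m l (H_group m l) (q jA) (q jB) (q jC)"
  proof (unfold_locales)
    fix x assume "x \<in> carrier (H_group m l)"
    then obtain g where "g \<in> carrier J" "x = q g"
      by (auto simp: H FactGroup_def RCOSETS_def q_def)
    then show "\<exists>k j i. x = R.E k j i" unfolding E using EJ_surj by blast
  next
    fix k j i k' j' i' assume "R.E k j i = R.E k' j' i'"
    then have "EJ k j i \<otimes>\<^bsub>J\<^esub> inv\<^bsub>J\<^esub> EJ k' j' i' \<in> center J" (is "?z \<in> _")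
      unfolding E by (simp add: q_eq)
    moreover obtain p r s where z: "?z = EJ p r s" using EJ_surj[of ?z] by auto
    ultimately have prs: "M dvd p" "M dvd r" "M dvd s" using center_J_imp_M_dvd[of p r s] by auto
    obtain t t' where jp: "jC [^]\<^bsub>J\<^esub> p = jA [^]\<^bsub>J\<^esub> (M * t)" and jr: "jB [^]\<^bsub>J\<^esub> r = jA [^]\<^bsub>J\<^esub> (M * t')"
      using bM_central[OF prs(2)] cM_central[OF prs(1)] by blast
    then have z': "?z = jA [^]\<^bsub>J\<^esub> (M * t + M * t' + s)"
      unfolding z EJ_def[of p r s] jp jr using J.a by (simp add: J.int_pow_mult)
    have "EJ k j i = ?z \<otimes>\<^bsub>J\<^esub> EJ k' j' i'" by (simp add: J.m_assoc)
    also have "\<dots> = EJ k' j' i' \<otimes>\<^bsub>J\<^esub> ?z" using \<open>?z \<in> center J\<close> EJ_closed by (rule J.center_commute)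
    also have "\<dots> = EJ k' j' (i' + (M * t + M * t' + s))"
      unfolding z' unfolding EJ_def by (rule J.normal_form_step_a)
    finally have "sim (k, j, i) (k', j', i' + (M * t + M * t' + s))" by (rule EJ_eq_imp_sim)
    then have "M dvd k - k'" "M dvd j - j'" and i: "M dvd i - (i' + (M * t + M * t' + s))"
      by (simp, simp, rule sim_imp_M_dvd)
    moreover have "M dvd M * t + M * t' + s" using prs by simp
    from dvd_add[OF i this] have "M dvd i - i'" by (simp add: algebra_simps)
    ultimately show "M dvd k - k' \<and> M dvd j - j' \<and> M dvd i - i'" by blast
  qed
  then show ?thesis by blast
qed

end

section \<open>The upper central series of H\<close>

text \<open>Membership in the next term of the upper central series, expressed by commutators instead of cosets.\<close>

lemma (in group) upper_central_step:
  assumes "N \<lhd> G"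
  shows "{x \<in> carrier G. N #> x \<in> center (G Mod N)}
    = {x \<in> carrier G. \<forall>y \<in> carrier G. (x \<otimes> y) \<otimes> inv (y \<otimes> x) \<in> N}"
proof -
  interpret N: normal N G by (rule assms)
  have "N #> x \<in> center (G Mod N) \<longleftrightarrow> (\<forall>y \<in> carrier G. (x \<otimes> y) \<otimes> inv (y \<otimes> x) \<in> N)"
    if x: "x \<in> carrier G" for x
  proof -
    have "N #> x \<in> center (G Mod N) \<longleftrightarrow> (\<forall>y \<in> carrier G. (N #> x) <#> (N #> y) = (N #> y) <#> (N #> x))"
      using x unfolding center_def FactGroup_def RCOSETS_def by auto
    also have "\<dots> \<longleftrightarrow> (\<forall>y \<in> carrier G. N #> (x \<otimes> y) = N #> (y \<otimes> x))"
      using x by (simp add: N.rcos_sum)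
    also have "\<dots> \<longleftrightarrow> (\<forall>y \<in> carrier G. (x \<otimes> y) \<otimes> inv (y \<otimes> x) \<in> N)"
      using x by (intro ball_cong refl rcos_eq_iff N.subgroup_axioms m_closed)
    finally show ?thesis .
  qed
  then show ?thesis by blast
qed

context macdonald_parameters
begin

definition \<gamma> :: int where "\<gamma> = 2 ^ (m - 2)"

lemma u_gamma: "u = \<gamma> * l" by (simp add: u_def \<gamma>_def)
lemma pow_m: "2 ^ m = 4 * \<gamma>"
proof -
  have "m = 2 + (m - 2)" using m by simp
  then have "(2::int) ^ m = 2 ^ 2 * 2 ^ (m - 2)" by (metis power_add)
  then show ?thesis by (simp add: \<gamma>_def)
qed
lemma h_gamma: "h = 2 * \<gamma>"
proof -
  have "m - 1 = Suc (m - 2)" using m by simp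
  then show ?thesis by (simp add: h_def \<gamma>_def)
qed
lemma M_gamma: "M = 8 * \<gamma>\<^sup>2"
proof -
  have "2 * M = (2 ^ m)\<^sup>2" by (simp add: two_M_eq power_mult mult.commute[of 2 m])
  then show ?thesis by (simp add: pow_m power2_eq_square)
qed
lemma gamma_pos: "\<gamma> > 0" by (simp add: \<gamma>_def)
lemma gamma_nz [simp]: "\<gamma> \<noteq> 0" by (simp add: \<gamma>_def)

lemma coprime_gamma: "odd x \<Longrightarrow> coprime (\<gamma>) x" "odd x \<Longrightarrow> coprime (2 * \<gamma>) x" "odd x \<Longrightarrow> coprime (4 * \<gamma>) x"
  by (simp_all add: \<gamma>_def pow_m[symmetric, unfolded \<gamma>_def])

end

context macdonald_quotient
begin

abbreviation "lK \<equiv> lawK u"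
abbreviation "lJ \<equiv> lawJ u"
abbreviation "lI \<equiv> lawI u"

text \<open>Some triple of exponents of \<open>x\<close>; only its class modulo \<open>M\<close> is determined by \<open>x\<close>.\<close>

definition coords :: "'a \<Rightarrow> int \<times> int \<times> int" where
  "coords x = (SOME t. x = (case t of (k, j, i) \<Rightarrow> E k j i))"
definition kc :: "'a \<Rightarrow> int" where "kc x = fst (coords x)"
definition jc :: "'a \<Rightarrow> int" where "jc x = fst (snd (coords x))"
definition ic :: "'a \<Rightarrow> int" where "ic x = snd (snd (coords x))"

lemma E_coords: assumes "x \<in> carrier G" shows "E (kc x) (jc x) (ic x) = x"
proof -
  obtain k j i where "x = (case (k, j, i) of (k, j, i) \<Rightarrow> E k j i)" using E_surj[OF assms] by auto
  then have "x = (case coords x of (k, j, i) \<Rightarrow> E k j i)"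
    unfolding coords_def by (rule someI[where P = "\<lambda>t. x = (case t of (k, j, i) \<Rightarrow> E k j i)"])
  then show ?thesis by (simp add: kc_def jc_def ic_def case_prod_beta)
qed

lemma coords_E: "[kc (E k j i) = k] (mod M)" "[jc (E k j i) = j] (mod M)" "[ic (E k j i) = i] (mod M)"
  using E_eq_imp[OF E_coords[OF E_closed, of k j i]] by (simp_all add: cong_iff_dvd_diff)

lemma E_eq_iff: "E k j i = E k' j' i' \<longleftrightarrow> [k = k'] (mod M) \<and> [j = j'] (mod M) \<and> [i = i'] (mod M)"
  using E_eq_imp[of k j i k' j' i'] E_cong[of k k' j j' i i'] unfolding cong_iff_dvd_diff by blast

text \<open>The condition under which congruence of exponents, modulo \<open>\<kappa>\<close> for \<open>c\<close> and modulo \<open>\<delta>\<close> for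
  \<open>b\<close> and \<open>a\<close>, is compatible with the multiplication law: \<open>j\<close> and \<open>i\<close> enter the new exponent of
  \<open>c\<close>, while \<open>k\<close> enters those of \<open>b\<close> and \<open>a\<close> only with a factor \<open>4u\<close>.\<close>

definition level :: "int \<Rightarrow> int \<Rightarrow> bool" where
  "level \<kappa> \<delta> \<longleftrightarrow> \<kappa> dvd \<delta> \<and> \<delta> dvd 4 * u * \<kappa> \<and> \<delta> dvd M"

definition lev :: "int \<Rightarrow> int \<Rightarrow> 'a \<Rightarrow> 'a \<Rightarrow> bool" where
  "lev \<kappa> \<delta> x y \<longleftrightarrow> [kc x = kc y] (mod \<kappa>) \<and> [jc x = jc y] (mod \<delta>) \<and> [ic x = ic y] (mod \<delta>)"

definition Z :: "int \<Rightarrow> int \<Rightarrow> 'a set" where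
  "Z \<kappa> \<delta> = {x \<in> carrier G. lev \<kappa> \<delta> x \<one>}"

lemma one_E: "\<one> = E 0 0 0" by (simp add: E_def)
lemma a_E: "a = E 0 0 1" using a by (simp add: E_def)
lemma b_E: "b = E 0 1 0" using b by (simp add: E_def)
lemma c_E: "c = E 1 0 0" using c by (simp add: E_def)

lemma level_dvd: assumes "level \<kappa> \<delta>" shows "\<kappa> dvd M" "\<delta> dvd M" "\<kappa> dvd \<delta>"
  using assms by (auto simp: level_def intro: dvd_trans)

lemma lev_refl [simp]: "lev \<kappa> \<delta> x x" by (simp add: lev_def)
lemma lev_sym: "lev \<kappa> \<delta> x y \<Longrightarrow> lev \<kappa> \<delta> y x" by (simp add: lev_def cong_sym_eq)
lemma lev_trans: "lev \<kappa> \<delta> x y \<Longrightarrow> lev \<kappa> \<delta> y z \<Longrightarrow> lev \<kappa> \<delta> x z"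
  unfolding lev_def using cong_trans by blast

lemma lev_E: assumes "level \<kappa> \<delta>"
  shows "lev \<kappa> \<delta> (E k j i) (E k' j' i') \<longleftrightarrow> [k = k'] (mod \<kappa>) \<and> [j = j'] (mod \<delta>) \<and> [i = i'] (mod \<delta>)"
proof -
  have *: "[x = y] (mod n) \<longleftrightarrow> [x' = y'] (mod n)" if "[x = x'] (mod M)" "[y = y'] (mod M)" "n dvd M" for x y x' y' n
    using that cong_dvd_modulus cong_trans cong_sym by meson
  show ?thesis
    unfolding lev_def using coords_E level_dvd[OF assms]
    by (intro conj_cong) (rule *, assumption?, assumption?, assumption?)+
qed

lemma law_level:
  assumes L: "level \<kappa> \<delta>"
    and 1: "[k = p] (mod \<kappa>)" "[j = q] (mod \<delta>)" "[i = r] (mod \<delta>)"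
    and 2: "[k' = p'] (mod \<kappa>)" "[j' = q'] (mod \<delta>)" "[i' = r'] (mod \<delta>)"
  shows "[lK k j i k' j' i' = lK p q r p' q' r'] (mod \<kappa>)"
    "[lJ k j i k' j' i' = lJ p q r p' q' r'] (mod \<delta>)"
    "[lI k j i k' j' i' = lI p q r p' q' r'] (mod \<delta>)"
proof -
  have d: "\<kappa> dvd \<delta>" using level_dvd[OF L] by blast
  have 3: "[j = q] (mod \<kappa>)" "[i = r] (mod \<kappa>)" "[j' = q'] (mod \<kappa>)" "[i' = r'] (mod \<kappa>)"
    using 1 2 d cong_dvd_modulus by blast+
  show "[lK k j i k' j' i' = lK p q r p' q' r'] (mod \<kappa>)"
    unfolding lawK_def by (intro cong_add cong_mult cong_diff 1 2 3 cong_refl)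
  have "[4 * u * k' = 4 * u * p'] (mod (4 * u * \<kappa>))"
    using 2(1) by (metis cong_cmult_leftI)
  then have 4: "[4 * u * k' = 4 * u * p'] (mod \<delta>)"
    using L unfolding level_def by (blast intro: cong_dvd_modulus)
  show "[lI k j i k' j' i' = lI p q r p' q' r'] (mod \<delta>)"
    unfolding lawI_def by (intro cong_add cong_mult 1 2 4 cong_refl)
  have "[j * (1 - (4 * u * k' + 4 * u * (i * j'))) + j' - 2 * u * i * (j' * (j' + 1)) =
      q * (1 - (4 * u * p' + 4 * u * (r * q'))) + q' - 2 * u * r * (q' * (q' + 1))] (mod \<delta>)"
    by (intro cong_add cong_mult cong_diff 1 2 4 cong_refl)
  then show "[lJ k j i k' j' i' = lJ p q r p' q' r'] (mod \<delta>)"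
    unfolding lawJ_def by (simp add: algebra_simps)
qed

lemma lev_mult:
  assumes L: "level \<kappa> \<delta>" and x: "x \<in> carrier G" "x' \<in> carrier G" "lev \<kappa> \<delta> x x'"
    and y: "y \<in> carrier G" "y' \<in> carrier G" "lev \<kappa> \<delta> y y'"
  shows "lev \<kappa> \<delta> (x \<otimes> y) (x' \<otimes> y')"
proof -
  have "lev \<kappa> \<delta> (E (kc x) (jc x) (ic x) \<otimes> E (kc y) (jc y) (ic y))
      (E (kc x') (jc x') (ic x') \<otimes> E (kc y') (jc y') (ic y'))"
    unfolding E_mult lev_E[OF L] using x(3) y(3) unfolding lev_def
    by (intro conjI law_level[OF L]) blast+
  then show ?thesis using x y by (simp add: E_coords)
qed

lemma lev_inv:
  assumes L: "level \<kappa> \<delta>" and x: "x \<in> carrier G" "y \<in> carrier G" "lev \<kappa> \<delta> x y"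
  shows "lev \<kappa> \<delta> (inv x) (inv y)"
proof -
  have "lev \<kappa> \<delta> (inv x \<otimes> y \<otimes> inv y) (inv x \<otimes> x \<otimes> inv y)"
    using x by (intro lev_mult[OF L] lev_sym[OF x(3)] m_closed inv_closed lev_refl)
  then show ?thesis using x by (simp add: m_assoc)
qed

lemma lev_int_pow:
  assumes L: "level \<kappa> \<delta>" and x: "x \<in> carrier G" "y \<in> carrier G" "lev \<kappa> \<delta> x y"
  shows "lev \<kappa> \<delta> (x [^] (n::int)) (y [^] n)"
proof -
  have nat: "lev \<kappa> \<delta> (x [^] n) (y [^] n)" for n :: nat
    by (induction n) (use x in \<open>simp_all add: lev_mult[OF L]\<close>)
  show ?thesis
  proof (cases "n \<ge> 0")
    case True
    then show ?thesis using nat[of "nat n"] by simp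
  next
    case False
    then have "n = - int (nat (- n))" by simp
    then show ?thesis
      using lev_inv[OF L _ _ nat[of "nat (- n)"]] x by (metis int_pow_neg_int nat_pow_closed)
  qed
qed

lemma mult_inv_in_Z_iff:
  assumes L: "level \<kappa> \<delta>" and x: "x \<in> carrier G" "y \<in> carrier G"
  shows "x \<otimes> inv y \<in> Z \<kappa> \<delta> \<longleftrightarrow> lev \<kappa> \<delta> x y"
proof
  assume "x \<otimes> inv y \<in> Z \<kappa> \<delta>"
  then have "lev \<kappa> \<delta> (x \<otimes> inv y \<otimes> y) (\<one> \<otimes> y)"
    using x by (intro lev_mult[OF L]) (auto simp: Z_def)
  then show "lev \<kappa> \<delta> x y" using x by (simp add: m_assoc)
next
  assume "lev \<kappa> \<delta> x y"
  then have "lev \<kappa> \<delta> (x \<otimes> inv y) (y \<otimes> inv y)"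
    using x by (intro lev_mult[OF L]) simp_all
  then show "x \<otimes> inv y \<in> Z \<kappa> \<delta>" using x by (simp add: Z_def)
qed

lemma normal_Z: assumes L: "level \<kappa> \<delta>" shows "Z \<kappa> \<delta> \<lhd> G"
proof (rule normal_invI)
  have "x \<otimes> y \<in> Z \<kappa> \<delta>" if "x \<in> Z \<kappa> \<delta>" "y \<in> Z \<kappa> \<delta>" for x y
    using lev_mult[OF L, of x \<one> y \<one>] that by (simp add: Z_def)
  moreover have "inv x \<in> Z \<kappa> \<delta>" if "x \<in> Z \<kappa> \<delta>" for x
    using lev_inv[OF L, of x \<one>] that by (simp add: Z_def)
  moreover have "\<one> \<in> Z \<kappa> \<delta>" by (simp add: Z_def)
  ultimately show "subgroup (Z \<kappa> \<delta>) G"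
    by (intro subgroupI) (auto simp: Z_def)
  show "x \<otimes> z \<otimes> inv x \<in> Z \<kappa> \<delta>" if "x \<in> carrier G" "z \<in> Z \<kappa> \<delta>" for x z
  proof -
    have z: "z \<in> carrier G" "lev \<kappa> \<delta> z \<one>" using that(2) by (simp_all add: Z_def)
    have "lev \<kappa> \<delta> (x \<otimes> z) x" using lev_mult[OF L, of x x z \<one>] that(1) z by simp
    then show ?thesis using that(1) z by (simp add: mult_inv_in_Z_iff[OF L])
  qed
qed

lemma Z_E: "level \<kappa> \<delta> \<Longrightarrow> E k j i \<in> Z \<kappa> \<delta> \<longleftrightarrow> \<kappa> dvd k \<and> \<delta> dvd j \<and> \<delta> dvd i"
  by (simp add: Z_def one_E lev_E cong_0_iff)

lemma levels: "level M M" "level (2 * \<gamma>) M" "level (2 * \<gamma>) (4 * \<gamma>)" "level 1 (2 * \<gamma>)" "level (4 * \<gamma>) (4 * \<gamma>)" "level 2 2"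
  unfolding level_def M_gamma u_gamma by (simp_all add: power2_eq_square)

text \<open>An element lies in the next term iff it commutes with \<open>a\<close> and \<open>b\<close> modulo the present one.
  The first hypothesis \<open>imp\<close> extracts the resulting divisibilities; \<open>conv\<close> says that they suffice
  to commute with every element.\<close>

lemma upper_central_Z:
  assumes L: "level \<kappa> \<delta>" "level \<kappa>' \<delta>'"
    and Z: "upper_central G n = Z \<kappa> \<delta>"
    and imp: "\<And>k j i. \<lbrakk>\<kappa> dvd j * (1 + 4 * u * k + 2 * u * (j - 1)); \<kappa> dvd i; \<delta> dvd 2 * u * (j * (j + 1));
        \<delta> dvd 4 * u * (k + j); \<delta> dvd 2 * u * (i * (i + 1))\<rbrakk> \<Longrightarrow> \<kappa>' dvd k \<and> \<delta>' dvd j \<and> \<delta>' dvd i"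
    and conv: "\<And>k j i. \<lbrakk>\<kappa>' dvd k; \<delta>' dvd j; \<delta>' dvd i\<rbrakk> \<Longrightarrow> \<kappa> dvd j \<and> \<kappa> dvd i \<and> \<delta> dvd 4 * u * k \<and> \<delta> dvd 4 * u * j
        \<and> \<delta> dvd 4 * u * i \<and> \<delta> dvd 2 * u * (j * (j + 1)) \<and> \<delta> dvd 2 * u * (i * (i + 1))"
  shows "upper_central G (Suc n) = Z \<kappa>' \<delta>'"
proof -
  have "upper_central G (Suc n) = {x \<in> carrier G. \<forall>y \<in> carrier G. (x \<otimes> y) \<otimes> inv (y \<otimes> x) \<in> Z \<kappa> \<delta>}"
    using upper_central_step[OF normal_Z[OF L(1)]] by (simp add: Z)
  also have "\<dots> = {x \<in> carrier G. \<forall>y \<in> carrier G. lev \<kappa> \<delta> (x \<otimes> y) (y \<otimes> x)}"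
    by (intro Collect_cong conj_cong ball_cong refl mult_inv_in_Z_iff[OF L(1)] m_closed)
  also have "\<dots> = Z \<kappa>' \<delta>'"
  proof (intro equalityI subsetI)
    fix x assume "x \<in> {x \<in> carrier G. \<forall>y \<in> carrier G. lev \<kappa> \<delta> (x \<otimes> y) (y \<otimes> x)}"
    then have x: "x \<in> carrier G" and A: "lev \<kappa> \<delta> (x \<otimes> E 0 0 1) (E 0 0 1 \<otimes> x)"
      and B: "lev \<kappa> \<delta> (x \<otimes> E 0 1 0) (E 0 1 0 \<otimes> x)"
      using E_closed by blast+
    obtain k j i where kji: "x = E k j i" using E_surj[OF x] by blast
    have "lK k j i 0 0 1 - lK 0 0 1 k j i = - (j * (1 + 4 * u * k + 2 * u * (j - 1)))"
      "lJ k j i 0 0 1 - lJ 0 0 1 k j i = 2 * u * (j * (j + 1))"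
      "lI k j i 0 0 1 - lI 0 0 1 k j i = - (4 * u * (k + j))"
      by (simp_all add: lawK_def lawJ_def lawI_def algebra_simps)
    then have "\<kappa> dvd j * (1 + 4 * u * k + 2 * u * (j - 1))" "\<delta> dvd 2 * u * (j * (j + 1))" "\<delta> dvd 4 * u * (k + j)"
      using A unfolding kji E_mult lev_E[OF L(1)] cong_iff_dvd_diff by (simp_all only: dvd_minus_iff)
    moreover have "lK k j i 0 1 0 - lK 0 1 0 k j i = i" "lI k j i 0 1 0 - lI 0 1 0 k j i = 2 * u * (i * (i + 1))"
      by (simp_all add: lawK_def lawI_def algebra_simps)
    then have "\<kappa> dvd i" "\<delta> dvd 2 * u * (i * (i + 1))"
      using B unfolding kji E_mult lev_E[OF L(1)] cong_iff_dvd_diff by (simp_all only:)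
    ultimately show "x \<in> Z \<kappa>' \<delta>'" unfolding kji Z_E[OF L(2)] by (intro imp)
  next
    fix x assume "x \<in> Z \<kappa>' \<delta>'"
    then have x: "x \<in> carrier G" by (simp add: Z_def)
    obtain k j i where kji: "x = E k j i" using E_surj[OF x] by blast
    have "\<kappa>' dvd k" "\<delta>' dvd j" "\<delta>' dvd i" using \<open>x \<in> Z \<kappa>' \<delta>'\<close> unfolding kji Z_E[OF L(2)] by auto
    note d = conv[OF this]
    have "lev \<kappa> \<delta> (x \<otimes> y) (y \<otimes> x)" if y: "y \<in> carrier G" for y
    proof -
      obtain p q r where pqr: "y = E p q r" using E_surj[OF y] by blast
      have "lK k j i p q r - lK p q r k j i =
          i * (q * (1 + 4 * u * p) + u * (q * (q - 1)) * (i + 1)) - j * (r * (1 + 4 * u * k) + u * (j - 1) * (r * (r + 1)))"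
        by (simp add: lawK_def algebra_simps)
      then have 1: "\<kappa> dvd lK k j i p q r - lK p q r k j i" using d by (simp only: dvd_diff dvd_mult2)
      have "even (q * (q + 1))" "even (r * (r + 1))" by simp_all
      then obtain s t where s: "q * (q + 1) = 2 * s" and t: "r * (r + 1) = 2 * t" by (elim dvdE)
      have "lJ k j i p q r - lJ p q r k j i =
          4 * u * k * q + 4 * u * i * (q * q * 0 - s + r * 0) - 4 * u * j * (p + i * q - r * q) + 2 * u * (j * (j + 1)) * r"
        unfolding lawJ_def s by (simp add: algebra_simps)
      then have 2: "\<delta> dvd lJ k j i p q r - lJ p q r k j i" using d by (simp only: dvd_diff dvd_add dvd_mult2)
      have "lI k j i p q r - lI p q r k j i = 4 * u * i * p - 4 * u * k * r + 2 * u * (i * (i + 1)) * q - 4 * u * j * t"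
        unfolding lawI_def t by (simp add: algebra_simps)
      then have 3: "\<delta> dvd lI k j i p q r - lI p q r k j i" using d by (simp only: dvd_diff dvd_add dvd_mult2)
      show ?thesis
        unfolding kji pqr E_mult lev_E[OF L(1)] cong_iff_dvd_diff using 1 2 3 by blast
    qed
    then show "x \<in> {x \<in> carrier G. \<forall>y \<in> carrier G. lev \<kappa> \<delta> (x \<otimes> y) (y \<otimes> x)}" using x by blast
  qed
  finally show ?thesis .
qed

lemma upper_central_0: "upper_central G 0 = Z M M"
proof -
  have "x = \<one>" if "x \<in> Z M M" for x
  proof -
    have x: "x \<in> carrier G" using that by (simp add: Z_def)
    obtain k j i where kji: "x = E k j i" using E_surj[OF x] by blast
    show ?thesis using that unfolding kji one_E Z_E[OF levels(1)] E_eq_iff by (simp add: cong_0_iff)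
  qed
  then have "Z M M \<subseteq> {\<one>}" by blast
  moreover have "{\<one>} \<subseteq> Z M M" by (simp add: Z_def)
  ultimately show ?thesis unfolding upper_central.simps by (rule equalityI[rotated])
qed

lemma dvd_4u_iff: "M dvd 4 * u * k \<longleftrightarrow> 2 * \<gamma> dvd k"
proof -
  have "M dvd 4 * u * k \<longleftrightarrow> 4 * \<gamma> * (2 * \<gamma>) dvd 4 * \<gamma> * (l * k)"
    by (simp add: M_gamma u_gamma power2_eq_square mult_ac)
  also have "\<dots> \<longleftrightarrow> 2 * \<gamma> dvd l * k" by (simp only: dvd_mult_cancel_left) simp
  finally show ?thesis using coprime_gamma(2)[OF l] by (simp add: coprime_dvd_mult_right_iff)
qed

lemma dvd_2u_iff: "M dvd 2 * u * k \<longleftrightarrow> 4 * \<gamma> dvd k"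
proof -
  have "M dvd 2 * u * k \<longleftrightarrow> 2 * \<gamma> * (4 * \<gamma>) dvd 2 * \<gamma> * (l * k)"
    by (simp add: M_gamma u_gamma power2_eq_square mult_ac)
  also have "\<dots> \<longleftrightarrow> 4 * \<gamma> dvd l * k" by (simp only: dvd_mult_cancel_left) simp
  finally show ?thesis using coprime_gamma(3)[OF l] by (simp add: coprime_dvd_mult_right_iff)
qed

lemma odd_factor: "odd (1 + 4 * u * k + 2 * u * (j - 1))" by simp

lemma consecutive_dvd: "\<lbrakk>2 * \<gamma> dvd j; 4 * \<gamma> dvd j * (j + 1)\<rbrakk> \<Longrightarrow> 4 * \<gamma> dvd j"
proof -
  assume "2 * \<gamma> dvd j" and d: "4 * \<gamma> dvd j * (j + 1)"
  then have "odd (j + 1)" by (auto elim: dvdE)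
  then show ?thesis using d coprime_gamma(3) by (simp add: coprime_dvd_mult_left_iff)
qed

lemma upper_central_1: "upper_central G 1 = Z (2 * \<gamma>) M"
  unfolding One_nat_def
proof (rule upper_central_Z[OF levels(1) levels(2) upper_central_0])
  fix k j i
  assume "M dvd j * (1 + 4 * u * k + 2 * u * (j - 1))" and i: "M dvd i" and kj: "M dvd 4 * u * (k + j)"
  then have j: "M dvd j" using coprime_P(2)[OF odd_factor] by (simp add: coprime_dvd_mult_left_iff)
  have "M dvd 4 * u * k" using kj dvd_mult[OF j, of "4 * u"] by (simp add: distrib_left dvd_add_left_iff)
  then show "2 * \<gamma> dvd k \<and> M dvd j \<and> M dvd i" using i j by (simp add: dvd_4u_iff)
next
  fix k j i assume d: "2 * \<gamma> dvd k" "M dvd j" "M dvd i"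
  then have "M dvd 4 * u * k" by (simp add: dvd_4u_iff)
  then show "M dvd j \<and> M dvd i \<and> M dvd 4 * u * k \<and> M dvd 4 * u * j
        \<and> M dvd 4 * u * i \<and> M dvd 2 * u * (j * (j + 1)) \<and> M dvd 2 * u * (i * (i + 1))"
    using d by simp
qed

lemma upper_central_2: "upper_central G 2 = Z (2 * \<gamma>) (4 * \<gamma>)"
  unfolding numeral_2_eq_2
proof (rule upper_central_Z[OF levels(2) levels(3) upper_central_1[unfolded One_nat_def]])
  fix k j i
  assume "2 * \<gamma> dvd j * (1 + 4 * u * k + 2 * u * (j - 1))" and i: "2 * \<gamma> dvd i" and jj: "M dvd 2 * u * (j * (j + 1))"
    and kj: "M dvd 4 * u * (k + j)" and ii: "M dvd 2 * u * (i * (i + 1))"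
  then have j: "2 * \<gamma> dvd j" using coprime_gamma(2)[OF odd_factor] by (simp add: coprime_dvd_mult_left_iff)
  have "2 * \<gamma> dvd k" using kj j unfolding dvd_4u_iff by (simp add: dvd_add_left_iff)
  then show "2 * \<gamma> dvd k \<and> 4 * \<gamma> dvd j \<and> 4 * \<gamma> dvd i"
    using jj ii i j consecutive_dvd unfolding dvd_2u_iff by blast
next
  fix k j i assume d: "2 * \<gamma> dvd k" "4 * \<gamma> dvd j" "4 * \<gamma> dvd i"
  then have "2 * \<gamma> dvd j" "2 * \<gamma> dvd i" by (auto elim!: dvdE)
  then show "2 * \<gamma> dvd j \<and> 2 * \<gamma> dvd i \<and> M dvd 4 * u * k \<and> M dvd 4 * u * j
        \<and> M dvd 4 * u * i \<and> M dvd 2 * u * (j * (j + 1)) \<and> M dvd 2 * u * (i * (i + 1))"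
    unfolding dvd_4u_iff dvd_2u_iff using d by (simp add: dvd_mult2)
qed

lemma upper_central_3: "upper_central G 3 = Z 1 (2 * \<gamma>)"
  unfolding numeral_3_eq_3
proof (rule upper_central_Z[OF levels(3) levels(4) upper_central_2[unfolded numeral_2_eq_2]])
  fix k j i
  assume "2 * \<gamma> dvd j * (1 + 4 * u * k + 2 * u * (j - 1))" and i: "2 * \<gamma> dvd i"
  then have j: "2 * \<gamma> dvd j" using coprime_gamma(2)[OF odd_factor] by (simp add: coprime_dvd_mult_left_iff)
  then show "1 dvd k \<and> 2 * \<gamma> dvd j \<and> 2 * \<gamma> dvd i" using i by simp
next
  fix k j i :: int assume d: "1 dvd k" "2 * \<gamma> dvd j" "2 * \<gamma> dvd i"
  have "4 * \<gamma> dvd 2 * u * (x * (x + 1))" for x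
  proof -
    have "even (x * (x + 1))" by simp
    then obtain t where t: "x * (x + 1) = 2 * t" by (elim dvdE)
    show ?thesis unfolding t u_gamma by simp
  qed
  then show "2 * \<gamma> dvd j \<and> 2 * \<gamma> dvd i \<and> 4 * \<gamma> dvd 4 * u * k \<and> 4 * \<gamma> dvd 4 * u * j
        \<and> 4 * \<gamma> dvd 4 * u * i \<and> 4 * \<gamma> dvd 2 * u * (j * (j + 1)) \<and> 4 * \<gamma> dvd 2 * u * (i * (i + 1))"
    using d by (simp add: u_gamma)
qed

text \<open>Powers with exponent \<open>2\<^sup>r\<^sup>+\<^sup>2\<close> by repeated squaring. The error terms double at each step as long
  as the exponent is at least 4, so the induction starts there.\<close>

lemma pow_4_2power:
  defines "n \<equiv> \<lambda>r::nat. (2::int) ^ r"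
  shows "\<exists>s t w. E k j i [^] (4 * n r) = E (4 * n r * k + 2 * n r * (4 * n r - 1) * (i * j) + 4 * n r * u * (i * j) + 8 * \<gamma> * n r * s)
     (4 * n r * j + 8 * \<gamma> * n r * t) (4 * n r * i + 8 * \<gamma> * n r * w)"
proof (induction r)
  case 0
  obtain T where T: "i * (i + 1) = 2 * T" using even_triangular[of i] by (elim dvdE)
  obtain S where S: "j * (j + 1) = 2 * S" using even_triangular[of j] by (elim dvdE)
  have S': "j * (j - 1) = 2 * (S - j)" using S by (simp add: algebra_simps)
  define y where "y = j - 2 * \<gamma> * l * (j * (k + i * j) + i * S)"
  define z where "z = i + 2 * \<gamma> * l * (k * i + j * T)"
  define t0 where "t0 = - l * (j * (k + i * j) + i * S)"
  define w0 where "w0 = l * (k * i + j * T)"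
  define s0 where "s0 = l * (k * i * j + (S - j) * T)"
  define v0 where "v0 = j * w0 + t0 * i + 2 * \<gamma> * t0 * w0"
  define K where "K = 2 * k + i * j + 4 * \<gamma> * s0"
  have y: "y = j + 2 * \<gamma> * t0" and z: "z = i + 2 * \<gamma> * w0"
    by (simp_all add: y_def z_def t0_def w0_def)
  have yz: "y * z = i * j + 2 * \<gamma> * v0" unfolding y z v0_def by (simp add: algebra_simps)
  have "E k j i \<otimes> E k j i = E K (2 * y) (2 * z)"
    unfolding E_mult lawK_def lawJ_def lawI_def T S S' K_def y_def z_def s0_def u_gamma
    by (simp add: algebra_simps)
  moreover have "E k j i [^] (4::int) = (E k j i \<otimes> E k j i) \<otimes> (E k j i \<otimes> E k j i)"
  proof -
    have "E k j i [^] (1 + 1 + (1 + 1) :: int) = (E k j i \<otimes> E k j i) \<otimes> (E k j i \<otimes> E k j i)"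
      by (simp only: int_pow_mult[OF E_closed] int_pow_1[OF E_closed])
    then show ?thesis by simp
  qed
  ultimately have 4: "E k j i [^] (4::int) = E (lK K (2 * y) (2 * z) K (2 * y) (2 * z))
      (lJ K (2 * y) (2 * z) K (2 * y) (2 * z)) (lI K (2 * y) (2 * z) K (2 * y) (2 * z))"
    by (simp add: E_mult)
  have "lK K (2 * y) (2 * z) K (2 * y) (2 * z) = 2 * K + 4 * (y * z) * (1 + 4 * u * K)
      + 4 * u * ((y * z) * ((2 * y - 1) * (2 * z + 1)))"
    unfolding lawK_def by (simp add: algebra_simps)
  also have "(y * z) * ((2 * y - 1) * (2 * z + 1)) = 2 * ((y * z) * (2 * (y * z) + y - z)) - y * z"
    by (simp add: algebra_simps)
  also have "2 * K + 4 * (y * z) * (1 + 4 * u * K) + 4 * u * (2 * ((y * z) * (2 * (y * z) + y - z)) - y * z)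
      = 4 * k + 6 * (i * j) + 4 * u * (i * j) + 8 * \<gamma> * (s0 + v0 + 2 * l * (y * z) * K
         + l * ((y * z) * (2 * (y * z) + y - z) - i * j - \<gamma> * v0))"
    unfolding yz by (simp add: K_def u_gamma algebra_simps)
  finally have K4: "lK K (2 * y) (2 * z) K (2 * y) (2 * z) = \<dots>" .
  have J4: "lJ K (2 * y) (2 * z) K (2 * y) (2 * z) = 4 * j + 8 * \<gamma> * (t0 - l * y * (K + 4 * z * y) - l * z * y * (2 * y + 1))"
    unfolding lawJ_def u_gamma by (simp add: algebra_simps) (simp add: y algebra_simps)
  have I4: "lI K (2 * y) (2 * z) K (2 * y) (2 * z) = 4 * i + 8 * \<gamma> * (w0 + l * K * z + l * y * z * (2 * z + 1))"
    unfolding lawI_def u_gamma by (simp add: algebra_simps) (simp add: z algebra_simps)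
  have n0: "n 0 = 1" by (simp add: n_def)
  show ?case
    unfolding n0 mult_1_right 4 K4 J4 I4 by (intro exI) simp
next
  case (Suc r)
  define N where "N = n r"
  obtain s t w where IH: "E k j i [^] (4 * N) = E (4 * N * k + 2 * N * (4 * N - 1) * (i * j) + 4 * N * u * (i * j) + 8 * \<gamma> * N * s)
     (4 * N * j + 8 * \<gamma> * N * t) (4 * N * i + 8 * \<gamma> * N * w)" (is "_ = E ?K ?J ?I")
    using Suc unfolding N_def by blast
  have n: "n (Suc r) = 2 * N" by (simp add: n_def N_def)
  define y where "y = j + 2 * \<gamma> * t"
  define z where "z = i + 2 * \<gamma> * w"
  define v where "v = j * w + t * i + 2 * \<gamma> * t * w"
  define K where "K = ?K"
  have J: "?J = 4 * N * y" and I: "?I = 4 * N * z" by (simp_all add: y_def z_def algebra_simps)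
  have yz: "y * z = i * j + 2 * \<gamma> * v" unfolding y_def z_def v_def by (simp add: algebra_simps)
  have "E k j i [^] (4 * (2 * N)) = E K (4 * N * y) (4 * N * z) \<otimes> E K (4 * N * y) (4 * N * z)"
  proof -
    have "E k j i [^] (4 * N + 4 * N) = E k j i [^] (4 * N) \<otimes> E k j i [^] (4 * N)"
      by (rule int_pow_mult[OF E_closed])
    then show ?thesis unfolding IH J I K_def by simp
  qed
  moreover have "lK K (4 * N * y) (4 * N * z) K (4 * N * y) (4 * N * z)
    = 4 * (2 * N) * k + 2 * (2 * N) * (4 * (2 * N) - 1) * (i * j) + 4 * (2 * N) * u * (i * j)
      + 8 * \<gamma> * (2 * N) * (s + 2 * N * v + 4 * N * l * (y * z) * K + N * l * (y * z) * ((4 * N * y - 1) * (4 * N * z + 1)))"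
  proof -
    have "lK K (4 * N * y) (4 * N * z) K (4 * N * y) (4 * N * z) = 2 * K + 16 * N * N * (y * z)
       + 16 * \<gamma> * N * (4 * N * l * (y * z) * K) + 16 * \<gamma> * N * (N * l * (y * z) * ((4 * N * y - 1) * (4 * N * z + 1)))"
      unfolding lawK_def u_gamma by (simp add: algebra_simps)
    also have "16 * N * N * (y * z) = 16 * N * N * (i * j) + 16 * \<gamma> * N * (2 * N * v)"
      unfolding yz by (simp add: algebra_simps)
    finally show ?thesis by (simp add: K_def algebra_simps)
  qed
  moreover have "lJ K (4 * N * y) (4 * N * z) K (4 * N * y) (4 * N * z) = 4 * (2 * N) * j
      + 8 * \<gamma> * (2 * N) * (t - l * y * (K + 16 * N * N * y * z) - 2 * N * l * z * y * (4 * N * y + 1))"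
    unfolding lawJ_def u_gamma by (simp add: algebra_simps) (simp add: y_def algebra_simps)
  moreover have "lI K (4 * N * y) (4 * N * z) K (4 * N * y) (4 * N * z) = 4 * (2 * N) * i
      + 8 * \<gamma> * (2 * N) * (w + l * K * z + 2 * N * l * y * z * (4 * N * z + 1))"
    unfolding lawI_def u_gamma by (simp add: algebra_simps) (simp add: z_def algebra_simps)
  ultimately show ?case
    unfolding n E_mult by (intro exI) simp
qed

end

section \<open>Powers and commutators in H\<close>

context macdonald_parameters
begin

text \<open>The conditions on the \<open>b\<close>- and \<open>a\<close>-exponents of \<open>f a = E k j i\<close> and \<open>f b = E k' j' i'\<close> that
  characterize the automorphisms \<open>f\<close> with \<open>i\<close> odd.\<close>

definition good :: "int \<Rightarrow> int \<Rightarrow> int \<Rightarrow> int \<Rightarrow> bool" where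
  "good i j i' j' \<longleftrightarrow> even j \<and> even i' \<and> [i = 1 + i'] (mod 4 * \<gamma>) \<and> [j' = 1 + j] (mod 4 * \<gamma>)
    \<and> [i' = j] (mod 2 * \<gamma>) \<and> [2 * j = 0] (mod 2 * \<gamma>)"

lemma gamma_cases: obtains "\<gamma> = 1" | "\<gamma> = 2" | "4 dvd \<gamma>"
proof -
  consider "m = 2" | "m = 3" | "m \<ge> 4" using m by linarith
  then show ?thesis
  proof cases
    case 3
    then obtain n where "m = 4 + n" by (rule less_eqE)
    then have "m - 2 = 2 + n" by simp
    then have "\<gamma> = 4 * 2 ^ n" unfolding \<gamma>_def by (simp only: power_add) simp
    then show ?thesis using that by simp
  next
    case 1
    then have "m - 2 = 0" by simp
    then have "\<gamma> = 1" unfolding \<gamma>_def by (simp only: power_0)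
    then show ?thesis by (rule that)
  next
    case 2
    then have "m - 2 = 1" by simp
    then have "\<gamma> = 2" unfolding \<gamma>_def by (simp only: power_one_right)
    then show ?thesis by (rule that)
  qed
qed

text \<open>The \<open>b\<close>- and \<open>a\<close>-exponents of the commutator of \<open>E k j i\<close> and \<open>E k' j' i'\<close>, divided by \<open>4u\<close>; see
  \<open>commutator_coords\<close>.\<close>

definition cd :: "int \<Rightarrow> int \<Rightarrow> int \<Rightarrow> int \<Rightarrow> int \<Rightarrow> int \<Rightarrow> int" where
  "cd k j i k' j' i' = j' * (k + i' * j) - j * (k' + i * j') - i * (j' * (j' + 1) div 2) + i' * (j * (j + 1) div 2)
     + (i * j' - j * i') * (j' + j)"
definition ce :: "int \<Rightarrow> int \<Rightarrow> int \<Rightarrow> int \<Rightarrow> int \<Rightarrow> int \<Rightarrow> int" where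
  "ce k j i k' j' i' = i * k' - i' * k + j' * (i * (i + 1) div 2) - j * (i' * (i' + 1) div 2) - (i * j' - j * i') * (i' + i)"

lemma half_products:
  "(1 + 2 * x) * (1 + 2 * x + 1) div 2 = (1 + 2 * x) * (1 + x)"
  "(2 * x) * (2 * x + 1) div 2 = x * (2 * x + 1)" for x :: int
proof -
  have "(1 + 2 * x) * (1 + 2 * x + 1) = 2 * ((1 + 2 * x) * (1 + x))" by (simp add: algebra_simps)
  then show "(1 + 2 * x) * (1 + 2 * x + 1) div 2 = (1 + 2 * x) * (1 + x)"
    by (simp only: nonzero_mult_div_cancel_left[OF numeral_neq_zero])
  have "(2 * x) * (2 * x + 1) = 2 * (x * (2 * x + 1))" by simp
  then show "(2 * x) * (2 * x + 1) div 2 = x * (2 * x + 1)"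
    by (simp only: nonzero_mult_div_cancel_left[OF numeral_neq_zero])
qed

text \<open>The \<open>c\<close>-exponents in the relations for the images of \<open>a\<close> and \<open>b\<close>. Modulo the
  conditions obtained from the other two exponents they no longer depend on \<open>k\<close> and \<open>k'\<close>; this is why
  the \<open>c\<close>-exponents of \<open>f a\<close> and \<open>f b\<close> can be prescribed freely.\<close>

lemma relation_polynomials:
  fixes p q r s k k' :: int
  defines "i \<equiv> 1 + 2 * p" and "j \<equiv> 2 * q" and "i' \<equiv> 2 * r" and "j' \<equiv> 1 + 2 * s"
  assumes q: "2 * \<gamma> dvd 4 * q" and r: "2 * \<gamma> dvd 4 * r" and D: "2 * \<gamma> dvd i * j' - j * i' - 1"
  shows "2 * \<gamma> dvd cd k j i k' j' i' * i - ce k j i k' j' i' * j - k - i * q \<longleftrightarrow> 2 * \<gamma> dvd s - q + 2 * (p * s + q * r)"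
    and "2 * \<gamma> dvd ce k j i k' j' i' * j' - cd k j i k' j' i' * i' - k' - r * j' \<longleftrightarrow> 2 * \<gamma> dvd p - r + 2 * (p * s + q * r)"
proof -
  have cd: "cd k j i k' j' i' = j' * (k + i' * j) - j * (k' + i * j') - i * (j' * (1 + s)) + i' * (q * (2 * q + 1)) + (i * j' - j * i') * (j' + j)"
    and ce: "ce k j i k' j' i' = i * k' - i' * k + j' * (i * (1 + p)) - j * (r * (2 * r + 1)) - (i * j' - j * i') * (i' + i)"
    unfolding cd_def ce_def i_def j_def i'_def j'_def half_products by simp_all
  \<comment> \<open>The last two summands are combinations of the quantities known to be divisible by \<open>2\<gamma>\<close>.\<close>
  have 5: "cd k j i k' j' i' * i - ce k j i k' j' i' * j - k - i * q = (s - q + 2 * (p * s + q * r))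
      + (i * j' - j * i' - 1) * (k + s * i) + 4 * q * (3 * p * r + 4 * p * r * s + p * s - 6 * p * q * r + p * p + 2 * p * p * s
        + r + 2 * r * s - 2 * q * r - 2 * q * r * r + 2 * r * k - i * k' + s * i * r)"
    unfolding cd ce unfolding i_def j_def i'_def j'_def by (simp add: algebra_simps)
  show "2 * \<gamma> dvd cd k j i k' j' i' * i - ce k j i k' j' i' * j - k - i * q \<longleftrightarrow> 2 * \<gamma> dvd s - q + 2 * (p * s + q * r)"
    unfolding 5 using q D by (simp only: dvd_add_left_iff dvd_mult2)
  have 6: "ce k j i k' j' i' * j' - cd k j i k' j' i' * i' - k' - r * j' = - (p - r + 2 * (p * s + q * r))
      + (i * j' - j * i' - 1) * (k' - p * j') + 4 * r * (2 * k' * q - k - 2 * k * s + 2 * p * q + 4 * p * q * s - p - 5 * p * s - 6 * p * s * s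
        + q + q * s + 2 * q * r * s + 2 * q * q * r - 1 - 3 * s - 3 * s * s - p * j' * q)"
    unfolding cd ce unfolding i_def j_def i'_def j'_def by (simp add: algebra_simps)
  show "2 * \<gamma> dvd ce k j i k' j' i' * j' - cd k j i k' j' i' * i' - k' - r * j' \<longleftrightarrow> 2 * \<gamma> dvd p - r + 2 * (p * s + q * r)"
    unfolding 6 using r D by (simp only: dvd_add_left_iff dvd_mult2 dvd_minus_iff)
qed

text \<open>On the right are the conditions as they come out of the relations. To simplify them one needs that
  \<open>\<gamma>\<close> divides \<open>ps + qr\<close>. For \<open>\<gamma> = 4e\<close> this holds because \<open>2e\<close> divides each of \<open>p, q, r, s\<close>; the
  two smallest values of \<open>\<gamma>\<close> are settled by parity.\<close>

lemma good_iff: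
  "good (1 + 2 * p) (2 * q) (2 * r) (1 + 2 * s) \<longleftrightarrow> 2 * \<gamma> dvd 4 * q \<and> 2 * \<gamma> dvd 4 * r
    \<and> 2 * \<gamma> dvd (1 + 2 * p) * (1 + 2 * s) - 2 * q * (2 * r) - 1
    \<and> 2 * \<gamma> dvd s - q + 2 * (p * s + q * r) \<and> 2 * \<gamma> dvd p - r + 2 * (p * s + q * r)"
    (is "_ \<longleftrightarrow> ?conds")
proof -
  have good: "good (1 + 2 * p) (2 * q) (2 * r) (1 + 2 * s) \<longleftrightarrow>
      2 * \<gamma> dvd p - r \<and> 2 * \<gamma> dvd s - q \<and> \<gamma> dvd r - q \<and> 2 * \<gamma> dvd 4 * q"
  proof -
    have "[1 + 2 * x = 1 + 2 * y] (mod 4 * \<gamma>) \<longleftrightarrow> 2 * \<gamma> dvd x - y" for x y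
    proof -
      have "(1 + 2 * x) - (1 + 2 * y) = 2 * (x - y)" by simp
      then show ?thesis
        unfolding cong_iff_dvd_diff using dvd_mult_cancel_left[of 2 "2 * \<gamma>" "x - y"] by (simp add: mult.assoc)
    qed
    moreover have "[2 * r = 2 * q] (mod 2 * \<gamma>) \<longleftrightarrow> \<gamma> dvd r - q"
      unfolding cong_iff_dvd_diff right_diff_distrib[symmetric] by (simp only: dvd_mult_cancel_left) simp
    ultimately show ?thesis unfolding good_def by (auto simp: cong_0_iff)
  qed
  have D: "(1 + 2 * p) * (1 + 2 * s) - 2 * q * (2 * r) - 1 = 2 * (p + s + 2 * (p * s) - 2 * (q * r))"
    by (simp add: algebra_simps)
  show ?thesis
  proof
    assume "good (1 + 2 * p) (2 * q) (2 * r) (1 + 2 * s)"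
    then have *: "2 * \<gamma> dvd p - r" "2 * \<gamma> dvd s - q" "\<gamma> dvd r - q" and q: "2 * \<gamma> dvd 4 * q"
      unfolding good by blast+
    obtain x where x: "p - r = 2 * \<gamma> * x" using *(1) by (elim dvdE)
    obtain y where y: "s - q = 2 * \<gamma> * y" using *(2) by (elim dvdE)
    obtain z where z: "r - q = \<gamma> * z" using *(3) by (elim dvdE)
    have eq: "p = r + 2 * \<gamma> * x" "s = q + 2 * \<gamma> * y" "r = q + \<gamma> * z" using x y z by simp_all
    have "4 * r = 4 * q + 2 * \<gamma> * (2 * z)" by (simp add: eq(3))
    then have r: "2 * \<gamma> dvd 4 * r" using q by (simp only: dvd_add dvd_triv_left)
    have ps: "p * s = q * r + 2 * \<gamma> * (r * y + x * q + 2 * \<gamma> * x * y)" (is "_ = _ + 2 * \<gamma> * ?w")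
      unfolding eq(1,2) by (simp add: algebra_simps)
    have "2 * (p + s + 2 * (p * s) - 2 * (q * r)) = 4 * q + 2 * \<gamma> * (z + 2 * x + 2 * y + 4 * ?w)"
      unfolding ps using eq by (simp add: algebra_simps)
    then have d: "2 * \<gamma> dvd 2 * (p + s + 2 * (p * s) - 2 * (q * r))" using q by (simp only: dvd_add dvd_triv_left)
    have "s - q + 2 * (p * s + q * r) = 4 * q * r + 2 * \<gamma> * (y + 2 * ?w)"
      "p - r + 2 * (p * s + q * r) = 4 * q * r + 2 * \<gamma> * (x + 2 * ?w)"
      unfolding ps x y by (simp_all add: algebra_simps)
    then have "2 * \<gamma> dvd s - q + 2 * (p * s + q * r)" "2 * \<gamma> dvd p - r + 2 * (p * s + q * r)"
      using q by (simp_all only: dvd_add dvd_mult2 dvd_triv_left)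
    then show ?conds unfolding D using q r d by blast
  next
    assume c: ?conds
    then have q: "2 * \<gamma> dvd 4 * q" and r: "2 * \<gamma> dvd 4 * r"
      and d: "2 * \<gamma> dvd 2 * (p + s + 2 * (p * s) - 2 * (q * r))"
      and s: "2 * \<gamma> dvd s - q + 2 * (p * s + q * r)" and p: "2 * \<gamma> dvd p - r + 2 * (p * s + q * r)"
      unfolding D by blast+
    have d': "\<gamma> dvd p + s + 2 * (p * s) - 2 * (q * r)" using d by (simp only: dvd_mult_cancel_left) simp
    have "\<gamma> dvd p * s + q * r"
    proof (cases rule: gamma_cases)
      case 1
      then show ?thesis by simp
    next
      case 2
      then have "even (p + s + 2 * (p * s) - 2 * (q * r))" using d' by simp
      then have ps: "even p \<longleftrightarrow> even s" by simp
      have "2 dvd 2 * \<gamma>" by simp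
      then have "even (s - q + 2 * (p * s + q * r))" "even (p - r + 2 * (p * s + q * r))"
        using s p dvd_trans by blast+
      then have "even s \<longleftrightarrow> even q" "even p \<longleftrightarrow> even r" by simp_all
      then show ?thesis using ps 2 by (simp add: even_add)
    next
      case 3
      then obtain e where e: "\<gamma> = 4 * e" by (elim dvdE)
      have "4 * (2 * e) dvd 4 * q" "4 * (2 * e) dvd 4 * r" using q r e by simp_all
      then have qe: "2 * e dvd q" and re: "2 * e dvd r"
        unfolding dvd_mult_cancel_left by simp_all
      have e2: "2 * e dvd 2 * \<gamma>" using e by simp
      have cop: "coprime (2 * e) x" if "odd x" for x
        by (rule coprime_divisors[OF e2 dvd_refl coprime_gamma(2)[OF that]])
      have "2 * e dvd (s - q + 2 * (p * s + q * r)) + q * (1 - 2 * r)" "2 * e dvd (p - r + 2 * (p * s + q * r)) + r * (1 - 2 * q)"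
        by (intro dvd_add dvd_mult2 dvd_trans[OF e2 s] dvd_trans[OF e2 p] qe re)+
      moreover have "(s - q + 2 * (p * s + q * r)) + q * (1 - 2 * r) = s * (1 + 2 * p)"
        "(p - r + 2 * (p * s + q * r)) + r * (1 - 2 * q) = p * (1 + 2 * s)"
        by (simp_all add: algebra_simps)
      ultimately have "2 * e dvd s * (1 + 2 * p)" "2 * e dvd p * (1 + 2 * s)" by (simp_all only:)
      then have "2 * e dvd s" "2 * e dvd p"
        using cop[of "1 + 2 * p"] cop[of "1 + 2 * s"] by (simp_all add: coprime_dvd_mult_left_iff)
      then have "2 * e * (2 * e) dvd p * s" "2 * e * (2 * e) dvd q * r"
        using qe re by (simp_all only: mult_dvd_mono)
      then have "2 * e * (2 * e) dvd p * s + q * r" by (rule dvd_add)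
      moreover have "2 * e * (2 * e) = \<gamma> * e" using e by simp
      ultimately show ?thesis by (metis dvd_mult_left)
    qed
    note g = this
    have w: "2 * \<gamma> dvd 2 * (p * s + q * r)" by (rule mult_dvd_mono[OF dvd_refl g])
    have sq: "2 * \<gamma> dvd s - q" and pr: "2 * \<gamma> dvd p - r" using s p w by (simp_all only: dvd_add_left_iff)
    have q': "\<gamma> dvd 2 * q" using q dvd_mult_cancel_left[of 2 \<gamma> "2 * q"] by simp
    moreover have "\<gamma> dvd s - q" "\<gamma> dvd p - r" by (rule dvd_mult_right[OF sq], rule dvd_mult_right[OF pr])
    ultimately have "\<gamma> dvd (p + s + 2 * (p * s) - 2 * (q * r)) - (s - q) - (p - r) - (p * s + q * r) * 2 + 2 * q * (2 * r) - 2 * q"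
      using d' g by (simp only: dvd_add dvd_diff dvd_mult2)
    then have "\<gamma> dvd r - q" by (simp add: algebra_simps)
    then show "good (1 + 2 * p) (2 * q) (2 * r) (1 + 2 * s)" unfolding good using sq pr q by blast
  qed
qed

end

context macdonald_quotient
begin

lemma E_linear_pow:
  "E (k) (4 * \<gamma> * j) (4 * \<gamma> * i) [^] (n::int) = E (n * k) (4 * \<gamma> * (n * j)) (4 * \<gamma> * (n * i))"
proof (rule int_pow_eqI)
  fix n :: int
  show "E ((n + 1) * k) (4 * \<gamma> * ((n + 1) * j)) (4 * \<gamma> * ((n + 1) * i)) =
      E (n * k) (4 * \<gamma> * (n * j)) (4 * \<gamma> * (n * i)) \<otimes> E k (4 * \<gamma> * j) (4 * \<gamma> * i)"
    unfolding E_mult E_eq_iff cong_iff_dvd_diff lawK_def lawJ_def lawI_def M_gamma u_gamma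
  proof (intro conjI)
    obtain t where t: "4 * \<gamma> * (n * i) * (4 * \<gamma> * (n * i) + 1) = 2 * t"
      using even_triangular[of "4 * \<gamma> * (n * i)"] by (elim dvdE)
    show "8 * \<gamma>\<^sup>2 dvd (n + 1) * k - (n * k + k + 4 * \<gamma> * j * (4 * \<gamma> * (n * i)) * (1 + 4 * (\<gamma> * l) * k)
       + \<gamma> * l * (4 * \<gamma> * j * (4 * \<gamma> * j - 1)) * (4 * \<gamma> * (n * i) * (4 * \<gamma> * (n * i) + 1)))"
      unfolding t by (rule dvdI[of _ _ "- (2 * j * n * i) * (1 + 4 * (\<gamma> * l) * k) - l * j * (4 * \<gamma> * j - 1) * t"])
        (simp add: algebra_simps power2_eq_square)
  qed (simp_all add: algebra_simps power2_eq_square)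
qed (simp_all add: one_E)

lemma gamma_as_power: "\<exists>r. \<gamma> = 2 ^ r" "\<exists>r. 2 * \<gamma>\<^sup>2 = (2::int) ^ r"
proof -
  show "\<exists>r. \<gamma> = 2 ^ r" by (rule exI[of _ "m - 2"]) (simp only: \<gamma>_def)
  have "2 * \<gamma>\<^sup>2 = (2::int) ^ Suc ((m - 2) * 2)" by (simp only: \<gamma>_def power_Suc power_mult)
  then show "\<exists>r. 2 * \<gamma>\<^sup>2 = (2::int) ^ r" by (rule exI)
qed

lemma pow_4gamma:
  "E k j i [^] (4 * \<gamma>) = E (4 * \<gamma> * k - 2 * \<gamma> * (i * j) + 4 * \<gamma> * u * (i * j)) (4 * \<gamma> * j) (4 * \<gamma> * i)"
proof -
  obtain r where r: "\<gamma> = 2 ^ r" using gamma_as_power(1) by blast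
  obtain s t w where "E k j i [^] (4 * \<gamma>) = E (4 * \<gamma> * k + 2 * \<gamma> * (4 * \<gamma> - 1) * (i * j) + 4 * \<gamma> * u * (i * j) + 8 * \<gamma> * \<gamma> * s)
     (4 * \<gamma> * j + 8 * \<gamma> * \<gamma> * t) (4 * \<gamma> * i + 8 * \<gamma> * \<gamma> * w)"
    using pow_4_2power[of k j i r] unfolding r[symmetric] by blast
  also have "\<dots> = E (4 * \<gamma> * k - 2 * \<gamma> * (i * j) + 4 * \<gamma> * u * (i * j)) (4 * \<gamma> * j) (4 * \<gamma> * i)"
    unfolding E_eq_iff cong_iff_dvd_diff M_gamma
    by (intro conjI dvdI[of _ _ "i * j + s"] dvdI[of _ _ t] dvdI[of _ _ w]) (simp_all add: algebra_simps power2_eq_square)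
  finally show ?thesis .
qed

lemma pow_4u:
  assumes "even (i * j)"
  shows "E k j i [^] (4 * u) = E (4 * u * k - 2 * u * (i * j)) (4 * u * j) (4 * u * i)"
proof -
  obtain t where t: "i * j = 2 * t" using assms by (elim dvdE)
  have "E k j i [^] (4 * u) = (E k j i [^] (4 * \<gamma>)) [^] l"
    by (simp add: int_pow_pow u_gamma mult.assoc)
  also have "\<dots> = E (l * (4 * \<gamma> * k - 2 * \<gamma> * (i * j) + 4 * \<gamma> * u * (i * j))) (4 * \<gamma> * (l * j)) (4 * \<gamma> * (l * i))"
    unfolding pow_4gamma by (rule E_linear_pow)
  also have "\<dots> = E (4 * u * k - 2 * u * (i * j)) (4 * u * j) (4 * u * i)"
    unfolding E_eq_iff cong_iff_dvd_diff M_gamma t u_gamma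
    by (intro conjI dvdI[of _ _ "l * l * t"] dvdI[of _ _ 0]) (simp_all add: algebra_simps power2_eq_square)
  finally show ?thesis .
qed

lemma pow_M: "E k j i [^] M = E (4 * \<gamma>\<^sup>2 * (i * j)) 0 0"
proof -
  obtain r where r: "2 * \<gamma>\<^sup>2 = (2::int) ^ r" using gamma_as_power(2) by blast
  let ?n = "2 * \<gamma>\<^sup>2"
  obtain s t w where "E k j i [^] (4 * ?n) = E (4 * ?n * k + 2 * ?n * (4 * ?n - 1) * (i * j) + 4 * ?n * u * (i * j) + 8 * \<gamma> * ?n * s)
     (4 * ?n * j + 8 * \<gamma> * ?n * t) (4 * ?n * i + 8 * \<gamma> * ?n * w)"
    using pow_4_2power[of k j i r] unfolding r[symmetric] by blast
  also have "\<dots> = E (4 * \<gamma>\<^sup>2 * (i * j)) 0 0"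
    unfolding E_eq_iff cong_iff_dvd_diff M_gamma u_gamma
    by (intro conjI dvdI[of _ _ "k + (2 * ?n - 1) * (i * j) + \<gamma> * l * (i * j) + 2 * \<gamma> * s"]
        dvdI[of _ _ "j + 2 * \<gamma> * t"] dvdI[of _ _ "i + 2 * \<gamma> * w"]) (simp_all add: algebra_simps power2_eq_square)
  finally show ?thesis by (simp add: M_gamma)
qed

text \<open>Automorphisms preserve the relations \<open>a\<^sup>M = b\<^sup>M = 1\<close>, so this restricts the images of \<open>a\<close> and \<open>b\<close>.\<close>

lemma pow_M_eq_one_iff: "E k j i [^] M = \<one> \<longleftrightarrow> even (i * j)"
proof -
  have "E k j i [^] M = \<one> \<longleftrightarrow> 4 * \<gamma>\<^sup>2 * 2 dvd 4 * \<gamma>\<^sup>2 * (i * j)"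
    unfolding pow_M one_E E_eq_iff by (simp add: cong_0_iff M_gamma)
  then show ?thesis by (simp only: dvd_mult_cancel_left) simp
qed

lemma even_pred_product: "even (x * (x - 1))" for x :: int
  by simp

lemma two_half: "2 * (x * (x + 1) div 2) = x * (x + 1)" for x :: int
  by simp

text \<open>The element \<open>E c1 c2 c3\<close> is the commutator of \<open>E k j i\<close> and \<open>E k' j' i'\<close>. Its
  \<open>c\<close>-exponent is the determinant of the exponents of \<open>b\<close> and \<open>a\<close>, up to a multiple of \<open>4\<gamma>\<close>, which
  is all that matters for its action on \<open>b\<close>- and \<open>a\<close>-exponents.\<close>

lemma commutator_coords:
  assumes eq: "E k' j' i' \<otimes> E k j i \<otimes> E c1 c2 c3 = E k j i \<otimes> E k' j' i'"
  shows "\<exists>w. E c1 c2 c3 = E (i * j' - j * i' + 4 * \<gamma> * w) (4 * u * cd k j i k' j' i') (4 * u * ce k j i k' j' i')"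
proof -
  define D where "D = i * j' - j * i'"
  define S where "S = j * (j + 1) div 2"
  define S' where "S' = j' * (j' + 1) div 2"
  define T where "T = i * (i + 1) div 2"
  define T' where "T' = i' * (i' + 1) div 2"
  define R where "R = c2 * (c2 + 1) div 2"
  have ST: "j * (j + 1) = 2 * S" "j' * (j' + 1) = 2 * S'" "i * (i + 1) = 2 * T" "i' * (i' + 1) = 2 * T'" "c2 * (c2 + 1) = 2 * R"
    unfolding S_def S'_def T_def T'_def R_def by (simp_all only: two_half)
  have STm: "j * (j - 1) = 2 * (S - j)" "j' * (j' - 1) = 2 * (S' - j')"
    using ST by (simp_all add: algebra_simps)
  define W2 where "W2 = - (j' * (k + i' * j) + i' * S)"
  define V2 where "V2 = - (j * (k' + i * j') + i * S')"
  define W3 where "W3 = i' * k + j * T'"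
  define V3 where "V3 = i * k' + j' * T"
  define w1 where "w1 = lK k' j' i' k j i"
  define v1 where "v1 = lK k j i k' j' i'"
  define w2 where "w2 = j' + j + 4 * u * W2"
  define v2 where "v2 = j + j' + 4 * u * V2"
  define w3 where "w3 = i' + i + 4 * u * W3"
  define v3 where "v3 = i + i' + 4 * u * V3"
  have laws: "lJ k' j' i' k j i = w2" "lJ k j i k' j' i' = v2" "lI k' j' i' k j i = w3" "lI k j i k' j' i' = v3"
    unfolding lawJ_def lawI_def ST w2_def v2_def w3_def v3_def W2_def V2_def W3_def V3_def by (simp_all add: algebra_simps)
  define R3 where "R3 = w3 * (w3 + 1) div 2"
  have R3: "w3 * (w3 + 1) = 2 * R3" unfolding R3_def by (simp only: two_half)
  have "8 * \<gamma>\<^sup>2 dvd lK w1 w2 w3 c1 c2 c3 - v1" "8 * \<gamma>\<^sup>2 dvd lJ w1 w2 w3 c1 c2 c3 - v2" "8 * \<gamma>\<^sup>2 dvd lI w1 w2 w3 c1 c2 c3 - v3"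
    using eq unfolding E_mult laws w1_def[symmetric] v1_def[symmetric] E_eq_iff cong_iff_dvd_diff M_gamma by blast+
  then obtain q1 q2 q3 where q: "lK w1 w2 w3 c1 c2 c3 - v1 = 8 * \<gamma>\<^sup>2 * q1" "lJ w1 w2 w3 c1 c2 c3 - v2 = 8 * \<gamma>\<^sup>2 * q2"
      "lI w1 w2 w3 c1 c2 c3 - v3 = 8 * \<gamma>\<^sup>2 * q3"
    by (elim dvdE) blast
  have c2: "c2 = 8 * \<gamma>\<^sup>2 * q2 + 4 * u * (V2 - W2 + w2 * (c1 + w3 * c2) + w3 * R)"
    unfolding q(2)[symmetric] lawJ_def ST by (simp add: v2_def w2_def algebra_simps)
  have c3: "c3 = 8 * \<gamma>\<^sup>2 * q3 + 4 * u * (V3 - W3 - w3 * c1 - c2 * R3)"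
    unfolding q(3)[symmetric] lawI_def R3 by (simp add: v3_def w3_def algebra_simps)
  obtain y where y: "c2 = 4 * \<gamma> * y"
  proof
    show "c2 = 4 * \<gamma> * (2 * \<gamma> * q2 + l * (V2 - W2 + w2 * (c1 + w3 * c2) + w3 * R))"
      by (subst c2) (simp add: u_gamma algebra_simps power2_eq_square)
  qed
  have vw1: "v1 - w1 = D + 4 * u * (j' * i * k' + (S' - j') * T - j * i' * k - (S - j) * T')"
    unfolding v1_def w1_def D_def lawK_def ST STm by (simp add: algebra_simps)
  have c1: "c1 = 8 * \<gamma>\<^sup>2 * q1 + (v1 - w1) - c2 * (w3 * (1 + 4 * u * c1) + 2 * u * (c2 - 1) * R3)"
    unfolding q(1)[symmetric] lawK_def R3 by (simp add: algebra_simps)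
  obtain w where w: "c1 = D + 4 * \<gamma> * w"
  proof
    show "c1 = D + 4 * \<gamma> * (2 * \<gamma> * q1 + l * (j' * i * k' + (S' - j') * T - j * i' * k - (S - j) * T')
        - y * (w3 * (1 + 4 * u * c1) + 2 * u * (c2 - 1) * R3))"
      by (subst c1) (simp add: vw1 y u_gamma algebra_simps power2_eq_square)
  qed
  have cd: "cd k j i k' j' i' = V2 - W2 + D * (j' + j)" and ce: "ce k j i k' j' i' = V3 - W3 - D * (i' + i)"
    unfolding cd_def ce_def S_def[symmetric] S'_def[symmetric] T_def[symmetric] T'_def[symmetric] D_def[symmetric]
      V2_def W2_def V3_def W3_def by (simp_all add: algebra_simps)
  have "c2 - 4 * u * cd k j i k' j' i' = 8 * \<gamma>\<^sup>2 * q2 + 4 * u * (w2 * c1 - D * (j' + j)) + 4 * u * w2 * w3 * c2 + 2 * u * w3 * (c2 * (c2 + 1))"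
    unfolding cd ST(5) by (subst c2) (simp add: algebra_simps)
  also have "w2 * c1 - D * (j' + j) = 4 * \<gamma> * (w * (j' + j) + l * W2 * c1)"
    unfolding w2_def by (simp add: w u_gamma algebra_simps)
  also have "8 * \<gamma>\<^sup>2 * q2 + 4 * u * (4 * \<gamma> * (w * (j' + j) + l * W2 * c1)) + 4 * u * w2 * w3 * c2
      + 2 * u * w3 * (c2 * (c2 + 1)) =
      8 * \<gamma>\<^sup>2 * (q2 + 2 * l * (w * (j' + j) + l * W2 * c1) + 2 * l * w2 * w3 * y + l * w3 * y * (c2 + 1))"
    by (simp add: y u_gamma algebra_simps power2_eq_square)
  finally have d: "c2 - 4 * u * cd k j i k' j' i' = \<dots>" .
  have "c3 - 4 * u * ce k j i k' j' i' = 8 * \<gamma>\<^sup>2 * q3 - 4 * u * (w3 * c1 - D * (i' + i)) - 4 * u * c2 * R3"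
    unfolding ce by (subst c3) (simp add: algebra_simps)
  also have "w3 * c1 - D * (i' + i) = 4 * \<gamma> * (w * (i' + i) + l * W3 * c1)"
    unfolding w3_def by (simp add: w u_gamma algebra_simps)
  finally have "c3 - 4 * u * ce k j i k' j' i' = 8 * \<gamma>\<^sup>2 * (q3 - 2 * l * (w * (i' + i) + l * W3 * c1) - 2 * l * y * R3)"
    by (simp add: y u_gamma algebra_simps power2_eq_square)
  with d have "8 * \<gamma>\<^sup>2 dvd c2 - 4 * u * cd k j i k' j' i'" "8 * \<gamma>\<^sup>2 dvd c3 - 4 * u * ce k j i k' j' i'"
    by (simp_all only: dvd_triv_left)
  then have "E c1 c2 c3 = E (D + 4 * \<gamma> * w) (4 * u * cd k j i k' j' i') (4 * u * ce k j i k' j' i')"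
    unfolding E_eq_iff cong_iff_dvd_diff M_gamma w by simp
  then show ?thesis unfolding D_def by blast
qed

lemma pow_alpha:
  assumes "even (i * j)"
  shows "E k j i [^] (1 + 4 * u) = E (k + 4 * u * k + 2 * u * (i * j)) (j + 4 * u * j) (i + 4 * u * i)"
proof -
  obtain t where t: "i * j = 2 * t" using assms by (elim dvdE)
  obtain T where T: "i * (i + 1) = 2 * T" using even_triangular[of i] by (elim dvdE)
  have "E k j i [^] (1 + 4 * u) = E k j i \<otimes> E k j i [^] (4 * u)"
    by (simp only: int_pow_mult[OF E_closed] int_pow_1[OF E_closed])
  also have "\<dots> = E (k + 4 * u * k + 2 * u * (i * j)) (j + 4 * u * j) (i + 4 * u * i)"
    unfolding pow_4u[OF assms] E_mult E_eq_iff cong_iff_dvd_diff lawK_def lawJ_def lawI_def T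
  proof (intro conjI dvd_u2)
    show "k + (4 * u * k - 2 * u * (i * j)) + 4 * u * j * i * (1 + 4 * u * (4 * u * k - 2 * u * (i * j))) +
        u * (4 * u * j * (4 * u * j - 1)) * (2 * T) - (k + 4 * u * k + 2 * u * (i * j)) =
        8 * u\<^sup>2 * (2 * j * i * (4 * u * k - 2 * u * (i * j)) + j * (4 * u * j - 1) * T)"
      by (simp add: algebra_simps power2_eq_square)
    show "j * (1 - 4 * u * (4 * u * k - 2 * u * (i * j) + i * (4 * u * j))) + 4 * u * j - 2 * u * i * (4 * u * j * (4 * u * j + 1)) -
        (j + 4 * u * j) = 8 * u\<^sup>2 * (- j * (2 * k + i * j) - i * j * (4 * u * j + 1))"
      by (simp add: algebra_simps power2_eq_square)
    show "i * (1 + 4 * u * (4 * u * k - 2 * u * (i * j))) + 2 * u * (4 * u * j) * (2 * T) + 4 * u * i - (i + 4 * u * i) =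
        8 * u\<^sup>2 * (i * (2 * k - i * j) + 2 * j * T)"
      by (simp add: algebra_simps power2_eq_square)
  qed
  finally show ?thesis .
qed

text \<open>The relation \<open>ac = ca\<^sup>\<alpha>\<close> for \<open>E k j i\<close> in place of \<open>a\<close> and an element of the shape given by \<open>commutator_coords\<close> in place of \<open>c\<close>.\<close>

lemma relation_A_iff:
  assumes "even (i * j)"
  shows "E k j i \<otimes> E (D + 4 * \<gamma> * w) (4 * u * d) (4 * u * e) = E (D + 4 * \<gamma> * w) (4 * u * d) (4 * u * e) \<otimes> E k j i [^] (1 + 4 * u)
    \<longleftrightarrow> M dvd 4 * u * (d * i - e * j - k) - 2 * u * (i * j) \<and> M dvd 4 * u * (j * (D + 1)) \<and> M dvd 4 * u * (i * (D - 1))"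
    (is "?L = ?R \<longleftrightarrow> _")
proof -
  obtain T where T: "i * (i + 1) = 2 * T" using even_triangular[of i] by (elim dvdE)
  let ?c = "D + 4 * \<gamma> * w"
  let ?x = "k + 4 * u * k + 2 * u * (i * j)"
  obtain Y where Y: "(j + 4 * u * j) * (j + 4 * u * j - 1) = 2 * Y"
    using even_pred_product[of "j + 4 * u * j"] by (elim dvdE)
  have 1: "M dvd 4 * u * (4 * \<gamma> * z)" for z by (simp add: M_gamma u_gamma power2_eq_square)
  have 2: "M dvd 8 * u\<^sup>2 * z" for z by (rule M_dvd_8u2)
  have "lK k j i ?c (4 * u * d) (4 * u * e) - lK ?c (4 * u * d) (4 * u * e) ?x (j + 4 * u * j) (i + 4 * u * i)
    = (4 * u * (d * i - e * j - k) - 2 * u * (i * j)) + 8 * u\<^sup>2 * (2 * d * i * ?c + d * (4 * u * d - 1) * T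
       - 2 * j * e - 2 * (j + 4 * u * j) * e * ?x - Y * e * (4 * u * e + 1))"
    unfolding lawK_def T Y by (simp add: algebra_simps power2_eq_square)
  then have K: "M dvd lK k j i ?c (4 * u * d) (4 * u * e) - lK ?c (4 * u * d) (4 * u * e) ?x (j + 4 * u * j) (i + 4 * u * i)
    \<longleftrightarrow> M dvd 4 * u * (d * i - e * j - k) - 2 * u * (i * j)"
    using 2 by (simp only: dvd_add_left_iff)
  have "lJ k j i ?c (4 * u * d) (4 * u * e) - lJ ?c (4 * u * d) (4 * u * e) ?x (j + 4 * u * j) (i + 4 * u * i)
    = - (4 * u * (j * (D + 1))) + (4 * u * (4 * \<gamma> * (- j * w)) + 8 * u\<^sup>2 * (- 2 * j * i * d - i * d * (4 * u * d + 1)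
       + 2 * d * (?x + 4 * u * e * (j + 4 * u * j)) + e * ((j + 4 * u * j) * (j + 4 * u * j + 1))))"
    unfolding lawJ_def by (simp add: algebra_simps power2_eq_square)
  then have J: "M dvd lJ k j i ?c (4 * u * d) (4 * u * e) - lJ ?c (4 * u * d) (4 * u * e) ?x (j + 4 * u * j) (i + 4 * u * i)
    \<longleftrightarrow> M dvd 4 * u * (j * (D + 1))"
    using 1 2 by (simp only: dvd_add_left_iff dvd_add dvd_minus_iff)
  have "lI k j i ?c (4 * u * d) (4 * u * e) - lI ?c (4 * u * d) (4 * u * e) ?x (j + 4 * u * j) (i + 4 * u * i)
    = 4 * u * (i * (D - 1)) + (4 * u * (4 * \<gamma> * (i * w)) + 8 * u\<^sup>2 * (2 * d * T - 2 * e * ?x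
        - (j + 4 * u * j) * e * (4 * u * e + 1)))"
    unfolding lawI_def T by (simp add: algebra_simps power2_eq_square)
  then have I: "M dvd lI k j i ?c (4 * u * d) (4 * u * e) - lI ?c (4 * u * d) (4 * u * e) ?x (j + 4 * u * j) (i + 4 * u * i)
    \<longleftrightarrow> M dvd 4 * u * (i * (D - 1))"
    using 1 2 by (simp only: dvd_add_left_iff dvd_add)
  show ?thesis
    unfolding pow_alpha[OF assms] E_mult E_eq_iff cong_iff_dvd_diff K J I ..
qed

lemma relation_B_iff:
  assumes "even (i * j)"
  shows "E (D + 4 * \<gamma> * w) (4 * u * d) (4 * u * e) \<otimes> E k j i = E k j i [^] (1 + 4 * u) \<otimes> E (D + 4 * \<gamma> * w) (4 * u * d) (4 * u * e)
    \<longleftrightarrow> M dvd 4 * u * (e * j - d * i - k) - 2 * u * (i * j) \<and> M dvd 4 * u * (j * (D - 1)) \<and> M dvd 4 * u * (i * (D + 1))"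
    (is "?L = ?R \<longleftrightarrow> _")
proof -
  let ?c = "D + 4 * \<gamma> * w"
  let ?x = "k + 4 * u * k + 2 * u * (i * j)"
  obtain Y where Y: "j * (j - 1) = 2 * Y"
    using even_pred_product[of j] by (elim dvdE)
  obtain T where T: "(i + 4 * u * i) * (i + 4 * u * i + 1) = 2 * T"
    using even_triangular[of "i + 4 * u * i"] by (elim dvdE)
  have 1: "M dvd 4 * u * (4 * \<gamma> * z)" for z by (simp add: M_gamma u_gamma power2_eq_square)
  have 2: "M dvd 8 * u\<^sup>2 * z" for z by (rule M_dvd_8u2)
  have "lK ?c (4 * u * d) (4 * u * e) k j i - lK ?x (j + 4 * u * j) (i + 4 * u * i) ?c (4 * u * d) (4 * u * e)
    = (4 * u * (e * j - d * i - k) - 2 * u * (i * j)) + 8 * u\<^sup>2 * (2 * j * e * k + Y * e * (4 * u * e + 1)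
       - 2 * d * i - 2 * d * (i + 4 * u * i) * ?c - d * (4 * u * d - 1) * T)"
    unfolding lawK_def T Y by (simp add: algebra_simps power2_eq_square)
  then have K: "M dvd lK ?c (4 * u * d) (4 * u * e) k j i - lK ?x (j + 4 * u * j) (i + 4 * u * i) ?c (4 * u * d) (4 * u * e)
    \<longleftrightarrow> M dvd 4 * u * (e * j - d * i - k) - 2 * u * (i * j)"
    using 2 by (simp only: dvd_add_left_iff)
  have "lJ ?c (4 * u * d) (4 * u * e) k j i - lJ ?x (j + 4 * u * j) (i + 4 * u * i) ?c (4 * u * d) (4 * u * e)
    = 4 * u * (j * (D - 1)) + (4 * u * (4 * \<gamma> * (j * w)) + 8 * u\<^sup>2 * (- 2 * d * (k + 4 * u * e * j)
       - e * (j * (j + 1)) + 2 * j * ?c + 2 * (j + 4 * u * j) * (i + 4 * u * i) * d + (i + 4 * u * i) * d * (4 * u * d + 1)))"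
    unfolding lawJ_def by (simp add: algebra_simps power2_eq_square)
  then have J: "M dvd lJ ?c (4 * u * d) (4 * u * e) k j i - lJ ?x (j + 4 * u * j) (i + 4 * u * i) ?c (4 * u * d) (4 * u * e)
    \<longleftrightarrow> M dvd 4 * u * (j * (D - 1))"
    using 1 2 by (simp only: dvd_add_left_iff dvd_add)
  have "lI ?c (4 * u * d) (4 * u * e) k j i - lI ?x (j + 4 * u * j) (i + 4 * u * i) ?c (4 * u * d) (4 * u * e)
    = - (4 * u * (i * (D + 1))) + (4 * u * (4 * \<gamma> * (- i * w)) + 8 * u\<^sup>2 * (2 * e * k + j * e * (4 * u * e + 1)
        - 2 * i * ?c - 2 * d * T))"
    unfolding lawI_def T by (simp add: algebra_simps power2_eq_square)
  then have I: "M dvd lI ?c (4 * u * d) (4 * u * e) k j i - lI ?x (j + 4 * u * j) (i + 4 * u * i) ?c (4 * u * d) (4 * u * e)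
    \<longleftrightarrow> M dvd 4 * u * (i * (D + 1))"
    using 1 2 by (simp only: dvd_add_left_iff dvd_add dvd_minus_iff)
  show ?thesis
    unfolding pow_alpha[OF assms] E_mult E_eq_iff cong_iff_dvd_diff K J I ..
qed

end

section \<open>Automorphisms of H\<close>

lemma (in group) upper_central_Suc_eq:
  "upper_central G n \<lhd> G \<Longrightarrow> upper_central G (Suc n)
    = {x \<in> carrier G. \<forall>y \<in> carrier G. (x \<otimes> y) \<otimes> inv (y \<otimes> x) \<in> upper_central G n}"
  using upper_central_step by simp

lemma (in group) intertwine_inv:
  assumes "x \<otimes> z = z \<otimes> y" "x \<in> carrier G" "y \<in> carrier G" "z \<in> carrier G"
  shows "y \<otimes> inv z = inv z \<otimes> x"
proof -
  have "inv z \<otimes> (x \<otimes> z) \<otimes> inv z = inv z \<otimes> x"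
    using assms(2-4) by (simp add: m_assoc)
  then show ?thesis
    unfolding assms(1) using assms(2-4) by (simp flip: m_assoc)
qed

lemma autoD:
  assumes "f \<in> auto G"
  shows "f \<in> hom G G" "bij_betw f (carrier G) (carrier G)" "f \<in> extensional (carrier G)"
  using assms by (simp_all add: auto_def Bij_def)

lemma autoI: "\<lbrakk>f \<in> hom G G; bij_betw f (carrier G) (carrier G); f \<in> extensional (carrier G)\<rbrakk> \<Longrightarrow> f \<in> auto G"
  by (simp add: auto_def Bij_def)

lemma (in group) group_hom_auto: "f \<in> auto G \<Longrightarrow> group_hom G G f"
  by (simp add: autoD(1) group_hom.intro group_hom_axioms_def is_group)

context macdonald_quotient
begin

lemma law_mod:
  "[lK k j i k' j' i' = k + k' + j' * i] (mod 4 * \<gamma>)"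
  "[lJ k j i k' j' i' = j + j'] (mod 4 * \<gamma>)"
  "[lI k j i k' j' i' = i + i'] (mod 4 * \<gamma>)"
proof -
  \<comment> \<open>Halving the products of consecutive integers turns the factors \<open>u\<close> and \<open>2u\<close> in the law into \<open>2u\<close> and \<open>4u\<close>.\<close>
  obtain T where T: "i * (i + 1) = 2 * T" using even_triangular[of i] by (elim dvdE)
  obtain S where S: "j' * (j' + 1) = 2 * S" using even_triangular[of j'] by (elim dvdE)
  obtain R where R: "j' * (j' - 1) = 2 * R" using even_pred_product[of j'] by (elim dvdE)
  have "lK k j i k' j' i' - (k + k' + j' * i) = 4 * \<gamma> * (l * (j' * i * k' + R * T))"
    "lJ k j i k' j' i' - (j + j') = 4 * \<gamma> * (- l * (j * (k' + i * j') + i * S))"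
    "lI k j i k' j' i' - (i + i') = 4 * \<gamma> * (l * (i * k' + j' * T))"
    unfolding lawK_def lawJ_def lawI_def T S R u_gamma by (simp_all add: algebra_simps)
  then show "[lK k j i k' j' i' = k + k' + j' * i] (mod 4 * \<gamma>)"
    "[lJ k j i k' j' i' = j + j'] (mod 4 * \<gamma>)"
    "[lI k j i k' j' i' = i + i'] (mod 4 * \<gamma>)"
    unfolding cong_iff_dvd_diff by (simp_all only: dvd_triv_left)
qed

lemma gamma4_dvd_M: "4 * \<gamma> dvd M" and gamma2_dvd_M: "2 * \<gamma> dvd M"
  by (simp_all add: M_gamma power2_eq_square)

lemma coords_E': "[kc (E k j i) = k] (mod 4 * \<gamma>)" "[jc (E k j i) = j] (mod 4 * \<gamma>)" "[ic (E k j i) = i] (mod 4 * \<gamma>)"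
  by (rule cong_dvd_modulus[OF coords_E(1) gamma4_dvd_M], rule cong_dvd_modulus[OF coords_E(2) gamma4_dvd_M],
      rule cong_dvd_modulus[OF coords_E(3) gamma4_dvd_M])

lemma coords_mult:
  assumes "x \<in> carrier G" "y \<in> carrier G"
  shows "[kc (x \<otimes> y) = kc x + kc y + jc y * ic x] (mod 4 * \<gamma>)"
    "[jc (x \<otimes> y) = jc x + jc y] (mod 4 * \<gamma>)" "[ic (x \<otimes> y) = ic x + ic y] (mod 4 * \<gamma>)"
proof -
  have xy: "x \<otimes> y = E (lK (kc x) (jc x) (ic x) (kc y) (jc y) (ic y)) (lJ (kc x) (jc x) (ic x) (kc y) (jc y) (ic y))
      (lI (kc x) (jc x) (ic x) (kc y) (jc y) (ic y))"
    unfolding E_mult[symmetric] using assms by (simp add: E_coords)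
  show "[kc (x \<otimes> y) = kc x + kc y + jc y * ic x] (mod 4 * \<gamma>)"
    "[jc (x \<otimes> y) = jc x + jc y] (mod 4 * \<gamma>)" "[ic (x \<otimes> y) = ic x + ic y] (mod 4 * \<gamma>)"
    unfolding xy by (rule cong_trans[OF coords_E'(1) law_mod(1)], rule cong_trans[OF coords_E'(2) law_mod(2)],
        rule cong_trans[OF coords_E'(3) law_mod(3)])
qed

lemma coords_pow:
  assumes "x \<in> carrier G"
  shows "[jc (x [^] (n::int)) = n * jc x] (mod 4 * \<gamma>)" "[ic (x [^] n) = n * ic x] (mod 4 * \<gamma>)"
proof -
  have *: "[f (x [^] (n::int)) = n * f x] (mod 4 * \<gamma>)"
    if add: "\<And>y z. y \<in> carrier G \<Longrightarrow> z \<in> carrier G \<Longrightarrow> [f (y \<otimes> z) = f y + f z] (mod 4 * \<gamma>)" for f n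
  proof (induction n rule: int_shift_induct)
    case 1
    have "[f \<one> + 0 = f \<one> + f \<one>] (mod 4 * \<gamma>)" using add[of \<one> \<one>] by simp
    then have "[0 = f \<one>] (mod 4 * \<gamma>)" by (simp only: cong_add_lcancel)
    then show ?case by (simp add: cong_sym_eq)
  next
    case (2 n)
    have "[f (x [^] (n + 1)) = f (x [^] n) + f x] (mod 4 * \<gamma>)"
      using add[of "x [^] n" x] assms by (simp add: int_pow_Suc)
    then have "[f (x [^] (n + 1)) = (n + 1) * f x] (mod 4 * \<gamma>) \<longleftrightarrow> [f (x [^] n) + f x = n * f x + f x] (mod 4 * \<gamma>)"
      unfolding cong_def by (simp add: distrib_right)
    then show ?case by (simp only: cong_add_rcancel)
  qed
  show "[jc (x [^] (n::int)) = n * jc x] (mod 4 * \<gamma>)" "[ic (x [^] n) = n * ic x] (mod 4 * \<gamma>)"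
    by (rule *, rule coords_mult(2), assumption+, rule *, rule coords_mult(3), assumption+)
qed

lemma normal_upper_central: "n \<le> 3 \<Longrightarrow> upper_central G n \<lhd> G"
proof -
  assume "n \<le> 3"
  then consider "n = 0" | "n = 1" | "n = 2" | "n = 3" by linarith
  then show ?thesis
    by cases (simp_all only: upper_central_0 upper_central_1 upper_central_2 upper_central_3 normal_Z levels)
qed

lemma commutators_in_Z3: "x \<in> carrier G \<Longrightarrow> y \<in> carrier G \<Longrightarrow> (x \<otimes> y) \<otimes> inv (y \<otimes> x) \<in> upper_central G 3"
proof -
  assume xy: "x \<in> carrier G" "y \<in> carrier G"
  have "[jc (x \<otimes> y) = jc (y \<otimes> x)] (mod 4 * \<gamma>)" "[ic (x \<otimes> y) = ic (y \<otimes> x)] (mod 4 * \<gamma>)"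
    using coords_mult[OF xy] coords_mult[OF xy(2,1)] unfolding cong_def by (simp_all add: add.commute)
  then have "[jc (x \<otimes> y) = jc (y \<otimes> x)] (mod 2 * \<gamma>)" "[ic (x \<otimes> y) = ic (y \<otimes> x)] (mod 2 * \<gamma>)"
    by (auto intro: cong_dvd_modulus)
  then show ?thesis
    unfolding upper_central_3 using xy by (simp add: mult_inv_in_Z_iff[OF levels(4)] lev_def)
qed

text \<open>The kernel of a homomorphism that is injective on the centre meets each term of the upper central series trivially: if \<open>x\<close> is in the kernel and in one term, its commutators are in the kernel and in the preceding term, hence trivial, so \<open>x\<close> is central. All commutators lie in the third term, so the argument extends to the whole group.\<close>

lemma inj_on_if_inj_on_center:
  assumes f: "f \<in> hom G G" and Z1: "\<And>x. x \<in> Z (2 * \<gamma>) M \<Longrightarrow> f x = \<one> \<Longrightarrow> x = \<one>"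
  shows "inj_on f (carrier G)"
proof -
  interpret f: group_hom G G f using f by unfold_locales
  have central: "x = \<one>" if x: "x \<in> carrier G" "f x = \<one>" and xy: "\<And>y. y \<in> carrier G \<Longrightarrow> (x \<otimes> y) \<otimes> inv (y \<otimes> x) = \<one>" for x
  proof -
    have "x \<in> upper_central G (Suc 0)"
      unfolding upper_central_Suc_eq[OF normal_upper_central[OF le0]] upper_central.simps(1) using x(1) xy by blast
    then have "x \<in> Z (2 * \<gamma>) M" using upper_central_1 unfolding One_nat_def by (simp only:)
    then show ?thesis using Z1 x(2) by blast
  qed
  have fcomm: "f ((x \<otimes> y) \<otimes> inv (y \<otimes> x)) = \<one>" if "x \<in> carrier G" "y \<in> carrier G" "f x = \<one>" for x y
    using that by simp
  have step: "x = \<one>" if n: "n < 3" and IH: "\<And>x. x \<in> upper_central G n \<Longrightarrow> f x = \<one> \<Longrightarrow> x = \<one>"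
      and x: "x \<in> upper_central G (Suc n)" "f x = \<one>" for n x
  proof -
    have "upper_central G n \<lhd> G" using n by (intro normal_upper_central) simp
    then have "x \<in> carrier G" "\<And>y. y \<in> carrier G \<Longrightarrow> (x \<otimes> y) \<otimes> inv (y \<otimes> x) \<in> upper_central G n"
      using x(1) upper_central_Suc_eq by blast+
    then show ?thesis using central IH fcomm x(2) by blast
  qed
  have 1: "x = \<one>" if "x \<in> upper_central G 1" "f x = \<one>" for x using Z1 that unfolding upper_central_1 by blast
  have 2: "x = \<one>" if "x \<in> upper_central G 2" "f x = \<one>" for x
    by (rule step[of 1]) (use 1 that in \<open>auto simp: numeral_2_eq_2\<close>)
  have 3: "x = \<one>" if "x \<in> upper_central G 3" "f x = \<one>" for x
    by (rule step[of 2]) (use 2 that in \<open>auto simp: numeral_3_eq_3 numeral_2_eq_2\<close>)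
  have "x = \<one>" if "x \<in> carrier G" "f x = \<one>" for x
    using central that commutators_in_Z3 3 fcomm by blast
  then show ?thesis using f.inj_on_one_iff by blast
qed

lemma finite_carrier: "finite (carrier G)"
proof (rule finite_subset)
  show "carrier G \<subseteq> (\<lambda>(k, j, i). E k j i) ` ({0..<M} \<times> {0..<M} \<times> {0..<M})"
  proof
    fix x assume "x \<in> carrier G"
    then obtain k j i where "x = E k j i" using E_surj by blast
    also have "\<dots> = E (k mod M) (j mod M) (i mod M)" unfolding E_eq_iff by (simp add: cong_def)
    finally have "x = (\<lambda>(k, j, i). E k j i) (k mod M, j mod M, i mod M)" by simp
    moreover have "M > 0" by (simp add: M_def)
    then have "(k mod M, j mod M, i mod M) \<in> {0..<M} \<times> {0..<M} \<times> {0..<M}" by simp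
    ultimately show "x \<in> (\<lambda>(k, j, i). E k j i) ` ({0..<M} \<times> {0..<M} \<times> {0..<M})" by (rule image_eqI)
  qed
qed simp

text \<open>Any triple satisfying the relations of \<open>H\<close> obeys the same multiplication law, so mapping normal
  forms to normal forms is a homomorphism. The centre of \<open>H\<close> is generated by \<open>c\<^sup>2\<^sup>\<gamma>\<close>, and the
  hypothesis on \<open>C\<close> makes the homomorphism injective there.\<close>

lemma automorphism_from_relations:
  assumes R: "macdonald_relations G A B C u M" and inj: "\<And>t. C [^] (2 * \<gamma> * t) = \<one> \<Longrightarrow> 4 * \<gamma> dvd t"
  shows "\<exists>f \<in> auto G. f a = A \<and> f b = B \<and> f c = C"
proof -
  interpret R: macdonald_relations G A B C u M by (rule R)
  define f where "f = (\<lambda>x \<in> carrier G. R.E (kc x) (jc x) (ic x))"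
  have f_E: "f (E k j i) = R.E k j i" for k j i
  proof -
    have "R.E (kc (E k j i)) (jc (E k j i)) (ic (E k j i)) = R.E k j i"
      using coords_E[of k j i] by (intro R.E_cong) (simp_all add: cong_iff_dvd_diff)
    then show ?thesis by (simp add: f_def)
  qed
  have hom: "f \<in> hom G G"
  proof (rule homI)
    show "f x \<in> carrier G" if "x \<in> carrier G" for x using that by (simp add: f_def)
    fix x y assume "x \<in> carrier G" "y \<in> carrier G"
    then obtain k j i k' j' i' where xy: "x = E k j i" "y = E k' j' i'" using E_surj by meson
    show "f (x \<otimes> y) = f x \<otimes> f y" unfolding xy E_mult f_E R.E_mult ..
  qed
  have "inj_on f (carrier G)"
  proof (rule inj_on_if_inj_on_center[OF hom])
    fix x assume x: "x \<in> Z (2 * \<gamma>) M" "f x = \<one>"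
    then have "x \<in> carrier G" by (simp add: Z_def)
    then obtain k j i where kji: "x = E k j i" using E_surj by blast
    have d: "2 * \<gamma> dvd k" "M dvd j" "M dvd i" using x(1) unfolding kji Z_E[OF levels(2)] by auto
    then obtain t where t: "k = 2 * \<gamma> * t" by (elim dvdE)
    have "R.E k j i = R.E k 0 0" using d by (intro R.E_cong) simp_all
    then have "C [^] (2 * \<gamma> * t) = \<one>" using x(2) R.c unfolding kji f_E by (simp add: R.E_def t)
    from inj[OF this] obtain s where "t = 4 * \<gamma> * s" by (elim dvdE)
    then have "k = M * s" by (simp add: t M_gamma power2_eq_square)
    then show "x = \<one>" using d unfolding kji one_E E_eq_iff by (simp add: cong_0_iff)
  qed
  moreover have "f ` carrier G \<subseteq> carrier G" using hom by (auto simp: hom_def)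
  ultimately have "bij_betw f (carrier G) (carrier G)"
    using endo_inj_surj[OF finite_carrier] by (simp add: bij_betw_def)
  then have "f \<in> auto G" using hom by (intro autoI) (simp_all add: f_def)
  moreover have "f a = A" "f b = B" "f c = C"
    using f_E[of 0 0 1] f_E[of 0 1 0] f_E[of 1 0 0] R.a R.b R.c a b c
    by (simp_all add: E_def R.E_def)
  ultimately show ?thesis by blast
qed

lemma c_pow_eq_one: "c [^] (k::int) = \<one> \<longleftrightarrow> M dvd k"
proof -
  have "c [^] k = E k 0 0" using c by (simp add: E_def)
  then show ?thesis unfolding one_E by (simp add: E_eq_iff cong_0_iff)
qed

lemma gamma4_dvd_iff: "M dvd 2 * \<gamma> * t \<longleftrightarrow> 4 * \<gamma> dvd t"
proof -
  have "M dvd 2 * \<gamma> * t \<longleftrightarrow> 2 * \<gamma> * (4 * \<gamma>) dvd 2 * \<gamma> * t" by (simp add: M_gamma power2_eq_square)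
  then show ?thesis by (simp only: dvd_mult_cancel_left) simp
qed

lemma swap_automorphism: "\<exists>f \<in> auto G. f a = b \<and> f b = a \<and> f c = inv c"
proof (rule automorphism_from_relations)
  show "macdonald_relations G b a (inv c) u M"
  proof unfold_locales
    show "b \<otimes> a = a \<otimes> b \<otimes> inv c" using a b c by (simp add: ab m_assoc)
    show "b \<otimes> inv c = inv c \<otimes> b [^] (1 + 4 * u)"
      by (rule intertwine_inv[OF cb[symmetric]]) (use b c in simp_all)
    show "inv c \<otimes> a = a [^] (1 + 4 * u) \<otimes> inv c"
      by (rule intertwine_inv[OF ac, symmetric]) (use a c in simp_all)
    show "inv c [^] M = \<one>" using c cM by (simp add: int_pow_inv)
  qed (use a b c aM bM M in simp_all)
  fix t assume "inv c [^] (2 * \<gamma> * t) = \<one>"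
  then have "c [^] (2 * \<gamma> * t) = \<one>" using c by (simp add: int_pow_inv)
  then show "4 * \<gamma> dvd t" by (simp only: c_pow_eq_one gamma4_dvd_iff)
qed

lemma commutator_pow: "E c1 (4 * u * d) (4 * u * e) [^] (n::int) = E (n * c1) (4 * u * (n * d)) (4 * u * (n * e))"
  using E_linear_pow[of c1 "l * d" "l * e" n] by (simp add: u_gamma mult_ac)

text \<open>The six divisibilities are those of \<open>relation_A_iff\<close> and \<open>relation_B_iff\<close>, three for each of the two
  relations.\<close>

lemma relations_iff_good:
  fixes p q r s k k' :: int
  defines "i \<equiv> 1 + 2 * p" and "j \<equiv> 2 * q" and "i' \<equiv> 2 * r" and "j' \<equiv> 1 + 2 * s"
  defines "D \<equiv> i * j' - j * i'" and "d \<equiv> cd k j i k' j' i'" and "e \<equiv> ce k j i k' j' i'"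
  shows "(M dvd 4 * u * (d * i - e * j - k) - 2 * u * (i * j) \<and> M dvd 4 * u * (j * (D + 1)) \<and> M dvd 4 * u * (i * (D - 1)))
     \<and> (M dvd 4 * u * (e * j' - d * i' - k') - 2 * u * (i' * j') \<and> M dvd 4 * u * (j' * (D - 1)) \<and> M dvd 4 * u * (i' * (D + 1)))
     \<longleftrightarrow> good i j i' j'"
proof -
  have e1: "4 * u * (d * i - e * j - k) - 2 * u * (i * j) = 4 * u * (d * i - e * j - k - i * q)"
    and e2: "4 * u * (e * j' - d * i' - k') - 2 * u * (i' * j') = 4 * u * (e * j' - d * i' - k' - r * j')"
    unfolding j_def i'_def by (simp_all add: algebra_simps)
  have odd: "2 * \<gamma> dvd i * x \<longleftrightarrow> 2 * \<gamma> dvd x" "2 * \<gamma> dvd j' * x \<longleftrightarrow> 2 * \<gamma> dvd x" for x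
    using coprime_gamma(2)[of i] coprime_gamma(2)[of j'] by (simp_all add: i_def j'_def coprime_dvd_mult_right_iff)
  have good: "good i j i' j' \<longleftrightarrow> 2 * \<gamma> dvd 4 * q \<and> 2 * \<gamma> dvd 4 * r \<and> 2 * \<gamma> dvd D - 1
      \<and> 2 * \<gamma> dvd s - q + 2 * (p * s + q * r) \<and> 2 * \<gamma> dvd p - r + 2 * (p * s + q * r)"
    unfolding D_def i_def j_def i'_def j'_def by (rule good_iff)
  show ?thesis
  proof (cases "2 * \<gamma> dvd D - 1")
    case False
    then show ?thesis unfolding good e1 e2 dvd_4u_iff odd by blast
  next
    case True
    have "j * (D + 1) = 4 * q + (D - 1) * j" "i' * (D + 1) = 4 * r + (D - 1) * i'"
      unfolding j_def i'_def by (simp_all add: algebra_simps)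
    then have 1: "2 * \<gamma> dvd j * (D + 1) \<longleftrightarrow> 2 * \<gamma> dvd 4 * q" "2 * \<gamma> dvd i' * (D + 1) \<longleftrightarrow> 2 * \<gamma> dvd 4 * r"
      using dvd_mult2[OF True] by (simp_all only: dvd_add_left_iff)
    show ?thesis
    proof (cases "2 * \<gamma> dvd 4 * q \<and> 2 * \<gamma> dvd 4 * r")
      case False
      then show ?thesis unfolding good e1 e2 dvd_4u_iff 1 by argo
    next
      case qr: True
      then have q4: "2 * \<gamma> dvd 4 * q" and r4: "2 * \<gamma> dvd 4 * r" by blast+
      have "2 * \<gamma> dvd d * i - e * j - k - i * q \<longleftrightarrow> 2 * \<gamma> dvd s - q + 2 * (p * s + q * r)"
        unfolding d_def e_def i_def j_def i'_def j'_def
        by (rule relation_polynomials(1)) (use q4 r4 True in \<open>simp_all only: D_def i_def j_def i'_def j'_def\<close>)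
      moreover have "2 * \<gamma> dvd e * j' - d * i' - k' - r * j' \<longleftrightarrow> 2 * \<gamma> dvd p - r + 2 * (p * s + q * r)"
        unfolding d_def e_def i_def j_def i'_def j'_def
        by (rule relation_polynomials(2)) (use q4 r4 True in \<open>simp_all only: D_def i_def j_def i'_def j'_def\<close>)
      ultimately show ?thesis
        unfolding good e1 e2 dvd_4u_iff 1 odd using True q4 r4 by (simp only: simp_thms)
    qed
  qed
qed

lemma good_parts:
  assumes "good i j i' j'"
  obtains p q r s where "i = 1 + 2 * p" "j = 2 * q" "i' = 2 * r" "j' = 1 + 2 * s"
proof -
  have j: "even j" "even i'" and "[i = 1 + i'] (mod 4 * \<gamma>)" "[j' = 1 + j] (mod 4 * \<gamma>)"
    using assms unfolding good_def by blast+
  then have "[i = 1 + i'] (mod 2)" "[j' = 1 + j] (mod 2)"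
    by (auto intro: cong_dvd_modulus)
  then have "odd i" "odd j'" using j unfolding cong_iff_dvd_diff by simp_all
  then obtain p s where "i = 2 * p + 1" "j' = 2 * s + 1" by (elim oddE)
  moreover obtain q r where "j = 2 * q" "i' = 2 * r" using j by (elim evenE)
  ultimately show ?thesis by (intro that[of p q r s]) simp_all
qed

text \<open>The images satisfy the relations by \<open>relations_iff_good\<close>, and the \<open>c\<close>-exponent of their commutator is odd, so that the centre is mapped injectively.\<close>

theorem automorphism_if_good:
  assumes "good i j i' j'"
  shows "\<exists>f \<in> auto G. f a = E k j i \<and> f b = E k' j' i'"
proof -
  obtain p q r s where pqrs: "i = 1 + 2 * p" "j = 2 * q" "i' = 2 * r" "j' = 1 + 2 * s"
    using good_parts[OF assms] .
  let ?A = "E k j i" and ?B = "E k' j' i'"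
  define D where "D = i * j' - j * i'"
  define C where "C = inv (?B \<otimes> ?A) \<otimes> (?A \<otimes> ?B)"
  have C: "C \<in> carrier G" "?B \<otimes> ?A \<otimes> C = ?A \<otimes> ?B"
    unfolding C_def by (simp_all add: m_assoc[symmetric])
  obtain c1 c2 c3 where "C = E c1 c2 c3" using E_surj[OF C(1)] by blast
  then obtain w where w: "C = E (D + 4 * \<gamma> * w) (4 * u * cd k j i k' j' i') (4 * u * ce k j i k' j' i')"
    using commutator_coords[of k' j' i' k j i c1 c2 c3] C(2) unfolding D_def by auto
  have ev: "even (i * j)" "even (i' * j')" by (simp_all add: pqrs)
  have rel: "(M dvd 4 * u * (cd k j i k' j' i' * i - ce k j i k' j' i' * j - k) - 2 * u * (i * j) \<and> M dvd 4 * u * (j * (D + 1)) \<and> M dvd 4 * u * (i * (D - 1)))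
     \<and> (M dvd 4 * u * (ce k j i k' j' i' * j' - cd k j i k' j' i' * i' - k') - 2 * u * (i' * j') \<and> M dvd 4 * u * (j' * (D - 1)) \<and> M dvd 4 * u * (i' * (D + 1)))"
    using relations_iff_good[where p = p and q = q and r = r and s = s and k = k and k' = k', folded pqrs] assms unfolding D_def by blast
  have "odd D" unfolding D_def pqrs by simp
  then have odd: "odd (D + 4 * \<gamma> * w)" by simp
  have "\<exists>f \<in> auto G. f a = ?A \<and> f b = ?B \<and> f c = C"
  proof (rule automorphism_from_relations)
    show "macdonald_relations G ?A ?B C u M"
    proof unfold_locales
      show "?A \<otimes> C = C \<otimes> ?A [^] (1 + 4 * u)" unfolding w relation_A_iff[OF ev(1)] using rel by blast
      show "C \<otimes> ?B = ?B [^] (1 + 4 * u) \<otimes> C" unfolding w relation_B_iff[OF ev(2)] using rel by blast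
      show "C [^] M = \<one>" unfolding w commutator_pow one_E E_eq_iff cong_0_iff by simp
    qed (use C M ev in \<open>simp_all add: pow_M_eq_one_iff\<close>)
    fix t assume "C [^] (2 * \<gamma> * t) = \<one>"
    then have "M dvd 2 * \<gamma> * (t * (D + 4 * \<gamma> * w))"
      unfolding w commutator_pow one_E E_eq_iff cong_0_iff by (simp add: mult_ac)
    then show "4 * \<gamma> dvd t"
      using coprime_gamma(3)[OF odd] by (simp only: gamma4_dvd_iff coprime_dvd_mult_left_iff)
  qed
  then show ?thesis by blast
qed

text \<open>The determinant of the exponents is odd, for otherwise the commutator of \<open>f a\<close> and \<open>f b\<close>, which is
  \<open>f c\<close>, would have order less than \<open>M\<close>. As \<open>i j\<close> and \<open>i' j'\<close> are even,
  the exponents are then, modulo 2, those of the identity or of the exchange of \<open>a\<close> and \<open>b\<close>.\<close>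

lemma good_if_automorphism_odd:
  assumes f: "f \<in> auto G" and fa: "f a = E k j i" and fb: "f b = E k' j' i'"
  shows "(odd i \<longrightarrow> good i j i' j') \<and> (even i \<longrightarrow> odd i')"
proof -
  interpret f: group_hom G G f using f by (rule group_hom_auto)
  have inj: "inj_on f (carrier G)" using autoD(2)[OF f] by (simp add: bij_betw_def)
  define C where "C = f c"
  have C: "C \<in> carrier G" unfolding C_def using c by simp
  have AB: "E k' j' i' \<otimes> E k j i \<otimes> C = E k j i \<otimes> E k' j' i'"
    unfolding C_def fa[symmetric] fb[symmetric] using a b c ab by (simp flip: f.hom_mult)
  have AC: "E k j i \<otimes> C = C \<otimes> E k j i [^] (1 + 4 * u)"
    unfolding C_def fa[symmetric] using a c ac by (simp flip: f.hom_mult f.hom_int_pow)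
  have CB: "C \<otimes> E k' j' i' = E k' j' i' [^] (1 + 4 * u) \<otimes> C"
    unfolding C_def fb[symmetric] using b c cb by (simp flip: f.hom_mult f.hom_int_pow)
  have "f a [^] M = \<one>" unfolding f.hom_int_pow[OF a, symmetric] aM by (rule f.hom_one)
  moreover have "f b [^] M = \<one>" unfolding f.hom_int_pow[OF b, symmetric] bM by (rule f.hom_one)
  ultimately have ev: "even (i * j)" "even (i' * j')"
    unfolding fa fb pow_M_eq_one_iff by simp_all
  define D where "D = i * j' - j * i'"
  obtain c1 c2 c3 where "C = E c1 c2 c3" using E_surj[OF C] by blast
  then obtain w where w: "C = E (D + 4 * \<gamma> * w) (4 * u * cd k j i k' j' i') (4 * u * ce k j i k' j' i')"
    using commutator_coords[of k' j' i' k j i c1 c2 c3] AB unfolding D_def by auto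
  \<comment> \<open>For even \<open>D\<close> the power with exponent \<open>4\<gamma>\<^sup>2 = M / 2\<close> of \<open>f c\<close> would vanish, but that of \<open>c\<close> does not.\<close>
  have "odd D"
  proof
    assume "even D"
    then obtain t where t: "D = 2 * t" by (elim evenE)
    have "C [^] (4 * \<gamma>\<^sup>2) = \<one>"
      unfolding w commutator_pow unfolding one_E E_eq_iff cong_0_iff unfolding M_gamma t u_gamma
      by (simp add: algebra_simps power2_eq_square)
    then have "f (c [^] (4 * \<gamma>\<^sup>2)) = f \<one>" unfolding C_def using c by (simp add: f.hom_int_pow)
    then have "c [^] (4 * \<gamma>\<^sup>2) = \<one>" using inj_onD[OF inj] c by simp
    then have "8 * \<gamma>\<^sup>2 dvd 4 * \<gamma>\<^sup>2" unfolding c_pow_eq_one M_gamma .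
    then have "8 * \<gamma>\<^sup>2 \<le> 4 * \<gamma>\<^sup>2" by (rule zdvd_imp_le) (use gamma_pos in simp)
    then show False using gamma_pos by simp
  qed
  then have "even i \<longrightarrow> odd i'" unfolding D_def by auto
  moreover have "good i j i' j'" if "odd i"
  proof -
    have "even j" "odd j'" "even i'" using that ev \<open>odd D\<close> unfolding D_def by auto
    then obtain q r where "j = 2 * q" "i' = 2 * r" by (elim evenE)
    moreover obtain p s where "i = 2 * p + 1" "j' = 2 * s + 1" using \<open>odd i\<close> \<open>odd j'\<close> by (elim oddE)
    ultimately have pqrs: "i = 1 + 2 * p" "j = 2 * q" "i' = 2 * r" "j' = 1 + 2 * s" by simp_all
    show ?thesis
      using relations_iff_good[where p = p and q = q and r = r and s = s and k = k and k' = k', folded pqrs] AC CB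
      unfolding w relation_A_iff[OF ev(1)] relation_B_iff[OF ev(2)] D_def by blast
  qed
  ultimately show ?thesis by blast
qed

end

section \<open>Normal subgroups of automorphism groups\<close>

lemma AutoGroup_simps:
  "carrier (AutoGroup G) = auto G" "\<one>\<^bsub>AutoGroup G\<^esub> = (\<lambda>x \<in> carrier G. x)"
  by (simp_all add: AutoGroup_def BijGroup_def)

lemma AutoGroup_mult:
  "\<lbrakk>f \<in> auto G; g \<in> auto G\<rbrakk> \<Longrightarrow> f \<otimes>\<^bsub>AutoGroup G\<^esub> g = compose (carrier G) f g"
  by (simp add: AutoGroup_def BijGroup_def auto_def)

lemma AutoGroup_apply:
  "\<lbrakk>f \<in> auto G; g \<in> auto G; x \<in> carrier G\<rbrakk> \<Longrightarrow> (f \<otimes>\<^bsub>AutoGroup G\<^esub> g) x = f (g x)"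
  by (simp add: AutoGroup_mult compose_def)

lemma auto_closed: "\<lbrakk>f \<in> auto G; x \<in> carrier G\<rbrakk> \<Longrightarrow> f x \<in> carrier G"
  using autoD(1) by (auto simp: hom_def)

text \<open>Automorphisms that act trivially modulo an equivalence \<open>R\<close> form a normal subgroup if all automorphisms respect \<open>R\<close>; every subgroup in the series is of this form.\<close>

lemma (in group) normal_AutoGroup_congruence:
  assumes R: "\<And>x. R x x" "\<And>x y. R x y \<Longrightarrow> R y x" "\<And>x y z. R x y \<Longrightarrow> R y z \<Longrightarrow> R x z"
    and pres: "\<And>f x y. \<lbrakk>f \<in> auto G; x \<in> carrier G; y \<in> carrier G; R x y\<rbrakk> \<Longrightarrow> R (f x) (f y)"
  shows "{f \<in> auto G. \<forall>x \<in> carrier G. R (f x) x} \<lhd> AutoGroup G" (is "?N \<lhd> _")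
proof -
  interpret A: group "AutoGroup G" by (rule AutoGroup)
  have inv: "inv\<^bsub>AutoGroup G\<^esub> f \<in> auto G" "\<And>x. x \<in> carrier G \<Longrightarrow> f ((inv\<^bsub>AutoGroup G\<^esub> f) x) = x" if f: "f \<in> auto G" for f
  proof -
    show i: "inv\<^bsub>AutoGroup G\<^esub> f \<in> auto G" using A.inv_closed f unfolding AutoGroup_simps by blast
    show "f ((inv\<^bsub>AutoGroup G\<^esub> f) x) = x" if "x \<in> carrier G" for x
      using A.r_inv[unfolded AutoGroup_simps, OF f] AutoGroup_apply[OF f i that] that by simp
  qed
  show ?thesis
  proof (rule A.normal_invI)
    show "subgroup ?N (AutoGroup G)"
    proof (rule A.subgroupI)
      have "\<one>\<^bsub>AutoGroup G\<^esub> \<in> ?N" using A.one_closed R(1) unfolding AutoGroup_simps by simp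
      then show "?N \<noteq> {}" by blast
      show "inv\<^bsub>AutoGroup G\<^esub> f \<in> ?N" if "f \<in> ?N" for f
      proof -
        have f: "f \<in> auto G" using that by blast
        have "R ((inv\<^bsub>AutoGroup G\<^esub> f) x) x" if x: "x \<in> carrier G" for x
        proof -
          have "R (f ((inv\<^bsub>AutoGroup G\<^esub> f) x)) ((inv\<^bsub>AutoGroup G\<^esub> f) x)"
            using \<open>f \<in> ?N\<close> auto_closed[OF inv(1)[OF f] x] by blast
          then show ?thesis unfolding inv(2)[OF f x] by (rule R(2))
        qed
        then show ?thesis using inv(1)[OF f] by blast
      qed
      show "f \<otimes>\<^bsub>AutoGroup G\<^esub> g \<in> ?N" if "f \<in> ?N" "g \<in> ?N" for f g
      proof -
        have fg: "f \<in> auto G" "g \<in> auto G" using that by blast+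
        have "R ((f \<otimes>\<^bsub>AutoGroup G\<^esub> g) x) x" if x: "x \<in> carrier G" for x
          unfolding AutoGroup_apply[OF fg x]
          using R(3)[of "f (g x)" "g x" x] \<open>f \<in> ?N\<close> \<open>g \<in> ?N\<close> auto_closed[OF fg(2) x] x by blast
        moreover have "f \<otimes>\<^bsub>AutoGroup G\<^esub> g \<in> auto G" using A.m_closed fg unfolding AutoGroup_simps by blast
        ultimately show ?thesis by blast
      qed
    qed (auto simp: AutoGroup_simps)
    show "h \<otimes>\<^bsub>AutoGroup G\<^esub> f \<otimes>\<^bsub>AutoGroup G\<^esub> inv\<^bsub>AutoGroup G\<^esub> h \<in> ?N"
      if "h \<in> carrier (AutoGroup G)" "f \<in> ?N" for h f
    proof -
      have hf: "h \<in> auto G" "f \<in> auto G" using that unfolding AutoGroup_simps by blast+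
      have hf': "h \<otimes>\<^bsub>AutoGroup G\<^esub> f \<in> auto G" using A.m_closed hf unfolding AutoGroup_simps by blast
      have "R ((h \<otimes>\<^bsub>AutoGroup G\<^esub> f \<otimes>\<^bsub>AutoGroup G\<^esub> inv\<^bsub>AutoGroup G\<^esub> h) x) x" if x: "x \<in> carrier G" for x
      proof -
        let ?y = "(inv\<^bsub>AutoGroup G\<^esub> h) x"
        have y: "?y \<in> carrier G" by (rule auto_closed[OF inv(1)[OF hf(1)] x])
        have "R (f ?y) ?y" using \<open>f \<in> ?N\<close> y by blast
        then have "R (h (f ?y)) (h ?y)" by (rule pres[OF hf(1) auto_closed[OF hf(2) y] y])
        then show ?thesis
          unfolding AutoGroup_apply[OF hf' inv(1)[OF hf(1)] x] AutoGroup_apply[OF hf y] inv(2)[OF hf(1) x] .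
      qed
      moreover have "h \<otimes>\<^bsub>AutoGroup G\<^esub> f \<otimes>\<^bsub>AutoGroup G\<^esub> inv\<^bsub>AutoGroup G\<^esub> h \<in> auto G"
        using A.m_closed[unfolded AutoGroup_simps, OF hf' inv(1)[OF hf(1)]] .
      ultimately show ?thesis by blast
    qed
  qed
qed

lemma (in group) Aut_sub_eq:
  assumes N: "upper_central G n \<lhd> G"
  shows "Aut_sub n G = {f \<in> auto G. \<forall>x \<in> carrier G. f x \<otimes> inv x \<in> upper_central G n}"
proof -
  let ?N = "upper_central G n"
  interpret N: normal ?N G by (rule N)
  have car: "carrier (G Mod ?N) = (\<lambda>x. ?N #> x) ` carrier G"
    by (auto simp: FactGroup_def RCOSETS_def)
  have "canonical_aut_map G ?N f = \<one>\<^bsub>AutoGroup (G Mod ?N)\<^esub> \<longleftrightarrow> (\<forall>x \<in> carrier G. f x \<otimes> inv x \<in> ?N)"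
    if f: "f \<in> auto G" for f
  proof -
    have "canonical_aut_map G ?N f = \<one>\<^bsub>AutoGroup (G Mod ?N)\<^esub> \<longleftrightarrow> (\<forall>P \<in> carrier (G Mod ?N). f ` P = P)"
      unfolding canonical_aut_map_def AutoGroup_simps by (auto simp: restrict_def fun_eq_iff)
    also have "\<dots> \<longleftrightarrow> (\<forall>x \<in> carrier G. f ` (?N #> x) = ?N #> x)"
      unfolding car by blast
    also have "\<dots> \<longleftrightarrow> (\<forall>x \<in> carrier G. f x \<otimes> inv x \<in> ?N)"
    proof
      assume *: "\<forall>x \<in> carrier G. f ` (?N #> x) = ?N #> x"
      show "\<forall>x \<in> carrier G. f x \<otimes> inv x \<in> ?N"
      proof
        fix x assume x: "x \<in> carrier G"
        have "f x \<in> ?N #> x" using * x rcos_self[OF x N.subgroup_axioms] by blast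
        then show "f x \<otimes> inv x \<in> ?N" by (rule N.rcos_module_imp[OF is_group x])
      qed
    next
      assume *: "\<forall>x \<in> carrier G. f x \<otimes> inv x \<in> ?N"
      have mem: "f y \<in> ?N #> y" if "y \<in> carrier G" for y
        using * that auto_closed[OF f that] N.rcos_module_rev[OF is_group that] by blast
      have eq: "?N #> y = ?N #> x" if "y \<in> ?N #> x" "x \<in> carrier G" for x y
        using repr_independence[OF that N.subgroup_axioms] by simp
      have sub: "?N #> x \<subseteq> carrier G" if "x \<in> carrier G" for x
        using that N.subset by (rule r_coset_subset_G[rotated])
      show "\<forall>x \<in> carrier G. f ` (?N #> x) = ?N #> x"
      proof (intro ballI equalityI subsetI)
        fix x y assume x: "x \<in> carrier G" and "y \<in> f ` (?N #> x)"
        then obtain z where z: "z \<in> ?N #> x" "y = f z" by blast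
        then show "y \<in> ?N #> x" using mem[of z] eq[OF z(1) x] sub[OF x] by blast
      next
        fix x y assume x: "x \<in> carrier G" and y: "y \<in> ?N #> x"
        have "y \<in> f ` carrier G" using autoD(2)[OF f] sub[OF x] y by (auto simp: bij_betw_def)
        then obtain z where z: "z \<in> carrier G" "y = f z" by blast
        have "y \<in> ?N #> z" using mem[OF z(1)] z(2) by simp
        then have "?N #> z = ?N #> x" using eq[OF _ z(1)] eq[OF y x] by blast
        then have "z \<in> ?N #> x" using rcos_self[OF z(1) N.subgroup_axioms] by simp
        then show "y \<in> f ` (?N #> x)" using z(2) by blast
      qed
    qed
    finally show ?thesis .
  qed
  then show ?thesis unfolding Aut_sub_def kernel_def AutoGroup_simps by blast
qed

section \<open>Homomorphisms into powers of cyclic groups\<close>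

lemma cyclic_power_hom:
  assumes n: "n > 0"
    and add: "\<And>t x y. \<lbrakk>t < k; x \<in> carrier K; y \<in> carrier K\<rbrakk> \<Longrightarrow> [\<phi> t (x \<otimes>\<^bsub>K\<^esub> y) = \<phi> t x + \<phi> t y] (mod int n)"
  shows "(\<lambda>x. \<lambda>t \<in> {..<k}. \<phi> t x mod int n) \<in> hom K (cyclic_power n k)"
proof (rule homI)
  fix x y assume xy: "x \<in> carrier K" "y \<in> carrier K"
  show "(\<lambda>t \<in> {..<k}. \<phi> t x mod int n) \<in> carrier (cyclic_power n k)"
    using n by (auto simp: cyclic_power_def carrier_integer_mod_group)
  show "(\<lambda>t \<in> {..<k}. \<phi> t (x \<otimes>\<^bsub>K\<^esub> y) mod int n)
      = (\<lambda>t \<in> {..<k}. \<phi> t x mod int n) \<otimes>\<^bsub>cyclic_power n k\<^esub> (\<lambda>t \<in> {..<k}. \<phi> t y mod int n)"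
    using add xy by (auto simp: cyclic_power_def cong_def mod_add_eq intro!: restrict_ext)
qed

lemma cyclic_power_eqI:
  assumes y: "y \<in> carrier (cyclic_power n k)" and n: "n > 0" and x: "\<And>t. t < k \<Longrightarrow> [x t = y t] (mod int n)"
  shows "(\<lambda>t \<in> {..<k}. x t mod int n) = y"
proof -
  have "y \<in> extensional {..<k}" "\<And>t. t < k \<Longrightarrow> y t mod int n = y t"
    using y n by (auto simp: cyclic_power_def carrier_integer_mod_group PiE_def Pi_def)
  then show ?thesis
    using x by (intro extensionalityI[of _ "{..<k}"]) (auto simp: cong_def)
qed

text \<open>The first isomorphism theorem for a homomorphism given by \<open>k\<close> integer coordinates, each additive modulo \<open>n\<close>.\<close>

lemma Mod_iso_cyclic_power:
  assumes K: "group K" and n: "n > 0"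
    and add: "\<And>t x y. \<lbrakk>t < k; x \<in> carrier K; y \<in> carrier K\<rbrakk> \<Longrightarrow> [\<phi> t (x \<otimes>\<^bsub>K\<^esub> y) = \<phi> t x + \<phi> t y] (mod int n)"
    and surj: "\<And>v. \<exists>x \<in> carrier K. \<forall>t<k. [\<phi> t x = v t] (mod int n)"
    and N: "N = {x \<in> carrier K. \<forall>t<k. [\<phi> t x = 0] (mod int n)}"
  shows "K Mod N \<cong> cyclic_power n k"
proof -
  define F where "F = (\<lambda>x. \<lambda>t \<in> {..<k}. \<phi> t x mod int n)"
  have hom: "F \<in> hom K (cyclic_power n k)" unfolding F_def by (rule cyclic_power_hom[OF n add])
  have grp: "group (cyclic_power n k)" by (simp add: cyclic_power_def)
  interpret F: group_hom K "cyclic_power n k" F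
    using K grp hom by (simp add: group_hom.intro group_hom_axioms_def)
  have "kernel K (cyclic_power n k) F = N"
    unfolding kernel_def N F_def by (auto simp: cyclic_power_def cong_def restrict_def fun_eq_iff)
  moreover have "F ` carrier K = carrier (cyclic_power n k)"
  proof (intro equalityI subsetI)
    fix y assume y: "y \<in> carrier (cyclic_power n k)"
    obtain x where x: "x \<in> carrier K" "\<And>t. t < k \<Longrightarrow> [\<phi> t x = y t] (mod int n)" using surj by blast
    have "F x = y" unfolding F_def by (rule cyclic_power_eqI[OF y n x(2)])
    then show "y \<in> F ` carrier K" using x(1) by blast
  qed (use F.hom_closed in blast)
  ultimately show ?thesis using F.FactGroup_iso by simp
qed

lemma iso_cyclic_power_DirProd:
  assumes n: "n > 0" and n': "n' > 0"
    and add: "\<And>t x y. \<lbrakk>t < k; x \<in> carrier K; y \<in> carrier K\<rbrakk> \<Longrightarrow> [\<phi> t (x \<otimes>\<^bsub>K\<^esub> y) = \<phi> t x + \<phi> t y] (mod int n)"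
    and add': "\<And>t x y. \<lbrakk>t < k'; x \<in> carrier K; y \<in> carrier K\<rbrakk> \<Longrightarrow> [\<psi> t (x \<otimes>\<^bsub>K\<^esub> y) = \<psi> t x + \<psi> t y] (mod int n')"
    and surj: "\<And>v w. \<exists>x \<in> carrier K. (\<forall>t<k. [\<phi> t x = v t] (mod int n)) \<and> (\<forall>t<k'. [\<psi> t x = w t] (mod int n'))"
    and inj: "\<And>x y. \<lbrakk>x \<in> carrier K; y \<in> carrier K; \<forall>t<k. [\<phi> t x = \<phi> t y] (mod int n);
       \<forall>t<k'. [\<psi> t x = \<psi> t y] (mod int n')\<rbrakk> \<Longrightarrow> x = y"
  shows "K \<cong> cyclic_power n k \<times>\<times> cyclic_power n' k'"
proof -
  define F where "F = (\<lambda>x. (\<lambda>t \<in> {..<k}. \<phi> t x mod int n))"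
  define F' where "F' = (\<lambda>x. (\<lambda>t \<in> {..<k'}. \<psi> t x mod int n'))"
  have F: "F \<in> hom K (cyclic_power n k)" unfolding F_def by (rule cyclic_power_hom[OF n add])
  have F': "F' \<in> hom K (cyclic_power n' k')" unfolding F'_def by (rule cyclic_power_hom[OF n' add'])
  have hom: "(\<lambda>x. (F x, F' x)) \<in> hom K (cyclic_power n k \<times>\<times> cyclic_power n' k')"
    using F F' by (simp add: hom_paired)
  moreover have "inj_on (\<lambda>x. (F x, F' x)) (carrier K)"
  proof (rule inj_onI)
    fix x y assume xy: "x \<in> carrier K" "y \<in> carrier K" and "(F x, F' x) = (F y, F' y)"
    then have eq: "F x = F y" "F' x = F' y" by simp_all
    have "\<forall>t<k. [\<phi> t x = \<phi> t y] (mod int n)"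
    proof (intro allI impI)
      fix t assume "t < k"
      then show "[\<phi> t x = \<phi> t y] (mod int n)" using fun_cong[OF eq(1), of t] by (simp add: F_def cong_def)
    qed
    moreover have "\<forall>t<k'. [\<psi> t x = \<psi> t y] (mod int n')"
    proof (intro allI impI)
      fix t assume "t < k'"
      then show "[\<psi> t x = \<psi> t y] (mod int n')" using fun_cong[OF eq(2), of t] by (simp add: F'_def cong_def)
    qed
    ultimately show "x = y" by (rule inj[OF xy])
  qed
  moreover have "(y, y') \<in> (\<lambda>x. (F x, F' x)) ` carrier K"
    if y: "y \<in> carrier (cyclic_power n k)" and y': "y' \<in> carrier (cyclic_power n' k')" for y y'
  proof -
    obtain x where x: "x \<in> carrier K" "\<And>t. t < k \<Longrightarrow> [\<phi> t x = y t] (mod int n)" "\<And>t. t < k' \<Longrightarrow> [\<psi> t x = y' t] (mod int n')"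
      using surj by blast
    have "F x = y" unfolding F_def by (rule cyclic_power_eqI[OF y n x(2)])
    moreover have "F' x = y'" unfolding F'_def by (rule cyclic_power_eqI[OF y' n' x(3)])
    ultimately show ?thesis using x(1) by blast
  qed
  then have "carrier (cyclic_power n k \<times>\<times> cyclic_power n' k') \<subseteq> (\<lambda>x. (F x, F' x)) ` carrier K"
    unfolding DirProd_def by auto
  moreover have "(\<lambda>x. (F x, F' x)) ` carrier K \<subseteq> carrier (cyclic_power n k \<times>\<times> cyclic_power n' k')"
    using hom unfolding hom_def by blast
  ultimately have "(\<lambda>x. (F x, F' x)) \<in> iso K (cyclic_power n k \<times>\<times> cyclic_power n' k')"
    unfolding iso_def bij_betw_def by blast
  then show ?thesis unfolding is_iso_def by blast
qed

lemma Mod_iso_integer_mod_group: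
  assumes K: "group K" and n: "n > 0"
    and add: "\<And>x y. \<lbrakk>x \<in> carrier K; y \<in> carrier K\<rbrakk> \<Longrightarrow> [\<phi> (x \<otimes>\<^bsub>K\<^esub> y) = \<phi> x + \<phi> y] (mod int n)"
    and surj: "\<And>v. \<exists>x \<in> carrier K. [\<phi> x = v] (mod int n)"
    and N: "N = {x \<in> carrier K. [\<phi> x = 0] (mod int n)}"
  shows "K Mod N \<cong> integer_mod_group n"
proof -
  define F where "F = (\<lambda>x. \<phi> x mod int n)"
  have hom: "F \<in> hom K (integer_mod_group n)"
    using n add by (intro homI) (auto simp: F_def carrier_integer_mod_group cong_def mod_add_eq)
  interpret F: group_hom K "integer_mod_group n" F
    using K hom by (simp add: group_hom.intro group_hom_axioms_def)
  have "kernel K (integer_mod_group n) F = N"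
    unfolding kernel_def N F_def by (auto simp: cong_def)
  moreover have "y \<in> F ` carrier K" if "y \<in> carrier (integer_mod_group n)" for y
  proof -
    obtain x where "x \<in> carrier K" "[\<phi> x = y] (mod int n)" using surj by blast
    then show ?thesis using that n by (intro image_eqI[of _ _ x]) (auto simp: F_def cong_def carrier_integer_mod_group)
  qed
  then have "F ` carrier K = carrier (integer_mod_group n)" using F.hom_closed by blast
  ultimately show ?thesis using F.FactGroup_iso by simp
qed

lemma cong_div:
  fixes d n :: int
  assumes "d \<noteq> 0" "d dvd x"
  shows "[x div d = v] (mod n) \<longleftrightarrow> [x = d * v] (mod d * n)"
proof -
  obtain y where x: "x = d * y" using assms(2) by (elim dvdE)
  have "d * n dvd d * y - d * v \<longleftrightarrow> n dvd y - v"
    unfolding right_diff_distrib[symmetric] using assms(1) by (simp only: dvd_mult_cancel_left) simp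
  then show ?thesis using assms(1) by (simp add: x cong_iff_dvd_diff)
qed

lemma cong_div_add:
  fixes d n :: int
  assumes d: "d \<noteq> 0" "d dvd x" "d dvd y" "d dvd z" and xyz: "[x = y + z] (mod d * n)"
  shows "[x div d = y div d + z div d] (mod n)"
  unfolding cong_div[OF d(1,2)] using xyz d by (simp add: distrib_left)

lemma all_less_2: "(\<forall>t<2. P t) \<longleftrightarrow> P 0 \<and> P (1::nat)"
  by (auto simp: less_Suc_eq numeral_eq_Suc)

section \<open>Congruence subgroups of Aut(H)\<close>

context macdonald_quotient
begin

lemma level_1_4gamma: "level 1 (4 * \<gamma>)"
  by (simp add: level_def u_gamma gamma4_dvd_M)

lemma lev_E_right:
  assumes L: "level \<kappa> \<delta>" and x: "x \<in> carrier G"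
  shows "lev \<kappa> \<delta> x (E k j i) \<longleftrightarrow> [kc x = k] (mod \<kappa>) \<and> [jc x = j] (mod \<delta>) \<and> [ic x = i] (mod \<delta>)"
  using lev_E[OF L, of "kc x" "jc x" "ic x" k j i] unfolding E_coords[OF x] .

lemmas lev_a = lev_E_right[where k = 0 and j = 0 and i = 1, folded a_E]
lemmas lev_b = lev_E_right[where k = 0 and j = 1 and i = 0, folded b_E]
lemmas lev_c = lev_E_right[where k = 1 and j = 0 and i = 0, folded c_E]

lemma auto_E:
  assumes f: "f \<in> auto G"
  shows "f (E k j i) = f c [^] k \<otimes> f b [^] j \<otimes> f a [^] i"
proof -
  interpret f: group_hom G G f using f by (rule group_hom_auto)
  show ?thesis using a b c by (simp add: E_def f.hom_int_pow)
qed

lemma auto_c: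
  assumes f: "f \<in> auto G"
  shows "f c = inv (f b \<otimes> f a) \<otimes> (f a \<otimes> f b)"
proof -
  interpret f: group_hom G G f using f by (rule group_hom_auto)
  have "f b \<otimes> f a \<otimes> f c = f a \<otimes> f b"
    using a b c ab by (simp flip: f.hom_mult)
  then show ?thesis
    using a b c by (intro iffD2[OF inv_solve_left]) simp_all
qed

lemma auto_closed_abc: "f \<in> auto G \<Longrightarrow> f a \<in> carrier G \<and> f b \<in> carrier G \<and> f c \<in> carrier G"
  by (simp add: auto_closed a b c)

text \<open>As \<open>c\<close> is a commutator of \<open>a\<close> and \<open>b\<close>, two automorphisms that agree to some level on \<open>a\<close> and \<open>b\<close> agree to that level everywhere.\<close>

lemma lev_generators:
  assumes L: "level \<kappa> \<delta>" and f: "f \<in> auto G" and g: "g \<in> auto G"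
    and A: "lev \<kappa> \<delta> (f a) (g a)" and B: "lev \<kappa> \<delta> (f b) (g b)" and x: "x \<in> carrier G"
  shows "lev \<kappa> \<delta> (f x) (g x)"
proof -
  have fc: "f a \<in> carrier G" "f b \<in> carrier G" "f c \<in> carrier G" using auto_closed_abc[OF f] by simp_all
  have gc: "g a \<in> carrier G" "g b \<in> carrier G" "g c \<in> carrier G" using auto_closed_abc[OF g] by simp_all
  have C: "lev \<kappa> \<delta> (f c) (g c)"
    unfolding auto_c[OF f] auto_c[OF g]
    by (intro lev_mult[OF L] lev_inv[OF L] A B m_closed inv_closed fc gc)
  show ?thesis
    unfolding auto_E[OF f, of "kc x" "jc x" "ic x", unfolded E_coords[OF x]]
      auto_E[OF g, of "kc x" "jc x" "ic x", unfolded E_coords[OF x]]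
    by (intro lev_mult[OF L] lev_int_pow[OF L] A B C m_closed int_pow_closed fc gc)
qed

lemma auto_eqI:
  assumes f: "f \<in> auto G" and g: "g \<in> auto G"
    and A: "lev M M (f a) (g a)" and B: "lev M M (f b) (g b)"
  shows "f = g"
proof (rule extensionalityI[OF autoD(3)[OF f] autoD(3)[OF g]])
  fix x assume x: "x \<in> carrier G"
  have fx: "f x \<in> carrier G" and gx: "g x \<in> carrier G" by (simp_all add: auto_closed x f g)
  have "lev M M (f x) (g x)" by (rule lev_generators[OF levels(1) f g A B x])
  then have "E (kc (f x)) (jc (f x)) (ic (f x)) = E (kc (g x)) (jc (g x)) (ic (g x))"
    unfolding lev_def E_eq_iff .
  then show "f x = g x" unfolding E_coords[OF fx] E_coords[OF gx] .
qed

text \<open>For \<open>(\<kappa>, \<delta>) = (2\<gamma>, 4\<gamma>)\<close>, \<open>(1, 4\<gamma>)\<close> and \<open>(1, 2\<gamma>)\<close> this will be \<open>Aut\<^sub>2\<close>, \<open>Inn Aut\<^sub>2\<close> and \<open>Aut\<^sub>3\<close>.\<close>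

definition Aut_lev :: "int \<Rightarrow> int \<Rightarrow> ('a \<Rightarrow> 'a) set" where
  "Aut_lev \<kappa> \<delta> = {f \<in> auto G. \<forall>x \<in> carrier G. lev \<kappa> \<delta> (f x) x}"

lemma one_auto: "(\<lambda>x \<in> carrier G. x) \<in> auto G"
  using monoid.one_closed[OF group.is_monoid[OF AutoGroup]] unfolding AutoGroup_simps .

lemma Aut_lev_iff:
  assumes L: "level \<kappa> \<delta>" and f: "f \<in> auto G"
  shows "f \<in> Aut_lev \<kappa> \<delta> \<longleftrightarrow> ([kc (f a) = 0] (mod \<kappa>) \<and> [jc (f a) = 0] (mod \<delta>) \<and> [ic (f a) = 1] (mod \<delta>))
    \<and> ([kc (f b) = 0] (mod \<kappa>) \<and> [jc (f b) = 1] (mod \<delta>) \<and> [ic (f b) = 0] (mod \<delta>))"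
proof -
  have ab: "f a \<in> carrier G" "f b \<in> carrier G" using auto_closed_abc[OF f] by simp_all
  have "f \<in> Aut_lev \<kappa> \<delta> \<longleftrightarrow> lev \<kappa> \<delta> (f a) a \<and> lev \<kappa> \<delta> (f b) b"
  proof
    show "lev \<kappa> \<delta> (f a) a \<and> lev \<kappa> \<delta> (f b) b" if "f \<in> Aut_lev \<kappa> \<delta>"
      using that a b unfolding Aut_lev_def by blast
    assume "lev \<kappa> \<delta> (f a) a \<and> lev \<kappa> \<delta> (f b) b"
    then have "lev \<kappa> \<delta> (f x) ((\<lambda>x \<in> carrier G. x) x)" if "x \<in> carrier G" for x
      by (intro lev_generators[OF L f one_auto _ _ that]) (simp_all add: a b)
    then show "f \<in> Aut_lev \<kappa> \<delta>" using f unfolding Aut_lev_def by simp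
  qed
  then show ?thesis unfolding lev_a[OF L ab(1)] lev_b[OF L ab(2)] .
qed

lemma Aut_lev_mono:
  assumes L: "level \<kappa> \<delta>" "level \<kappa>' \<delta>'" and d: "\<kappa>' dvd \<kappa>" "\<delta>' dvd \<delta>"
  shows "Aut_lev \<kappa> \<delta> \<subseteq> Aut_lev \<kappa>' \<delta>'"
  unfolding Aut_lev_def lev_def using d by (blast intro: cong_dvd_modulus)

lemma Aut_lev_auto: "f \<in> Aut_lev \<kappa> \<delta> \<Longrightarrow> f \<in> auto G"
  by (simp add: Aut_lev_def)

lemma auto_upper_central:
  assumes f: "f \<in> auto G"
  shows "n \<le> 3 \<Longrightarrow> x \<in> upper_central G n \<Longrightarrow> f x \<in> upper_central G n"
proof (induction n arbitrary: x)
  interpret f: group_hom G G f using f by (rule group_hom_auto)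
  {
    case 0
    then show ?case by simp
  next
    case (Suc n)
    have N: "upper_central G n \<lhd> G" using Suc.prems(1) by (intro normal_upper_central) simp
    have x: "x \<in> carrier G" "\<And>y. y \<in> carrier G \<Longrightarrow> (x \<otimes> y) \<otimes> inv (y \<otimes> x) \<in> upper_central G n"
      using Suc.prems(2) unfolding upper_central_Suc_eq[OF N] by blast+
    have "(f x \<otimes> y) \<otimes> inv (y \<otimes> f x) \<in> upper_central G n" if "y \<in> carrier G" for y
    proof -
      have "y \<in> f ` carrier G" using autoD(2)[OF f] that by (simp add: bij_betw_def)
      then obtain z where z: "z \<in> carrier G" "y = f z" by blast
      have "(f x \<otimes> y) \<otimes> inv (y \<otimes> f x) = f ((x \<otimes> z) \<otimes> inv (z \<otimes> x))" using x(1) z by simp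
      then show ?thesis using Suc.IH[OF _ x(2)[OF z(1)]] Suc.prems(1) by simp
    qed
    then show ?case unfolding upper_central_Suc_eq[OF N]
      by (intro CollectI conjI ballI f.hom_closed x(1))
  }
qed

lemma auto_lev:
  assumes f: "f \<in> auto G" and n: "n \<le> 3" and Z: "upper_central G n = Z \<kappa> \<delta>" and L: "level \<kappa> \<delta>"
    and x: "x \<in> carrier G" "y \<in> carrier G" "lev \<kappa> \<delta> x y"
  shows "lev \<kappa> \<delta> (f x) (f y)"
proof -
  interpret f: group_hom G G f using f by (rule group_hom_auto)
  have "x \<otimes> inv y \<in> Z \<kappa> \<delta>" using x by (simp add: mult_inv_in_Z_iff[OF L])
  then have "f (x \<otimes> inv y) \<in> Z \<kappa> \<delta>" using auto_upper_central[OF f n] unfolding Z by blast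
  then show ?thesis using x by (simp add: mult_inv_in_Z_iff[OF L])
qed

lemma Aut_sub_lev:
  assumes n: "n \<le> 3" and Z: "upper_central G n = Z \<kappa> \<delta>" and L: "level \<kappa> \<delta>"
  shows "Aut_sub n G = Aut_lev \<kappa> \<delta>" and "Aut_lev \<kappa> \<delta> \<lhd> AutoGroup G"
proof -
  show "Aut_sub n G = Aut_lev \<kappa> \<delta>"
    unfolding Aut_sub_eq[OF normal_upper_central[OF n]] Aut_lev_def Z
    by (simp add: mult_inv_in_Z_iff[OF L] auto_closed cong: conj_cong)
  show "Aut_lev \<kappa> \<delta> \<lhd> AutoGroup G" unfolding Aut_lev_def
  proof (rule normal_AutoGroup_congruence)
    show "lev \<kappa> \<delta> y x" if "lev \<kappa> \<delta> x y" for x y using that by (rule lev_sym)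
    show "lev \<kappa> \<delta> x z" if "lev \<kappa> \<delta> x y" "lev \<kappa> \<delta> y z" for x y z using that by (rule lev_trans)
    show "lev \<kappa> \<delta> (f x) (f y)" if "f \<in> auto G" "x \<in> carrier G" "y \<in> carrier G" "lev \<kappa> \<delta> x y" for f x y
      using that by (intro auto_lev[OF that(1) n Z L])
  qed simp
qed

lemma coords_inv:
  assumes x: "x \<in> carrier G"
  shows "[jc (inv x) = - jc x] (mod 4 * \<gamma>)" "[ic (inv x) = - ic x] (mod 4 * \<gamma>)"
  using coords_pow[OF x, of "- 1"] x by (simp_all add: int_pow_neg)

lemma coords_auto_c:
  assumes f: "f \<in> auto G"
  shows "[jc (f c) = 0] (mod 4 * \<gamma>)" "[ic (f c) = 0] (mod 4 * \<gamma>)"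
proof -
  have fc: "f a \<in> carrier G" "f b \<in> carrier G" using auto_closed_abc[OF f] by simp_all
  have *: "[\<phi> (f c) = 0] (mod 4 * \<gamma>)"
    if mult: "\<And>x y. \<lbrakk>x \<in> carrier G; y \<in> carrier G\<rbrakk> \<Longrightarrow> [\<phi> (x \<otimes> y) = \<phi> x + \<phi> y] (mod 4 * \<gamma>)"
      and inv: "\<And>x. x \<in> carrier G \<Longrightarrow> [\<phi> (inv x) = - \<phi> x] (mod 4 * \<gamma>)" for \<phi>
  proof -
    have "[\<phi> (f c) = \<phi> (inv (f b \<otimes> f a)) + \<phi> (f a \<otimes> f b)] (mod 4 * \<gamma>)"
      unfolding auto_c[OF f] using fc by (intro mult) simp_all
    also have "[\<phi> (inv (f b \<otimes> f a)) + \<phi> (f a \<otimes> f b) = - \<phi> (f b \<otimes> f a) + (\<phi> (f a) + \<phi> (f b))] (mod 4 * \<gamma>)"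
      using fc by (intro cong_add mult inv) simp_all
    also have "[- \<phi> (f b \<otimes> f a) + (\<phi> (f a) + \<phi> (f b)) = - (\<phi> (f b) + \<phi> (f a)) + (\<phi> (f a) + \<phi> (f b))] (mod 4 * \<gamma>)"
      using fc by (intro cong_add cong_refl) (simp only: cong_minus_minus_iff mult)
    finally show ?thesis by simp
  qed
  show "[jc (f c) = 0] (mod 4 * \<gamma>)" by (rule *[OF coords_mult(2) coords_inv(1)])
  show "[ic (f c) = 0] (mod 4 * \<gamma>)" by (rule *[OF coords_mult(3) coords_inv(2)])
qed

text \<open>Modulo \<open>4\<gamma>\<close> the exponents of \<open>b\<close> and \<open>a\<close> are additive, so an automorphism acts on them by the
  matrix of the exponents of \<open>f b\<close> and \<open>f a\<close>.\<close>

lemma coords_auto: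
  assumes f: "f \<in> auto G" and x: "x \<in> carrier G"
  shows "[jc (f x) = jc x * jc (f b) + ic x * jc (f a)] (mod 4 * \<gamma>)"
    "[ic (f x) = jc x * ic (f b) + ic x * ic (f a)] (mod 4 * \<gamma>)"
proof -
  have fc: "f a \<in> carrier G" "f b \<in> carrier G" "f c \<in> carrier G" using auto_closed_abc[OF f] by simp_all
  have *: "[\<phi> (f x) = jc x * \<phi> (f b) + ic x * \<phi> (f a)] (mod 4 * \<gamma>)"
    if mult: "\<And>x y. \<lbrakk>x \<in> carrier G; y \<in> carrier G\<rbrakk> \<Longrightarrow> [\<phi> (x \<otimes> y) = \<phi> x + \<phi> y] (mod 4 * \<gamma>)"
      and pow: "\<And>x n. x \<in> carrier G \<Longrightarrow> [\<phi> (x [^] (n::int)) = n * \<phi> x] (mod 4 * \<gamma>)"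
      and 0: "[\<phi> (f c) = 0] (mod 4 * \<gamma>)" for \<phi>
  proof -
    have "[\<phi> (f x) = \<phi> (f c [^] kc x \<otimes> f b [^] jc x) + \<phi> (f a [^] ic x)] (mod 4 * \<gamma>)"
      unfolding auto_E[OF f, of "kc x" "jc x" "ic x", unfolded E_coords[OF x]] using fc by (intro mult) simp_all
    also have "[\<phi> (f c [^] kc x \<otimes> f b [^] jc x) + \<phi> (f a [^] ic x)
        = (\<phi> (f c [^] kc x) + \<phi> (f b [^] jc x)) + ic x * \<phi> (f a)] (mod 4 * \<gamma>)"
      using fc by (intro cong_add mult pow) simp_all
    also have "[(\<phi> (f c [^] kc x) + \<phi> (f b [^] jc x)) + ic x * \<phi> (f a)
        = (kc x * \<phi> (f c) + jc x * \<phi> (f b)) + ic x * \<phi> (f a)] (mod 4 * \<gamma>)"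
      using fc by (intro cong_add pow cong_refl) simp_all
    also have "[(kc x * \<phi> (f c) + jc x * \<phi> (f b)) + ic x * \<phi> (f a)
        = (kc x * 0 + jc x * \<phi> (f b)) + ic x * \<phi> (f a)] (mod 4 * \<gamma>)"
      by (intro cong_add cong_mult 0 cong_refl)
    finally show ?thesis by simp
  qed
  show "[jc (f x) = jc x * jc (f b) + ic x * jc (f a)] (mod 4 * \<gamma>)"
    by (rule *[OF coords_mult(2) coords_pow(1) coords_auto_c(1)[OF f]])
  show "[ic (f x) = jc x * ic (f b) + ic x * ic (f a)] (mod 4 * \<gamma>)"
    by (rule *[OF coords_mult(3) coords_pow(2) coords_auto_c(2)[OF f]])
qed

text \<open>The corresponding subgroup of \<open>H\<close> is no term of the upper central series; that automorphisms preserve it follows from \<open>coords_auto\<close>.\<close>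

lemma normal_Aut_lev_1_4gamma: "Aut_lev 1 (4 * \<gamma>) \<lhd> AutoGroup G"
  unfolding Aut_lev_def
proof (rule normal_AutoGroup_congruence)
  show "lev 1 (4 * \<gamma>) y x" if "lev 1 (4 * \<gamma>) x y" for x y using that by (rule lev_sym)
  show "lev 1 (4 * \<gamma>) x z" if "lev 1 (4 * \<gamma>) x y" "lev 1 (4 * \<gamma>) y z" for x y z using that by (rule lev_trans)
  show "lev 1 (4 * \<gamma>) (f x) (f y)"
    if f: "f \<in> auto G" and xy: "x \<in> carrier G" "y \<in> carrier G" and lev: "lev 1 (4 * \<gamma>) x y" for f x y
  proof -
    have e: "[jc x = jc y] (mod 4 * \<gamma>)" "[ic x = ic y] (mod 4 * \<gamma>)" using lev unfolding lev_def by blast+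
    have *: "[jc x * s + ic x * t = jc y * s + ic y * t] (mod 4 * \<gamma>)" for s t
      by (intro cong_add cong_mult e cong_refl)
    show ?thesis unfolding lev_def
      using cong_trans[OF coords_auto(1)[OF f xy(1)] cong_trans[OF * cong_sym[OF coords_auto(1)[OF f xy(2)]]]]
        cong_trans[OF coords_auto(2)[OF f xy(1)] cong_trans[OF * cong_sym[OF coords_auto(2)[OF f xy(2)]]]] by simp
  qed
qed simp

lemma Aut_lev_chain:
  "Aut_sub 2 G = Aut_lev (2 * \<gamma>) (4 * \<gamma>)" "Aut_lev (2 * \<gamma>) (4 * \<gamma>) \<lhd> AutoGroup G"
  "Aut_sub 3 G = Aut_lev 1 (2 * \<gamma>)" "Aut_lev 1 (2 * \<gamma>) \<lhd> AutoGroup G"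
  using Aut_sub_lev[OF _ upper_central_2 levels(3)] Aut_sub_lev[OF _ upper_central_3 levels(4)] by simp_all

end

section \<open>Inner automorphisms and the invariants of an automorphism\<close>

lemma (in group) inner_auto:
  assumes g: "g \<in> carrier G"
  shows "(\<lambda>x \<in> carrier G. inv g \<otimes> x \<otimes> g) \<in> auto G"
proof (rule autoI)
  show "(\<lambda>x \<in> carrier G. inv g \<otimes> x \<otimes> g) \<in> hom G G"
  proof (rule homI)
    fix x y assume xy: "x \<in> carrier G" "y \<in> carrier G"
    have cancel: "g \<otimes> (inv g \<otimes> z) = z" if "z \<in> carrier G" for z
      using g that by (simp flip: m_assoc)
    show "(\<lambda>x \<in> carrier G. inv g \<otimes> x \<otimes> g) (x \<otimes> y)
        = (\<lambda>x \<in> carrier G. inv g \<otimes> x \<otimes> g) x \<otimes> (\<lambda>x \<in> carrier G. inv g \<otimes> x \<otimes> g) y"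
      using g xy by (simp add: m_assoc cancel)
  qed (simp add: g)
  show "bij_betw (\<lambda>x \<in> carrier G. inv g \<otimes> x \<otimes> g) (carrier G) (carrier G)"
  proof (rule bij_betwI[where g = "\<lambda>y. g \<otimes> y \<otimes> inv g"])
    have *: "inv y \<otimes> (y \<otimes> x \<otimes> inv y) \<otimes> y = x" if "x \<in> carrier G" "y \<in> carrier G" for x y
      using that by (simp add: m_assoc) (simp flip: m_assoc)
    show "(\<lambda>x \<in> carrier G. inv g \<otimes> x \<otimes> g) (g \<otimes> y \<otimes> inv g) = y" if "y \<in> carrier G" for y
      using g that *[of y g] by simp
    show "g \<otimes> (\<lambda>x \<in> carrier G. inv g \<otimes> x \<otimes> g) x \<otimes> inv g = x" if "x \<in> carrier G" for x
      using g that *[of x "inv g"] by simp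
  qed (use g in auto)
qed simp

context macdonald_quotient
begin

lemma AutoGroup_closed: "f \<in> auto G \<Longrightarrow> g \<in> auto G \<Longrightarrow> f \<otimes>\<^bsub>AutoGroup G\<^esub> g \<in> auto G"
  using monoid.m_closed[OF group.is_monoid[OF AutoGroup]] unfolding AutoGroup_simps .

lemma AutoGroup_inv:
  assumes f: "f \<in> auto G"
  shows "inv\<^bsub>AutoGroup G\<^esub> f \<in> auto G" and "x \<in> carrier G \<Longrightarrow> (inv\<^bsub>AutoGroup G\<^esub> f) (f x) = x"
proof -
  interpret A: group "AutoGroup G" by (rule AutoGroup)
  show i: "inv\<^bsub>AutoGroup G\<^esub> f \<in> auto G" using A.inv_closed[unfolded AutoGroup_simps, OF f] .
  show "(inv\<^bsub>AutoGroup G\<^esub> f) (f x) = x" if "x \<in> carrier G"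
    using A.l_inv[unfolded AutoGroup_simps, OF f] AutoGroup_apply[OF i f that] that by simp
qed

text \<open>Conjugation by \<open>g\<close> fixes the \<open>b\<close>- and \<open>a\<close>-exponents modulo \<open>4\<gamma>\<close>. It adds \<open>jc g\<close> to the
  \<open>c\<close>-exponent of \<open>a\<close> and subtracts \<open>ic g\<close> from that of \<open>b\<close>, so a suitable \<open>g\<close> reproduces the
  \<open>c\<close>-exponents of a given \<open>f\<close>; what remains of \<open>f\<close> is in \<open>Aut\<^sub>2\<close>.\<close>

lemma Inn_mult_Aut2: "Inn G <#>\<^bsub>AutoGroup G\<^esub> Aut_lev (2 * \<gamma>) (4 * \<gamma>) = Aut_lev 1 (4 * \<gamma>)"
proof (intro equalityI subsetI)
  interpret A: group "AutoGroup G" by (rule AutoGroup)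
  interpret N: normal "Aut_lev 1 (4 * \<gamma>)" "AutoGroup G" by (rule normal_Aut_lev_1_4gamma)
  {
    fix h assume "h \<in> Inn G <#>\<^bsub>AutoGroup G\<^esub> Aut_lev (2 * \<gamma>) (4 * \<gamma>)"
    then obtain i f where h: "h = i \<otimes>\<^bsub>AutoGroup G\<^esub> f" and i: "i \<in> Inn G" and f: "f \<in> Aut_lev (2 * \<gamma>) (4 * \<gamma>)"
      unfolding set_mult_def by blast
    obtain g where g: "g \<in> carrier G" and ig: "i = (\<lambda>x \<in> carrier G. inv g \<otimes> x \<otimes> g)"
      using i unfolding Inn_def by blast
    have "lev 1 (4 * \<gamma>) (i x) x" if x: "x \<in> carrier G" for x
    proof -
      have "[\<phi> (inv g \<otimes> x \<otimes> g) = - \<phi> g + \<phi> x + \<phi> g] (mod 4 * \<gamma>)"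
        if mult: "\<And>x y. \<lbrakk>x \<in> carrier G; y \<in> carrier G\<rbrakk> \<Longrightarrow> [\<phi> (x \<otimes> y) = \<phi> x + \<phi> y] (mod 4 * \<gamma>)"
          and inv: "\<And>x. x \<in> carrier G \<Longrightarrow> [\<phi> (inv x) = - \<phi> x] (mod 4 * \<gamma>)" for \<phi>
      proof -
        have "[\<phi> (inv g \<otimes> x \<otimes> g) = \<phi> (inv g \<otimes> x) + \<phi> g] (mod 4 * \<gamma>)" using x g by (intro mult) simp_all
        also have "[\<phi> (inv g \<otimes> x) + \<phi> g = (\<phi> (inv g) + \<phi> x) + \<phi> g] (mod 4 * \<gamma>)"
          using x g by (intro cong_add mult cong_refl) simp_all
        also have "[(\<phi> (inv g) + \<phi> x) + \<phi> g = (- \<phi> g + \<phi> x) + \<phi> g] (mod 4 * \<gamma>)"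
          using x g by (intro cong_add inv cong_refl) simp_all
        finally show ?thesis .
      qed
      from this[OF coords_mult(2) coords_inv(1)] this[OF coords_mult(3) coords_inv(2)]
      show ?thesis using x unfolding ig lev_def by simp
    qed
    then have "i \<in> Aut_lev 1 (4 * \<gamma>)" using inner_auto[OF g] unfolding Aut_lev_def ig by blast
    moreover have "f \<in> Aut_lev 1 (4 * \<gamma>)"
      using Aut_lev_mono[OF levels(3) level_1_4gamma] f by auto
    ultimately show "h \<in> Aut_lev 1 (4 * \<gamma>)" unfolding h by (rule N.m_closed)
  next
    fix f assume f: "f \<in> Aut_lev 1 (4 * \<gamma>)"
    then have fa: "f \<in> auto G" by (rule Aut_lev_auto)
    have fab: "f a \<in> carrier G" "f b \<in> carrier G" using auto_closed_abc[OF fa] by simp_all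
    \<comment> \<open>By the formula for \<open>kc (i x)\<close> below, conjugation by this \<open>g\<close> has the \<open>c\<close>-exponents of \<open>f\<close>.\<close>
    define g where "g = E 0 (kc (f a)) (- kc (f b))"
    have g: "g \<in> carrier G" by (simp add: g_def)
    define i where "i = (\<lambda>x \<in> carrier G. inv g \<otimes> x \<otimes> g)"
    have i: "i \<in> auto G" unfolding i_def by (rule inner_auto[OF g])
    have ic: "i a \<in> carrier G" "i b \<in> carrier G" using auto_closed_abc[OF i] by simp_all
    have gi: "g \<otimes> i x = x \<otimes> g" if "x \<in> carrier G" for x
      using that g by (simp add: i_def m_assoc[symmetric])
    have 4: "jc (E k j i) mod (4 * \<gamma>) = j mod (4 * \<gamma>)" "ic (E k j i) mod (4 * \<gamma>) = i mod (4 * \<gamma>)"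
      "kc (E k j i) mod (4 * \<gamma>) = k mod (4 * \<gamma>)" for k j i
      using coords_E'[of k j i] unfolding cong_def by simp_all
    have key: "[jc (i x) = jc x] (mod 4 * \<gamma>) \<and> [ic (i x) = ic x] (mod 4 * \<gamma>)
       \<and> [kc (i x) = kc x + jc g * ic x - jc x * ic g] (mod 4 * \<gamma>)" if x: "x \<in> carrier G" for x
    proof -
      have ix: "i x \<in> carrier G" by (rule auto_closed[OF i x])
      have "[jc g + jc (i x) = jc x + jc g] (mod 4 * \<gamma>)"
        using coords_mult(2)[OF g ix] coords_mult(2)[OF x g] unfolding gi[OF x] cong_def by simp
      then have j: "[jc (i x) = jc x] (mod 4 * \<gamma>)" by (simp add: add.commute[of _ "jc g"] cong_add_lcancel)
      have "[ic g + ic (i x) = ic x + ic g] (mod 4 * \<gamma>)"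
        using coords_mult(3)[OF g ix] coords_mult(3)[OF x g] unfolding gi[OF x] cong_def by simp
      then have i: "[ic (i x) = ic x] (mod 4 * \<gamma>)" by (simp add: add.commute[of _ "ic g"] cong_add_lcancel)
      have "[kc g + kc (i x) + jc (i x) * ic g = kc x + kc g + jc g * ic x] (mod 4 * \<gamma>)"
        using coords_mult(1)[OF g ix] coords_mult(1)[OF x g] unfolding gi[OF x] cong_def by simp
      moreover have "[kc g + kc (i x) + jc (i x) * ic g = kc g + kc (i x) + jc x * ic g] (mod 4 * \<gamma>)"
        by (intro cong_add cong_mult cong_refl j)
      ultimately have "[kc g + kc (i x) + jc x * ic g = kc x + kc g + jc g * ic x] (mod 4 * \<gamma>)"
        using cong_trans cong_sym by blast
      then have "[kc (i x) = kc x + jc g * ic x - jc x * ic g] (mod 4 * \<gamma>)"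
        unfolding cong_iff_dvd_diff by (simp add: algebra_simps)
      with i j show ?thesis by blast
    qed
    have A: "[kc a = 0] (mod 4 * \<gamma>)" "[jc a = 0] (mod 4 * \<gamma>)" "[ic a = 1] (mod 4 * \<gamma>)"
      and B: "[kc b = 0] (mod 4 * \<gamma>)" "[jc b = 1] (mod 4 * \<gamma>)" "[ic b = 0] (mod 4 * \<gamma>)"
      using coords_E'[of 0 0 1, folded a_E] coords_E'[of 0 1 0, folded b_E] by simp_all
    have F: "([jc (f a) = 0] (mod 4 * \<gamma>) \<and> [ic (f a) = 1] (mod 4 * \<gamma>)) \<and> ([jc (f b) = 1] (mod 4 * \<gamma>) \<and> [ic (f b) = 0] (mod 4 * \<gamma>))"
      using f unfolding Aut_lev_iff[OF level_1_4gamma fa] by blast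
    have G: "[jc g = kc (f a)] (mod 4 * \<gamma>)" "[ic g = - kc (f b)] (mod 4 * \<gamma>)"
      unfolding g_def by (rule coords_E'(2), rule coords_E'(3))
    have "[kc a + jc g * ic a - jc a * ic g = 0 + kc (f a) * 1 - 0 * - kc (f b)] (mod 4 * \<gamma>)"
      by (intro cong_add cong_diff cong_mult A G)
    then have ka: "[kc (f a) = kc (i a)] (mod 4 * \<gamma>)" using cong_trans[OF conjunct2[OF conjunct2[OF key[OF a]]]] by (simp add: cong_sym_eq)
    have "[kc b + jc g * ic b - jc b * ic g = 0 + kc (f a) * 0 - 1 * - kc (f b)] (mod 4 * \<gamma>)"
      by (intro cong_add cong_diff cong_mult B G)
    then have kb: "[kc (f b) = kc (i b)] (mod 4 * \<gamma>)" using cong_trans[OF conjunct2[OF conjunct2[OF key[OF b]]]] by (simp add: cong_sym_eq)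
    have d: "2 * \<gamma> dvd 4 * \<gamma>" by simp
    have la: "lev (2 * \<gamma>) (4 * \<gamma>) (f a) (i a)"
      unfolding lev_def using cong_dvd_modulus[OF ka d] key[OF a] F A unfolding cong_def by simp
    have lb: "lev (2 * \<gamma>) (4 * \<gamma>) (f b) (i b)"
      unfolding lev_def using cong_dvd_modulus[OF kb d] key[OF b] F B unfolding cong_def by simp
    define h where "h = inv\<^bsub>AutoGroup G\<^esub> i \<otimes>\<^bsub>AutoGroup G\<^esub> f"
    have h: "h \<in> auto G" unfolding h_def by (intro AutoGroup_closed AutoGroup_inv(1) i fa)
    have "lev (2 * \<gamma>) (4 * \<gamma>) (h x) x" if x: "x \<in> carrier G" for x
    proof -
      have "lev (2 * \<gamma>) (4 * \<gamma>) ((inv\<^bsub>AutoGroup G\<^esub> i) (f x)) ((inv\<^bsub>AutoGroup G\<^esub> i) (i x))"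
        by (rule auto_lev[OF AutoGroup_inv(1)[OF i] _ upper_central_2 levels(3) auto_closed[OF fa x] auto_closed[OF i x]
              lev_generators[OF levels(3) fa i la lb x]]) simp
      then show ?thesis
        unfolding h_def AutoGroup_apply[OF AutoGroup_inv(1)[OF i] fa x] AutoGroup_inv(2)[OF i x] .
    qed
    then have h2: "h \<in> Aut_lev (2 * \<gamma>) (4 * \<gamma>)" using h unfolding Aut_lev_def by blast
    have "f = i \<otimes>\<^bsub>AutoGroup G\<^esub> h"
      using A.l_one[unfolded AutoGroup_simps(1), OF fa] A.r_inv[unfolded AutoGroup_simps(1), OF i]
        A.m_assoc[unfolded AutoGroup_simps(1), OF i AutoGroup_inv(1)[OF i] fa] unfolding h_def by simp
    moreover have "i \<in> Inn G" unfolding Inn_def i_def using g by blast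
    ultimately show "f \<in> Inn G <#>\<^bsub>AutoGroup G\<^esub> Aut_lev (2 * \<gamma>) (4 * \<gamma>)"
      using h2 unfolding set_mult_def by blast
  }
qed

lemma coords_compose:
  assumes f: "f \<in> auto G" and g: "g \<in> auto G"
  shows "[jc ((f \<otimes>\<^bsub>AutoGroup G\<^esub> g) a) = jc (g a) * jc (f b) + ic (g a) * jc (f a)] (mod 4 * \<gamma>)"
    "[ic ((f \<otimes>\<^bsub>AutoGroup G\<^esub> g) a) = jc (g a) * ic (f b) + ic (g a) * ic (f a)] (mod 4 * \<gamma>)"
    "[jc ((f \<otimes>\<^bsub>AutoGroup G\<^esub> g) b) = jc (g b) * jc (f b) + ic (g b) * jc (f a)] (mod 4 * \<gamma>)"
    "[ic ((f \<otimes>\<^bsub>AutoGroup G\<^esub> g) b) = jc (g b) * ic (f b) + ic (g b) * ic (f a)] (mod 4 * \<gamma>)"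
  unfolding AutoGroup_apply[OF f g a] AutoGroup_apply[OF f g b]
  by (rule coords_auto[OF f] auto_closed[OF g a] auto_closed[OF g b])+

lemma auto_good:
  assumes f: "f \<in> auto G" and odd: "odd (ic (f a))"
  shows "good (ic (f a)) (jc (f a)) (ic (f b)) (jc (f b))"
  using good_if_automorphism_odd[OF f E_coords[symmetric, OF auto_closed[OF f a]] E_coords[symmetric, OF auto_closed[OF f b]]] odd by blast

lemma auto_good_swapped:
  assumes f: "f \<in> auto G" and even: "even (ic (f a))"
  shows "good (ic (f b)) (jc (f b)) (ic (f a)) (jc (f a))"
proof -
  obtain s where s: "s \<in> auto G" "s a = b" "s b = a" using swap_automorphism by blast
  have "odd (ic (f b))"
    using good_if_automorphism_odd[OF f E_coords[symmetric, OF auto_closed[OF f a]] E_coords[symmetric, OF auto_closed[OF f b]]] even by blast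
  then show ?thesis
    using auto_good[OF AutoGroup_closed[OF f s(1)]]
    unfolding AutoGroup_apply[OF f s(1) a] AutoGroup_apply[OF f s(1) b] s(2,3) by blast
qed

text \<open>Modulo \<open>2\<gamma>\<close> the matrix of an automorphism has only two parameters: \<open>e\<close> tells whether \<open>a\<close> and \<open>b\<close>
  are exchanged, and \<open>t\<close> is \<open>0\<close> or \<open>\<gamma>\<close>, the latter only for even \<open>\<gamma>\<close>. Because \<open>2t\<close> vanishes
  modulo \<open>2\<gamma>\<close>, the signs of \<open>t\<close> do not matter.\<close>

lemma auto_shape:
  assumes f: "f \<in> auto G"
  obtains e t where "e = 0 \<or> e = 1" "2 * \<gamma> dvd 2 * t" "even t"
    "[jc (f a) = e + t] (mod 2 * \<gamma>)" "[ic (f a) = 1 - e + t] (mod 2 * \<gamma>)"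
    "[jc (f b) = 1 - e + t] (mod 2 * \<gamma>)" "[ic (f b) = e + t] (mod 2 * \<gamma>)"
proof -
  have d: "2 * \<gamma> dvd 4 * \<gamma>" by simp
  have *: "even j \<and> 2 * \<gamma> dvd 2 * j \<and> [i = 1 + j] (mod 2 * \<gamma>) \<and> [j' = 1 + j] (mod 2 * \<gamma>) \<and> [i' = j] (mod 2 * \<gamma>)"
    if "good i j i' j'" for i j i' j'
  proof -
    have g: "even j" "[i = 1 + i'] (mod 4 * \<gamma>)" "[j' = 1 + j] (mod 4 * \<gamma>)" "[i' = j] (mod 2 * \<gamma>)" "[2 * j = 0] (mod 2 * \<gamma>)"
      using that unfolding good_def by blast+
    have "[i = 1 + j] (mod 2 * \<gamma>)"
      by (rule cong_trans[OF cong_dvd_modulus[OF g(2) d] cong_add[OF cong_refl g(4)]])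
    then show ?thesis using g(1) cong_dvd_modulus[OF g(3) d] g(4,5) by (simp only: cong_0_iff simp_thms)
  qed
  show ?thesis
  proof (cases "even (ic (f a))")
    case False
    with *[OF auto_good[OF f False]] show ?thesis by (intro that[of 0 "jc (f a)"]) simp_all
  next
    case True
    with *[OF auto_good_swapped[OF f True]] show ?thesis by (intro that[of 1 "jc (f b)"]) simp_all
  qed
qed

lemma Aut_lev_1_iff:
  assumes L: "level 1 \<delta>" and f: "f \<in> auto G"
  shows "f \<in> Aut_lev 1 \<delta> \<longleftrightarrow> [jc (f a) = 0] (mod \<delta>) \<and> [ic (f a) = 1] (mod \<delta>) \<and> [jc (f b) = 1] (mod \<delta>) \<and> [ic (f b) = 0] (mod \<delta>)"
  unfolding Aut_lev_iff[OF L f] by simp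

text \<open>The product of the exponents of \<open>f a\<close> recovers \<open>t\<close> without reference to \<open>e\<close>, because \<open>e (1 - e) = 0\<close>.\<close>

lemma shape_product:
  assumes "e = 0 \<or> e = 1" "2 * \<gamma> dvd 2 * t" "even t" "[j = e + t] (mod 2 * \<gamma>)" "[i = 1 - e + t] (mod 2 * \<gamma>)"
  shows "[i * j = t] (mod 2 * \<gamma>)"
proof -
  obtain w where w: "t = 2 * w" using assms(3) by (elim evenE)
  have "[i * j = (1 - e + t) * (e + t)] (mod 2 * \<gamma>)" by (intro cong_mult assms)
  moreover have "(1 - e + t) * (e + t) - t = e * (1 - e) + 2 * t * w" unfolding w by (simp add: algebra_simps)
  then have "(1 - e + t) * (e + t) - t = 2 * t * w" using assms(1) by auto
  then have "[(1 - e + t) * (e + t) = t] (mod 2 * \<gamma>)" using dvd_mult2[OF assms(2)] by (simp only: cong_iff_dvd_diff)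
  ultimately show ?thesis by (rule cong_trans)
qed

text \<open>Under composition \<open>t\<close> is additive and \<open>e\<close> is additive modulo 2. They are the two invariants
  that separate the classes of \<open>Aut(H)\<close> modulo \<open>Aut\<^sub>3\<close>; here they appear in the form
  \<open>ic (f a) * jc (f a)\<close> and \<open>jc (f a)\<close>.\<close>

lemma auto_invariants:
  assumes f: "f \<in> auto G"
  shows "\<gamma> dvd ic (f a) * jc (f a)"
    and "f \<in> Aut_lev 1 (2 * \<gamma>) \<longleftrightarrow> even (jc (f a)) \<and> 2 * \<gamma> dvd ic (f a) * jc (f a)"
    and "g \<in> auto G \<Longrightarrow> [jc ((f \<otimes>\<^bsub>AutoGroup G\<^esub> g) a) = jc (f a) + jc (g a)] (mod 2)"
    and "g \<in> auto G \<Longrightarrow> [ic ((f \<otimes>\<^bsub>AutoGroup G\<^esub> g) a) * jc ((f \<otimes>\<^bsub>AutoGroup G\<^esub> g) a)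
        = ic (f a) * jc (f a) + ic (g a) * jc (g a)] (mod 2 * \<gamma>)"
proof -
  obtain e t where s: "e = 0 \<or> e = 1" "2 * \<gamma> dvd 2 * t" "even t"
    "[jc (f a) = e + t] (mod 2 * \<gamma>)" "[ic (f a) = 1 - e + t] (mod 2 * \<gamma>)"
    "[jc (f b) = 1 - e + t] (mod 2 * \<gamma>)" "[ic (f b) = e + t] (mod 2 * \<gamma>)"
    using auto_shape[OF f] .
  have p: "[ic (f a) * jc (f a) = t] (mod 2 * \<gamma>)" using s by (intro shape_product)
  have t: "\<gamma> dvd t" using s(2) by simp
  have "\<gamma> dvd ic (f a) * jc (f a) - t"
    using p unfolding cong_iff_dvd_diff by (rule dvd_mult_right)
  then show "\<gamma> dvd ic (f a) * jc (f a)" using dvd_add[OF _ t] by fastforce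
  have par: "[x = y] (mod 2)" if "[x = y] (mod 2 * \<gamma>)" for x y :: int using that by (rule cong_dvd_modulus) simp
  have je: "even (jc (f a)) \<longleftrightarrow> e = 0" using par[OF s(4)] s(1,3) unfolding cong_iff_dvd_diff by auto
  have pt: "2 * \<gamma> dvd ic (f a) * jc (f a) \<longleftrightarrow> 2 * \<gamma> dvd t" using p by (rule cong_dvd_iff)
  show "f \<in> Aut_lev 1 (2 * \<gamma>) \<longleftrightarrow> even (jc (f a)) \<and> 2 * \<gamma> dvd ic (f a) * jc (f a)"
  proof
    assume "f \<in> Aut_lev 1 (2 * \<gamma>)"
    then have "2 * \<gamma> dvd jc (f a)" unfolding Aut_lev_1_iff[OF levels(4) f] cong_0_iff by blast
    then show "even (jc (f a)) \<and> 2 * \<gamma> dvd ic (f a) * jc (f a)" using dvd_mult_left by auto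
  next
    assume "even (jc (f a)) \<and> 2 * \<gamma> dvd ic (f a) * jc (f a)"
    then have et: "e = 0" "2 * \<gamma> dvd t" unfolding je pt by blast+
    then have "[t = 0] (mod 2 * \<gamma>)" "[1 + t = 1 + 0] (mod 2 * \<gamma>)" unfolding cong_iff_dvd_diff by simp_all
    then show "f \<in> Aut_lev 1 (2 * \<gamma>)"
      using s(4-7) unfolding Aut_lev_1_iff[OF levels(4) f] et(1) cong_def by simp
  qed
  assume g: "g \<in> auto G"
  obtain e' t' where s': "e' = 0 \<or> e' = 1" "2 * \<gamma> dvd 2 * t'" "even t'"
    "[jc (g a) = e' + t'] (mod 2 * \<gamma>)" "[ic (g a) = 1 - e' + t'] (mod 2 * \<gamma>)"
    "[jc (g b) = 1 - e' + t'] (mod 2 * \<gamma>)" "[ic (g b) = e' + t'] (mod 2 * \<gamma>)"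
    using auto_shape[OF g] .
  define E where "E = e + e' - 2 * (e * e')"
  have E: "E = 0 \<or> E = 1" using s(1) s'(1) unfolding E_def by auto
  have 2: "2 * \<gamma> dvd 2 * t * t'" by (rule dvd_mult2[OF s(2)])
  have d: "2 * \<gamma> dvd 4 * \<gamma>" by simp
  have "[jc ((f \<otimes>\<^bsub>AutoGroup G\<^esub> g) a) = (e' + t') * (1 - e + t) + (1 - e' + t') * (e + t)] (mod 2 * \<gamma>)"
    by (rule cong_trans[OF cong_dvd_modulus[OF coords_compose(1)[OF f g] d]]) (intro cong_add cong_mult s s')
  moreover have "(e' + t') * (1 - e + t) + (1 - e' + t') * (e + t) - (E + (t + t')) = 2 * t * t'"
    unfolding E_def by (simp add: algebra_simps)
  then have "[(e' + t') * (1 - e + t) + (1 - e' + t') * (e + t) = E + (t + t')] (mod 2 * \<gamma>)"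
    using 2 by (simp only: cong_iff_dvd_diff)
  ultimately have j: "[jc ((f \<otimes>\<^bsub>AutoGroup G\<^esub> g) a) = E + (t + t')] (mod 2 * \<gamma>)" by (rule cong_trans)
  have "[ic ((f \<otimes>\<^bsub>AutoGroup G\<^esub> g) a) = (e' + t') * (e + t) + (1 - e' + t') * (1 - e + t)] (mod 2 * \<gamma>)"
    by (rule cong_trans[OF cong_dvd_modulus[OF coords_compose(2)[OF f g] d]]) (intro cong_add cong_mult s s')
  moreover have "(e' + t') * (e + t) + (1 - e' + t') * (1 - e + t) - (1 - E + (t + t')) = 2 * t * t'"
    unfolding E_def by (simp add: algebra_simps)
  then have "[(e' + t') * (e + t) + (1 - e' + t') * (1 - e + t) = 1 - E + (t + t')] (mod 2 * \<gamma>)"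
    using 2 by (simp only: cong_iff_dvd_diff)
  ultimately have i: "[ic ((f \<otimes>\<^bsub>AutoGroup G\<^esub> g) a) = 1 - E + (t + t')] (mod 2 * \<gamma>)" by (rule cong_trans)
  have tt: "2 * \<gamma> dvd 2 * (t + t')" "even (t + t')" using s(2,3) s'(2,3) by (simp_all add: distrib_left)
  have p': "[ic (g a) * jc (g a) = t'] (mod 2 * \<gamma>)" using s' by (intro shape_product)
  show "[ic ((f \<otimes>\<^bsub>AutoGroup G\<^esub> g) a) * jc ((f \<otimes>\<^bsub>AutoGroup G\<^esub> g) a) = ic (f a) * jc (f a) + ic (g a) * jc (g a)] (mod 2 * \<gamma>)"
    using shape_product[OF E tt j i] cong_add[OF p p'] cong_trans cong_sym by blast
  show "[jc ((f \<otimes>\<^bsub>AutoGroup G\<^esub> g) a) = jc (f a) + jc (g a)] (mod 2)"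
  proof -
    have "[jc (f a) + jc (g a) = (e + t) + (e' + t')] (mod 2)" by (intro cong_add par s s')
    moreover have "[E + (t + t') = (e + t) + (e' + t')] (mod 2)" unfolding E_def cong_iff_dvd_diff by simp
    ultimately show ?thesis using par[OF j] cong_trans cong_sym by blast
  qed
qed

end

section \<open>The factors above Aut2\<close>

context macdonald_quotient
begin

lemma group_Aut_sub: "N \<lhd> AutoGroup G \<Longrightarrow> group (AutoGroup G\<lparr>carrier := N\<rparr>)"
  by (intro subgroup.subgroup_is_group normal_imp_subgroup AutoGroup)

lemma Aut_mod_Aut3_invariants:
  assumes f: "f \<in> auto G" and g: "g \<in> auto G"
  shows "[(ic ((f \<otimes>\<^bsub>AutoGroup G\<^esub> g) a) * jc ((f \<otimes>\<^bsub>AutoGroup G\<^esub> g) a)) div \<gamma>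
     = (ic (f a) * jc (f a)) div \<gamma> + (ic (g a) * jc (g a)) div \<gamma>] (mod 2)"
  by (rule cong_div_add[OF gamma_nz])
    (use auto_invariants(1)[OF AutoGroup_closed[OF f g]] auto_invariants(1)[OF f] auto_invariants(1)[OF g]
      auto_invariants(4)[OF f g] in \<open>simp_all add: mult.commute[of \<gamma>]\<close>)

text \<open>For \<open>m > 2\<close> the number \<open>\<gamma>\<close> is even, so \<open>t = \<gamma>\<close> is possible and both invariants take both values.\<close>

theorem Aut_mod_Aut3:
  assumes "m > 2"
  shows "AutoGroup G Mod Aut_lev 1 (2 * \<gamma>) \<cong> cyclic_power 2 2"
proof -
  define \<phi> where "\<phi> = (\<lambda>(t::nat) f. if t = 0 then jc (f a) else (ic (f a) * jc (f a)) div \<gamma>)"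
  have add: "[\<phi> t (f \<otimes>\<^bsub>AutoGroup G\<^esub> g) = \<phi> t f + \<phi> t g] (mod 2)" if "f \<in> auto G" "g \<in> auto G" for t f g
    unfolding \<phi>_def using auto_invariants(3)[OF that] Aut_mod_Aut3_invariants[OF that] by simp
  have "\<gamma> = 2 * 2 ^ (m - 3)"
  proof -
    have "m - 2 = Suc (m - 3)" using assms by simp
    then show ?thesis unfolding \<gamma>_def by simp
  qed
  then have ev: "even \<gamma>" by simp
  show ?thesis
  proof (rule Mod_iso_cyclic_power[where \<phi> = \<phi>])
    show "group (AutoGroup G)" by (rule AutoGroup)
    show "[\<phi> t (f \<otimes>\<^bsub>AutoGroup G\<^esub> g) = \<phi> t f + \<phi> t g] (mod int 2)"
      if "f \<in> carrier (AutoGroup G)" "g \<in> carrier (AutoGroup G)" for t f g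
      using add[of f g t] that by (simp add: AutoGroup_simps)
    show "\<exists>f \<in> carrier (AutoGroup G). \<forall>t<2. [\<phi> t f = v t] (mod int 2)" for v
    proof -
      obtain s where s: "s \<in> auto G" "s a = b" using swap_automorphism by blast
      \<comment> \<open>The value \<open>v 1\<close> is attained by an automorphism with \<open>e = 0\<close>; the exchange of \<open>a\<close> and \<open>b\<close> then adjusts \<open>v 0\<close>.\<close>
      have "good (1 + \<gamma> * v 1) (\<gamma> * v 1) (\<gamma> * v 1) (1 + \<gamma> * v 1)"
        using ev unfolding good_def by (simp add: cong_0_iff)
      then obtain f where f: "f \<in> auto G" "f a = E 0 (\<gamma> * v 1) (1 + \<gamma> * v 1)"
        using automorphism_if_good[where k = 0 and k' = 0] by blast
      have d: "2 * \<gamma> dvd 4 * \<gamma>" by simp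
      have j: "[jc (f a) = \<gamma> * v 1] (mod 2 * \<gamma>)" and i: "[ic (f a) = 1 + \<gamma> * v 1] (mod 2 * \<gamma>)"
        unfolding f(2) by (rule cong_dvd_modulus[OF coords_E'(2) d], rule cong_dvd_modulus[OF coords_E'(3) d])
      have "[ic (f a) * jc (f a) = \<gamma> * v 1] (mod 2 * \<gamma>)"
        by (rule shape_product[of 0]) (use i j ev in simp_all)
      then have f1: "[\<phi> 1 f = v 1] (mod 2)"
        unfolding \<phi>_def using cong_div[OF gamma_nz auto_invariants(1)[OF f(1)], of "v 1" 2] by (simp add: mult.commute[of \<gamma>])
      have "[jc (f a) = \<gamma> * v 1] (mod 2)" using j by (rule cong_dvd_modulus) simp
      then have f0: "[\<phi> 0 f = 0] (mod 2)" using ev unfolding \<phi>_def cong_iff_dvd_diff by simp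
      have s': "[jc (s a) = 1] (mod 2 * \<gamma>)" "[ic (s a) = 0] (mod 2 * \<gamma>)"
        unfolding s(2) using cong_dvd_modulus[OF coords_E'(2)[of 0 1 0, folded b_E] d]
          cong_dvd_modulus[OF coords_E'(3)[of 0 1 0, folded b_E] d] by blast+
      have "[jc (s a) = 1] (mod 2)" by (intro cong_dvd_modulus[OF s'(1)]) simp
      then have s0: "[\<phi> 0 s = 1] (mod 2)" unfolding \<phi>_def by simp
      have "[ic (s a) * jc (s a) = \<gamma> * 0] (mod 2 * \<gamma>)" using cong_mult[OF s'(2,1)] by simp
      then have s1: "[\<phi> 1 s = 0] (mod 2)"
        unfolding \<phi>_def using cong_div[OF gamma_nz auto_invariants(1)[OF s(1)], of 0 2] by (simp add: mult.commute[of \<gamma>])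
      show ?thesis
      proof (cases "even (v 0)")
        case True
        then have "[\<phi> 0 f = v 0] (mod 2)" using f0 by (simp add: cong_iff_dvd_diff)
        then show ?thesis using f1 f(1) by (intro bexI[of _ f]) (simp_all add: all_less_2 AutoGroup_simps)
      next
        case False
        have fs: "f \<otimes>\<^bsub>AutoGroup G\<^esub> s \<in> auto G" by (rule AutoGroup_closed[OF f(1) s(1)])
        have "[\<phi> 0 (f \<otimes>\<^bsub>AutoGroup G\<^esub> s) = 0 + 1] (mod 2)"
          by (rule cong_trans[OF add[OF f(1) s(1)] cong_add[OF f0 s0]])
        moreover have "[0 + 1 = v 0] (mod 2)" using False by (simp add: cong_iff_dvd_diff)
        ultimately have 0: "[\<phi> 0 (f \<otimes>\<^bsub>AutoGroup G\<^esub> s) = v 0] (mod 2)" by (rule cong_trans)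
        have "[\<phi> 1 (f \<otimes>\<^bsub>AutoGroup G\<^esub> s) = v 1 + 0] (mod 2)"
          by (rule cong_trans[OF add[OF f(1) s(1)] cong_add[OF f1 s1]])
        then show ?thesis using 0 fs by (intro bexI[of _ "f \<otimes>\<^bsub>AutoGroup G\<^esub> s"]) (simp_all add: all_less_2 AutoGroup_simps)
      qed
    qed
    have "f \<in> Aut_lev 1 (2 * \<gamma>) \<longleftrightarrow> [\<phi> 0 f = 0] (mod 2) \<and> [\<phi> 1 f = 0] (mod 2)" if f: "f \<in> auto G" for f
      unfolding \<phi>_def auto_invariants(2)[OF f] using cong_div[OF gamma_nz auto_invariants(1)[OF f], of 0 2]
      by (simp add: cong_0_iff mult.commute[of \<gamma>])
    then show "Aut_lev 1 (2 * \<gamma>) = {f \<in> carrier (AutoGroup G). \<forall>t<2. [\<phi> t f = 0] (mod int 2)}"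
      using Aut_lev_auto unfolding AutoGroup_simps all_less_2 by auto
  qed simp
qed

text \<open>For \<open>m = 2\<close>, where \<open>\<gamma> = 1\<close>, the evenness of \<open>t\<close> forces \<open>t\<close> to vanish modulo \<open>2\<gamma>\<close>; only the exchange of \<open>a\<close> and \<open>b\<close> is left.\<close>

theorem Aut_mod_Aut3_m2:
  assumes "m = 2"
  shows "AutoGroup G Mod Aut_lev 1 (2 * \<gamma>) \<cong> integer_mod_group 2"
proof -
  have \<gamma>: "\<gamma> = 1" unfolding \<gamma>_def using assms by simp
  show ?thesis
  proof (rule Mod_iso_integer_mod_group[where \<phi> = "\<lambda>f. jc (f a)"])
    show "group (AutoGroup G)" by (rule AutoGroup)
    show "[jc ((f \<otimes>\<^bsub>AutoGroup G\<^esub> g) a) = jc (f a) + jc (g a)] (mod int 2)"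
      if "f \<in> carrier (AutoGroup G)" "g \<in> carrier (AutoGroup G)" for f g
      using auto_invariants(3)[of f g] that by (simp add: AutoGroup_simps)
    show "\<exists>f \<in> carrier (AutoGroup G). [jc (f a) = v] (mod int 2)" for v
    proof (cases "even v")
      case True
      have "[jc a = 0] (mod 4 * \<gamma>)" using coords_E'(2)[of 0 0 1, folded a_E] .
      then have "[jc a = 0] (mod 2)" by (rule cong_dvd_modulus) simp
      then show ?thesis using True one_auto a
        by (intro bexI[of _ "\<lambda>x \<in> carrier G. x"]) (simp_all add: AutoGroup_simps cong_iff_dvd_diff)
    next
      case False
      obtain s where s: "s \<in> auto G" "s a = b" using swap_automorphism by blast
      have "[jc b = 1] (mod 4 * \<gamma>)" using coords_E'(2)[of 0 1 0, folded b_E] .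
      then have "[jc b = 1] (mod 2)" by (rule cong_dvd_modulus) simp
      then show ?thesis using False s
        by (intro bexI[of _ s]) (simp_all add: AutoGroup_simps cong_iff_dvd_diff)
    qed
    have "f \<in> Aut_lev 1 (2 * \<gamma>) \<longleftrightarrow> [jc (f a) = 0] (mod 2)" if f: "f \<in> auto G" for f
      using auto_invariants(2)[OF f] unfolding \<gamma> by (auto simp: cong_0_iff)
    then show "Aut_lev 1 (2 * \<gamma>) = {f \<in> carrier (AutoGroup G). [jc (f a) = 0] (mod int 2)}"
      using Aut_lev_auto unfolding AutoGroup_simps by auto
  qed simp
qed

lemma Aut3_coords:
  assumes f: "f \<in> Aut_lev 1 (2 * \<gamma>)"
  shows "2 * \<gamma> dvd jc (f a)" "2 * \<gamma> dvd ic (f b)" "[ic (f a) = 1 + ic (f b)] (mod 4 * \<gamma>)"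
    "[jc (f b) = 1 + jc (f a)] (mod 4 * \<gamma>)" "2 * \<gamma> dvd ic (f a) - 1" "2 * \<gamma> dvd jc (f b) - 1"
proof -
  have fa: "f \<in> auto G" using f by (rule Aut_lev_auto)
  have e: "2 * \<gamma> dvd jc (f a)" "2 * \<gamma> dvd ic (f b)" "2 * \<gamma> dvd ic (f a) - 1" "2 * \<gamma> dvd jc (f b) - 1"
    using f unfolding Aut_lev_1_iff[OF levels(4) fa] by (simp_all add: cong_iff_dvd_diff)
  then show "2 * \<gamma> dvd jc (f a)" "2 * \<gamma> dvd ic (f b)" "2 * \<gamma> dvd ic (f a) - 1" "2 * \<gamma> dvd jc (f b) - 1" by blast+
  have "2 dvd ic (f a) - 1" using e(3) by (rule dvd_mult_left)
  then have "odd (ic (f a))" by simp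
  from auto_good[OF fa this] show "[ic (f a) = 1 + ic (f b)] (mod 4 * \<gamma>)" "[jc (f b) = 1 + jc (f a)] (mod 4 * \<gamma>)"
    unfolding good_def by blast+
qed

text \<open>In \<open>Aut\<^sub>3\<close> the matrix is the identity modulo \<open>2\<gamma>\<close>, so composition adds the deviations modulo
  \<open>4\<gamma>\<close>. By \<open>good\<close> the two off-diagonal ones determine the others and are arbitrary.\<close>

theorem Aut3_mod_InnAut2: "AutoGroup G\<lparr>carrier := Aut_lev 1 (2 * \<gamma>)\<rparr> Mod Aut_lev 1 (4 * \<gamma>) \<cong> cyclic_power 2 2"
proof -
  define \<phi> where "\<phi> = (\<lambda>(t::nat) f. if t = 0 then jc (f a) div (2 * \<gamma>) else ic (f b) div (2 * \<gamma>))"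
  have nz: "2 * \<gamma> \<noteq> 0" by simp
  have 4: "2 * \<gamma> * 2 = 4 * \<gamma>" by simp
  have add: "[\<phi> t (f \<otimes>\<^bsub>AutoGroup G\<^esub> g) = \<phi> t f + \<phi> t g] (mod 2)"
    if f: "f \<in> Aut_lev 1 (2 * \<gamma>)" and g: "g \<in> Aut_lev 1 (2 * \<gamma>)" for t f g
  proof -
    have fg: "f \<otimes>\<^bsub>AutoGroup G\<^esub> g \<in> Aut_lev 1 (2 * \<gamma>)" using f g by (rule subgroup.m_closed[OF normal_imp_subgroup[OF Aut_lev_chain(4)]])
    note fa = Aut_lev_auto[OF f] and ga = Aut_lev_auto[OF g]
    obtain x y z w where f': "jc (f a) = 2 * \<gamma> * x" "ic (f b) = 2 * \<gamma> * y" "ic (f a) - 1 = 2 * \<gamma> * z" "jc (f b) - 1 = 2 * \<gamma> * w"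
      using Aut3_coords[OF f] unfolding dvd_def by blast
    obtain x' y' z' w' where g': "jc (g a) = 2 * \<gamma> * x'" "ic (g b) = 2 * \<gamma> * y'" "ic (g a) - 1 = 2 * \<gamma> * z'" "jc (g b) - 1 = 2 * \<gamma> * w'"
      using Aut3_coords[OF g] unfolding dvd_def by blast
    have f'': "ic (f a) = 1 + 2 * \<gamma> * z" "jc (f b) = 1 + 2 * \<gamma> * w" and g'': "ic (g a) = 1 + 2 * \<gamma> * z'" "jc (g b) = 1 + 2 * \<gamma> * w'"
      using f' g' by simp_all
    have "jc (g a) * jc (f b) + ic (g a) * jc (f a) - (jc (f a) + jc (g a)) = 4 * \<gamma> * (\<gamma> * (x' * w + z' * x))"
      unfolding f' g' f'' g'' by (simp add: algebra_simps)
    then have "[jc (g a) * jc (f b) + ic (g a) * jc (f a) = jc (f a) + jc (g a)] (mod 4 * \<gamma>)"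
      unfolding cong_iff_dvd_diff by (simp only: dvd_triv_left)
    then have 0: "[jc ((f \<otimes>\<^bsub>AutoGroup G\<^esub> g) a) = jc (f a) + jc (g a)] (mod 2 * \<gamma> * 2)"
      unfolding 4 by (rule cong_trans[OF coords_compose(1)[OF fa ga]])
    have "jc (g b) * ic (f b) + ic (g b) * ic (f a) - (ic (f b) + ic (g b)) = 4 * \<gamma> * (\<gamma> * (w' * y + y' * z))"
      unfolding f' g' f'' g'' by (simp add: algebra_simps)
    then have "[jc (g b) * ic (f b) + ic (g b) * ic (f a) = ic (f b) + ic (g b)] (mod 4 * \<gamma>)"
      unfolding cong_iff_dvd_diff by (simp only: dvd_triv_left)
    then have 1: "[ic ((f \<otimes>\<^bsub>AutoGroup G\<^esub> g) b) = ic (f b) + ic (g b)] (mod 2 * \<gamma> * 2)"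
      unfolding 4 by (rule cong_trans[OF coords_compose(4)[OF fa ga]])
    show ?thesis
      unfolding \<phi>_def
      using cong_div_add[OF nz Aut3_coords(1)[OF fg] Aut3_coords(1)[OF f] Aut3_coords(1)[OF g] 0]
        cong_div_add[OF nz Aut3_coords(2)[OF fg] Aut3_coords(2)[OF f] Aut3_coords(2)[OF g] 1] by simp
  qed
  show ?thesis
  proof (rule Mod_iso_cyclic_power[where \<phi> = \<phi>])
    show "group (AutoGroup G\<lparr>carrier := Aut_lev 1 (2 * \<gamma>)\<rparr>)" by (rule group_Aut_sub[OF Aut_lev_chain(4)])
    show "[\<phi> t (f \<otimes>\<^bsub>AutoGroup G\<lparr>carrier := Aut_lev 1 (2 * \<gamma>)\<rparr>\<^esub> g) = \<phi> t f + \<phi> t g] (mod int 2)"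
      if "f \<in> carrier (AutoGroup G\<lparr>carrier := Aut_lev 1 (2 * \<gamma>)\<rparr>)" "g \<in> carrier (AutoGroup G\<lparr>carrier := Aut_lev 1 (2 * \<gamma>)\<rparr>)" for t f g
      using add[of f g t] that by simp
    show "\<exists>f \<in> carrier (AutoGroup G\<lparr>carrier := Aut_lev 1 (2 * \<gamma>)\<rparr>). \<forall>t<2. [\<phi> t f = v t] (mod int 2)" for v
    proof -
      have "good (1 + 2 * \<gamma> * v 1) (2 * \<gamma> * v 0) (2 * \<gamma> * v 1) (1 + 2 * \<gamma> * v 0)"
        unfolding good_def by (simp add: cong_iff_dvd_diff)
      then obtain f where f: "f \<in> auto G" "f a = E 0 (2 * \<gamma> * v 0) (1 + 2 * \<gamma> * v 1)" "f b = E 0 (1 + 2 * \<gamma> * v 0) (2 * \<gamma> * v 1)"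
        using automorphism_if_good[where k = 0 and k' = 0] by blast
      have d: "2 * \<gamma> dvd 4 * \<gamma>" by simp
      note c4 = coords_E'(2)[of 0 "2 * \<gamma> * v 0" "1 + 2 * \<gamma> * v 1", folded f(2)] coords_E'(3)[of 0 "2 * \<gamma> * v 0" "1 + 2 * \<gamma> * v 1", folded f(2)]
        coords_E'(2)[of 0 "1 + 2 * \<gamma> * v 0" "2 * \<gamma> * v 1", folded f(3)] coords_E'(3)[of 0 "1 + 2 * \<gamma> * v 0" "2 * \<gamma> * v 1", folded f(3)]
      have z: "[2 * \<gamma> * x = 0] (mod 2 * \<gamma>)" "[1 + 2 * \<gamma> * x = 1] (mod 2 * \<gamma>)" for x by (simp_all add: cong_iff_dvd_diff)
      have f3: "f \<in> Aut_lev 1 (2 * \<gamma>)"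
        unfolding Aut_lev_1_iff[OF levels(4) f(1)]
        by (intro conjI cong_trans[OF cong_dvd_modulus[OF c4(1) d] z(1)] cong_trans[OF cong_dvd_modulus[OF c4(2) d] z(2)]
          cong_trans[OF cong_dvd_modulus[OF c4(3) d] z(2)] cong_trans[OF cong_dvd_modulus[OF c4(4) d] z(1)])
      have "[\<phi> 0 f = v 0] (mod 2)" "[\<phi> 1 f = v 1] (mod 2)"
        unfolding \<phi>_def using cong_div[OF nz Aut3_coords(1)[OF f3], of "v 0" 2] cong_div[OF nz Aut3_coords(2)[OF f3], of "v 1" 2] c4(1,4)
        unfolding 4 by simp_all
      then show ?thesis using f3 by (intro bexI[of _ f]) (simp_all add: all_less_2)
    qed
    have "f \<in> Aut_lev 1 (4 * \<gamma>) \<longleftrightarrow> [\<phi> 0 f = 0] (mod 2) \<and> [\<phi> 1 f = 0] (mod 2)" if f: "f \<in> Aut_lev 1 (2 * \<gamma>)" for f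
    proof -
      note fa = Aut_lev_auto[OF f]
      have "[\<phi> 0 f = 0] (mod 2) \<longleftrightarrow> [jc (f a) = 0] (mod 4 * \<gamma>)" "[\<phi> 1 f = 0] (mod 2) \<longleftrightarrow> [ic (f b) = 0] (mod 4 * \<gamma>)"
        unfolding \<phi>_def using cong_div[OF nz Aut3_coords(1)[OF f], of 0 2] cong_div[OF nz Aut3_coords(2)[OF f], of 0 2]
        unfolding 4 by simp_all
      moreover have "[ic (f a) = 1] (mod 4 * \<gamma>)" if "[ic (f b) = 0] (mod 4 * \<gamma>)"
        using cong_trans[OF Aut3_coords(3)[OF f] cong_add[OF cong_refl that]] by simp
      moreover have "[jc (f b) = 1] (mod 4 * \<gamma>)" if "[jc (f a) = 0] (mod 4 * \<gamma>)"
        using cong_trans[OF Aut3_coords(4)[OF f] cong_add[OF cong_refl that]] by simp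
      ultimately show ?thesis unfolding Aut_lev_1_iff[OF level_1_4gamma fa] by blast
    qed
    moreover have "Aut_lev 1 (4 * \<gamma>) \<subseteq> Aut_lev 1 (2 * \<gamma>)" by (rule Aut_lev_mono[OF level_1_4gamma levels(4)]) simp_all
    ultimately show "Aut_lev 1 (4 * \<gamma>) = {f \<in> carrier (AutoGroup G\<lparr>carrier := Aut_lev 1 (2 * \<gamma>)\<rparr>). \<forall>t<2. [\<phi> t f = 0] (mod int 2)}"
      unfolding all_less_2 by auto
  qed simp
qed

lemma gamma2_eq: "int (2 ^ (m - 1)) = 2 * \<gamma>" and gamma4_eq: "int (2 ^ m) = 4 * \<gamma>"
  using h_gamma by (simp_all add: h_def pow_m)

text \<open>The \<open>c\<close>-exponent of \<open>f c\<close> is the determinant of the matrix modulo \<open>4\<gamma>\<close>, which is 1 here.\<close>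

lemma InnAut2_c:
  assumes f: "f \<in> Aut_lev 1 (4 * \<gamma>)"
  shows "lev (4 * \<gamma>) (4 * \<gamma>) (f c) c"
proof -
  have fa: "f \<in> auto G" using f by (rule Aut_lev_auto)
  interpret f: group_hom G G f using fa by (rule group_hom_auto)
  have cl: "f a \<in> carrier G" "f b \<in> carrier G" "f c \<in> carrier G" using auto_closed_abc[OF fa] by simp_all
  have F: "[jc (f a) = 0] (mod 4 * \<gamma>)" "[ic (f a) = 1] (mod 4 * \<gamma>)" "[jc (f b) = 1] (mod 4 * \<gamma>)" "[ic (f b) = 0] (mod 4 * \<gamma>)"
    using f unfolding Aut_lev_1_iff[OF level_1_4gamma fa] by blast+
  have "f b \<otimes> f a \<otimes> f c = f a \<otimes> f b"
    using a b c ab by (simp flip: f.hom_mult)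
  then have "[kc (f b \<otimes> f a \<otimes> f c) = kc (f a) + kc (f b) + jc (f b) * ic (f a)] (mod 4 * \<gamma>)"
    using coords_mult(1)[OF cl(1,2)] by (simp only:)
  also have "[kc (f a) + kc (f b) + jc (f b) * ic (f a) = kc (f a) + kc (f b) + 1 * 1] (mod 4 * \<gamma>)"
    by (intro cong_add cong_mult cong_refl F)
  finally have 1: "[kc (f b \<otimes> f a \<otimes> f c) = kc (f a) + kc (f b) + 1 * 1] (mod 4 * \<gamma>)" .
  have "[kc (f b \<otimes> f a \<otimes> f c) = kc (f b \<otimes> f a) + kc (f c) + jc (f c) * ic (f b \<otimes> f a)] (mod 4 * \<gamma>)"
    using cl by (intro coords_mult) simp_all
  also have "[kc (f b \<otimes> f a) + kc (f c) + jc (f c) * ic (f b \<otimes> f a)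
      = (kc (f b) + kc (f a) + jc (f a) * ic (f b)) + kc (f c) + 0 * ic (f b \<otimes> f a)] (mod 4 * \<gamma>)"
    by (intro cong_add cong_mult cong_refl coords_mult(1) cl coords_auto_c[OF fa])
  also have "[(kc (f b) + kc (f a) + jc (f a) * ic (f b)) + kc (f c) + 0 * ic (f b \<otimes> f a)
      = (kc (f b) + kc (f a) + 0 * 0) + kc (f c) + 0 * ic (f b \<otimes> f a)] (mod 4 * \<gamma>)"
    by (intro cong_add cong_mult cong_refl F)
  finally have "[kc (f a) + kc (f b) + 1 * 1 = (kc (f b) + kc (f a) + 0 * 0) + kc (f c) + 0 * ic (f b \<otimes> f a)] (mod 4 * \<gamma>)"
    by (rule cong_trans[OF cong_sym[OF 1]])
  then have "[kc (f a) + kc (f b) + 1 = kc (f a) + kc (f b) + kc (f c)] (mod 4 * \<gamma>)"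
    by (simp add: add.commute)
  then have "[1 = kc (f c)] (mod 4 * \<gamma>)" by (simp only: cong_add_lcancel)
  then show ?thesis
    unfolding lev_c[OF levels(5) cl(3)] using coords_auto_c[OF fa] by (simp add: cong_sym_eq)
qed

text \<open>Modulo \<open>Z\<^sub>2\<close>, \<open>g a\<close> is \<open>c\<^sup>k a\<close> where \<open>k\<close> is its \<open>c\<close>-exponent, and \<open>f\<close> fixes \<open>c\<close>; so
  \<open>c\<close>-exponents add up under composition. The same holds for \<open>b\<close>.\<close>

theorem InnAut2_mod_Aut2:
  "AutoGroup G\<lparr>carrier := Aut_lev 1 (4 * \<gamma>)\<rparr> Mod Aut_lev (2 * \<gamma>) (4 * \<gamma>) \<cong> cyclic_power (2 ^ (m - 1)) 2"
proof -
  define \<phi> where "\<phi> = (\<lambda>(t::nat) f. if t = 0 then kc (f a) else kc (f b))"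
  have d: "2 * \<gamma> dvd 4 * \<gamma>" by simp
  have main: "[kc (f y) = kc y + kc (f x)] (mod 2 * \<gamma>)"
    if f: "f \<in> Aut_lev 1 (4 * \<gamma>)" and x: "x \<in> carrier G" and y: "y \<in> carrier G"
      and yx: "lev (2 * \<gamma>) (4 * \<gamma>) y (c [^] kc y \<otimes> x)" for f x y
  proof -
    have fa: "f \<in> auto G" using f by (rule Aut_lev_auto)
    interpret f: group_hom G G f using fa by (rule group_hom_auto)
    have "lev (2 * \<gamma>) (4 * \<gamma>) (f y) (f (c [^] kc y \<otimes> x))"
      using x y yx c by (intro auto_lev[OF fa _ upper_central_2 levels(3)]) simp_all
    then have "[kc (f y) = kc (f c [^] kc y \<otimes> f x)] (mod 2 * \<gamma>)"
      unfolding lev_def using x c by (simp add: f.hom_int_pow)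
    also have "lev (4 * \<gamma>) (4 * \<gamma>) (f c [^] kc y \<otimes> f x) (c [^] kc y \<otimes> f x)"
      using x c by (intro lev_mult[OF levels(5)] lev_int_pow[OF levels(5)] InnAut2_c[OF f]) simp_all
    then have "[kc (f c [^] kc y \<otimes> f x) = kc (c [^] kc y \<otimes> f x)] (mod 2 * \<gamma>)"
      unfolding lev_def using d by (blast intro: cong_dvd_modulus)
    also have "[kc (c [^] kc y \<otimes> f x) = kc (c [^] kc y) + kc (f x) + jc (f x) * ic (c [^] kc y)] (mod 2 * \<gamma>)"
      using x c by (intro cong_dvd_modulus[OF coords_mult(1) d]) simp_all
    also have "[kc (c [^] kc y) + kc (f x) + jc (f x) * ic (c [^] kc y) = kc y + kc (f x) + jc (f x) * 0] (mod 2 * \<gamma>)"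
    proof -
      have "c [^] kc y = E (kc y) 0 0" using c by (simp add: E_def)
      then have "[kc (c [^] kc y) = kc y] (mod 2 * \<gamma>)" "[ic (c [^] kc y) = 0] (mod 2 * \<gamma>)"
        using cong_dvd_modulus[OF coords_E'(1) d] cong_dvd_modulus[OF coords_E'(3) d] by simp_all
      then show ?thesis by (intro cong_add cong_mult cong_refl)
    qed
    finally show ?thesis by simp
  qed
  have add: "[\<phi> t (f \<otimes>\<^bsub>AutoGroup G\<^esub> g) = \<phi> t f + \<phi> t g] (mod 2 * \<gamma>)"
    if f: "f \<in> Aut_lev 1 (4 * \<gamma>)" and g: "g \<in> Aut_lev 1 (4 * \<gamma>)" for t f g
  proof -
    have fa: "f \<in> auto G" and ga: "g \<in> auto G" using f g by (auto dest: Aut_lev_auto)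
    have cl: "g a \<in> carrier G" "g b \<in> carrier G" using auto_closed_abc[OF ga] by simp_all
    have Gm: "[jc (g a) = 0] (mod 4 * \<gamma>)" "[ic (g a) = 1] (mod 4 * \<gamma>)" "[jc (g b) = 1] (mod 4 * \<gamma>)" "[ic (g b) = 0] (mod 4 * \<gamma>)"
      using g unfolding Aut_lev_1_iff[OF level_1_4gamma ga] by blast+
    have ca: "c [^] k \<otimes> a = E k 0 1" and cb: "c [^] k \<otimes> b = E k 1 0" for k :: int
      using a b c by (simp_all add: E_def)
    have "lev (2 * \<gamma>) (4 * \<gamma>) (g a) (c [^] kc (g a) \<otimes> a)"
      unfolding ca lev_E_right[OF levels(3) cl(1)] using Gm by simp
    from main[OF f a cl(1) this] have A: "[kc (f (g a)) = kc (f a) + kc (g a)] (mod 2 * \<gamma>)" by (simp add: add.commute)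
    have "lev (2 * \<gamma>) (4 * \<gamma>) (g b) (c [^] kc (g b) \<otimes> b)"
      unfolding cb lev_E_right[OF levels(3) cl(2)] using Gm by simp
    from main[OF f b cl(2) this] have B: "[kc (f (g b)) = kc (f b) + kc (g b)] (mod 2 * \<gamma>)" by (simp add: add.commute)
    show ?thesis
      unfolding \<phi>_def AutoGroup_apply[OF fa ga a] AutoGroup_apply[OF fa ga b] using A B by simp
  qed
  show ?thesis
  proof (rule Mod_iso_cyclic_power[where \<phi> = \<phi>], unfold gamma2_eq)
    show "group (AutoGroup G\<lparr>carrier := Aut_lev 1 (4 * \<gamma>)\<rparr>)" by (rule group_Aut_sub[OF normal_Aut_lev_1_4gamma])
    show "[\<phi> t (f \<otimes>\<^bsub>AutoGroup G\<lparr>carrier := Aut_lev 1 (4 * \<gamma>)\<rparr>\<^esub> g) = \<phi> t f + \<phi> t g] (mod 2 * \<gamma>)"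
      if "f \<in> carrier (AutoGroup G\<lparr>carrier := Aut_lev 1 (4 * \<gamma>)\<rparr>)" "g \<in> carrier (AutoGroup G\<lparr>carrier := Aut_lev 1 (4 * \<gamma>)\<rparr>)" for t f g
      using add[of f g t] that by simp
    show "\<exists>f \<in> carrier (AutoGroup G\<lparr>carrier := Aut_lev 1 (4 * \<gamma>)\<rparr>). \<forall>t<2. [\<phi> t f = v t] (mod 2 * \<gamma>)" for v
    proof -
      have "good 1 0 0 1" unfolding good_def by simp
      then obtain f where f: "f \<in> auto G" "f a = E (v 0) 0 1" "f b = E (v 1) 1 0"
        using automorphism_if_good[where k = "v 0" and k' = "v 1"] by blast
      have "f \<in> Aut_lev 1 (4 * \<gamma>)"
        unfolding Aut_lev_1_iff[OF level_1_4gamma f(1)] f(2,3) by (intro conjI coords_E')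
      moreover have "[\<phi> 0 f = v 0] (mod 2 * \<gamma>)" "[\<phi> 1 f = v 1] (mod 2 * \<gamma>)"
        unfolding \<phi>_def f(2,3) using cong_dvd_modulus[OF coords_E'(1) d] by simp_all
      ultimately show ?thesis by (intro bexI[of _ f]) (simp_all add: all_less_2)
    qed
    have "f \<in> Aut_lev (2 * \<gamma>) (4 * \<gamma>) \<longleftrightarrow> [\<phi> 0 f = 0] (mod 2 * \<gamma>) \<and> [\<phi> 1 f = 0] (mod 2 * \<gamma>)" if f: "f \<in> Aut_lev 1 (4 * \<gamma>)" for f
    proof -
      note fa = Aut_lev_auto[OF f]
      show ?thesis
        using f unfolding \<phi>_def Aut_lev_1_iff[OF level_1_4gamma fa] Aut_lev_iff[OF levels(3) fa] by simp
    qed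
    moreover have "Aut_lev (2 * \<gamma>) (4 * \<gamma>) \<subseteq> Aut_lev 1 (4 * \<gamma>)" by (rule Aut_lev_mono[OF levels(3) level_1_4gamma]) simp_all
    ultimately show "Aut_lev (2 * \<gamma>) (4 * \<gamma>) = {f \<in> carrier (AutoGroup G\<lparr>carrier := Aut_lev 1 (4 * \<gamma>)\<rparr>). \<forall>t<2. [\<phi> t f = 0] (mod 2 * \<gamma>)}"
      unfolding all_less_2 by auto
  qed simp
qed

end

section \<open>The group Aut2\<close>

context macdonald_quotient
begin

text \<open>Multiplication by an element of \<open>Z\<^sub>2\<close> adds the exponents except for the term \<open>q * i\<close>, which depends on \<open>i\<close> only modulo \<open>2\<gamma>\<close>.\<close>

lemma E_mult_Z2:
  assumes "2 * \<gamma> dvd p" "4 * \<gamma> dvd q" "4 * \<gamma> dvd r"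
  shows "E k j i \<otimes> E p q r = E (k + p + q * i) (j + q) (i + r)"
proof -
  obtain p' where p: "p = 2 * \<gamma> * p'" using assms(1) by (elim dvdE)
  obtain q' where q: "q = 4 * \<gamma> * q'" using assms(2) by (elim dvdE)
  obtain T where T: "i * (i + 1) = 2 * T" using even_triangular[of i] by (elim dvdE)
  have "lK k j i p q r - (k + p + q * i) = M * (l * (4 * \<gamma> * q' * i * p' + q' * (q - 1) * T))"
    "lJ k j i p q r - (j + q) = M * (- l * (j * (p' + 2 * i * q') + i * (q' * (q + 1))))"
    "lI k j i p q r - (i + r) = M * (l * (i * p' + 2 * q' * T))"
    unfolding lawK_def lawJ_def lawI_def T u_gamma M_gamma by (simp_all add: p q algebra_simps power2_eq_square)
  then show ?thesis unfolding E_mult E_eq_iff cong_iff_dvd_diff by (simp only: dvd_triv_left simp_thms)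
qed

text \<open>The subgroup \<open>Z\<^sub>2\<close> is generated by \<open>c\<^sup>2\<^sup>\<gamma>\<close>, \<open>b\<^sup>4\<^sup>\<gamma>\<close> and \<open>a\<^sup>4\<^sup>\<gamma>\<close>. These powers depend on the exponents of \<open>f c\<close>, \<open>f b\<close> and \<open>f a\<close> only to the precision to which an element of \<open>Aut\<^sub>2\<close> fixes them.\<close>

lemma Aut2_fixes_Z2:
  assumes f: "f \<in> Aut_lev (2 * \<gamma>) (4 * \<gamma>)" and pqr: "2 * \<gamma> dvd p" "4 * \<gamma> dvd q" "4 * \<gamma> dvd r"
  shows "f (E p q r) = E p q r"
proof -
  have fa: "f \<in> auto G" using f by (rule Aut_lev_auto)
  have cl: "f a \<in> carrier G" "f b \<in> carrier G" "f c \<in> carrier G" using auto_closed_abc[OF fa] by simp_all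
  have F: "([kc (f a) = 0] (mod 2 * \<gamma>) \<and> [jc (f a) = 0] (mod 4 * \<gamma>) \<and> [ic (f a) = 1] (mod 4 * \<gamma>))
    \<and> ([kc (f b) = 0] (mod 2 * \<gamma>) \<and> [jc (f b) = 1] (mod 4 * \<gamma>) \<and> [ic (f b) = 0] (mod 4 * \<gamma>))"
    using f unfolding Aut_lev_iff[OF levels(3) fa] .
  have E_pow: "E k j i [^] (4 * \<gamma>) = E 0 (4 * \<gamma> * j) (4 * \<gamma> * i)" if k: "2 * \<gamma> dvd k" and ij: "4 * \<gamma> dvd i * j" for k j i
  proof -
    obtain x where x: "k = 2 * \<gamma> * x" using k by (elim dvdE)
    obtain y where y: "i * j = 4 * \<gamma> * y" using ij by (elim dvdE)
    have "4 * \<gamma> * k - 2 * \<gamma> * (i * j) + 4 * \<gamma> * u * (i * j) - 0 = M * (x - y + 2 * u * y)"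
      unfolding x y M_gamma by (simp add: algebra_simps power2_eq_square)
    then show ?thesis unfolding pow_4gamma E_eq_iff cong_iff_dvd_diff by (simp only: dvd_triv_left) simp
  qed
  have E_eq: "E 0 (4 * \<gamma> * j) (4 * \<gamma> * i) = E 0 (4 * \<gamma> * j') (4 * \<gamma> * i')" if j: "[j = j'] (mod 4 * \<gamma>)" and i: "[i = i'] (mod 4 * \<gamma>)" for j i j' i'
  proof -
    have "[4 * \<gamma> * j = 4 * \<gamma> * j'] (mod M)" "[4 * \<gamma> * i = 4 * \<gamma> * i'] (mod M)"
      using cong_dvd_modulus[OF cong_cmult_leftI[OF j, of "4 * \<gamma>"], of M] cong_dvd_modulus[OF cong_cmult_leftI[OF i, of "4 * \<gamma>"], of M]
      by (simp_all add: M_gamma power2_eq_square)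
    then show ?thesis unfolding E_eq_iff by simp
  qed
  have A: "f a [^] (4 * \<gamma>) = a [^] (4 * \<gamma>)"
  proof -
    have "4 * \<gamma> dvd jc (f a)" using F by (simp add: cong_0_iff)
    then have "E (kc (f a)) (jc (f a)) (ic (f a)) [^] (4 * \<gamma>) = E 0 (4 * \<gamma> * jc (f a)) (4 * \<gamma> * ic (f a))"
      using F by (intro E_pow) (simp_all add: cong_0_iff)
    also have "\<dots> = E 0 (4 * \<gamma> * 0) (4 * \<gamma> * 1)" using F by (intro E_eq) blast+
    finally show ?thesis using a cl by (simp add: E_coords) (simp add: E_def)
  qed
  have B: "f b [^] (4 * \<gamma>) = b [^] (4 * \<gamma>)"
  proof -
    have "4 * \<gamma> dvd ic (f b)" using F by (simp add: cong_0_iff)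
    then have "E (kc (f b)) (jc (f b)) (ic (f b)) [^] (4 * \<gamma>) = E 0 (4 * \<gamma> * jc (f b)) (4 * \<gamma> * ic (f b))"
      using F by (intro E_pow) (simp_all add: cong_0_iff)
    also have "\<dots> = E 0 (4 * \<gamma> * 1) (4 * \<gamma> * 0)" using F by (intro E_eq) blast+
    finally show ?thesis using b cl by (simp add: E_coords) (simp add: E_def)
  qed
  have C: "f c [^] (2 * \<gamma>) = c [^] (2 * \<gamma>)"
  proof -
    have "f \<in> Aut_lev 1 (4 * \<gamma>)" using Aut_lev_mono[OF levels(3) level_1_4gamma] f by auto
    from InnAut2_c[OF this] have fc: "4 * \<gamma> dvd kc (f c) - 1" "4 * \<gamma> dvd jc (f c)" "4 * \<gamma> dvd ic (f c)"
      unfolding lev_c[OF levels(5) cl(3)] by (simp_all add: cong_iff_dvd_diff)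
    then obtain x y z where xyz: "kc (f c) - 1 = 4 * \<gamma> * x" "jc (f c) = 4 * \<gamma> * y" "ic (f c) = 4 * \<gamma> * z" unfolding dvd_def by blast
    then have x: "kc (f c) = 1 + 4 * \<gamma> * x" by simp
    have "E (1 + 4 * \<gamma> * x) (4 * \<gamma> * y) (4 * \<gamma> * z) [^] (2 * \<gamma>)
        = E (2 * \<gamma> * (1 + 4 * \<gamma> * x)) (4 * \<gamma> * (2 * \<gamma> * y)) (4 * \<gamma> * (2 * \<gamma> * z))"
      by (rule E_linear_pow)
    also have "\<dots> = E (2 * \<gamma>) 0 0"
      unfolding E_eq_iff cong_iff_dvd_diff M_gamma by (simp add: algebra_simps power2_eq_square)
    finally have "E (kc (f c)) (jc (f c)) (ic (f c)) [^] (2 * \<gamma>) = E (2 * \<gamma>) 0 0" unfolding x xyz(2,3) .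
    then show ?thesis using c cl by (simp add: E_coords) (simp add: E_def)
  qed
  have pow: "x [^] n = y [^] n" if xy: "x [^] d = y [^] d" "d dvd n" "x \<in> carrier G" "y \<in> carrier G" for x y and n d :: int
  proof -
    obtain s where "n = d * s" using xy(2) by (elim dvdE)
    then show ?thesis using xy by (simp flip: int_pow_pow)
  qed
  show ?thesis
    unfolding auto_E[OF fa] pow[OF C pqr(1) cl(3) c] pow[OF B pqr(2) cl(2) b] pow[OF A pqr(3) cl(1) a] by (simp add: E_def)
qed

text \<open>Write \<open>g a = a z\<close> with \<open>z\<close> in \<open>Z\<^sub>2\<close>. Then \<open>f (g a) = f a \<otimes> z\<close> since \<open>f\<close> fixes \<open>z\<close>, and the deviations of \<open>f\<close> and \<open>g\<close> from the identity add up modulo \<open>M\<close>.\<close>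

lemma Aut2_compose:
  assumes f: "f \<in> Aut_lev (2 * \<gamma>) (4 * \<gamma>)" and g: "g \<in> Aut_lev (2 * \<gamma>) (4 * \<gamma>)"
  shows "[kc (f (g a)) = kc (f a) + kc (g a)] (mod M)" "[jc (f (g a)) = jc (f a) + jc (g a)] (mod M)"
    "[ic (f (g a)) - 1 = (ic (f a) - 1) + (ic (g a) - 1)] (mod M)"
    "[kc (f (g b)) = kc (f b) + kc (g b)] (mod M)" "[jc (f (g b)) - 1 = (jc (f b) - 1) + (jc (g b) - 1)] (mod M)"
    "[ic (f (g b)) = ic (f b) + ic (g b)] (mod M)"
proof -
  have fa: "f \<in> auto G" and ga: "g \<in> auto G" using f g by (auto dest: Aut_lev_auto)
  interpret f: group_hom G G f using fa by (rule group_hom_auto)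
  have clf: "f a \<in> carrier G" "f b \<in> carrier G" using auto_closed_abc[OF fa] by simp_all
  have clg: "g a \<in> carrier G" "g b \<in> carrier G" using auto_closed_abc[OF ga] by simp_all
  have F: "4 * \<gamma> dvd ic (f a) - 1" "4 * \<gamma> dvd ic (f b)"
    using f unfolding Aut_lev_iff[OF levels(3) fa] by (simp_all add: cong_iff_dvd_diff)
  have Gm: "2 * \<gamma> dvd kc (g a)" "4 * \<gamma> dvd jc (g a)" "4 * \<gamma> dvd ic (g a) - 1" "2 * \<gamma> dvd kc (g b)" "4 * \<gamma> dvd jc (g b) - 1" "4 * \<gamma> dvd ic (g b)"
    using g unfolding Aut_lev_iff[OF levels(3) ga] by (simp_all add: cong_iff_dvd_diff)
  have d: "2 * \<gamma> dvd kc (g a) - jc (g a)" using Gm(1,2) by (intro dvd_diff dvd_trans[OF _ Gm(2)]) simp_all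
  have "a \<otimes> E (kc (g a) - jc (g a)) (jc (g a)) (ic (g a) - 1) = g a"
    using E_mult_Z2[OF d Gm(2,3), of 0 0 1, folded a_E] by (simp add: E_coords[OF clg(1)])
  then have "f (g a) = f (a \<otimes> E (kc (g a) - jc (g a)) (jc (g a)) (ic (g a) - 1))" by (simp only:)
  also have "\<dots> = f a \<otimes> E (kc (g a) - jc (g a)) (jc (g a)) (ic (g a) - 1)"
    unfolding f.hom_mult[OF a E_closed] Aut2_fixes_Z2[OF f d Gm(2,3)] ..
  also have "\<dots> = E (kc (f a) + (kc (g a) - jc (g a)) + jc (g a) * ic (f a)) (jc (f a) + jc (g a)) (ic (f a) + (ic (g a) - 1))"
    using E_mult_Z2[OF d Gm(2,3), of "kc (f a)" "jc (f a)" "ic (f a)"] unfolding E_coords[OF clf(1)] .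
  also have "\<dots> = E (kc (f a) + kc (g a)) (jc (f a) + jc (g a)) (ic (f a) + (ic (g a) - 1))"
  proof -
    obtain x y where xy: "jc (g a) = 4 * \<gamma> * x" "ic (f a) - 1 = 4 * \<gamma> * y" using Gm(2) F(1) unfolding dvd_def by blast
    have "kc (f a) + (kc (g a) - jc (g a)) + jc (g a) * ic (f a) - (kc (f a) + kc (g a)) = jc (g a) * (ic (f a) - 1)"
      by (simp add: algebra_simps)
    also have "\<dots> = M * (2 * x * y)" unfolding xy M_gamma by (simp add: power2_eq_square)
    finally show ?thesis unfolding E_eq_iff cong_iff_dvd_diff by (simp only: dvd_triv_left) simp
  qed
  finally have A: "f (g a) = E (kc (f a) + kc (g a)) (jc (f a) + jc (g a)) (ic (f a) + (ic (g a) - 1))" .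
  have "b \<otimes> E (kc (g b)) (jc (g b) - 1) (ic (g b)) = g b"
    using E_mult_Z2[OF Gm(4-6), of 0 1 0, folded b_E] by (simp add: E_coords[OF clg(2)])
  then have "f (g b) = f (b \<otimes> E (kc (g b)) (jc (g b) - 1) (ic (g b)))" by (simp only:)
  also have "\<dots> = f b \<otimes> E (kc (g b)) (jc (g b) - 1) (ic (g b))"
    unfolding f.hom_mult[OF b E_closed] Aut2_fixes_Z2[OF f Gm(4-6)] ..
  also have "\<dots> = E (kc (f b) + kc (g b) + (jc (g b) - 1) * ic (f b)) (jc (f b) + (jc (g b) - 1)) (ic (f b) + ic (g b))"
    using E_mult_Z2[OF Gm(4-6), of "kc (f b)" "jc (f b)" "ic (f b)"] unfolding E_coords[OF clf(2)] .
  also have "\<dots> = E (kc (f b) + kc (g b)) (jc (f b) + (jc (g b) - 1)) (ic (f b) + ic (g b))"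
  proof -
    obtain x y where xy: "jc (g b) - 1 = 4 * \<gamma> * x" "ic (f b) = 4 * \<gamma> * y" using Gm(5) F(2) unfolding dvd_def by blast
    have "kc (f b) + kc (g b) + (jc (g b) - 1) * ic (f b) - (kc (f b) + kc (g b)) = M * (2 * x * y)"
      unfolding xy M_gamma by (simp add: power2_eq_square)
    then show ?thesis unfolding E_eq_iff cong_iff_dvd_diff by (simp only: dvd_triv_left) simp
  qed
  finally have B: "f (g b) = E (kc (f b) + kc (g b)) (jc (f b) + (jc (g b) - 1)) (ic (f b) + ic (g b))" .
  show "[kc (f (g a)) = kc (f a) + kc (g a)] (mod M)" "[jc (f (g a)) = jc (f a) + jc (g a)] (mod M)"
    "[kc (f (g b)) = kc (f b) + kc (g b)] (mod M)" "[ic (f (g b)) = ic (f b) + ic (g b)] (mod M)"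
    unfolding A B by (rule coords_E)+
  have eq: "(x - 1) + (y - 1) = x + (y - 1) - 1" for x y :: int by simp
  show "[ic (f (g a)) - 1 = (ic (f a) - 1) + (ic (g a) - 1)] (mod M)" "[jc (f (g b)) - 1 = (jc (f b) - 1) + (jc (g b) - 1)] (mod M)"
    unfolding A B eq by (intro cong_diff coords_E cong_refl)+
qed

text \<open>The deviations from the identity in the six exponents of \<open>f a\<close> and \<open>f b\<close> are independent and
  additive modulo \<open>M = 2\<gamma> \<cdot> 4\<gamma>\<close>. Those in \<open>b\<close> and \<open>a\<close> are multiples of \<open>4\<gamma>\<close>, which gives four
  factors of order \<open>2\<gamma> = 2\<^sup>m\<^sup>-\<^sup>1\<close>; those in \<open>c\<close> are multiples of \<open>2\<gamma>\<close>, which gives two factors of order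
  \<open>4\<gamma> = 2\<^sup>m\<close>.\<close>

theorem Aut2_iso:
  "AutoGroup G\<lparr>carrier := Aut_lev (2 * \<gamma>) (4 * \<gamma>)\<rparr> \<cong> cyclic_power (2 ^ (m - 1)) 4 \<times>\<times> cyclic_power (2 ^ m) 2"
proof -
  define x where "x = (\<lambda>(t::nat) f. if t = 0 then jc (f a) else if t = 1 then ic (f a) - 1 else if t = 2 then ic (f b) else jc (f b) - 1)"
  define y where "y = (\<lambda>(t::nat) f. if t = 0 then kc (f a) else kc (f b))"
  have M: "4 * \<gamma> * (2 * \<gamma>) = M" "2 * \<gamma> * (4 * \<gamma>) = M" by (simp_all add: M_gamma power2_eq_square)
  have nz: "4 * \<gamma> \<noteq> 0" "2 * \<gamma> \<noteq> 0" by simp_all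
  let ?K = "AutoGroup G\<lparr>carrier := Aut_lev (2 * \<gamma>) (4 * \<gamma>)\<rparr>"
  have dvd: "4 * \<gamma> dvd x t f" "2 * \<gamma> dvd y t f" if f: "f \<in> Aut_lev (2 * \<gamma>) (4 * \<gamma>)" for t f
    using f unfolding Aut_lev_iff[OF levels(3) Aut_lev_auto[OF f]] x_def y_def by (simp_all add: cong_iff_dvd_diff)
  have closed: "f \<otimes>\<^bsub>AutoGroup G\<^esub> g \<in> Aut_lev (2 * \<gamma>) (4 * \<gamma>)"
    if "f \<in> Aut_lev (2 * \<gamma>) (4 * \<gamma>)" "g \<in> Aut_lev (2 * \<gamma>) (4 * \<gamma>)" for f g
    using that by (rule subgroup.m_closed[OF normal_imp_subgroup[OF Aut_lev_chain(2)]])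
  have add: "[x t (f \<otimes>\<^bsub>AutoGroup G\<^esub> g) = x t f + x t g] (mod M)" "[y t (f \<otimes>\<^bsub>AutoGroup G\<^esub> g) = y t f + y t g] (mod M)"
    if f: "f \<in> Aut_lev (2 * \<gamma>) (4 * \<gamma>)" and g: "g \<in> Aut_lev (2 * \<gamma>) (4 * \<gamma>)" for t f g
    unfolding x_def y_def AutoGroup_apply[OF Aut_lev_auto[OF f] Aut_lev_auto[OF g] a]
      AutoGroup_apply[OF Aut_lev_auto[OF f] Aut_lev_auto[OF g] b]
    using Aut2_compose[OF f g] by simp_all
  show ?thesis
  proof (rule iso_cyclic_power_DirProd[where \<phi> = "\<lambda>t f. x t f div (4 * \<gamma>)" and \<psi> = "\<lambda>t f. y t f div (2 * \<gamma>)"], unfold gamma2_eq gamma4_eq)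
    show "[x t (f \<otimes>\<^bsub>?K\<^esub> g) div (4 * \<gamma>) = x t f div (4 * \<gamma>) + x t g div (4 * \<gamma>)] (mod 2 * \<gamma>)"
      if "f \<in> carrier ?K" "g \<in> carrier ?K" for t f g
      using that cong_div_add[OF nz(1) dvd(1)[OF closed[of f g], of t] dvd(1)[of f t] dvd(1)[of g t], where n = "2 * \<gamma>"] add(1)[of f g t]
      unfolding M by simp
    show "[y t (f \<otimes>\<^bsub>?K\<^esub> g) div (2 * \<gamma>) = y t f div (2 * \<gamma>) + y t g div (2 * \<gamma>)] (mod 4 * \<gamma>)"
      if "f \<in> carrier ?K" "g \<in> carrier ?K" for t f g
      using that cong_div_add[OF nz(2) dvd(2)[OF closed[of f g], of t] dvd(2)[of f t] dvd(2)[of g t], where n = "4 * \<gamma>"] add(2)[of f g t]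
      unfolding M by simp
    show "\<exists>f \<in> carrier ?K. (\<forall>t<4. [x t f div (4 * \<gamma>) = v t] (mod 2 * \<gamma>)) \<and> (\<forall>t<2. [y t f div (2 * \<gamma>) = w t] (mod 4 * \<gamma>))" for v w
    proof -
      have "good (1 + 4 * \<gamma> * v 1) (4 * \<gamma> * v 0) (4 * \<gamma> * v 2) (1 + 4 * \<gamma> * v 3)"
        unfolding good_def by (simp add: cong_iff_dvd_diff flip: right_diff_distrib)
      then obtain f where f: "f \<in> auto G" "f a = E (2 * \<gamma> * w 0) (4 * \<gamma> * v 0) (1 + 4 * \<gamma> * v 1)"
          "f b = E (2 * \<gamma> * w 1) (1 + 4 * \<gamma> * v 3) (4 * \<gamma> * v 2)"
        using automorphism_if_good by blast
      have "lev (2 * \<gamma>) (4 * \<gamma>) (f a) a" "lev (2 * \<gamma>) (4 * \<gamma>) (f b) b"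
        unfolding f(2,3) lev_a[OF levels(3) E_closed] lev_b[OF levels(3) E_closed]
        using lev_E_right[OF levels(3) E_closed, of "2 * \<gamma> * w 0" "4 * \<gamma> * v 0" "1 + 4 * \<gamma> * v 1" 0 0 1]
          lev_E_right[OF levels(3) E_closed, of "2 * \<gamma> * w 1" "1 + 4 * \<gamma> * v 3" "4 * \<gamma> * v 2" 0 1 0]
        unfolding lev_E[OF levels(3)] by (simp_all add: cong_iff_dvd_diff)
      then have f2: "f \<in> Aut_lev (2 * \<gamma>) (4 * \<gamma>)"
        unfolding Aut_lev_iff[OF levels(3) f(1)] lev_a[OF levels(3) auto_closed[OF f(1) a]] lev_b[OF levels(3) auto_closed[OF f(1) b]] by blast
      have xv: "[x t f = 4 * \<gamma> * v t] (mod M)" if "t < 4" for t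
      proof -
        have "[ic (f a) - 1 = 1 + 4 * \<gamma> * v 1 - 1] (mod M)" "[jc (f b) - 1 = 1 + 4 * \<gamma> * v 3 - 1] (mod M)"
          unfolding f(2,3) by (intro cong_diff coords_E cong_refl)+
        moreover have "[jc (f a) = 4 * \<gamma> * v 0] (mod M)" "[ic (f b) = 4 * \<gamma> * v 2] (mod M)"
          unfolding f(2,3) by (rule coords_E)+
        moreover have "t = 0 \<or> t = 1 \<or> t = 2 \<or> t = 3" using \<open>t < 4\<close> by linarith
        ultimately show ?thesis unfolding x_def by (elim disjE) simp_all
      qed
      have yw: "[y t f = 2 * \<gamma> * w t] (mod M)" if "t < 2" for t
      proof -
        have "t = 0 \<or> t = 1" using that by linarith
        moreover have "[kc (f a) = 2 * \<gamma> * w 0] (mod M)" "[kc (f b) = 2 * \<gamma> * w 1] (mod M)"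
          unfolding f(2,3) by (rule coords_E)+
        ultimately show ?thesis unfolding y_def by auto
      qed
      have "[x t f div (4 * \<gamma>) = v t] (mod 2 * \<gamma>)" if "t < 4" for t
        using cong_div[OF nz(1) dvd(1)[OF f2, of t], of "v t" "2 * \<gamma>"] xv[OF that] unfolding M by blast
      moreover have "[y t f div (2 * \<gamma>) = w t] (mod 4 * \<gamma>)" if "t < 2" for t
        using cong_div[OF nz(2) dvd(2)[OF f2, of t], of "w t" "4 * \<gamma>"] yw[OF that] unfolding M by blast
      ultimately show ?thesis using f2 by (intro bexI[of _ f]) simp_all
    qed
    fix f g
    assume fg: "f \<in> carrier ?K" "g \<in> carrier ?K"
      and X: "\<forall>t<4. [x t f div (4 * \<gamma>) = x t g div (4 * \<gamma>)] (mod 2 * \<gamma>)"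
      and Y: "\<forall>t<2. [y t f div (2 * \<gamma>) = y t g div (2 * \<gamma>)] (mod 4 * \<gamma>)"
    have f: "f \<in> Aut_lev (2 * \<gamma>) (4 * \<gamma>)" and g: "g \<in> Aut_lev (2 * \<gamma>) (4 * \<gamma>)" using fg by simp_all
    have X': "[x t f = x t g] (mod M)" if "t < 4" for t
      using cong_div[OF nz(1) dvd(1)[OF f, of t], of "x t g div (4 * \<gamma>)" "2 * \<gamma>"] X that dvd(1)[OF g, of t] unfolding M by simp
    have Y': "[y t f = y t g] (mod M)" if "t < 2" for t
      using cong_div[OF nz(2) dvd(2)[OF f, of t], of "y t g div (2 * \<gamma>)" "4 * \<gamma>"] Y that dvd(2)[OF g, of t] unfolding M by simp
    have "[jc (f a) = jc (g a)] (mod M)" "[ic (f b) = ic (g b)] (mod M)" "[ic (f a) - 1 + 1 = ic (g a) - 1 + 1] (mod M)"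
      "[jc (f b) - 1 + 1 = jc (g b) - 1 + 1] (mod M)"
      using X'[of 0] X'[of 2] cong_add[OF X'[of 1] cong_refl[of 1]] cong_add[OF X'[of 3] cong_refl[of 1]] unfolding x_def by simp_all
    moreover have "[kc (f a) = kc (g a)] (mod M)" "[kc (f b) = kc (g b)] (mod M)"
      using Y'[of 0] Y'[of 1] unfolding y_def by simp_all
    ultimately show "f = g"
      by (intro auto_eqI Aut_lev_auto[OF f] Aut_lev_auto[OF g]) (simp_all add: lev_def)
  qed simp_all
qed

lemma Aut_chain_strict:
  "{\<one>\<^bsub>AutoGroup G\<^esub>} \<subset> Aut_lev (2 * \<gamma>) (4 * \<gamma>)" "Aut_lev (2 * \<gamma>) (4 * \<gamma>) \<subset> Aut_lev 1 (4 * \<gamma>)"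
  "Aut_lev 1 (4 * \<gamma>) \<subset> Aut_lev 1 (2 * \<gamma>)" "Aut_lev 1 (2 * \<gamma>) \<subset> auto G"
proof -
  have good: "good 1 0 0 1" "good 1 (2 * \<gamma>) 0 (1 + 2 * \<gamma>)" unfolding good_def by (simp_all add: cong_iff_dvd_diff)
  have d: "2 * \<gamma> dvd 4 * \<gamma>" by simp
  have n1: "\<not> 2 * \<gamma> dvd 1" by (metis dvd_mult_left odd_one)
  have n2: "\<not> 4 * \<gamma> dvd 2 * \<gamma>"
  proof
    assume "4 * \<gamma> dvd 2 * \<gamma>"
    from zdvd_imp_le[OF this] gamma_pos show False by simp
  qed
  obtain f where f: "f \<in> auto G" "f a = E 0 0 1" "f b = E (2 * \<gamma>) 1 0" using automorphism_if_good[OF good(1)] by blast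
  have "f \<in> Aut_lev (2 * \<gamma>) (4 * \<gamma>)"
    using cong_trans[OF cong_dvd_modulus[OF coords_E'(1) d, of "2 * \<gamma>" 1 0], of 0] cong_dvd_modulus[OF coords_E'(1) d, of 0 0 1]
    unfolding Aut_lev_iff[OF levels(3) f(1)] f(2,3) by (intro conjI coords_E') (simp_all add: cong_iff_dvd_diff)
  moreover have "f \<noteq> \<one>\<^bsub>AutoGroup G\<^esub>"
  proof
    assume "f = \<one>\<^bsub>AutoGroup G\<^esub>"
    then have "E (2 * \<gamma>) 1 0 = E 0 1 0" using f(3) b b_E by (simp add: AutoGroup_simps)
    then have "M dvd 2 * \<gamma>" unfolding E_eq_iff by (simp add: cong_0_iff)
    then show False using n2 dvd_trans[OF gamma4_dvd_M] by blast
  qed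
  moreover have "\<one>\<^bsub>AutoGroup G\<^esub> \<in> Aut_lev (2 * \<gamma>) (4 * \<gamma>)"
    by (rule subgroup.one_closed[OF normal_imp_subgroup[OF Aut_lev_chain(2)]])
  ultimately show "{\<one>\<^bsub>AutoGroup G\<^esub>} \<subset> Aut_lev (2 * \<gamma>) (4 * \<gamma>)" by auto
  obtain f where f: "f \<in> auto G" "f a = E 0 0 1" "f b = E 1 1 0" using automorphism_if_good[OF good(1)] by blast
  have "f \<in> Aut_lev 1 (4 * \<gamma>)"
    unfolding Aut_lev_1_iff[OF level_1_4gamma f(1)] f(2,3) by (intro conjI coords_E')
  moreover have "f \<notin> Aut_lev (2 * \<gamma>) (4 * \<gamma>)"
  proof
    assume "f \<in> Aut_lev (2 * \<gamma>) (4 * \<gamma>)"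
    then have "[kc (E 1 1 0) = 0] (mod 2 * \<gamma>)" unfolding Aut_lev_iff[OF levels(3) f(1)] f(3) by blast
    then have "[1 = 0] (mod 2 * \<gamma>)" by (rule cong_trans[OF cong_sym[OF cong_dvd_modulus[OF coords_E'(1) d]]])
    then show False using n1 by (simp add: cong_0_iff)
  qed
  ultimately show "Aut_lev (2 * \<gamma>) (4 * \<gamma>) \<subset> Aut_lev 1 (4 * \<gamma>)"
    using Aut_lev_mono[OF levels(3) level_1_4gamma] by auto
  obtain f where f: "f \<in> auto G" "f a = E 0 (2 * \<gamma>) 1" "f b = E 0 (1 + 2 * \<gamma>) 0"
    using automorphism_if_good[OF good(2)] by blast
  have j: "[jc (f a) = 2 * \<gamma>] (mod 4 * \<gamma>)" "[jc (f b) = 1 + 2 * \<gamma>] (mod 4 * \<gamma>)" unfolding f(2,3) by (rule coords_E')+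
  have i: "[ic (f a) = 1] (mod 4 * \<gamma>)" "[ic (f b) = 0] (mod 4 * \<gamma>)" unfolding f(2,3) by (rule coords_E')+
  have "[jc (f a) = 0] (mod 2 * \<gamma>)" "[jc (f b) = 1] (mod 2 * \<gamma>)"
    using cong_trans[OF cong_dvd_modulus[OF j(1) d], of 0] cong_trans[OF cong_dvd_modulus[OF j(2) d], of 1] by (simp_all add: cong_iff_dvd_diff)
  then have "f \<in> Aut_lev 1 (2 * \<gamma>)"
    using cong_dvd_modulus[OF i(1) d] cong_dvd_modulus[OF i(2) d] unfolding Aut_lev_1_iff[OF levels(4) f(1)] by blast
  moreover have "f \<notin> Aut_lev 1 (4 * \<gamma>)"
  proof
    assume "f \<in> Aut_lev 1 (4 * \<gamma>)"
    then have "[jc (f a) = 0] (mod 4 * \<gamma>)" unfolding Aut_lev_1_iff[OF level_1_4gamma f(1)] by blast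
    then have "[2 * \<gamma> = 0] (mod 4 * \<gamma>)" by (rule cong_trans[OF cong_sym[OF j(1)]])
    then show False using n2 by (simp add: cong_0_iff)
  qed
  ultimately show "Aut_lev 1 (4 * \<gamma>) \<subset> Aut_lev 1 (2 * \<gamma>)"
    using Aut_lev_mono[OF level_1_4gamma levels(4)] by auto
  obtain s where s: "s \<in> auto G" "s a = b" using swap_automorphism by blast
  have "s \<notin> Aut_lev 1 (2 * \<gamma>)"
  proof
    assume "s \<in> Aut_lev 1 (2 * \<gamma>)"
    then have "[jc b = 0] (mod 2 * \<gamma>)" unfolding Aut_lev_1_iff[OF levels(4) s(1)] s(2) by blast
    then have "[1 = 0] (mod 2 * \<gamma>)"
      by (rule cong_trans[OF cong_sym[OF cong_dvd_modulus[OF coords_E'(2)[of 0 1 0, folded b_E] d]]])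
    then show False using n1 by (simp add: cong_0_iff)
  qed
  then show "Aut_lev 1 (2 * \<gamma>) \<subset> auto G" using s(1) Aut_lev_auto by blast
qed

end

theorem theorem6p15:
  fixes m :: nat and l :: int
  assumes "m > 1" and "odd l"
  shows "let H = H_group m l;
             Aut = AutoGroup H;
             Aut2 = Aut_sub 2 H;
             InnAut2 = Inn H <#>\<^bsub>Aut\<^esub> Aut2;
             Aut3 = Aut_sub 3 H
         in {\<one>\<^bsub>Aut\<^esub>} \<lhd> Aut \<and> Aut2 \<lhd> Aut \<and> InnAut2 \<lhd> Aut \<and> Aut3 \<lhd> Aut \<and>
            {\<one>\<^bsub>Aut\<^esub>} \<subset> Aut2 \<and> Aut2 \<subset> InnAut2 \<and> InnAut2 \<subset> Aut3 \<and> Aut3 \<subset> carrier Aut \<and>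
            Aut\<lparr>carrier := Aut2\<rparr> \<cong> cyclic_power (2 ^ (m - 1)) 4 \<times>\<times> cyclic_power (2 ^ m) 2 \<and>
            Aut\<lparr>carrier := InnAut2\<rparr> Mod Aut2 \<cong> cyclic_power (2 ^ (m - 1)) 2 \<and>
            Aut\<lparr>carrier := Aut3\<rparr> Mod InnAut2 \<cong> cyclic_power 2 2 \<and>
            (m > 2 \<longrightarrow> Aut Mod Aut3 \<cong> cyclic_power 2 2) \<and>
            (m = 2 \<longrightarrow> Aut Mod Aut3 \<cong> integer_mod_group 2)"
proof -
  interpret macdonald_parameters m l using assms by unfold_locales
  obtain a b c where "macdonald_quotient m l (H_group m l) a b c" using macdonald_quotient_H by blast
  then interpret H: macdonald_quotient m l "H_group m l" a b c .
  show ?thesis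
    unfolding Let_def H.Aut_lev_chain(1,3) H.Inn_mult_Aut2 AutoGroup_simps(1)
    by (intro conjI impI H.Aut_lev_chain H.normal_Aut_lev_1_4gamma group.one_is_normal H.AutoGroup
        H.Aut_chain_strict H.Aut2_iso H.InnAut2_mod_Aut2 H.Aut3_mod_InnAut2 H.Aut_mod_Aut3 H.Aut_mod_Aut3_m2)
qed

end
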